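(* Suppose that the composition law $\#$ on $\mathcal S(\Xi)$ satisfies Hypotheses A and B. Then the mappings $\mathbf M,\mathbf N,\mathbf R$ define linear continuous mappings of the Schwartz space $\mathcal S(\Xi\times\Xi)$ into itself. They extend uniquely to linear continuous mappings of the space of tempered distributions $\mathcal S'(\Xi\times\Xi)$ into itself.
   Context: Notation. Let $\Xi=\mathbb R^n\times\mathbb R^n$ with points $X=(x,\xi)$, $Y=(y,\eta)$ and symplectic form $\sigma(X,Y)=y\cdot\xi-x\cdot\eta$. $dX$ denotes Lebesgue measure on $\Xi$ multiplied by $(2\pi)^{-n}$, so that the symplectic Fourier transform $(\mathfrak Ff)(Y)=\widehat f(Y)=\int_\Xi e^{-i\sigma(Y,Z)}f(Z)\,dZ$ is unitary in $L^2(\Xi)$ and $\mathfrak F^2=1$. $\langle f,g\rangle=\int_\Xi f(X)g(X)\,dX$ (bilinear), and the same symbol denotes the duality between $\mathcal S'(\Xi)$ and $\mathcal S(\Xi)$ (in either order). Similarly $\langle\!\langle F,G\rangle\!\rangle=\int_\Xi\int_\Xi F(X,Y)G(X,Y)\,dX\,dY$ and its extension to a duality between $\mathcal S'(\Xi\times\Xi)$ and $\mathcal S(\Xi\times\Xi)$. Spaces of tempered distributions carry the strong dual topology. Functions are complex valued. Hypothesis A. $\#:\mathcal S(\Xi)\times\mathcal S(\Xi)\to\mathcal S(\Xi)$ is bilinear, associative and separately continuous, $\mathcal S(\Xi)$ is a $^*$-algebra with the product $\#$ and the involution $f^\#:=\overline f$ (so $\overline{f\#g}=\overline g\#\overline f$),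 and $\int_\Xi (f\#g)(X)\,dX=\int_\Xi f(X)g(X)\,dX$ for all $f,g\in\mathcal S(\Xi)$. Extension. Under Hypothesis A, for $f\in\mathcal S'(\Xi)$, $g\in\mathcal S(\Xi)$, the distributions $f\#g,\ g\#f\in\mathcal S'(\Xi)$ are defined by $\langle f\#g,h\rangle:=\langle f,g\#h\rangle$ and $\langle g\#f,h\rangle:=\langle f,h\#g\rangle$ for $h\in\mathcal S(\Xi)$; these extend $\#$ and satisfy $(f_1\#g)\#f_2=f_1\#(g\#f_2)$ for $f_1,f_2\in\mathcal S(\Xi)$, $g\in\mathcal S'(\Xi)$. Hypothesis B. $f_1\#g\#f_2\in\mathcal S(\Xi)$ for all $f_1,f_2\in\mathcal S(\Xi)$, $g\in\mathcal S'(\Xi)$. The mappings. Under Hypothesis A, $\mathbf R$ and $\mathbf N$ are the linear continuous maps $\mathcal S(\Xi\times\Xi)\to\mathcal S'(\Xi\times\Xi)$ uniquely determined, for all $f_1,f_2,g_1,g_2\in\mathcal S(\Xi)$, by $\langle\!\langle\mathbf R(f_1\otimes f_2),g_1\otimes g_2\rangle\!\rangle=\langle g_1\#f_1,g_2\#f_2\rangle$ and $\langle\!\langle\mathbf N(f_1\otimes f_2),g_1\otimes g_2\rangle\!\rangle=\langle\widehat g_1\#f_1,\widehat g_2\#f_2\rangle$. The modulation mapping is $\mathbf M:=\mathbf C\circ\mathbf N$, where $\mathbf C(F):=F\circ C$ (extended to tempered distributions) and $C(X,Y):=(-X,X-Y)$. *)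

theory Defs
  imports "HOL-Analysis.Analysis"
begin

section \<open>Linear spaces of complex functions and their topologies\<close>

text \<open>
  All spaces below (Schwartz functions, tempered distributions) are sets of functions
  \<open>'x \<Rightarrow> complex\<close> with the pointwise complex vector space structure. Their locally convex
  topologies are values of type \<open>topology\<close> whose \<open>topspace\<close> is the space in question.
\<close>

definition clinear_functional_on :: "('x \<Rightarrow> complex) set \<Rightarrow> (('x \<Rightarrow> complex) \<Rightarrow> complex) \<Rightarrow> bool" where
  "clinear_functional_on V T \<longleftrightarrow>
     (\<forall>f\<in>V. \<forall>g\<in>V. \<forall>a b. T (\<lambda>x. a * f x + b * g x) = a * T f + b * T g)"

definition clinear_map_on :: "('x \<Rightarrow> complex) set \<Rightarrow> (('x \<Rightarrow> complex) \<Rightarrow> ('y \<Rightarrow> complex)) \<Rightarrow> bool" where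
  "clinear_map_on V \<Phi> \<longleftrightarrow>
     (\<forall>f\<in>V. \<forall>g\<in>V. \<forall>a b. \<Phi> (\<lambda>x. a * f x + b * g x) = (\<lambda>y. a * \<Phi> f y + b * \<Phi> g y))"

definition linear_continuous_map ::
    "('x \<Rightarrow> complex) topology \<Rightarrow> ('y \<Rightarrow> complex) topology \<Rightarrow>
     (('x \<Rightarrow> complex) \<Rightarrow> ('y \<Rightarrow> complex)) \<Rightarrow> bool" where
  "linear_continuous_map V W \<Phi> \<longleftrightarrow> clinear_map_on (topspace V) \<Phi> \<and> continuous_map V W \<Phi>"

definition seminorm_topology ::
    "('x \<Rightarrow> complex) set \<Rightarrow> (('x \<Rightarrow> complex) \<Rightarrow> real) set \<Rightarrow> ('x \<Rightarrow> complex) topology" where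
  "seminorm_topology V P =
     topology_generated_by {{g \<in> V. p (\<lambda>x. g x - f x) < e} |f p e. f \<in> V \<and> p \<in> P \<and> e > 0}"


section \<open>The Schwartz space\<close>

fun iterated_derivative ::
    "'a::euclidean_space list \<Rightarrow> ('a \<Rightarrow> complex) \<Rightarrow> 'a \<Rightarrow> complex" where
  "iterated_derivative [] f = f"
| "iterated_derivative (v # vs) f = (\<lambda>x. frechet_derivative (iterated_derivative vs f) (at x) v)"

text \<open>
  The partial derivatives \<open>\<partial>\<^sup>\<alpha>\<close> are the iterated derivatives along lists of coordinate
  vectors. Differentiability of all of them is the usual smoothness.
\<close>

definition schwartz :: "('a::euclidean_space \<Rightarrow> complex) set" where
  "schwartz = {f. \<forall>vs\<in>lists Basis.
     (\<forall>x. iterated_derivative vs f differentiable at x) \<and>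
     (\<forall>k. bounded (range (\<lambda>x. norm x ^ k * cmod (iterated_derivative vs f x))))}"

definition schwartz_seminorm ::
    "nat \<Rightarrow> 'a::euclidean_space list \<Rightarrow> ('a \<Rightarrow> complex) \<Rightarrow> real" where
  "schwartz_seminorm k vs f = (SUP x. norm x ^ k * cmod (iterated_derivative vs f x))"

definition schwartz_seminorms :: "(('a::euclidean_space \<Rightarrow> complex) \<Rightarrow> real) set" where
  "schwartz_seminorms = {schwartz_seminorm k vs |k vs. vs \<in> lists Basis}"

definition schwartz_topology :: "('a::euclidean_space \<Rightarrow> complex) topology" where
  "schwartz_topology = seminorm_topology schwartz schwartz_seminorms"

definition bounded_in_schwartz :: "('a::euclidean_space \<Rightarrow> complex) set \<Rightarrow> bool" where
  "bounded_in_schwartz B \<longleftrightarrow> B \<subseteq> schwartz \<and> (\<forall>p\<in>schwartz_seminorms. bdd_above (p ` B))"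


section \<open>Tempered distributions with the strong dual topology\<close>

text \<open>
  A distribution is a functional on all functions that is zero by convention outside the
  Schwartz space, so that equality of distributions is equality on Schwartz functions.
\<close>

definition tempered :: "(('a::euclidean_space \<Rightarrow> complex) \<Rightarrow> complex) set" where
  "tempered = {T. clinear_functional_on schwartz T \<and>
                  continuous_map schwartz_topology euclidean T \<and>
                  (\<forall>f. f \<notin> schwartz \<longrightarrow> T f = 0)}"

definition strong_seminorm ::
    "('a::euclidean_space \<Rightarrow> complex) set \<Rightarrow> (('a \<Rightarrow> complex) \<Rightarrow> complex) \<Rightarrow> real" where
  "strong_seminorm B T = (SUP f\<in>B. cmod (T f))"

definition tempered_topology :: "(('a::euclidean_space \<Rightarrow> complex) \<Rightarrow> complex) topology" where
  "tempered_topology =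
     seminorm_topology tempered {strong_seminorm B |B. bounded_in_schwartz B \<and> B \<noteq> {}}"

definition pairing :: "'a measure \<Rightarrow> ('a \<Rightarrow> complex) \<Rightarrow> ('a \<Rightarrow> complex) \<Rightarrow> complex" where
  "pairing \<mu> f g = (LINT x|\<mu>. f x * g x)"

text \<open>The distribution defined by the function \<open>f\<close>, via the bilinear pairing.\<close>

definition distribution_of ::
    "'a::euclidean_space measure \<Rightarrow> ('a \<Rightarrow> complex) \<Rightarrow> ('a \<Rightarrow> complex) \<Rightarrow> complex" where
  "distribution_of \<mu> f = (\<lambda>h. if h \<in> schwartz then pairing \<mu> f h else 0)"


section \<open>Phase space\<close>

type_synonym 'n phase = "(real^'n) \<times> (real^'n)"

definition symplectic :: "'n::finite phase \<Rightarrow> 'n phase \<Rightarrow> real" where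
  "symplectic X Y = fst Y \<bullet> snd X - fst X \<bullet> snd Y"

definition phase_measure :: "'n::finite phase measure" where
  "phase_measure = density lborel (\<lambda>_. ennreal (1 / (2 * pi) ^ CARD('n)))"

definition phase_measure2 :: "('n::finite phase \<times> 'n phase) measure" where
  "phase_measure2 = phase_measure \<Otimes>\<^sub>M phase_measure"

definition symplectic_fourier :: "('n::finite phase \<Rightarrow> complex) \<Rightarrow> 'n phase \<Rightarrow> complex" where
  "symplectic_fourier f Y = (LINT Z|phase_measure. exp (- \<i> * of_real (symplectic Y Z)) * f Z)"

definition tensor :: "('a \<Rightarrow> complex) \<Rightarrow> ('b \<Rightarrow> complex) \<Rightarrow> 'a \<times> 'b \<Rightarrow> complex" where
  "tensor f g = (\<lambda>(X, Y). f X * g Y)"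


section \<open>Composition laws\<close>

type_synonym 'n composition =
  "('n phase \<Rightarrow> complex) \<Rightarrow> ('n phase \<Rightarrow> complex) \<Rightarrow> 'n phase \<Rightarrow> complex"

text \<open>Only the values of a composition law on Schwartz functions are relevant.\<close>

definition hypothesis_A :: "'n::finite composition \<Rightarrow> bool" where
  "hypothesis_A law \<longleftrightarrow>
     (\<forall>f\<in>schwartz. \<forall>g\<in>schwartz. law f g \<in> schwartz) \<and>
     (\<forall>g\<in>schwartz. linear_continuous_map schwartz_topology schwartz_topology (\<lambda>f. law f g)) \<and>
     (\<forall>f\<in>schwartz. linear_continuous_map schwartz_topology schwartz_topology (\<lambda>g. law f g)) \<and>
     (\<forall>f\<in>schwartz. \<forall>g\<in>schwartz. \<forall>h\<in>schwartz. law (law f g) h = law f (law g h)) \<and>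
     (\<forall>f\<in>schwartz. \<forall>g\<in>schwartz.
        (\<lambda>X. cnj (law f g X)) = law (\<lambda>X. cnj (g X)) (\<lambda>X. cnj (f X))) \<and>
     (\<forall>f\<in>schwartz. \<forall>g\<in>schwartz.
        (LINT X|phase_measure. law f g X) = (LINT X|phase_measure. f X * g X))"

text \<open>The extensions \<open>T # g\<close> and \<open>g # T\<close> for a distribution \<open>T\<close> and a Schwartz function \<open>g\<close>.\<close>

definition comp_right ::
    "'n::finite composition \<Rightarrow> (('n phase \<Rightarrow> complex) \<Rightarrow> complex) \<Rightarrow> ('n phase \<Rightarrow> complex) \<Rightarrow>
     ('n phase \<Rightarrow> complex) \<Rightarrow> complex" where
  "comp_right law T g = (\<lambda>h. if h \<in> schwartz then T (law g h) else 0)"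

definition comp_left ::
    "'n::finite composition \<Rightarrow> ('n phase \<Rightarrow> complex) \<Rightarrow> (('n phase \<Rightarrow> complex) \<Rightarrow> complex) \<Rightarrow>
     ('n phase \<Rightarrow> complex) \<Rightarrow> complex" where
  "comp_left law g T = (\<lambda>h. if h \<in> schwartz then T (law h g) else 0)"

definition hypothesis_B :: "'n::finite composition \<Rightarrow> bool" where
  "hypothesis_B law \<longleftrightarrow>
     (\<forall>f1\<in>schwartz. \<forall>f2\<in>schwartz. \<forall>T\<in>tempered.
        \<exists>u\<in>schwartz. comp_right law (comp_left law f1 T) f2 = distribution_of phase_measure u)"


section \<open>The mappings R, N and M\<close>

text \<open>
  \<open>R\<close> and \<open>N\<close> map Schwartz functions on the doubled phase space to distributions. The clause
  on non-Schwartz arguments only makes the described object unique as a total function.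
\<close>

definition mapping_R ::
    "'n::finite composition \<Rightarrow> ('n phase \<times> 'n phase \<Rightarrow> complex) \<Rightarrow>
     ('n phase \<times> 'n phase \<Rightarrow> complex) \<Rightarrow> complex" where
  "mapping_R law = (THE R.
     linear_continuous_map schwartz_topology tempered_topology R \<and>
     (\<forall>f1\<in>schwartz. \<forall>f2\<in>schwartz. \<forall>g1\<in>schwartz. \<forall>g2\<in>schwartz.
        R (tensor f1 f2) (tensor g1 g2) = pairing phase_measure (law g1 f1) (law g2 f2)) \<and>
     (\<forall>F. F \<notin> schwartz \<longrightarrow> R F = (\<lambda>_. 0)))"

definition mapping_N ::
    "'n::finite composition \<Rightarrow> ('n phase \<times> 'n phase \<Rightarrow> complex) \<Rightarrow>
     ('n phase \<times> 'n phase \<Rightarrow> complex) \<Rightarrow> complex" where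
  "mapping_N law = (THE N.
     linear_continuous_map schwartz_topology tempered_topology N \<and>
     (\<forall>f1\<in>schwartz. \<forall>f2\<in>schwartz. \<forall>g1\<in>schwartz. \<forall>g2\<in>schwartz.
        N (tensor f1 f2) (tensor g1 g2) =
          pairing phase_measure (law (symplectic_fourier g1) f1) (law (symplectic_fourier g2) f2)) \<and>
     (\<forall>F. F \<notin> schwartz \<longrightarrow> N F = (\<lambda>_. 0)))"

definition coord_change :: "'n::finite phase \<times> 'n phase \<Rightarrow> 'n phase \<times> 'n phase" where
  "coord_change = (\<lambda>(X, Y). (- X, X - Y))"

text \<open>
  The extension of \<open>F \<mapsto> F \<circ> C\<close> to distributions. No Jacobian factor appears because the
  linear bijection \<open>C\<close> has determinant of modulus one.
\<close>

definition pullback_C ::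
    "(('n::finite phase \<times> 'n phase \<Rightarrow> complex) \<Rightarrow> complex) \<Rightarrow>
     ('n phase \<times> 'n phase \<Rightarrow> complex) \<Rightarrow> complex" where
  "pullback_C T = (\<lambda>h. T (h \<circ> inv coord_change))"

definition mapping_M ::
    "'n::finite composition \<Rightarrow> ('n phase \<times> 'n phase \<Rightarrow> complex) \<Rightarrow>
     ('n phase \<times> 'n phase \<Rightarrow> complex) \<Rightarrow> complex" where
  "mapping_M law = pullback_C \<circ> mapping_N law"


section \<open>Basic facts\<close>

lemma iterated_derivative_zero: "iterated_derivative vs (\<lambda>_. 0) = (\<lambda>_. 0)"
  by (induction vs) (auto simp: frechet_derivative_const)

lemma zero_in_schwartz: "(\<lambda>_. 0) \<in> schwartz"
  by (auto simp: schwartz_def iterated_derivative_zero)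

lemma topspace_schwartz_topology [simp]: "topspace schwartz_topology = schwartz"
proof -
  have "f \<in> topspace schwartz_topology" if "f \<in> schwartz" for f :: "'a \<Rightarrow> complex"
  proof -
    have "schwartz_seminorm 0 [] (\<lambda>x. f x - f x) < 1"
      by (simp add: schwartz_seminorm_def)
    moreover have "schwartz_seminorm 0 ([]::'a list) \<in> schwartz_seminorms"
      by (auto simp: schwartz_seminorms_def)
    ultimately show ?thesis
      using that zero_less_one[where ?'a = real]
      unfolding schwartz_topology_def seminorm_topology_def topology_generated_by_topspace
      by blast
  qed
  then show ?thesis
    by (auto simp: schwartz_topology_def seminorm_topology_def)
qed

lemma topspace_tempered_topology [simp]: "topspace tempered_topology = tempered"
proof -
  have "T \<in> topspace tempered_topology" if "T \<in> tempered" for T :: "('a \<Rightarrow> complex) \<Rightarrow> complex"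
  proof -
    let ?B = "{\<lambda>_. 0} :: ('a \<Rightarrow> complex) set"
    have "strong_seminorm ?B (\<lambda>x. T x - T x) < 1"
      by (simp add: strong_seminorm_def)
    moreover have "strong_seminorm ?B \<in> {strong_seminorm B |B. bounded_in_schwartz B \<and> B \<noteq> {}}"
      using zero_in_schwartz by (auto simp: bounded_in_schwartz_def)
    ultimately show ?thesis
      using that zero_less_one[where ?'a = real]
      unfolding tempered_topology_def seminorm_topology_def topology_generated_by_topspace
      by blast
  qed
  then show ?thesis
    by (auto simp: tempered_topology_def seminorm_topology_def)
qed

lemma inv_coord_change: "inv coord_change = (\<lambda>(U, V). (- U, - U - V))"
  by (rule inv_equality) (auto simp: coord_change_def)

end

theory Submission
  imports Defs
begin

text \<open>
  Write \<open>q(f1, f2, g1, g2)\<close> for the integral of \<open>(g1 # f1)(g2 # f2)\<close>. By Hypothesis A the integral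
  is a trace on the algebra of Schwartz functions: the integral of \<open>f # g\<close> is that of \<open>f g\<close>, which is
  symmetric in \<open>f\<close> and \<open>g\<close>. So \<open>q\<close> is the trace of \<open>g1 # f1 # g2 # f2\<close> and is invariant under
  cyclic permutations of this product. The mapping \<open>R\<close> is the operator with kernel \<open>q\<close>, and the theorem
  reduces to one claim: there is a continuous operator \<open>K\<close> of the Schwartz space of
  \<open>\<Xi> \<times> \<Xi>\<close> whose pairing of \<open>K (f1 \<otimes> f2)\<close> with \<open>g1 \<otimes> g2\<close> is a constant times
  \<open>q(f1, f2, g1, g2)\<close>.

  The claim is an estimate on matrix coefficients. Let \<open>h\<^sub>\<alpha>\<close> be the Hermite functions and
  \<open>w\<^sub>\<alpha> = 1 + |\<alpha>|\<close>. Expansion in Hermite functions identifies the Schwartz space with the rapidly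
  decreasing sequences, so an infinite matrix defines a continuous operator as soon as its rows
  decrease rapidly, with bounds that grow at most polynomially in the index of the row (lemma
  \<open>matrix_operator\<close>). For \<open>q\<close> this says that for each \<open>N\<close> there are \<open>C\<close> and \<open>M\<close> such that
  \<open>w\<^sub>\<gamma>\<close> and \<open>w\<^sub>\<delta>\<close> to the power \<open>N\<close>, times \<open>|q(h\<^sub>\<alpha>, h\<^sub>\<beta>, h\<^sub>\<gamma>, h\<^sub>\<delta>)|\<close>, is at most
  \<open>C\<close> times \<open>w\<^sub>\<alpha>\<close> and \<open>w\<^sub>\<beta>\<close> to the power \<open>M\<close>.

  Fix first \<open>f1\<close> and \<open>f2\<close> (lemma \<open>four_form_decay\<close>). For an absolutely summable family \<open>c\<close> the
  functional \<open>T = \<Sum>\<^sub>\<delta> c\<^sub>\<delta> w\<^sub>\<delta>^N \<langle>\<cdot>, h\<^sub>\<delta>\<rangle>\<close> is a tempered distribution, and Hypothesis B turns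
  \<open>f1 # T # f2\<close> into a Schwartz function \<open>u\<close>. By cyclicity the sum over \<open>\<delta>\<close> of
  \<open>c\<^sub>\<delta> w\<^sub>\<delta>^N q(f1, f2, h\<^sub>\<gamma>, h\<^sub>\<delta>)\<close> is a multiple of \<open>\<langle>u, h\<^sub>\<gamma>\<rangle>\<close>, which decreases rapidly in
  \<open>\<gamma>\<close>. As \<open>c\<close> was an arbitrary element of the Banach space of summable families, uniform
  boundedness shows that \<open>w\<^sub>\<gamma>^N w\<^sub>\<delta>^N q(f1, f2, h\<^sub>\<gamma>, h\<^sub>\<delta>)\<close> is bounded. The dependence on \<open>f1\<close>
  and then on \<open>f2\<close> is controlled by two more applications of uniform boundedness, now on the Schwartz
  space (lemma \<open>four_form_joint_bound\<close>).

  Once \<open>K\<close> is available, cyclicity of the trace identifies its transpose: it is \<open>K\<close> preceded by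
  the flip of the two factors (lemma \<open>kernel_transpose\<close>). An operator of the Schwartz space with a
  transpose that is again such an operator extends to tempered distributions by duality, and the
  extension is unique because the Hermite partial sums of a tempered distribution converge to it
  strongly (lemma \<open>transpose_extension\<close>). The mappings \<open>N\<close> and \<open>M\<close> arise from \<open>R\<close> by composition
  with a symplectic Fourier transform and with a linear change of variables, both of which have
  such transposes.
\<close>

section \<open>Linear maps between seminormed function spaces\<close>

definition function_space :: "('x \<Rightarrow> complex) set \<Rightarrow> bool" where
  "function_space V \<longleftrightarrow> (\<lambda>_. 0) \<in> V \<and> (\<forall>f\<in>V. \<forall>g\<in>V. \<forall>a b. (\<lambda>x. a * f x + b * g x) \<in> V)"

definition seminorm_on :: "('x \<Rightarrow> complex) set \<Rightarrow> (('x \<Rightarrow> complex) \<Rightarrow> real) \<Rightarrow> bool" where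
  "seminorm_on V p \<longleftrightarrow>
     (\<forall>f\<in>V. 0 \<le> p f) \<and>
     (\<forall>f\<in>V. \<forall>g\<in>V. \<forall>a b. p (\<lambda>x. a * f x + b * g x) \<le> cmod a * p f + cmod b * p g)"

lemma function_space_lin:
  "function_space V \<Longrightarrow> f \<in> V \<Longrightarrow> g \<in> V \<Longrightarrow> (\<lambda>x. a * f x + b * g x) \<in> V"
  by (simp add: function_space_def)

lemma function_space_ops:
  assumes "function_space V" "f \<in> V" "g \<in> V"
  shows "(\<lambda>x. f x + g x) \<in> V" "(\<lambda>x. f x - g x) \<in> V" "(\<lambda>x. a * f x) \<in> V"
  using function_space_lin[OF assms, of 1 1] function_space_lin[OF assms, of 1 "-1"]
    function_space_lin[OF assms, of a 0] by simp_all

lemma function_space_sum: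
  assumes "function_space V" "finite A" "\<And>i. i \<in> A \<Longrightarrow> f i \<in> V"
  shows "(\<lambda>x. \<Sum>i\<in>A. c i * f i x) \<in> V"
  using assms(2,3)
proof (induction A rule: finite_induct)
  case empty
  then show ?case using assms(1) by (simp add: function_space_def)
next
  case (insert i A)
  then have "(\<lambda>x. c i * f i x + 1 * (\<Sum>i\<in>A. c i * f i x)) \<in> V"
    by (intro function_space_lin[OF assms(1)]) auto
  then show ?case using insert by simp
qed

lemma functional_lin:
  "clinear_functional_on V T \<Longrightarrow> f \<in> V \<Longrightarrow> g \<in> V \<Longrightarrow>
     T (\<lambda>x. a * f x + b * g x) = a * T f + b * T g"
  by (simp add: clinear_functional_on_def)

lemma functional_ops:
  assumes "clinear_functional_on V T" "f \<in> V" "g \<in> V"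
  shows "T (\<lambda>x. f x + g x) = T f + T g" "T (\<lambda>x. f x - g x) = T f - T g" "T (\<lambda>x. a * f x) = a * T f"
  using functional_lin[OF assms, of 1 1] functional_lin[OF assms, of 1 "-1"]
    functional_lin[OF assms, of a 0] by simp_all

lemma functional_sum:
  assumes "clinear_functional_on V T" "function_space V" "finite A" "\<And>i. i \<in> A \<Longrightarrow> f i \<in> V"
  shows "T (\<lambda>x. \<Sum>i\<in>A. c i * f i x) = (\<Sum>i\<in>A. c i * T (f i))"
  using assms(3,4)
proof (induction A rule: finite_induct)
  case empty
  have "T (\<lambda>x. 0 * 0 + 0 * 0) = 0 * T (\<lambda>_. 0) + 0 * T (\<lambda>_. 0)"
    using assms(1,2) by (intro functional_lin) (auto simp: function_space_def)
  then show ?case by simp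
next
  case (insert i A)
  have "T (\<lambda>x. c i * f i x + 1 * (\<Sum>i\<in>A. c i * f i x)) = c i * T (f i) + 1 * T (\<lambda>x. \<Sum>i\<in>A. c i * f i x)"
    using insert assms by (intro functional_lin[OF assms(1)] function_space_sum) auto
  then show ?case using insert by simp
qed

lemma seminorm_lin:
  "seminorm_on V p \<Longrightarrow> f \<in> V \<Longrightarrow> g \<in> V \<Longrightarrow>
     p (\<lambda>x. a * f x + b * g x) \<le> cmod a * p f + cmod b * p g"
  by (simp add: seminorm_on_def)

lemma seminorm_nonneg: "seminorm_on V p \<Longrightarrow> f \<in> V \<Longrightarrow> 0 \<le> p f"
  by (simp add: seminorm_on_def)

lemma seminorm_ops:
  assumes "seminorm_on V p" "f \<in> V" "g \<in> V"
  shows "p (\<lambda>x. f x + g x) \<le> p f + p g" "p (\<lambda>x. f x - g x) \<le> p f + p g"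
    "p (\<lambda>x. a * f x) \<le> cmod a * p f"
  using seminorm_lin[OF assms, of 1 1] seminorm_lin[OF assms, of 1 "-1"]
    seminorm_lin[OF assms, of a 0] by simp_all

lemma seminorm_diff_self:
  assumes "seminorm_on V p" "f \<in> V" "function_space V"
  shows "p (\<lambda>x. f x - f x) = 0"
proof -
  have "p (\<lambda>x. 0 * f x + 0 * f x) \<le> 0" using seminorm_lin[OF assms(1,2,2), of 0 0] by simp
  moreover have "0 \<le> p (\<lambda>x. 0 * f x + 0 * f x)"
    using seminorm_nonneg[OF assms(1) function_space_lin[OF assms(3,2,2)]] .
  ultimately show ?thesis by simp
qed

lemma topspace_seminorm_topology_subset: "topspace (seminorm_topology V P) \<subseteq> V"
  by (auto simp: seminorm_topology_def)

lemma seminorm_ball_open: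
  assumes "f \<in> V" "p \<in> P" "e > 0"
  shows "openin (seminorm_topology V P) {g \<in> V. p (\<lambda>x. g x - f x) < e}"
  unfolding seminorm_topology_def openin_topology_generated_by_iff
  by (rule generate_topology_on.Basis) (use assms in blast)

text \<open>The balls about arbitrary centres form only a subbase. By the triangle inequality a ball
  about another centre contains a small ball about \<open>f\<close>, so finitely many seminorms at \<open>f\<close>
  itself suffice.\<close>

lemma seminorm_neighbourhood:
  assumes P: "\<And>p. p \<in> P \<Longrightarrow> seminorm_on V p" and V: "function_space V"
    and U: "openin (seminorm_topology V P) U" and f: "f \<in> U"
  shows "\<exists>P0 e. finite P0 \<and> P0 \<subseteq> P \<and> e > 0 \<and>
           (\<forall>g\<in>V. (\<forall>p\<in>P0. p (\<lambda>x. g x - f x) < e) \<longrightarrow> g \<in> U)"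
  using U[unfolded seminorm_topology_def openin_topology_generated_by_iff] f
proof (induction rule: generate_topology_on.induct)
  case Empty
  then show ?case by simp
next
  case (Int a b)
  then have fab: "f \<in> a" "f \<in> b" by auto
  from Int.IH(1)[OF fab(1)] obtain P1 e1 where
    A: "finite P1 \<and> P1 \<subseteq> P \<and> e1 > 0 \<and> (\<forall>g\<in>V. (\<forall>p\<in>P1. p (\<lambda>x. g x - f x) < e1) \<longrightarrow> g \<in> a)"
    by (elim exE)
  from Int.IH(2)[OF fab(2)] obtain P2 e2 where
    B: "finite P2 \<and> P2 \<subseteq> P \<and> e2 > 0 \<and> (\<forall>g\<in>V. (\<forall>p\<in>P2. p (\<lambda>x. g x - f x) < e2) \<longrightarrow> g \<in> b)"
    by (elim exE)
  from A B show ?case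
    by (intro exI[of _ "P1 \<union> P2"] exI[of _ "min e1 e2"]) auto
next
  case (UN K)
  then obtain k where k: "k \<in> K" "f \<in> k" by blast
  from UN.IH[OF this] k(1) show ?case by blast
next
  case (Basis s)
  then obtain h p e where s: "s = {g \<in> V. p (\<lambda>x. g x - h x) < e}" "h \<in> V" "p \<in> P" "e > 0"
    by blast
  have fV: "f \<in> V" and fh: "p (\<lambda>x. f x - h x) < e" using Basis s by auto
  have "g \<in> s" if "g \<in> V" "p (\<lambda>x. g x - f x) < e - p (\<lambda>x. f x - h x)" for g
  proof -
    have "p (\<lambda>x. (g x - f x) + (f x - h x)) \<le> p (\<lambda>x. g x - f x) + p (\<lambda>x. f x - h x)"
      using that fV s(2) by (intro seminorm_ops(1)[OF P[OF s(3)]] function_space_ops(2)[OF V]) auto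
    then show ?thesis using that s by simp
  qed
  then show ?case
    using s fh by (intro exI[of _ "{p}"] exI[of _ "e - p (\<lambda>x. f x - h x)"]) auto
qed

lemma topspace_seminorm_topology:
  assumes "\<And>p. p \<in> P \<Longrightarrow> seminorm_on V p" "P \<noteq> {}" "function_space V"
  shows "topspace (seminorm_topology V P) = V"
proof -
  have "f \<in> topspace (seminorm_topology V P)" if "f \<in> V" for f
  proof -
    obtain p where p: "p \<in> P" using assms(2) by blast
    have "f \<in> {g \<in> V. p (\<lambda>x. g x - f x) < 1}"
      using that seminorm_diff_self[OF assms(1)[OF p] that assms(3)] by simp
    then show ?thesis
      using openin_subset[OF seminorm_ball_open[OF that p, of 1]] by auto
  qed
  then show ?thesis using topspace_seminorm_topology_subset by blast
qed

text \<open>For linear maps, continuity between seminorm topologies means that each seminorm of the target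
  is dominated by finitely many seminorms of the source. This lemma and the next ones show the two
  directions, with the complex plane as a possible target.\<close>

lemma seminorm_continuous_functional_bound:
  assumes P: "\<And>p. p \<in> P \<Longrightarrow> seminorm_on V p" "P \<noteq> {}" and V: "function_space V"
    and lin: "clinear_functional_on V T"
    and cont: "continuous_map (seminorm_topology V P) euclidean T"
  shows "\<exists>P0 C. finite P0 \<and> P0 \<subseteq> P \<and> C \<ge> 0 \<and> (\<forall>f\<in>V. cmod (T f) \<le> C * (\<Sum>p\<in>P0. p f))"
proof -
  have top: "topspace (seminorm_topology V P) = V"
    by (rule topspace_seminorm_topology[OF P V])
  let ?z = "\<lambda>_. 0 :: complex"
  have z: "?z \<in> V" using V by (simp add: function_space_def)
  have T0: "T ?z = 0" using functional_lin[OF lin z z, of 0 0] by simp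
  have "openin (seminorm_topology V P) {f \<in> V. T f \<in> ball 0 1}"
    using openin_continuous_map_preimage[OF cont, of "ball 0 1"] top by simp
  from seminorm_neighbourhood[OF P(1) V this, of ?z] z T0
  obtain P0 e where P0: "finite P0" "P0 \<subseteq> P" "e > 0"
    and imp: "\<And>g. g \<in> V \<Longrightarrow> (\<forall>p\<in>P0. p g < e) \<Longrightarrow> cmod (T g) < 1" by auto
  have "cmod (T f) \<le> (2 / e) * (\<Sum>p\<in>P0. p f)" if f: "f \<in> V" for f
  proof (rule ccontr)
    let ?S = "\<Sum>p\<in>P0. p f"
    assume "\<not> ?thesis"
    then have lt: "2 / e * ?S < cmod (T f)" by simp
    have pn: "p f \<ge> 0" if "p \<in> P0" for p
      using seminorm_nonneg[OF P(1)] that P0 f by auto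
    have S0: "?S \<ge> 0" by (intro sum_nonneg pn)
    have T: "cmod (T f) > 0" using lt S0 \<open>e > 0\<close> 
      by (smt (verit) divide_nonneg_nonneg mult_nonneg_nonneg)
    define c where "c = complex_of_real (1 / cmod (T f))"
    have cm: "cmod c = 1 / cmod (T f)" using T by (simp add: c_def norm_divide)
    have "p (\<lambda>x. c * f x) < e" if p: "p \<in> P0" for p
    proof -
      have "p (\<lambda>x. c * f x) \<le> cmod c * p f"
        using P0 p by (intro seminorm_ops(3)[OF P(1) f f]) auto
      also have "\<dots> \<le> cmod c * ?S"
        using member_le_sum[OF p, of "\<lambda>p. p f"] pn P0 by (intro mult_left_mono) auto
      also have "\<dots> < e"
      proof -
        have "2 * ?S < e * cmod (T f)" using lt \<open>e > 0\<close> by (simp add: field_simps)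
        then have "?S < e * cmod (T f)" using S0 by linarith
        then show ?thesis unfolding cm using T by (simp add: pos_divide_less_eq)
      qed
      finally show ?thesis .
    qed
    then have "cmod (T (\<lambda>x. c * f x)) < 1"
      using function_space_ops(3)[OF V f f, of c] imp by blast
    moreover have "cmod (T (\<lambda>x. c * f x)) = 1"
      using functional_ops(3)[OF lin f f, of c] cm T by (simp add: norm_mult)
    ultimately show False by simp
  qed
  then show ?thesis using P0
    by (intro exI[of _ P0] exI[of _ "2 / e"]) (auto intro: less_imp_le)
qed

lemma seminorm_small_open:
  assumes P: "\<And>p. p \<in> P \<Longrightarrow> seminorm_on V p" "P \<noteq> {}" and V: "function_space V"
    and U: "U \<subseteq> V"
    and nb: "\<And>f. f \<in> U \<Longrightarrow> \<exists>P0 e. finite P0 \<and> P0 \<subseteq> P \<and> e > 0 \<and>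
           (\<forall>g\<in>V. (\<forall>p\<in>P0. p (\<lambda>x. g x - f x) < e) \<longrightarrow> g \<in> U)"
  shows "openin (seminorm_topology V P) U"
proof (subst openin_subopen, intro ballI)
  fix f assume f: "f \<in> U"
  from nb[OF f] obtain P0 e where P0: "finite P0" "P0 \<subseteq> P" "e > 0"
    and imp: "\<forall>g\<in>V. (\<forall>p\<in>P0. p (\<lambda>x. g x - f x) < e) \<longrightarrow> g \<in> U" by blast
  obtain q where q: "q \<in> P" using P(2) by blast
  let ?W = "\<Inter>p\<in>insert q P0. {g \<in> V. p (\<lambda>x. g x - f x) < e}"
  have "openin (seminorm_topology V P) ?W"
    using P0 f U q by (intro openin_INT2 seminorm_ball_open) auto
  moreover have "f \<in> ?W"
  proof -
    have "p (\<lambda>x. f x - f x) < e" if "p \<in> insert q P0" for p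
    proof -
      have "p \<in> P" "f \<in> V" using that P0 q f U by auto
      then show ?thesis using seminorm_diff_self[OF P(1) _ V, of p f] P0(3) by simp
    qed
    then show ?thesis using f U by auto
  qed
  moreover have "?W \<subseteq> U" using imp by auto
  ultimately show "\<exists>T. openin (seminorm_topology V P) T \<and> f \<in> T \<and> T \<subseteq> U" by blast
qed

lemma seminorm_bound_continuous_map:
  assumes P: "\<And>p. p \<in> P \<Longrightarrow> seminorm_on V p" "P \<noteq> {}" and V: "function_space V"
    and Q: "\<And>q. q \<in> Q \<Longrightarrow> seminorm_on W q" "Q \<noteq> {}" and W: "function_space W"
    and maps: "\<And>f. f \<in> V \<Longrightarrow> \<Phi> f \<in> W" and lin: "clinear_map_on V \<Phi>"
    and bound: "\<And>q. q \<in> Q \<Longrightarrow> \<exists>P0 C. finite P0 \<and> P0 \<subseteq> P \<and> (\<forall>f\<in>V. q (\<Phi> f) \<le> C * (\<Sum>p\<in>P0. p f))"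
  shows "continuous_map (seminorm_topology V P) (seminorm_topology W Q) \<Phi>"
  unfolding seminorm_topology_def[of W]
proof (rule continuous_on_generated_topo)
  have topV: "topspace (seminorm_topology V P) = V" by (rule topspace_seminorm_topology[OF P V])
  have topW: "topspace (seminorm_topology W Q) = W" by (rule topspace_seminorm_topology[OF Q W])
  show "\<Phi> ` topspace (seminorm_topology V P)
      \<subseteq> \<Union> {{g \<in> W. q (\<lambda>x. g x - f x) < e} |f q e. f \<in> W \<and> q \<in> Q \<and> e > 0}"
    unfolding topV topology_generated_by_topspace[symmetric] seminorm_topology_def[symmetric] topW
    using maps by (intro image_subsetI)
  fix U assume "U \<in> {{g \<in> W. q (\<lambda>x. g x - f x) < e} |f q e. f \<in> W \<and> q \<in> Q \<and> e > 0}"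
  then obtain h q e where U: "U = {g \<in> W. q (\<lambda>x. g x - h x) < e}" "h \<in> W" "q \<in> Q" "e > 0" by blast
  obtain P0 C where P0: "finite P0" "P0 \<subseteq> P" and C: "\<forall>f\<in>V. q (\<Phi> f) \<le> C * (\<Sum>p\<in>P0. p f)"
    using bound[OF U(3)] by blast
  define N where "N = 1 + \<bar>C\<bar> * real (card P0)"
  have N: "N > 0" by (simp add: N_def add_pos_nonneg)
  show "openin (seminorm_topology V P) (\<Phi> -` U \<inter> topspace (seminorm_topology V P))"
  proof (rule seminorm_small_open[OF P V])
    show "\<Phi> -` U \<inter> topspace (seminorm_topology V P) \<subseteq> V" using topV by blast
    fix f assume "f \<in> \<Phi> -` U \<inter> topspace (seminorm_topology V P)"
    then have f: "f \<in> V" and less: "q (\<lambda>x. \<Phi> f x - h x) < e" using topV U(1) by auto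
    define d where "d = (e - q (\<lambda>x. \<Phi> f x - h x)) / N"
    have d: "d > 0" using less N by (simp add: d_def)
    have "g \<in> \<Phi> -` U \<inter> topspace (seminorm_topology V P)"
      if g: "g \<in> V" and small: "\<forall>p\<in>P0. p (\<lambda>x. g x - f x) < d" for g
    proof -
      have gf: "(\<lambda>x. g x - f x) \<in> V" by (rule function_space_ops(2)[OF V g f])
      have "\<Phi> (\<lambda>x. 1 * g x + (-1) * f x) = (\<lambda>y. 1 * \<Phi> g y + (-1) * \<Phi> f y)"
        using lin f g unfolding clinear_map_on_def by blast
      then have eq: "\<Phi> (\<lambda>x. g x - f x) = (\<lambda>y. \<Phi> g y - \<Phi> f y)" by simp
      have pn: "p (\<lambda>x. g x - f x) \<ge> 0" if "p \<in> P0" for p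
        using seminorm_nonneg[OF P(1) gf] that P0 by auto
      have "q (\<lambda>y. \<Phi> g y - \<Phi> f y) \<le> C * (\<Sum>p\<in>P0. p (\<lambda>x. g x - f x))"
        using C gf eq by metis
      also have "\<dots> \<le> \<bar>C\<bar> * (\<Sum>p\<in>P0. d)"
        using small pn by (intro mult_mono sum_mono sum_nonneg) (auto intro: less_imp_le)
      also have "\<dots> < N * d" using d by (simp add: N_def algebra_simps)
      also have "\<dots> = e - q (\<lambda>x. \<Phi> f x - h x)" using N by (simp add: d_def)
      finally have "q (\<lambda>y. \<Phi> g y - \<Phi> f y) + q (\<lambda>x. \<Phi> f x - h x) < e" by simp
      moreover have "q (\<lambda>y. (\<Phi> g y - \<Phi> f y) + (\<Phi> f y - h y))
          \<le> q (\<lambda>y. \<Phi> g y - \<Phi> f y) + q (\<lambda>x. \<Phi> f x - h x)"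
        using U(2) f g by (intro seminorm_ops(1)[OF Q(1)[OF U(3)]] function_space_ops(2)[OF W] maps) auto
      ultimately have "q (\<lambda>y. \<Phi> g y - h y) < e" by simp
      then show ?thesis using maps[OF g] topV U(1) g by auto
    qed
    then show "\<exists>P0 e. finite P0 \<and> P0 \<subseteq> P \<and> e > 0 \<and>
           (\<forall>g\<in>V. (\<forall>p\<in>P0. p (\<lambda>x. g x - f x) < e) \<longrightarrow> g \<in> \<Phi> -` U \<inter> topspace (seminorm_topology V P))"
      using P0 d by (intro exI[of _ P0] exI[of _ d]) auto
  qed
qed

lemma seminorm_bound_continuous_functional:
  assumes P: "\<And>p. p \<in> P \<Longrightarrow> seminorm_on V p" "P \<noteq> {}" and V: "function_space V"
    and lin: "clinear_functional_on V T"
    and P0: "finite P0" "P0 \<subseteq> P" and bound: "\<And>f. f \<in> V \<Longrightarrow> cmod (T f) \<le> C * (\<Sum>p\<in>P0. p f)"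
  shows "continuous_map (seminorm_topology V P) euclidean T"
  unfolding continuous_map_def
proof (intro conjI allI impI)
  have topV: "topspace (seminorm_topology V P) = V" by (rule topspace_seminorm_topology[OF P V])
  show "T \<in> topspace (seminorm_topology V P) \<rightarrow> topspace euclidean" by simp
  fix U :: "complex set" assume "openin euclidean U"
  then have U: "open U" by simp
  define N where "N = 1 + \<bar>C\<bar> * real (card P0)"
  have N: "N > 0" by (simp add: N_def add_pos_nonneg)
  show "openin (seminorm_topology V P) {f \<in> topspace (seminorm_topology V P). T f \<in> U}"
  proof (rule seminorm_small_open[OF P V])
    fix f assume "f \<in> {f \<in> topspace (seminorm_topology V P). T f \<in> U}"
    then have f: "f \<in> V" "T f \<in> U" using topV by auto
    then obtain e where e: "e > 0" "ball (T f) e \<subseteq> U" using U open_contains_ball by blast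
    have "g \<in> {f \<in> topspace (seminorm_topology V P). T f \<in> U}"
      if g: "g \<in> V" and small: "\<forall>p\<in>P0. p (\<lambda>x. g x - f x) < e / N" for g
    proof -
      have gf: "(\<lambda>x. g x - f x) \<in> V" by (rule function_space_ops(2)[OF V g f(1)])
      have pn: "p (\<lambda>x. g x - f x) \<ge> 0" if "p \<in> P0" for p
        using seminorm_nonneg[OF P(1) gf] that P0 by auto
      have "cmod (T g - T f) \<le> C * (\<Sum>p\<in>P0. p (\<lambda>x. g x - f x))"
        using bound[OF gf] functional_ops(2)[OF lin g f(1)] by simp
      also have "\<dots> \<le> \<bar>C\<bar> * (\<Sum>p\<in>P0. e / N)"
        using small pn by (intro mult_mono sum_mono sum_nonneg) (auto intro: less_imp_le)
      also have "\<dots> = (N - 1) * (e / N)" by (simp add: N_def)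
      also have "\<dots> < N * (e / N)" using e N by (intro mult_strict_right_mono) auto
      also have "\<dots> = e" using N by simp
      finally have "T g \<in> ball (T f) e" by (simp add: dist_norm norm_minus_commute)
      then show ?thesis using e topV g by auto
    qed
    then show "\<exists>P0 e. finite P0 \<and> P0 \<subseteq> P \<and> e > 0 \<and> (\<forall>g\<in>V. (\<forall>p\<in>P0. p (\<lambda>x. g x - f x) < e) \<longrightarrow>
           g \<in> {f \<in> topspace (seminorm_topology V P). T f \<in> U})"
      using P0 e N by (intro exI[of _ P0] exI[of _ "e / N"]) auto
  qed (use topV in auto)
qed

section \<open>Uniform boundedness\<close>

text \<open>Pointwise bounds on a family of functionals imply uniform ones. The bounds may grow like an
  unknown power of a weight \<open>\<theta>\<close> of the index; this power is uniform as well. Instead of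
  completeness of a metric, only the convergence of absolutely convergent series under all the
  functionals is assumed, so the lemma applies to the Schwartz space and to summable families alike.

  The proof is the gliding hump. If the claim fails, functions \<open>f\<^sub>k\<close> and indices \<open>j\<^sub>k\<close> are chosen
  one after the other such that \<open>f\<^sub>k\<close> is tiny for all seminorms and functionals used before, while
  the partial sum \<open>g\<^sub>k\<close> is large for the functional \<open>l\<close> with index \<open>j\<^sub>k\<close>. The sum of the series
  then violates the pointwise bound.\<close>

lemma uniform_boundedness_growth:
  fixes V :: "('x \<Rightarrow> complex) set" and p :: "nat \<Rightarrow> ('x \<Rightarrow> complex) \<Rightarrow> real"
    and l :: "'j \<Rightarrow> ('x \<Rightarrow> complex) \<Rightarrow> complex" and \<theta> :: "'j \<Rightarrow> real"
  assumes V: "function_space V" and p: "\<And>m. seminorm_on V (p m)"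
    and mono: "\<And>m n f. f \<in> V \<Longrightarrow> m \<le> n \<Longrightarrow> p m f \<le> p n f"
    and complete: "\<And>f. (\<And>k. f k \<in> V) \<Longrightarrow> (\<And>m. summable (\<lambda>k. p m (f k))) \<Longrightarrow>
                     \<exists>g\<in>V. \<forall>j. (\<lambda>k. l j (f k)) sums l j g"
    and lin: "\<And>j. clinear_functional_on V (l j)"
    and bounded: "\<And>j. \<exists>m C. \<forall>f\<in>V. cmod (l j f) \<le> C * p m f"
    and \<theta>: "\<And>j. \<theta> j \<ge> 1"
    and pointwise: "\<And>f. f \<in> V \<Longrightarrow> \<exists>M::nat. \<forall>j. cmod (l j f) \<le> real M * \<theta> j ^ M"
  shows "\<exists>M::nat. \<forall>j. \<forall>f\<in>V. cmod (l j f) \<le> real M * \<theta> j ^ M * p M f"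
proof (rule ccontr)
  assume "\<not> ?thesis"
  then have bad: "\<exists>j f. f \<in> V \<and> real M * \<theta> j ^ M * p M f < cmod (l j f)" for M
    by (meson not_le)
  \<comment> \<open>A state consists of the newest term \<open>f\<close>, the partial sum \<open>g\<close>, the index \<open>j\<close> at which \<open>g\<close> is large,
    and a seminorm with constant \<open>C\<close> which dominates the functional with index \<open>j\<close>. The constants
    increase along \<open>step\<close>, so a term small for the current seminorm is small for all earlier functionals.\<close>
  define ok where "ok = (\<lambda>k (f :: 'x \<Rightarrow> complex, g, j, m::nat, C::real).
     f \<in> V \<and> g \<in> V \<and> C \<ge> 1 \<and> real (k + 2) * \<theta> j ^ k \<le> cmod (l j g) \<and>
     (\<forall>h\<in>V. cmod (l j h) \<le> C * p m h))"
  define step where "step = (\<lambda>k (f :: 'x \<Rightarrow> complex, g, j::'j, m, C) (f', g', j'::'j, m', C').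
     g' = (\<lambda>x. g x + f' x) \<and> m \<le> m' \<and> C \<le> C' \<and> C * p (max m k) f' \<le> (1/2) ^ Suc k)"
  have extend: "\<exists>f' g' j' m' C'. ok n (f', g', j', m', C') \<and>
      g' = (\<lambda>x. g x + f' x) \<and> m \<le> m' \<and> C \<le> C' \<and> C * p (max m k) f' \<le> (1/2) ^ Suc k"
    if g: "g \<in> V" and C: "C \<ge> 1" for g m C k n
  proof -
    obtain N where N: "real N \<ge> C * 2 ^ Suc k * real (n + 2)"
      using real_arch_simple[of "C * 2 ^ Suc k * real (n + 2)"] by (elim exE)
    define M where "M = N + n + max m k + 1"
    have M: "real M \<ge> C * 2 ^ Suc k * real (n + 2)" "M \<ge> n" "M \<ge> max m k" "M \<ge> 1"
      using N unfolding M_def by linarith+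
    obtain j f where f: "f \<in> V" "real M * \<theta> j ^ M * p M f < cmod (l j f)"
      using bad[of M] by (elim exE conjE)
    define L where "L = cmod (l j f)"
    have pM: "p M f \<ge> 0" by (rule seminorm_nonneg[OF p f(1)])
    have \<theta>M: "\<theta> j ^ M \<ge> \<theta> j ^ n" "\<theta> j ^ n \<ge> 1" "\<theta> j ^ M > 0"
      using \<theta>[of j] M(2) power_increasing[of n M "\<theta> j"] one_le_power[of "\<theta> j" n]
        zero_less_power[of "\<theta> j" M] by linarith+
    have "0 \<le> real M * \<theta> j ^ M * p M f"
      by (rule mult_nonneg_nonneg[OF mult_nonneg_nonneg[OF of_nat_0_le_iff less_imp_le[OF \<theta>M(3)]] pM])
    then have L: "L > 0" using f(2) unfolding L_def by linarith
    define R where "R = real (n + 2) * \<theta> j ^ n"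
    have R: "R > 0" using \<theta>M(2) unfolding R_def by (intro mult_pos_pos) auto
    define c where "c = complex_of_real (R / L)"
    have cm: "cmod c = R / L" using R L by (simp add: c_def norm_divide)
    define h where "h = (\<lambda>x. c * f x)"
    have h: "h \<in> V" unfolding h_def by (rule function_space_ops(3)[OF V f(1) f(1)])
    have lh: "cmod (l j h) = R"
      unfolding h_def functional_ops(3)[OF lin f(1) f(1)] norm_mult cm using L by (simp add: L_def)
    have ph: "p (max m k) (\<lambda>x. s * h x) \<le> (1/2) ^ Suc k / C" if s: "cmod s = 1" for s
    proof -
      have "p (max m k) (\<lambda>x. s * h x) \<le> cmod s * (cmod c * p (max m k) f)"
      proof -
        have "p (max m k) (\<lambda>x. s * h x) \<le> cmod s * p (max m k) h"
          by (rule seminorm_ops(3)[OF p h h])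
        also have "p (max m k) h \<le> cmod c * p (max m k) f"
          unfolding h_def by (rule seminorm_ops(3)[OF p f(1) f(1)])
        finally show ?thesis by (simp add: s)
      qed
      also have "\<dots> \<le> R / L * p M f"
        using s cm mono[OF f(1) M(3)] R L by (simp add: divide_right_mono mult_left_mono)
      also have "\<dots> \<le> R / (real M * \<theta> j ^ M)"
      proof (cases "p M f = 0")
        case False
        have pos: "p M f > 0" using pM False by simp
        have "real M * \<theta> j ^ M > 0" using M(4) \<theta>M by simp
        then have "p M f / L \<le> 1 / (real M * \<theta> j ^ M)"
          using f(2) L unfolding L_def[symmetric] by (simp add: field_simps)
        then have "R * (p M f / L) \<le> R * (1 / (real M * \<theta> j ^ M))" using R by (intro mult_left_mono) auto
        then show ?thesis by simp
      qed (use R \<theta>M in auto)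
      also have "\<dots> \<le> R / (real M * \<theta> j ^ n)"
        using R M(4) \<theta>M by (intro divide_left_mono mult_left_mono mult_pos_pos) auto
      also have "\<dots> = real (n + 2) / real M"
      proof -
        have "\<theta> j ^ n \<noteq> 0" using \<theta>M(2) by linarith
        then show ?thesis unfolding R_def by (rule mult_divide_mult_cancel_right)
      qed
      also have "\<dots> \<le> (1/2) ^ Suc k / C"
        using M(1,4) C by (simp add: field_simps power_one_over)
      finally show ?thesis .
    qed
    \<comment> \<open>The value at \<open>g\<close> could cancel that at \<open>h\<close>; it cannot do so for both signs of \<open>h\<close>.\<close>
    have "\<exists>s. cmod s = 1 \<and> R \<le> cmod (l j (\<lambda>x. 1 * g x + s * h x))"
    proof (rule ccontr)
      assume neg: "\<not> ?thesis"
      have less: "cmod (l j (\<lambda>x. 1 * g x + s * h x)) < R" if "cmod s = 1" for s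
        using neg that by (meson not_le)
      have "cmod (l j g + l j h) < R" "cmod (l j g - l j h) < R"
        using less[of 1] less[of "-1"]
        unfolding functional_lin[OF lin g h] by simp_all
      then have "cmod ((l j g + l j h) - (l j g - l j h)) < R + R"
        using norm_triangle_ineq4[of "l j g + l j h" "l j g - l j h"] by linarith
      also have "(l j g + l j h) - (l j g - l j h) = 2 * l j h" by simp
      finally show False using lh by (simp add: norm_mult)
    qed
    then obtain s where s: "cmod s = 1" "R \<le> cmod (l j (\<lambda>x. 1 * g x + s * h x))"
      by (elim exE conjE)
    obtain m1 C1 where b: "\<forall>f\<in>V. cmod (l j f) \<le> C1 * p m1 f" using bounded[of j] by (elim exE)
    have b': "cmod (l j f) \<le> max C (max 1 C1) * p (max m m1) f" if "f \<in> V" for f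
    proof -
      have "cmod (l j f) \<le> max C (max 1 C1) * p m1 f"
      proof -
        have "C1 * p m1 f \<le> max C (max 1 C1) * p m1 f"
          using seminorm_nonneg[OF p that, of m1] by (intro mult_right_mono) auto
        moreover have "cmod (l j f) \<le> C1 * p m1 f" using b that by blast
        ultimately show ?thesis by linarith
      qed
      also have "\<dots> \<le> max C (max 1 C1) * p (max m m1) f"
        using mono[OF that, of m1 "max m m1"] by (intro mult_left_mono) auto
      finally show ?thesis .
    qed
    let ?f' = "\<lambda>x. s * h x" and ?g' = "\<lambda>x. g x + s * h x"
    have "ok n (?f', ?g', j, max m m1, max C (max 1 C1))"
      using function_space_ops(3)[OF V h h, of s] function_space_lin[OF V g h, of 1 s] b' s(2)
      unfolding ok_def R_def by auto
    moreover have "C * p (max m k) ?f' \<le> (1/2) ^ Suc k"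
      using ph[OF s(1)] C by (simp add: field_simps)
    moreover have "m \<le> max m m1" "C \<le> max C (max 1 C1)" by simp_all
    ultimately show ?thesis by (intro exI conjI) (assumption | rule refl)+
  qed
  have zero: "(\<lambda>_. 0) \<in> V" using V by (simp add: function_space_def)
  have "\<exists>s0. ok 0 s0"
    using extend[OF zero, of 1 0 0 0] by blast
  then obtain S where S: "\<And>k. ok k (S k)" "\<And>k. step k (S k) (S (Suc k))"
  proof -
    assume a: "\<And>S. (\<And>k. ok k (S k)) \<Longrightarrow> (\<And>k. step k (S k) (S (Suc k))) \<Longrightarrow> thesis"
    have ex: "\<exists>s'. ok (Suc k) s' \<and> step k s s'" if okk: "ok k s" for s k
    proof -
      obtain f g j m C where s: "s = (f, g, j, m, C)" by (cases s) auto
      have "g \<in> V" "C \<ge> 1" using okk unfolding s ok_def by auto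
      from extend[OF this, of "Suc k" m k] obtain f' g' j' m' C' where
        *: "ok (Suc k) (f', g', j', m', C') \<and> g' = (\<lambda>x. g x + f' x) \<and> m \<le> m' \<and> C \<le> C' \<and>
          C * p (max m k) f' \<le> (1/2) ^ Suc k"
        by (elim exE) (rule that)
      then have "step k s (f', g', j', m', C')" unfolding s step_def by simp
      with * show ?thesis by blast
    qed
    from \<open>\<exists>s0. ok 0 s0\<close> obtain s0 where "ok 0 s0" ..
    have "\<exists>S. \<forall>n. ok n (S n) \<and> step n (S n) (S (Suc n))"
      using \<open>ok 0 s0\<close> ex by (intro dependent_nat_choice) blast+
    then show thesis using a by blast
  qed
  define f g j m C where "f k = fst (S k)" and "g k = fst (snd (S k))" and "j k = fst (snd (snd (S k)))"
    and "m k = fst (snd (snd (snd (S k))))" and "C k = snd (snd (snd (snd (S k))))" for k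
  have Sk: "S k = (f k, g k, j k, m k, C k)" for k
    by (simp add: f_def g_def j_def m_def C_def)
  have fV: "f k \<in> V" and gV: "g k \<in> V" and C1: "C k \<ge> 1"
    and big: "real (k + 2) * \<theta> (j k) ^ k \<le> cmod (l (j k) (g k))"
    and lb: "h \<in> V \<Longrightarrow> cmod (l (j k) h) \<le> C k * p (m k) h" for k h
    using S(1)[of k] unfolding Sk ok_def by auto
  have gS: "g (Suc k) = (\<lambda>x. g k x + f (Suc k) x)" and mS: "m k \<le> m (Suc k)" and CS: "C k \<le> C (Suc k)"
    and small: "C k * p (max (m k) k) (f (Suc k)) \<le> (1/2) ^ Suc k" for k
    using S(2)[of k] unfolding Sk step_def by auto
  have mmono: "k \<le> i \<Longrightarrow> m k \<le> m i" and Cmono: "k \<le> i \<Longrightarrow> C k \<le> C i" for k i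
    using mS CS by (auto intro: lift_Suc_mono_le)
  have small': "p q (f (Suc k)) \<le> (1/2) ^ Suc k" if "q \<le> k" for q k
  proof -
    have "p q (f (Suc k)) \<le> 1 * p (max (m k) k) (f (Suc k))"
      using mono[OF fV, of q "max (m k) k" "Suc k"] that by simp
    also have "\<dots> \<le> C k * p (max (m k) k) (f (Suc k))"
      using C1 seminorm_nonneg[OF p fV] by (intro mult_right_mono) auto
    finally show ?thesis using small[of k] by simp
  qed
  define F where "F k = (if k = 0 then g 0 else f k)" for k
  have FV: "F k \<in> V" for k using fV gV by (simp add: F_def)
  have "summable (\<lambda>k. p q (F k))" for q
  proof (rule summable_comparison_test'[of "\<lambda>k. (1/2) ^ k" "Suc q"])
    show "norm (p q (F n)) \<le> (1/2) ^ n" if "n \<ge> Suc q" for n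
      using small'[of q "n - 1"] that seminorm_nonneg[OF p fV, of q n] by (simp add: F_def)
  qed (simp add: summable_geometric)
  from complete[OF FV this] obtain G where
    G: "G \<in> V" "\<And>i. (\<lambda>k. l i (F k)) sums l i G" by (elim bexE) auto
  have part: "(\<Sum>k\<le>n. l i (F k)) = l i (g n)" for i n
  proof (induction n)
    case (Suc n)
    have "l i (g (Suc n)) = l i (g n) + l i (f (Suc n))"
      unfolding gS by (rule functional_ops(1)[OF lin gV fV])
    then show ?case using Suc by (simp add: F_def)
  qed (simp add: F_def)
  obtain M where M: "\<And>i. cmod (l i G) \<le> real M * \<theta> i ^ M" using pointwise[OF G(1)] by (elim exE) auto
  let ?j = "j M"
  \<comment> \<open>Later terms hardly change the functional that is large at stage \<open>M\<close>, where \<open>M\<close> is the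
    exponent in the pointwise bound at the limit \<open>G\<close>.\<close>
  have tail: "cmod (l ?j (g n) - l ?j (g M)) \<le> 1" if "n \<ge> M" for n
  proof -
    have "cmod (l ?j (g n) - l ?j (g M)) \<le> (\<Sum>k\<in>{M..<n}. (1/2) ^ Suc k)"
      using that
    proof (induction n rule: dec_induct)
      case (step n)
      have "cmod (l ?j (f (Suc n))) \<le> C M * p (m M) (f (Suc n))" by (rule lb[OF fV])
      also have "\<dots> \<le> C n * p (max (m n) n) (f (Suc n))"
        using mmono[OF step(1)] Cmono[OF step(1)] C1[of n] seminorm_nonneg[OF p fV]
        by (intro mult_mono mono fV) auto
      also have "\<dots> \<le> (1/2) ^ Suc n" by (rule small)
      finally have *: "cmod (l ?j (f (Suc n))) \<le> (1/2) ^ Suc n" .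
      have "l ?j (g (Suc n)) - l ?j (g M) = (l ?j (g n) - l ?j (g M)) + l ?j (f (Suc n))"
        unfolding gS functional_ops(1)[OF lin gV fV] by simp
      then have "cmod (l ?j (g (Suc n)) - l ?j (g M))
          \<le> (\<Sum>k\<in>{M..<n}. (1/2) ^ Suc k) + (1/2) ^ Suc n"
        using * step.IH by (metis add_mono norm_triangle_mono)
      then show ?case using step(1) by (simp add: sum.atLeastLessThan_Suc)
    qed simp
    also have "\<dots> \<le> (\<Sum>k<n. (1/2) ^ Suc k)" by (intro sum_mono2) auto
    also have "\<dots> = 1 - (1/2::real) ^ n" by (induction n) auto
    also have "\<dots> \<le> 1" by simp
    finally show ?thesis .
  qed
  have "(\<lambda>n. l ?j (g n)) \<longlonglongrightarrow> l ?j G" using G(2)[of ?j] unfolding sums_def_le part .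
  then have "(\<lambda>n. cmod (l ?j (g n) - l ?j (g M))) \<longlonglongrightarrow> cmod (l ?j G - l ?j (g M))"
    by (intro tendsto_intros)
  then have "cmod (l ?j G - l ?j (g M)) \<le> 1"
    by (rule tendsto_upperbound) (use tail in \<open>auto simp: eventually_sequentially\<close>)
  then have "cmod (l ?j (g M)) \<le> cmod (l ?j G) + 1"
    using norm_triangle_sub[of "l ?j (g M)" "l ?j G"] by (simp add: norm_minus_commute)
  then have "real (M + 2) * \<theta> ?j ^ M \<le> real M * \<theta> ?j ^ M + 1" using big[of M] M[of ?j] by linarith
  moreover have "\<theta> ?j ^ M \<ge> 1" using \<theta> by (intro one_le_power) auto
  ultimately show False by (simp add: algebra_simps)
qed

section \<open>The Schwartz space\<close>

abbreviation pd :: "'a::euclidean_space \<Rightarrow> ('a \<Rightarrow> complex) \<Rightarrow> 'a \<Rightarrow> complex" where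
  "pd b f \<equiv> (\<lambda>x. frechet_derivative f (at x) b)"

lemma iterated_derivative_append:
  "iterated_derivative (us @ vs) f = iterated_derivative us (iterated_derivative vs f)"
  by (induction us) auto

lemma schwartz_differentiable:
  "f \<in> schwartz \<Longrightarrow> vs \<in> lists Basis \<Longrightarrow> iterated_derivative vs f differentiable at x"
  by (simp add: schwartz_def)

lemma schwartz_differentiable0: "f \<in> schwartz \<Longrightarrow> f differentiable at x"
  using schwartz_differentiable[of f "[]" x] by simp

lemma schwartz_bounded:
  "f \<in> schwartz \<Longrightarrow> vs \<in> lists Basis \<Longrightarrow>
     bounded (range (\<lambda>x. norm x ^ k * cmod (iterated_derivative vs f x)))"
  by (simp add: schwartz_def)

lemma schwartz_iterated:
  "f \<in> schwartz \<Longrightarrow> us \<in> lists Basis \<Longrightarrow> iterated_derivative us f \<in> schwartz"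
  by (auto simp: schwartz_def iterated_derivative_append[symmetric])

lemma schwartz_pd: "f \<in> schwartz \<Longrightarrow> b \<in> Basis \<Longrightarrow> pd b f \<in> schwartz"
  using schwartz_iterated[of f "[b]"] by simp

text \<open>To see that a function is Schwartz it suffices to find a class of differentiable, rapidly
  decreasing functions that contains it and is closed under partial derivatives. This avoids formulas
  for iterated derivatives of products, Fourier transforms and Hermite functions.\<close>

lemma schwartz_coinduct:
  assumes f: "f \<in> A"
    and diff: "\<And>g x. g \<in> A \<Longrightarrow> g differentiable at x"
    and pd: "\<And>g b. g \<in> A \<Longrightarrow> b \<in> Basis \<Longrightarrow> pd b g \<in> A"
    and bdd: "\<And>g k. g \<in> A \<Longrightarrow> bounded (range (\<lambda>x. norm x ^ k * cmod (g x)))"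
  shows "f \<in> schwartz"
proof -
  have "iterated_derivative vs f \<in> A" if "vs \<in> lists Basis" for vs
    using that by (induction vs) (auto simp: f pd)
  then show ?thesis using diff bdd by (auto simp: schwartz_def)
qed

lemma pd_lincomb:
  assumes "f differentiable at x" "g differentiable at x"
  shows "pd b (\<lambda>x. a * f x + c * g x) x = a * pd b f x + c * pd b g x"
proof -
  have "((\<lambda>x. a * f x + c * g x) has_derivative
      (\<lambda>h. a * frechet_derivative f (at x) h + c * frechet_derivative g (at x) h)) (at x)"
    using assms by (intro derivative_intros) (auto simp: frechet_derivative_works)
  from frechet_derivative_at[OF this, symmetric] show ?thesis by simp
qed

lemma cmod_lincomb_le: "cmod (a * u + b * v) \<le> cmod a * cmod u + cmod b * cmod v"
  using norm_triangle_ineq[of "a * u" "b * v"] by (simp add: norm_mult)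

lemma iterated_derivative_lincomb:
  assumes "f \<in> schwartz" "g \<in> schwartz" "vs \<in> lists Basis"
  shows "iterated_derivative vs (\<lambda>x. a * f x + c * g x)
       = (\<lambda>x. a * iterated_derivative vs f x + c * iterated_derivative vs g x)"
  using assms(3)
proof (induction vs)
  case (Cons v vs)
  then have v: "vs \<in> lists Basis" by simp
  have "pd v (\<lambda>x. a * iterated_derivative vs f x + c * iterated_derivative vs g x) x
      = a * pd v (iterated_derivative vs f) x + c * pd v (iterated_derivative vs g) x" for x
    by (intro pd_lincomb schwartz_differentiable assms v)
  then show ?case by (simp add: Cons.IH)
qed simp

lemma function_space_schwartz: "function_space schwartz"
  unfolding function_space_def
proof (intro conjI ballI allI)
  show "(\<lambda>_. 0) \<in> schwartz" by (rule zero_in_schwartz)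
  fix f g :: "'a \<Rightarrow> complex" and a c assume fg: "f \<in> schwartz" "g \<in> schwartz"
  show "(\<lambda>x. a * f x + c * g x) \<in> schwartz"
    unfolding schwartz_def
  proof (intro CollectI ballI conjI allI)
    fix vs :: "'a list" and x k assume vs: "vs \<in> lists Basis"
    show "iterated_derivative vs (\<lambda>x. a * f x + c * g x) differentiable at x"
      unfolding iterated_derivative_lincomb[OF fg vs]
      by (intro derivative_intros schwartz_differentiable fg vs)
    obtain B1 where B1: "\<And>x. norm x ^ k * cmod (iterated_derivative vs f x) \<le> B1"
      using schwartz_bounded[OF fg(1) vs, of k] by (auto simp: bounded_iff)
    obtain B2 where B2: "\<And>x. norm x ^ k * cmod (iterated_derivative vs g x) \<le> B2"
      using schwartz_bounded[OF fg(2) vs, of k] by (auto simp: bounded_iff)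
    have "norm x ^ k * cmod (a * iterated_derivative vs f x + c * iterated_derivative vs g x)
        \<le> cmod a * B1 + cmod c * B2" for x
    proof -
      have "norm x ^ k * cmod (a * iterated_derivative vs f x + c * iterated_derivative vs g x)
          \<le> norm x ^ k * (cmod a * cmod (iterated_derivative vs f x) + cmod c * cmod (iterated_derivative vs g x))"
        by (intro mult_left_mono cmod_lincomb_le) simp
      also have "\<dots> = cmod a * (norm x ^ k * cmod (iterated_derivative vs f x))
          + cmod c * (norm x ^ k * cmod (iterated_derivative vs g x))" by (simp add: algebra_simps)
      also have "\<dots> \<le> cmod a * B1 + cmod c * B2" by (intro add_mono mult_left_mono B1 B2) auto
      finally show ?thesis .
    qed
    then show "bounded (range (\<lambda>x. norm x ^ k * cmod (iterated_derivative vs (\<lambda>x. a * f x + c * g x) x)))"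
      unfolding iterated_derivative_lincomb[OF fg vs] bounded_iff by auto
  qed
qed

lemmas schwartz_lincomb = function_space_lin[OF function_space_schwartz]
lemmas schwartz_ops = function_space_ops[OF function_space_schwartz]
lemmas schwartz_sum = function_space_sum[OF function_space_schwartz]

lemma schwartz_seminorm_bound:
  assumes "f \<in> schwartz" "vs \<in> lists Basis"
  shows "norm x ^ k * cmod (iterated_derivative vs f x) \<le> schwartz_seminorm k vs f"
  unfolding schwartz_seminorm_def
  using schwartz_bounded[OF assms, of k] by (intro cSUP_upper bounded_imp_bdd_above) auto

lemma schwartz_seminorm_le:
  assumes "\<And>x. norm x ^ k * cmod (iterated_derivative vs f x) \<le> C"
  shows "schwartz_seminorm k vs f \<le> C"
  unfolding schwartz_seminorm_def using assms by (intro cSUP_least) auto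

lemma schwartz_seminorm_nonneg:
  assumes "f \<in> schwartz" "vs \<in> lists Basis"
  shows "0 \<le> schwartz_seminorm k vs f"
  by (rule order_trans[OF _ schwartz_seminorm_bound[OF assms, of undefined k]]) simp

lemma seminorm_on_schwartz_seminorm:
  assumes "vs \<in> lists Basis"
  shows "seminorm_on schwartz (schwartz_seminorm k vs)"
  unfolding seminorm_on_def
proof (intro conjI ballI allI)
  show "0 \<le> schwartz_seminorm k vs f" if "f \<in> schwartz" for f
    by (rule schwartz_seminorm_nonneg[OF that assms])
  fix f g :: "'a \<Rightarrow> complex" and a b assume fg: "f \<in> schwartz" "g \<in> schwartz"
  show "schwartz_seminorm k vs (\<lambda>x. a * f x + b * g x)
      \<le> cmod a * schwartz_seminorm k vs f + cmod b * schwartz_seminorm k vs g"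
  proof (rule schwartz_seminorm_le)
    fix x
    have "norm x ^ k * cmod (a * iterated_derivative vs f x + b * iterated_derivative vs g x)
        \<le> norm x ^ k * (cmod a * cmod (iterated_derivative vs f x) + cmod b * cmod (iterated_derivative vs g x))"
      by (intro mult_left_mono cmod_lincomb_le) simp
    also have "\<dots> = cmod a * (norm x ^ k * cmod (iterated_derivative vs f x))
        + cmod b * (norm x ^ k * cmod (iterated_derivative vs g x))" by (simp add: algebra_simps)
    also have "\<dots> \<le> cmod a * schwartz_seminorm k vs f + cmod b * schwartz_seminorm k vs g"
      by (intro add_mono mult_left_mono schwartz_seminorm_bound fg assms) auto
    finally show "norm x ^ k * cmod (iterated_derivative vs (\<lambda>x. a * f x + b * g x) x)
        \<le> cmod a * schwartz_seminorm k vs f + cmod b * schwartz_seminorm k vs g"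
      unfolding iterated_derivative_lincomb[OF fg assms] .
  qed
qed

definition basis_words :: "nat \<Rightarrow> 'a::euclidean_space list set" where
  "basis_words m = {vs \<in> lists Basis. length vs \<le> m}"

text \<open>The sums of the first seminorms form an increasing sequence of norms with the same topology;
  a single norm then suffices in every estimate.\<close>

definition snorm :: "nat \<Rightarrow> ('a::euclidean_space \<Rightarrow> complex) \<Rightarrow> real" where
  "snorm m f = (\<Sum>vs\<in>basis_words m. \<Sum>k\<le>m. schwartz_seminorm k vs f)"

lemma finite_basis_words [simp]: "finite (basis_words m :: 'a::euclidean_space list set)"
proof (rule finite_subset)
  show "basis_words m \<subseteq> {xs :: 'a list. set xs \<subseteq> Basis \<and> length xs \<le> m}"
    by (auto simp: basis_words_def)
  show "finite {xs :: 'a list. set xs \<subseteq> Basis \<and> length xs \<le> m}"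
    by (rule finite_lists_length_le) simp
qed

lemma basis_words_lists: "vs \<in> basis_words m \<Longrightarrow> vs \<in> lists Basis"
  by (simp add: basis_words_def)

lemma seminorm_on_sum:
  assumes "finite A" "\<And>i. i \<in> A \<Longrightarrow> seminorm_on V (p i)"
  shows "seminorm_on V (\<lambda>f. \<Sum>i\<in>A. p i f)"
  unfolding seminorm_on_def
proof (intro conjI ballI allI)
  fix f g a b assume fg: "f \<in> V" "g \<in> V"
  show "0 \<le> (\<Sum>i\<in>A. p i f)" using assms fg by (intro sum_nonneg seminorm_nonneg) auto
  have "(\<Sum>i\<in>A. p i (\<lambda>x. a * f x + b * g x)) \<le> (\<Sum>i\<in>A. cmod a * p i f + cmod b * p i g)"
    using assms fg by (intro sum_mono seminorm_lin) auto
  then show "(\<Sum>i\<in>A. p i (\<lambda>x. a * f x + b * g x)) \<le> cmod a * (\<Sum>i\<in>A. p i f) + cmod b * (\<Sum>i\<in>A. p i g)"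
    by (simp add: sum.distrib sum_distrib_left)
qed

lemma seminorm_on_snorm: "seminorm_on schwartz (snorm m)"
proof -
  have "seminorm_on schwartz (\<lambda>f::'a \<Rightarrow> complex. \<Sum>vs\<in>basis_words m. \<Sum>k\<le>m. schwartz_seminorm k vs f)"
    by (intro seminorm_on_sum seminorm_on_schwartz_seminorm finite_basis_words finite_atMost)
       (rule basis_words_lists)
  then show ?thesis by (simp add: snorm_def[abs_def])
qed

lemma snorm_nonneg: "f \<in> schwartz \<Longrightarrow> 0 \<le> snorm m f"
  by (rule seminorm_nonneg[OF seminorm_on_snorm])

lemma snorm_mono:
  assumes "f \<in> schwartz" "m \<le> n"
  shows "snorm m f \<le> snorm n f"
proof -
  have "snorm m f \<le> (\<Sum>vs\<in>basis_words m. \<Sum>k\<le>n. schwartz_seminorm k vs f)"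
    unfolding snorm_def using assms
    by (intro sum_mono sum_mono2 schwartz_seminorm_nonneg basis_words_lists) auto
  also have "\<dots> \<le> snorm n f"
    unfolding snorm_def using assms
    by (intro sum_mono2 sum_nonneg schwartz_seminorm_nonneg basis_words_lists[of _ n] finite_basis_words)
       (auto simp: basis_words_def)
  finally show ?thesis .
qed

lemma schwartz_seminorm_le_snorm:
  assumes "f \<in> schwartz" "vs \<in> lists Basis" "length vs \<le> m" "k \<le> m"
  shows "schwartz_seminorm k vs f \<le> snorm m f"
proof -
  have "schwartz_seminorm k vs f \<le> (\<Sum>k\<le>m. schwartz_seminorm k vs f)"
    using assms by (intro member_le_sum schwartz_seminorm_nonneg) auto
  also have "\<dots> \<le> snorm m f" unfolding snorm_def
    using assms by (intro member_le_sum[of _ _ "\<lambda>vs. \<Sum>k\<le>m. schwartz_seminorm k vs f"]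
       sum_nonneg schwartz_seminorm_nonneg finite_basis_words) (auto simp: basis_words_def)
  finally show ?thesis .
qed

lemma snorm_bound:
  assumes "f \<in> schwartz" "vs \<in> lists Basis" "length vs \<le> m" "k \<le> m"
  shows "norm x ^ k * cmod (iterated_derivative vs f x) \<le> snorm m f"
  using schwartz_seminorm_bound[OF assms(1,2)] schwartz_seminorm_le_snorm[OF assms] by (rule order_trans)

lemma snorm_bound0:
  assumes "f \<in> schwartz" "k \<le> m"
  shows "norm x ^ k * cmod (f x) \<le> snorm m f"
  using snorm_bound[OF assms(1), of "[]" m k x] assms by simp

lemma snorm_leI:
  assumes "\<And>k vs x. k \<le> m \<Longrightarrow> vs \<in> basis_words m \<Longrightarrow> norm x ^ k * cmod (iterated_derivative vs f x) \<le> C"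
  shows "snorm m (f :: 'a::euclidean_space \<Rightarrow> complex) \<le> real (card (basis_words m :: 'a list set)) * real (Suc m) * C"
proof -
  have "snorm m f \<le> (\<Sum>vs\<in>(basis_words m :: 'a list set). \<Sum>k\<le>m. C)"
    unfolding snorm_def by (intro sum_mono schwartz_seminorm_le assms) auto
  then show ?thesis by (simp add: algebra_simps)
qed

lemma schwartz_seminorm_pd: "schwartz_seminorm k vs (pd b f) = schwartz_seminorm k (vs @ [b]) f"
  by (simp add: schwartz_seminorm_def iterated_derivative_append)

lemma derivative_expand:
  fixes f :: "'a::euclidean_space \<Rightarrow> complex"
  assumes "f differentiable at x"
  shows "frechet_derivative f (at x) v = (\<Sum>b\<in>Basis. of_real (v \<bullet> b) * pd b f x)"
proof -
  have lin: "linear (frechet_derivative f (at x))" by (rule linear_frechet_derivative[OF assms])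
  have "frechet_derivative f (at x) (\<Sum>b\<in>Basis. (v \<bullet> b) *\<^sub>R b) = (\<Sum>b\<in>Basis. (v \<bullet> b) *\<^sub>R pd b f x)"
    by (simp add: linear_sum[OF lin] linear_cmul[OF lin])
  then show ?thesis by (simp add: euclidean_representation scaleR_conv_of_real)
qed

lemma schwartz_has_derivative:
  fixes f :: "'a::euclidean_space \<Rightarrow> complex"
  assumes "f \<in> schwartz"
  shows "(f has_derivative (\<lambda>v. \<Sum>b\<in>Basis. of_real (v \<bullet> b) * pd b f x)) (at x)"
proof -
  have "(f has_derivative frechet_derivative f (at x)) (at x)"
    using schwartz_differentiable0[OF assms] by (simp add: frechet_derivative_works)
  also have "frechet_derivative f (at x) = (\<lambda>v. \<Sum>b\<in>Basis. of_real (v \<bullet> b) * pd b f x)"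
    by (rule ext) (rule derivative_expand[OF schwartz_differentiable0[OF assms]])
  finally show ?thesis .
qed

lemma norm_sum_Basis_le:
  fixes v :: "'a::euclidean_space"
  assumes "\<And>b. b \<in> Basis \<Longrightarrow> cmod (u b) \<le> C"
  shows "cmod (\<Sum>b\<in>Basis. of_real (v \<bullet> b) * u b) \<le> real DIM('a) * C * norm v"
proof -
  have C: "C \<ge> 0" by (rule order_trans[OF norm_ge_zero assms[OF SOME_Basis]])
  have "cmod (\<Sum>b\<in>Basis. of_real (v \<bullet> b) * u b) \<le> (\<Sum>b\<in>(Basis::'a set). norm v * C)"
    by (intro sum_norm_le) (use assms C in \<open>auto simp: norm_mult intro!: mult_mono Basis_le_norm\<close>)
  then show ?thesis by (simp add: algebra_simps)
qed

lemma schwartz_lipschitz: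
  fixes f :: "'a::euclidean_space \<Rightarrow> complex"
  assumes f: "f \<in> schwartz"
  shows "cmod (f y - f x) \<le> real DIM('a) * snorm 1 f * norm (y - x)"
proof (rule differentiable_bound[of UNIV])
  fix z :: 'a assume "z \<in> UNIV"
  show "(f has_derivative (\<lambda>v. \<Sum>b\<in>Basis. of_real (v \<bullet> b) * pd b f z)) (at z within UNIV)"
    using schwartz_has_derivative[OF f] .
  show "onorm (\<lambda>v. \<Sum>b\<in>Basis. of_real (v \<bullet> b) * pd b f z) \<le> real DIM('a) * snorm 1 f"
  proof (rule onorm_bound)
    show "0 \<le> real DIM('a) * snorm 1 f" by (simp add: snorm_nonneg f)
    show "cmod (\<Sum>b\<in>Basis. of_real (v \<bullet> b) * pd b f z) \<le> real DIM('a) * snorm 1 f * norm v" for v :: 'a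
      by (rule norm_sum_Basis_le) (use snorm_bound[OF f, of "[b]" 1 0 z for b] in auto)
  qed
qed auto

lemma snorm_pd_le:
  assumes "f \<in> schwartz" "b \<in> Basis"
  shows "snorm m (pd b f) \<le> real (card (basis_words m :: 'a list set)) * real (Suc m) *
            snorm (Suc m) (f :: 'a::euclidean_space \<Rightarrow> complex)"
proof (rule snorm_leI)
  fix k vs x assume "k \<le> m" "vs \<in> (basis_words m :: 'a list set)"
  then show "norm x ^ k * cmod (iterated_derivative vs (pd b f) x) \<le> snorm (Suc m) f"
    using snorm_bound[OF assms(1), of "vs @ [b]" "Suc m" k x] assms(2)
    by (simp add: iterated_derivative_append basis_words_def)
qed

text \<open>The bound is uniform in \<open>x\<close> and linear in \<open>f\<close>, so it can be summed over series of Schwartz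
  functions and yields their derivatives.\<close>

lemma schwartz_taylor:
  assumes "f \<in> schwartz"
  shows "cmod (f (x + v) - f x - (\<Sum>b\<in>Basis. of_real (v \<bullet> b) * pd b f x)) \<le> 
    (real DIM('a) ^ 2 * 2 * real (card (basis_words 1 :: 'a list set))) * snorm 2 (f :: 'a::euclidean_space \<Rightarrow> complex) * norm v ^ 2"
proof -
  define K where "K = real DIM('a) * (real (card (basis_words 1 :: 'a list set)) * 2 * snorm 2 f)"
  have K: "K \<ge> 0" using snorm_nonneg[OF assms] by (simp add: K_def)
  define \<phi> where "\<phi> y = f y - (\<Sum>b\<in>Basis. of_real (y \<bullet> b) * pd b f x)" for y
  have lip: "cmod (pd b f y - pd b f x) \<le> K * norm (y - x)" if "b \<in> Basis" for b y
  proof -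
    have "cmod (pd b f y - pd b f x) \<le> real DIM('a) * snorm 1 (pd b f) * norm (y - x)"
      by (rule schwartz_lipschitz[OF schwartz_pd[OF assms that]])
    also have "\<dots> \<le> K * norm (y - x)"
      unfolding K_def using snorm_pd_le[OF assms that, of 1]
      by (intro mult_right_mono mult_left_mono) (auto simp: numeral_2_eq_2)
    finally show ?thesis .
  qed
  have "cmod (\<phi> (x + v) - \<phi> x) \<le> (real DIM('a) * (K * norm v)) * norm (x + v - x)"
  proof (rule differentiable_bound[of "cball x (norm v)"])
    fix z assume z: "z \<in> cball x (norm v)"
    show "(\<phi> has_derivative (\<lambda>v. (\<Sum>b\<in>Basis. of_real (v \<bullet> b) * pd b f z) -
         (\<Sum>b\<in>Basis. of_real (v \<bullet> b) * pd b f x))) (at z within cball x (norm v))"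
      unfolding \<phi>_def
      by (intro has_derivative_diff has_derivative_at_withinI[OF schwartz_has_derivative[OF assms]])
         (auto intro!: derivative_eq_intros)
    show "onorm (\<lambda>v. (\<Sum>b\<in>Basis. of_real (v \<bullet> b) * pd b f z) -
         (\<Sum>b\<in>Basis. of_real (v \<bullet> b) * pd b f x)) \<le> real DIM('a) * (K * norm v)"
    proof (rule onorm_bound)
      show "0 \<le> real DIM('a) * (K * norm v)" using K by simp
      fix w :: 'a
      have "cmod (\<Sum>b\<in>Basis. of_real (w \<bullet> b) * (pd b f z - pd b f x)) \<le> real DIM('a) * (K * norm v) * norm w"
      proof (rule norm_sum_Basis_le)
        fix b :: 'a assume "b \<in> Basis"
        have "norm (z - x) \<le> norm v" using z by (simp add: dist_norm norm_minus_commute)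
        then have "K * norm (z - x) \<le> K * norm v" using K by (rule mult_left_mono)
        then show "cmod (pd b f z - pd b f x) \<le> K * norm v" using lip[OF \<open>b \<in> Basis\<close>, of z] by linarith
      qed
      then show "cmod ((\<Sum>b\<in>Basis. of_real (w \<bullet> b) * pd b f z) -
         (\<Sum>b\<in>Basis. of_real (w \<bullet> b) * pd b f x)) \<le> real DIM('a) * (K * norm v) * norm w"
        by (simp add: sum_subtractf algebra_simps)
    qed
  qed (auto simp: dist_norm)
  moreover have "\<phi> (x + v) - \<phi> x = f (x + v) - f x - (\<Sum>b\<in>Basis. of_real (v \<bullet> b) * pd b f x)"
    by (simp add: \<phi>_def inner_add_left algebra_simps sum.distrib)
  ultimately have "cmod (f (x + v) - f x - (\<Sum>b\<in>Basis. of_real (v \<bullet> b) * pd b f x))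
      \<le> (real DIM('a) * (K * norm v)) * norm (x + v - x)" by simp
  then show ?thesis by (simp add: K_def power2_eq_square mult_ac)
qed

lemma has_sum_finite_sum:
  fixes f :: "'b \<Rightarrow> 'i \<Rightarrow> 'c::topological_comm_monoid_add"
  assumes "finite B" "\<And>b. b \<in> B \<Longrightarrow> (f b has_sum s b) I"
  shows "((\<lambda>i. \<Sum>b\<in>B. f b i) has_sum (\<Sum>b\<in>B. s b)) I"
  using assms by (induction B rule: finite_induct) (auto intro!: has_sum_add)

lemma has_sum_minus:
  fixes f g :: "'i \<Rightarrow> 'c::real_normed_vector"
  assumes "(f has_sum a) I" "(g has_sum b) I"
  shows "((\<lambda>i. f i - g i) has_sum (a - b)) I"
  using has_sum_add[OF assms(1), of "\<lambda>i. - g i" "- b"] assms(2) by (simp add: has_sum_uminus)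

text \<open>Summability in every norm replaces completeness of the Schwartz space. The index set may be any set,
  because the Hermite expansions are indexed by multi-indices.\<close>

definition schwartz_summable :: "('i \<Rightarrow> 'a::euclidean_space \<Rightarrow> complex) \<Rightarrow> 'i set \<Rightarrow> bool" where
  "schwartz_summable f I \<longleftrightarrow> (\<forall>i\<in>I. f i \<in> schwartz) \<and> (\<forall>m. (\<lambda>i. snorm m (f i)) summable_on I)"

lemma schwartz_summable_pointwise:
  assumes "schwartz_summable f I"
  shows "(\<lambda>i. cmod (f i x)) summable_on I"
proof (rule summable_on_comparison_test)
  show "(\<lambda>i. snorm 0 (f i)) summable_on I"
    using assms by (simp add: schwartz_summable_def)
  show "cmod (f i x) \<le> snorm 0 (f i)" if "i \<in> I" for i
    using assms that snorm_bound0[of "f i" 0 0 x] by (simp add: schwartz_summable_def)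
qed simp

lemma schwartz_summable_pd:
  fixes f :: "'i \<Rightarrow> 'a::euclidean_space \<Rightarrow> complex"
  assumes "schwartz_summable f I" "b \<in> Basis"
  shows "schwartz_summable (\<lambda>i. pd b (f i)) I"
  unfolding schwartz_summable_def
proof (intro conjI ballI allI)
  show "pd b (f i) \<in> schwartz" if "i \<in> I" for i
    using assms that by (intro schwartz_pd) (auto simp: schwartz_summable_def)
  fix m
  show "(\<lambda>i. snorm m (pd b (f i))) summable_on I"
  proof (rule summable_on_comparison_test)
    show "(\<lambda>i. real (card (basis_words m :: 'a list set)) * real (Suc m) * snorm (Suc m) (f i)) summable_on I"
      using assms by (intro summable_on_cmult_right) (auto simp: schwartz_summable_def)
    fix i assume "i \<in> I"
    then have fi: "f i \<in> schwartz" using assms by (simp add: schwartz_summable_def)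
    show "snorm m (pd b (f i)) \<le> real (card (basis_words m :: 'a list set)) * real (Suc m) * snorm (Suc m) (f i)"
      by (rule snorm_pd_le[OF fi assms(2)])
    show "0 \<le> snorm m (pd b (f i))" by (intro snorm_nonneg schwartz_pd fi assms(2))
  qed
qed

lemma infsum_norm_le:
  fixes f :: "'i \<Rightarrow> complex"
  assumes "g summable_on I" "\<And>i. i \<in> I \<Longrightarrow> cmod (f i) \<le> g i"
  shows "cmod (infsum f I) \<le> infsum g I"
proof -
  have n: "(\<lambda>i. cmod (f i)) summable_on I"
    by (rule summable_on_comparison_test[OF assms]) auto
  have "cmod (infsum f I) \<le> (\<Sum>\<^sub>\<infinity>i\<in>I. cmod (f i))"
    by (rule norm_infsum_bound[OF n])
  also have "\<dots> \<le> infsum g I" by (rule infsum_mono[OF n assms])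
  finally show ?thesis .
qed

lemma has_derivative_quadratic_bound:
  fixes f :: "'a::real_normed_vector \<Rightarrow> 'b::real_normed_vector"
  assumes L: "bounded_linear L" and bound: "\<And>v. norm (f (x + v) - f x - L v) \<le> K * norm v ^ 2"
  shows "(f has_derivative L) (at x)"
proof -
  have ev: "\<forall>\<^sub>F v in at 0. norm (norm (f (x + v) - f x - L v) / norm v) \<le> K * norm v"
    unfolding eventually_at_filter
    by (rule always_eventually) (use bound in \<open>auto simp: divide_le_eq power2_eq_square mult.assoc\<close>)
  have "((\<lambda>v::'a. K * norm v) \<longlongrightarrow> 0) (at 0)" by (intro tendsto_eq_intros) auto
  then have "(\<lambda>v. norm (f (x + v) - f x - L v) / norm v) \<midarrow>0\<rightarrow> 0"
    by (rule Lim_null_comparison[OF ev])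
  with L show ?thesis unfolding has_derivative_at by simp
qed

text \<open>Summing the uniform second order Taylor bounds of the terms gives a second order bound for the sum,
  with the sum of the derivatives as the linear part.\<close>

lemma schwartz_series_derivative:
  fixes f :: "'i \<Rightarrow> 'a::euclidean_space \<Rightarrow> complex"
  assumes f: "schwartz_summable f I"
  shows "((\<lambda>x. \<Sum>\<^sub>\<infinity>i\<in>I. f i x) has_derivative
      (\<lambda>v. \<Sum>b\<in>Basis. of_real (v \<bullet> b) * (\<Sum>\<^sub>\<infinity>i\<in>I. pd b (f i) x))) (at x)"
proof -
  let ?L = "\<lambda>v. \<Sum>b\<in>Basis. of_real (v \<bullet> b) * (\<Sum>\<^sub>\<infinity>i\<in>I. pd b (f i) x)"
  define C where "C = real DIM('a) ^ 2 * 2 * real (card (basis_words 1 :: 'a list set))"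
  define K where "K = C * (\<Sum>\<^sub>\<infinity>i\<in>I. snorm 2 (f i))"
  have sm: "(\<lambda>i. f i y) summable_on I" for y
    by (rule abs_summable_summable[OF schwartz_summable_pointwise[OF f]])
  have smb: "(\<lambda>i. pd b (f i) y) summable_on I" if "b \<in> Basis" for b y
    by (rule abs_summable_summable[OF schwartz_summable_pointwise[OF schwartz_summable_pd[OF f that]]])
  have sn: "(\<lambda>i. snorm 2 (f i)) summable_on I" using f by (simp add: schwartz_summable_def)
  have bound: "cmod ((\<Sum>\<^sub>\<infinity>i\<in>I. f i (x + v)) - (\<Sum>\<^sub>\<infinity>i\<in>I. f i x) - ?L v) \<le> K * norm v ^ 2" for v
  proof -
    have s1: "((\<lambda>i. \<Sum>b\<in>Basis. of_real (v \<bullet> b) * pd b (f i) x) has_sum ?L v) I"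
      by (intro has_sum_finite_sum has_sum_cmult_right has_sum_infsum smb) auto
    have "((\<lambda>i. f i (x + v) - f i x - (\<Sum>b\<in>Basis. of_real (v \<bullet> b) * pd b (f i) x)) has_sum
        ((\<Sum>\<^sub>\<infinity>i\<in>I. f i (x + v)) - (\<Sum>\<^sub>\<infinity>i\<in>I. f i x) - ?L v)) I"
      by (intro has_sum_minus s1 has_sum_infsum sm)
    then have eq: "(\<Sum>\<^sub>\<infinity>i\<in>I. f i (x + v)) - (\<Sum>\<^sub>\<infinity>i\<in>I. f i x) - ?L v
      = (\<Sum>\<^sub>\<infinity>i\<in>I. f i (x + v) - f i x - (\<Sum>b\<in>Basis. of_real (v \<bullet> b) * pd b (f i) x))"
      by (simp add: infsumI)
    have "cmod \<dots> \<le> (\<Sum>\<^sub>\<infinity>i\<in>I. C * snorm 2 (f i) * norm v ^ 2)"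
    proof (rule infsum_norm_le)
      show "(\<lambda>i. C * snorm 2 (f i) * norm v ^ 2) summable_on I"
        by (intro summable_on_cmult_left summable_on_cmult_right sn)
      show "cmod (f i (x + v) - f i x - (\<Sum>b\<in>Basis. of_real (v \<bullet> b) * pd b (f i) x)) \<le> C * snorm 2 (f i) * norm v ^ 2"
        if "i \<in> I" for i
        using schwartz_taylor[of "f i" x v] f that by (simp add: C_def schwartz_summable_def)
    qed
    also have "\<dots> = K * norm v ^ 2"
      by (simp add: K_def infsum_cmult_left' infsum_cmult_right')
    finally show ?thesis using eq by simp
  qed
  have "bounded_linear ?L"
    by (intro bounded_linear_sum bounded_linear_mult_const bounded_linear_of_real[THEN bounded_linear_compose]
        bounded_linear_inner_left)
  then show ?thesis by (rule has_derivative_quadratic_bound) (rule bound)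
qed

lemma schwartz_series_iterated:
  fixes f :: "'i \<Rightarrow> 'a::euclidean_space \<Rightarrow> complex"
  assumes f: "schwartz_summable f I" and vs: "vs \<in> lists Basis"
  shows "iterated_derivative vs (\<lambda>x. \<Sum>\<^sub>\<infinity>i\<in>I. f i x) = (\<lambda>x. \<Sum>\<^sub>\<infinity>i\<in>I. iterated_derivative vs (f i) x)
    \<and> schwartz_summable (\<lambda>i. iterated_derivative vs (f i)) I"
  using vs
proof (induction vs)
  case (Cons b vs)
  then have b: "b \<in> Basis" and eq: "iterated_derivative vs (\<lambda>x. \<Sum>\<^sub>\<infinity>i\<in>I. f i x) = (\<lambda>x. \<Sum>\<^sub>\<infinity>i\<in>I. iterated_derivative vs (f i) x)"
    and sm: "schwartz_summable (\<lambda>i. iterated_derivative vs (f i)) I" by auto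
  have "pd b (\<lambda>x. \<Sum>\<^sub>\<infinity>i\<in>I. iterated_derivative vs (f i) x) x = (\<Sum>\<^sub>\<infinity>i\<in>I. pd b (iterated_derivative vs (f i)) x)" for x
    unfolding frechet_derivative_at[OF schwartz_series_derivative[OF sm], symmetric]
    using b by (simp add: inner_Basis if_distrib[of of_real] if_distrib[of "\<lambda>z. z * _"] cong: if_cong)
  then show ?case using schwartz_summable_pd[OF sm b] by (simp add: eq)
qed (use f in auto)

lemma schwartz_series:
  fixes f :: "'i \<Rightarrow> 'a::euclidean_space \<Rightarrow> complex"
  assumes f: "schwartz_summable f I"
  shows "(\<lambda>x. \<Sum>\<^sub>\<infinity>i\<in>I. f i x) \<in> schwartz"
    and "snorm m (\<lambda>x. \<Sum>\<^sub>\<infinity>i\<in>I. f i x)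
       \<le> real (card (basis_words m :: 'a list set)) * real (Suc m) * (\<Sum>\<^sub>\<infinity>i\<in>I. snorm m (f i))"
proof -
  have b: "norm x ^ k * cmod (iterated_derivative vs (\<lambda>x. \<Sum>\<^sub>\<infinity>i\<in>I. f i x) x) \<le> (\<Sum>\<^sub>\<infinity>i\<in>I. snorm n (f i))"
    if "vs \<in> lists Basis" "length vs \<le> n" "k \<le> n" for k vs n x
  proof -
    have "cmod (\<Sum>\<^sub>\<infinity>i\<in>I. of_real (norm x ^ k) * iterated_derivative vs (f i) x) \<le> (\<Sum>\<^sub>\<infinity>i\<in>I. snorm n (f i))"
      using f that by (intro infsum_norm_le)
        (auto simp: schwartz_summable_def norm_mult norm_power intro!: snorm_bound)
    then show ?thesis
      using schwartz_series_iterated[OF f that(1)] by (simp add: infsum_cmult_right' norm_mult norm_power)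
  qed
  show "(\<lambda>x. \<Sum>\<^sub>\<infinity>i\<in>I. f i x) \<in> schwartz"
    unfolding schwartz_def
  proof (intro CollectI ballI conjI allI)
    fix vs :: "'a list" and x k assume vs: "vs \<in> lists Basis"
    show "iterated_derivative vs (\<lambda>x. \<Sum>\<^sub>\<infinity>i\<in>I. f i x) differentiable at x"
      unfolding conjunct1[OF schwartz_series_iterated[OF f vs]] differentiable_def
      by (rule exI) (rule schwartz_series_derivative[OF conjunct2[OF schwartz_series_iterated[OF f vs]]])
    show "bounded (range (\<lambda>x. norm x ^ k * cmod (iterated_derivative vs (\<lambda>x. \<Sum>\<^sub>\<infinity>i\<in>I. f i x) x)))"
      unfolding bounded_iff using b[OF vs, of "length vs + k" k] by auto
  qed
  show "snorm m (\<lambda>x. \<Sum>\<^sub>\<infinity>i\<in>I. f i x)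
       \<le> real (card (basis_words m :: 'a list set)) * real (Suc m) * (\<Sum>\<^sub>\<infinity>i\<in>I. snorm m (f i))"
    by (rule snorm_leI) (auto simp: basis_words_def intro!: b)
qed


lemma schwartz_difference_quotient:
  fixes u :: "'b::euclidean_space \<Rightarrow> complex"
  assumes u: "u \<in> schwartz" and b: "b \<in> Basis"
  shows "(\<lambda>n. of_real (real (Suc n)) * (u (x + (1 / real (Suc n)) *\<^sub>R b) - u x)) \<longlonglongrightarrow> pd b u x"
proof -
  define K where "K = (real DIM('b) ^ 2 * 2 * real (card (basis_words 1 :: 'b list set))) * snorm 2 u"
  have "cmod (of_real (real (Suc n)) * (u (x + (1 / real (Suc n)) *\<^sub>R b) - u x) - pd b u x) \<le> K / real (Suc n)" for n
  proof -
    define r where "r = real (Suc n)"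
    have r: "r > 0" by (simp add: r_def)
    let ?d = "u (x + (1 / r) *\<^sub>R b) - u x - of_real (1 / r) * pd b u x"
    have "(\<Sum>c\<in>Basis. of_real (((1 / r) *\<^sub>R b) \<bullet> c) * pd c u x)
        = (\<Sum>c\<in>Basis. if c = b then of_real (1 / r) * pd b u x else 0)"
      using b by (intro sum.cong) (auto simp: inner_Basis)
    also have "\<dots> = of_real (1 / r) * pd b u x" using b by simp
    finally have "cmod ?d \<le> K * norm ((1 / r) *\<^sub>R b) ^ 2"
      using schwartz_taylor[OF u, of x "(1 / r) *\<^sub>R b"] unfolding K_def by simp
    also have "norm ((1 / r) *\<^sub>R b) = 1 / r" using b r by simp
    finally have "r * cmod ?d \<le> r * (K * (1 / r) ^ 2)" by (rule mult_left_mono) (use r in simp)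
    also have "r * (K * (1 / r) ^ 2) = K / r" using r by (simp add: power2_eq_square)
    also have "r * cmod ?d = cmod (of_real r * ?d)" using r by (simp add: norm_mult)
    also have "of_real r * ?d = of_real r * (u (x + (1 / r) *\<^sub>R b) - u x) - pd b u x"
      using r by (simp add: algebra_simps)
    finally show ?thesis unfolding r_def .
  qed
  then have ev: "\<forall>\<^sub>F n in sequentially. cmod (of_real (real (Suc n)) * (u (x + (1 / real (Suc n)) *\<^sub>R b) - u x) - pd b u x) \<le> K / real (Suc n)"
    by (simp only: eventually_True)
  have "(\<lambda>n. K / real (Suc n)) \<longlonglongrightarrow> 0"
    by (rule LIMSEQ_Suc[OF lim_const_over_n])
  then have "(\<lambda>n. of_real (real (Suc n)) * (u (x + (1 / real (Suc n)) *\<^sub>R b) - u x) - pd b u x) \<longlonglongrightarrow> 0"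
    by (rule Lim_null_comparison[OF ev])
  then show ?thesis by (simp add: LIM_zero_iff del: of_nat_Suc)
qed

section \<open>Continuous functionals and operators on the Schwartz space\<close>

text \<open>The continuous linear functionals and operators, in terms of the increasing norms. Values outside
  the Schwartz space are left unconstrained, so that any formula can be used as an operator.\<close>

definition sfunctional :: "(('a::euclidean_space \<Rightarrow> complex) \<Rightarrow> complex) \<Rightarrow> bool" where
  "sfunctional T \<longleftrightarrow> clinear_functional_on schwartz T \<and>
     (\<exists>m C. \<forall>f\<in>schwartz. cmod (T f) \<le> C * snorm m f)"

definition soperator ::
    "(('a::euclidean_space \<Rightarrow> complex) \<Rightarrow> ('b::euclidean_space \<Rightarrow> complex)) \<Rightarrow> bool" where
  "soperator A \<longleftrightarrow> (\<forall>f\<in>schwartz. A f \<in> schwartz) \<and> clinear_map_on schwartz A \<and>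
     (\<forall>m. \<exists>n C. \<forall>f\<in>schwartz. snorm m (A f) \<le> C * snorm n f)"

lemma sfunctional_linear: "sfunctional T \<Longrightarrow> clinear_functional_on schwartz T"
  by (simp add: sfunctional_def)

lemma soperator_linear: "soperator A \<Longrightarrow> clinear_map_on schwartz A"
  by (simp add: soperator_def)

lemma soperator_schwartz: "soperator A \<Longrightarrow> f \<in> schwartz \<Longrightarrow> A f \<in> schwartz"
  by (simp add: soperator_def)

lemma sfunctional_bound:
  assumes "sfunctional T"
  obtains C m where "C \<ge> 0" "\<And>f. f \<in> schwartz \<Longrightarrow> cmod (T f) \<le> C * snorm m f"
proof -
  obtain m C where b: "\<forall>f\<in>schwartz. cmod (T f) \<le> C * snorm m f"
    using assms unfolding sfunctional_def by (elim conjE exE)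
  have "cmod (T f) \<le> \<bar>C\<bar> * snorm m f" if "f \<in> schwartz" for f
  proof -
    have "C * snorm m f \<le> \<bar>C\<bar> * snorm m f" using snorm_nonneg[OF that] by (intro mult_right_mono) auto
    then show ?thesis using b[rule_format, OF that] by linarith
  qed
  then show ?thesis by (intro that[of "\<bar>C\<bar>" m]) auto
qed

lemma soperator_bound:
  assumes "soperator A"
  obtains C n where "C \<ge> 0" "\<And>f. f \<in> schwartz \<Longrightarrow> snorm m (A f) \<le> C * snorm n f"
proof -
  obtain n C where b: "\<forall>f\<in>schwartz. snorm m (A f) \<le> C * snorm n f"
    using assms unfolding soperator_def by (elim conjE exE allE[of _ m])
  have "snorm m (A f) \<le> \<bar>C\<bar> * snorm n f" if "f \<in> schwartz" for f
  proof -
    have "C * snorm n f \<le> \<bar>C\<bar> * snorm n f" using snorm_nonneg[OF that] by (intro mult_right_mono) auto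
    then show ?thesis using b[rule_format, OF that] by linarith
  qed
  then show ?thesis by (intro that[of "\<bar>C\<bar>" n]) auto
qed

lemma soperator_apply:
  assumes "soperator A" "f \<in> schwartz" "g \<in> schwartz"
  shows "A (\<lambda>x. a * f x + b * g x) = (\<lambda>y. a * A f y + b * A g y)"
  using soperator_linear[OF assms(1)] assms(2,3) unfolding clinear_map_on_def by (elim ballE allE) auto

lemma soperator_compose:
  fixes A :: "('b::euclidean_space \<Rightarrow> complex) \<Rightarrow> ('a::euclidean_space \<Rightarrow> complex)"
    and B :: "('c::euclidean_space \<Rightarrow> complex) \<Rightarrow> ('b \<Rightarrow> complex)"
  assumes "soperator A" "soperator B"
  shows "soperator (\<lambda>f. A (B f))"
  unfolding soperator_def
proof (intro conjI allI ballI)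
  show "A (B f) \<in> schwartz" if "f \<in> schwartz" for f
    by (rule soperator_schwartz[OF assms(1) soperator_schwartz[OF assms(2) that]])
  show "clinear_map_on schwartz (\<lambda>f. A (B f))"
    unfolding clinear_map_on_def
  proof (intro ballI allI)
    fix f g :: "'c \<Rightarrow> complex" and a b assume fg: "f \<in> schwartz" "g \<in> schwartz"
    show "A (B (\<lambda>x. a * f x + b * g x)) = (\<lambda>y. a * A (B f) y + b * A (B g) y)"
      unfolding soperator_apply[OF assms(2) fg]
      by (rule soperator_apply[OF assms(1) soperator_schwartz[OF assms(2) fg(1)] soperator_schwartz[OF assms(2) fg(2)]])
  qed
  fix m
  obtain n C where C: "C \<ge> 0" "\<And>f. f \<in> schwartz \<Longrightarrow> snorm m (A f) \<le> C * snorm n f"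
    by (rule soperator_bound[OF assms(1)], rule that)
  obtain k D where D: "D \<ge> 0" "\<And>f. f \<in> schwartz \<Longrightarrow> snorm n (B f) \<le> D * snorm k f"
    by (rule soperator_bound[OF assms(2)], rule that)
  have "snorm m (A (B f)) \<le> (C * D) * snorm k f" if "f \<in> schwartz" for f
    unfolding mult.assoc
    by (rule order_trans[OF C(2)[OF soperator_schwartz[OF assms(2) that]] mult_left_mono[OF D(2)[OF that] C(1)]])
  then show "\<exists>n C. \<forall>f\<in>schwartz. snorm m (A (B f)) \<le> C * snorm n f" by (intro exI[of _ k] exI[of _ "C * D"] ballI)
qed

lemma sfunctional_compose:
  fixes T :: "('b::euclidean_space \<Rightarrow> complex) \<Rightarrow> complex"
    and B :: "('c::euclidean_space \<Rightarrow> complex) \<Rightarrow> ('b \<Rightarrow> complex)"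
  assumes "sfunctional T" "soperator B"
  shows "sfunctional (\<lambda>f. T (B f))"
  unfolding sfunctional_def
proof (intro conjI)
  show "clinear_functional_on schwartz (\<lambda>f. T (B f))"
    unfolding clinear_functional_on_def
  proof (intro ballI allI)
    fix f g :: "'c \<Rightarrow> complex" and a b assume fg: "f \<in> schwartz" "g \<in> schwartz"
    show "T (B (\<lambda>x. a * f x + b * g x)) = a * T (B f) + b * T (B g)"
      unfolding soperator_apply[OF assms(2) fg]
      by (rule functional_lin[OF sfunctional_linear[OF assms(1)] soperator_schwartz[OF assms(2) fg(1)] soperator_schwartz[OF assms(2) fg(2)]])
  qed
  obtain n C where C: "C \<ge> 0" "\<And>f. f \<in> schwartz \<Longrightarrow> cmod (T f) \<le> C * snorm n f"
    by (rule sfunctional_bound[OF assms(1)], rule that)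
  obtain k D where D: "D \<ge> 0" "\<And>f. f \<in> schwartz \<Longrightarrow> snorm n (B f) \<le> D * snorm k f"
    by (rule soperator_bound[OF assms(2)], rule that)
  have "cmod (T (B f)) \<le> (C * D) * snorm k f" if "f \<in> schwartz" for f
    unfolding mult.assoc
    by (rule order_trans[OF C(2)[OF soperator_schwartz[OF assms(2) that]] mult_left_mono[OF D(2)[OF that] C(1)]])
  then show "\<exists>m C. \<forall>f\<in>schwartz. cmod (T (B f)) \<le> C * snorm m f" by (intro exI[of _ k] exI[of _ "C * D"] ballI)
qed

lemma sfunctional_lincomb:
  fixes S T :: "('a::euclidean_space \<Rightarrow> complex) \<Rightarrow> complex"
  assumes "sfunctional S" "sfunctional T"
  shows "sfunctional (\<lambda>f. a * S f + b * T f)"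
  unfolding sfunctional_def
proof (intro conjI)
  show "clinear_functional_on schwartz (\<lambda>f. a * S f + b * T f)"
    unfolding clinear_functional_on_def
  proof (intro ballI allI)
    fix f g :: "'a \<Rightarrow> complex" and c d assume fg: "f \<in> schwartz" "g \<in> schwartz"
    show "a * S (\<lambda>x. c * f x + d * g x) + b * T (\<lambda>x. c * f x + d * g x)
        = c * (a * S f + b * T f) + d * (a * S g + b * T g)"
      by (simp only: functional_lin[OF sfunctional_linear[OF assms(1)] fg]
          functional_lin[OF sfunctional_linear[OF assms(2)] fg] algebra_simps)
  qed
  obtain n C where C: "C \<ge> 0" "\<And>f. f \<in> schwartz \<Longrightarrow> cmod (S f) \<le> C * snorm n f"
    by (rule sfunctional_bound[OF assms(1)], rule that)
  obtain k D where D: "D \<ge> 0" "\<And>f. f \<in> schwartz \<Longrightarrow> cmod (T f) \<le> D * snorm k f"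
    by (rule sfunctional_bound[OF assms(2)], rule that)
  have "cmod (a * S f + b * T f) \<le> (cmod a * C + cmod b * D) * snorm (max n k) f" if f: "f \<in> schwartz" for f
  proof -
    have "cmod (a * S f + b * T f) \<le> cmod a * (C * snorm n f) + cmod b * (D * snorm k f)"
      using cmod_lincomb_le[of a "S f" b "T f"] mult_left_mono[OF C(2)[OF f] norm_ge_zero[of a]]
        mult_left_mono[OF D(2)[OF f] norm_ge_zero[of b]] by linarith
    also have "\<dots> \<le> cmod a * (C * snorm (max n k) f) + cmod b * (D * snorm (max n k) f)"
      using C D f by (intro add_mono mult_left_mono snorm_mono) auto
    finally show ?thesis by (simp add: algebra_simps)
  qed
  then show "\<exists>m C. \<forall>f\<in>schwartz. cmod (a * S f + b * T f) \<le> C * snorm m f" by (intro exI[of _ "max n k"] exI[of _ "cmod a * C + cmod b * D"] ballI)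
qed

text \<open>By linearity the error after a finite part is the value of \<open>T\<close> on the remaining series, which
  is small in the norm that dominates \<open>T\<close>.\<close>

lemma sfunctional_series:
  assumes T: "sfunctional T" and f: "schwartz_summable f I"
  shows "((\<lambda>i. T (f i)) has_sum T (\<lambda>x. \<Sum>\<^sub>\<infinity>i\<in>I. f i x)) I"
proof -
  obtain m C where C: "C \<ge> 0" "\<And>f. f \<in> schwartz \<Longrightarrow> cmod (T f) \<le> C * snorm m f"
    by (rule sfunctional_bound[OF T], rule that)
  define K where "K = real (card (basis_words m :: 'a list set)) * real (Suc m)"
  let ?g = "\<lambda>x. \<Sum>\<^sub>\<infinity>i\<in>I. f i x"
  have sn: "(\<lambda>i. snorm m (f i)) summable_on I" and fS: "\<And>i. i \<in> I \<Longrightarrow> f i \<in> schwartz"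
    using f by (auto simp: schwartz_summable_def)
  have tail: "cmod (sum (\<lambda>i. T (f i)) F - T ?g) \<le> C * (K * ((\<Sum>\<^sub>\<infinity>i\<in>I. snorm m (f i)) - sum (\<lambda>i. snorm m (f i)) F))"
    if F: "finite F" "F \<subseteq> I" for F
  proof -
    have fF: "(\<lambda>x. \<Sum>i\<in>F. f i x) \<in> schwartz"
      using schwartz_sum[OF F(1), of f "\<lambda>_. 1"] fS F(2) by (auto simp: subset_iff)
    have TF: "T (\<lambda>x. \<Sum>i\<in>F. f i x) = (\<Sum>i\<in>F. T (f i))"
      using functional_sum[OF sfunctional_linear[OF T] function_space_schwartz F(1), of f "\<lambda>_. 1"] fS F(2)
      by (auto simp: subset_iff)
    have sub: "schwartz_summable f (I - F)"
      using f unfolding schwartz_summable_def by (auto intro: summable_on_subset_banach)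
    have eq: "(\<lambda>x. ?g x - (\<Sum>i\<in>F. f i x)) = (\<lambda>x. \<Sum>\<^sub>\<infinity>i\<in>I - F. f i x)"
      using infsum_Diff[OF abs_summable_summable[OF schwartz_summable_pointwise[OF f]] summable_on_finite[OF F(1)] F(2)]
        F(1) by (simp add: fun_eq_iff)
    have "cmod (T ?g - (\<Sum>i\<in>F. T (f i))) = cmod (T (\<lambda>x. \<Sum>\<^sub>\<infinity>i\<in>I - F. f i x))"
      using functional_ops(2)[OF sfunctional_linear[OF T] schwartz_series(1)[OF f] fF] unfolding eq TF by simp
    also have "\<dots> \<le> C * snorm m (\<lambda>x. \<Sum>\<^sub>\<infinity>i\<in>I - F. f i x)"
      by (rule C(2)[OF schwartz_series(1)[OF sub]])
    also have "\<dots> \<le> C * (K * (\<Sum>\<^sub>\<infinity>i\<in>I - F. snorm m (f i)))"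
      unfolding K_def by (intro mult_left_mono schwartz_series(2)[OF sub] C(1))
    also have "(\<Sum>\<^sub>\<infinity>i\<in>I - F. snorm m (f i)) = (\<Sum>\<^sub>\<infinity>i\<in>I. snorm m (f i)) - sum (\<lambda>i. snorm m (f i)) F"
      using infsum_Diff[OF sn summable_on_finite[OF F(1)] F(2)] F(1) by simp
    finally show ?thesis by (simp add: norm_minus_commute)
  qed
  have lim: "((\<lambda>F. C * (K * ((\<Sum>\<^sub>\<infinity>i\<in>I. snorm m (f i)) - sum (\<lambda>i. snorm m (f i)) F))) \<longlongrightarrow>
      C * (K * ((\<Sum>\<^sub>\<infinity>i\<in>I. snorm m (f i)) - (\<Sum>\<^sub>\<infinity>i\<in>I. snorm m (f i))))) (finite_subsets_at_top I)"
    by (intro tendsto_intros infsum_tendsto sn)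
  have "((\<lambda>F. sum (\<lambda>i. T (f i)) F - T ?g) \<longlongrightarrow> 0) (finite_subsets_at_top I)"
    by (rule Lim_null_comparison[OF _ lim[simplified]])
       (intro eventually_finite_subsets_at_top_weakI tail)
  then show ?thesis unfolding has_sum_def by (simp add: LIM_zero_iff)
qed

lemma sfunctional_uniform_boundedness:
  fixes l :: "'j \<Rightarrow> ('a::euclidean_space \<Rightarrow> complex) \<Rightarrow> complex"
  assumes l: "\<And>j. sfunctional (l j)" and \<theta>: "\<And>j. \<theta> j \<ge> 1"
    and pointwise: "\<And>f. f \<in> schwartz \<Longrightarrow> \<exists>M::nat. \<forall>j. cmod (l j f) \<le> real M * \<theta> j ^ M"
  shows "\<exists>M::nat. \<forall>j. \<forall>f\<in>schwartz. cmod (l j f) \<le> real M * \<theta> j ^ M * snorm M f"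
proof (rule uniform_boundedness_growth[OF function_space_schwartz seminorm_on_snorm snorm_mono])
  fix f :: "nat \<Rightarrow> 'a \<Rightarrow> complex"
  assume f: "\<And>k. f k \<in> schwartz" "\<And>m. summable (\<lambda>k. snorm m (f k))"
  have "schwartz_summable f UNIV"
    unfolding schwartz_summable_def using f by (auto intro!: summable_nonneg_imp_summable_on snorm_nonneg)
  then show "\<exists>g\<in>schwartz. \<forall>j. (\<lambda>k. l j (f k)) sums l j g"
    by (intro bexI[of _ "\<lambda>x. \<Sum>\<^sub>\<infinity>i\<in>UNIV. f i x"] schwartz_series(1) allI has_sum_imp_sums
        sfunctional_series[OF l])
next
  show "clinear_functional_on schwartz (l j)" for j by (rule sfunctional_linear[OF l])
  show "\<exists>m C. \<forall>f\<in>schwartz. cmod (l j f) \<le> C * snorm m f" for j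
    using l[of j] by (simp add: sfunctional_def)
qed (use \<theta> pointwise in auto)

lemma sfunctional_equicontinuous:
  fixes l :: "'j \<Rightarrow> ('a::euclidean_space \<Rightarrow> complex) \<Rightarrow> complex"
  assumes l: "\<And>j. sfunctional (l j)"
    and pointwise: "\<And>f. f \<in> schwartz \<Longrightarrow> bounded (range (\<lambda>j. l j f))"
  shows "\<exists>M::nat. \<forall>j. \<forall>f\<in>schwartz. cmod (l j f) \<le> real M * snorm M f"
proof -
  have "\<exists>M::nat. \<forall>j. \<forall>f\<in>schwartz. cmod (l j f) \<le> real M * 1 ^ M * snorm M f"
  proof (rule sfunctional_uniform_boundedness[OF l])
    fix f :: "'a \<Rightarrow> complex" assume "f \<in> schwartz"
    then obtain B where B: "\<And>j. cmod (l j f) \<le> B" using pointwise by (auto simp: bounded_iff)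
    obtain M :: nat where "B \<le> real M" using real_arch_simple[of B] by (elim exE)
    then have "cmod (l j f) \<le> real M * 1 ^ M" for j using B[of j] by simp
    then show "\<exists>M::nat. \<forall>j. cmod (l j f) \<le> real M * 1 ^ M" by (intro exI allI)
  qed auto
  then show ?thesis by simp
qed

text \<open>This is the Banach-Steinhaus theorem: a pointwise convergent sequence is equicontinuous, and a
  common bound passes to the limit.\<close>

lemma sfunctional_limit:
  assumes l: "\<And>n::nat. sfunctional (l n)" and lim: "\<And>f. f \<in> schwartz \<Longrightarrow> (\<lambda>n. l n f) \<longlonglongrightarrow> T f"
  shows "sfunctional T"
proof -
  obtain M :: nat where M: "\<And>n f. f \<in> schwartz \<Longrightarrow> cmod (l n f) \<le> real M * snorm M f"
    using sfunctional_equicontinuous[of l, OF l convergent_imp_bounded[OF lim]] by auto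
  show ?thesis unfolding sfunctional_def
  proof (intro conjI)
    show "\<exists>m C. \<forall>f\<in>schwartz. cmod (T f) \<le> C * snorm m f"
    proof (intro exI[of _ M] exI[of _ "real M"] ballI)
      fix f :: "'a \<Rightarrow> complex" assume f: "f \<in> schwartz"
      show "cmod (T f) \<le> real M * snorm M f"
        by (rule tendsto_upperbound[OF tendsto_norm[OF lim[OF f]]]) (simp_all add: M f)
    qed
    show "clinear_functional_on schwartz T"
      unfolding clinear_functional_on_def
    proof (intro ballI allI)
      fix f g :: "'a \<Rightarrow> complex" and a b assume fg: "f \<in> schwartz" "g \<in> schwartz"
      have "(\<lambda>n. l n (\<lambda>x. a * f x + b * g x)) \<longlonglongrightarrow> a * T f + b * T g"
        unfolding functional_lin[OF sfunctional_linear[OF l] fg] by (intro tendsto_intros lim fg)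
      with lim[OF schwartz_lincomb[OF fg, of a b]] show "T (\<lambda>x. a * f x + b * g x) = a * T f + b * T g"
        by (rule LIMSEQ_unique)
    qed
  qed
qed

lemma sfunctional_eval: "sfunctional (\<lambda>f. f x)"
  unfolding sfunctional_def
proof (intro conjI)
  show "clinear_functional_on schwartz (\<lambda>f. f x)" by (simp add: clinear_functional_on_def)
  have "cmod (f x) \<le> 1 * snorm 0 f" if "f \<in> schwartz" for f
    using snorm_bound0[OF that, of 0 0 x] by simp
  then show "\<exists>m C. \<forall>f\<in>schwartz. cmod (f x) \<le> C * snorm m f" by (intro exI[of _ 0] exI[of _ 1] ballI)
qed

text \<open>A form of the closed graph theorem: if all point evaluations of \<open>A\<close> are continuous, so is \<open>A\<close>.
  The functionals that evaluate derivatives are limits of difference quotients, hence continuous. Those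
  with a power of \<open>norm x\<close> in front are bounded at each \<open>f\<close>, because \<open>A f\<close> is Schwartz, and
  uniform boundedness over all \<open>x\<close> turns this into a seminorm estimate. Tensor products with a fixed factor,
  substitutions and Fourier transforms are continuous for this reason.\<close>

lemma soperator_closed_graph:
  fixes A :: "('a::euclidean_space \<Rightarrow> complex) \<Rightarrow> ('b::euclidean_space \<Rightarrow> complex)"
  assumes maps: "\<And>f. f \<in> schwartz \<Longrightarrow> A f \<in> schwartz"
    and eval: "\<And>x. sfunctional (\<lambda>f. A f x)"
  shows "soperator A"
proof -
  have lin: "clinear_map_on schwartz A"
    unfolding clinear_map_on_def
  proof (intro ballI allI ext)
    fix f g :: "'a \<Rightarrow> complex" and a b y assume fg: "f \<in> schwartz" "g \<in> schwartz"
    show "A (\<lambda>x. a * f x + b * g x) y = a * A f y + b * A g y"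
      by (rule functional_lin[OF sfunctional_linear[OF eval[of y]] fg])
  qed
  have deriv: "sfunctional (\<lambda>f. iterated_derivative vs (A f) x)" if "vs \<in> lists Basis" for vs x
    using that
  proof (induction vs arbitrary: x)
    case (Cons b vs)
    \<comment> \<open>The difference quotient of step \<open>1 / Suc n\<close>, written as a linear combination of two functionals
      that are continuous by the induction hypothesis.\<close>
    define l where "l n f = of_real (real (Suc n)) * iterated_derivative vs (A f) (x + (1 / real (Suc n)) *\<^sub>R b)
        + (- of_real (real (Suc n))) * iterated_derivative vs (A f) x" for n f
    show ?case
    proof (rule sfunctional_limit)
      show "sfunctional (l n)" for n
        unfolding l_def[abs_def]
        by (rule sfunctional_lincomb[OF Cons.IH[of "x + (1 / real (Suc n)) *\<^sub>R b"] Cons.IH[of x]])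
      fix f :: "'a \<Rightarrow> complex" assume "f \<in> schwartz"
      let ?u = "iterated_derivative vs (A f)"
      have u: "?u \<in> schwartz" using maps[OF \<open>f \<in> schwartz\<close>] Cons.prems Cons.hyps by (intro schwartz_iterated) auto
      have b: "b \<in> Basis" using Cons.prems Cons.hyps by simp
      have "(\<lambda>n. l n f) = (\<lambda>n. of_real (real (Suc n)) * (?u (x + (1 / real (Suc n)) *\<^sub>R b) - ?u x))"
        unfolding l_def by (rule ext) (simp only: right_diff_distrib mult_minus_left mult_minus_right distrib_left diff_conv_add_uminus)
      then show "(\<lambda>n. l n f) \<longlonglongrightarrow> iterated_derivative (b # vs) (A f) x"
        using schwartz_difference_quotient[OF u b, of x] by simp
    qed
  next
    case Nil
    show ?case unfolding iterated_derivative.simps by (rule eval)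
  qed
  show ?thesis unfolding soperator_def
  proof (intro conjI allI ballI lin)
    fix m
    have "\<exists>M::nat. \<forall>x. \<forall>f\<in>schwartz. cmod (of_real (norm x ^ k) * iterated_derivative vs (A f) x) \<le> real M * snorm M f"
      if "vs \<in> basis_words m" for k vs
    proof (rule sfunctional_equicontinuous)
      show "sfunctional (\<lambda>f. of_real (norm x ^ k) * iterated_derivative vs (A f) x)" for x
      proof -
        have vs: "vs \<in> lists Basis" using that by (simp add: basis_words_def)
        show ?thesis
          using sfunctional_lincomb[OF deriv[OF vs, of x] deriv[OF vs, of x], of "of_real (norm x ^ k)" 0]
          by simp
      qed
      show "bounded (range (\<lambda>x. of_real (norm x ^ k) * iterated_derivative vs (A f) x))" if "f \<in> schwartz" for f
        using schwartz_bounded[OF maps[OF that], of vs k] \<open>vs \<in> basis_words m\<close>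
        by (simp add: bounded_iff norm_mult norm_power basis_words_def)
    qed
    note equi = this
    define M where "M k vs = (SOME M::nat. \<forall>x. \<forall>f\<in>schwartz.
        cmod (of_real (norm x ^ k) * iterated_derivative vs (A f) x) \<le> real M * snorm M f)" for k vs
    have M: "cmod (of_real (norm x ^ k) * iterated_derivative vs (A f) x) \<le> real (M k vs) * snorm (M k vs) f"
      if "vs \<in> basis_words m" "f \<in> schwartz" for k vs x f
      using someI_ex[OF equi[OF that(1), of k]] that(2) unfolding M_def[symmetric] by blast
    define N where "N = (\<Sum>k\<le>m. \<Sum>vs\<in>basis_words m. M k vs)"
    have MN: "M k vs \<le> N" if "k \<le> m" "vs \<in> basis_words m" for k vs
    proof -
      have "M k vs \<le> (\<Sum>vs\<in>basis_words m. M k vs)" using that by (intro member_le_sum) auto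
      also have "\<dots> \<le> N" unfolding N_def
        using that by (intro member_le_sum[of k "{..m}" "\<lambda>k. \<Sum>vs\<in>basis_words m. M k vs"]) auto
      finally show ?thesis .
    qed
    have "snorm m (A f) \<le> real (card (basis_words m :: 'b list set)) * real (Suc m) * (real N * snorm N f)"
      if f: "f \<in> schwartz" for f
    proof (rule snorm_leI)
      fix k vs x assume kvs: "k \<le> m" "vs \<in> (basis_words m :: 'b list set)"
      have "norm x ^ k * cmod (iterated_derivative vs (A f) x) \<le> real (M k vs) * snorm (M k vs) f"
        using M[OF kvs(2) f, of x k] by (simp add: norm_mult norm_power)
      also have "\<dots> \<le> real N * snorm N f"
        using MN[OF kvs] f by (intro mult_mono snorm_mono snorm_nonneg) auto
      finally show "norm x ^ k * cmod (iterated_derivative vs (A f) x) \<le> real N * snorm N f" .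
    qed
    then show "\<exists>n C. \<forall>f\<in>schwartz. snorm m (A f) \<le> C * snorm n f"
      by (intro exI[of _ N] exI[of _ "real (card (basis_words m :: 'b list set)) * real (Suc m) * real N"])
         (simp add: mult.assoc)
  next
    show "A f \<in> schwartz" if "f \<in> schwartz" for f by (rule maps[OF that])
  qed
qed

section \<open>Products, coordinates and linear substitutions\<close>

text \<open>Products alone are not closed under partial derivatives, but sums of products are.\<close>

inductive_set product_sums :: "('a::euclidean_space \<Rightarrow> complex) set" where
  product: "f \<in> schwartz \<Longrightarrow> g \<in> schwartz \<Longrightarrow> (\<lambda>x. f x * g x) \<in> product_sums"
| sum: "u \<in> product_sums \<Longrightarrow> v \<in> product_sums \<Longrightarrow> (\<lambda>x. u x + v x) \<in> product_sums"

lemma pd_eqI: "(f has_derivative D) (at x) \<Longrightarrow> frechet_derivative f (at x) b = D b"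
  using frechet_derivative_at[of f D x] by simp

lemma has_derivative_frechet: "f differentiable at x \<Longrightarrow> (f has_derivative frechet_derivative f (at x)) (at x)"
  by (simp add: frechet_derivative_works)

lemma schwartz_has_frechet: "f \<in> schwartz \<Longrightarrow> (f has_derivative frechet_derivative f (at x)) (at x)"
  by (rule has_derivative_frechet[OF schwartz_differentiable0])

lemma schwartz_bound0:
  assumes "f \<in> schwartz"
  obtains B where "B \<ge> 0" "\<And>x. norm x ^ k * cmod (f x) \<le> B"
  using that[OF snorm_nonneg[OF assms] snorm_bound0[OF assms order_refl]] .

lemma schwartz_mult:
  fixes f g :: "'a::euclidean_space \<Rightarrow> complex"
  assumes "f \<in> schwartz" "g \<in> schwartz"
  shows "(\<lambda>x. f x * g x) \<in> schwartz"
proof -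
  have diff: "u differentiable at x" if "u \<in> product_sums" for u :: "'a \<Rightarrow> complex" and x
    using that
  proof induction
    case (product f g)
    show ?case by (rule differentiable_mult[OF schwartz_differentiable0[OF product(1)] schwartz_differentiable0[OF product(2)]])
  next
    case (sum u v)
    show ?case by (rule differentiable_add[OF sum(3,4)])
  qed
  have bdd: "\<exists>B. \<forall>x. norm x ^ k * cmod (u x) \<le> B" if "u \<in> product_sums" for u :: "'a \<Rightarrow> complex" and k
    using that
  proof induction
    case (product f g)
    obtain B where B: "B \<ge> 0" "\<And>x. norm x ^ k * cmod (f x) \<le> B" by (rule schwartz_bound0[OF product(1), where k=k], rule that)
    obtain C where C: "C \<ge> 0" "\<And>x. norm x ^ 0 * cmod (g x) \<le> C" by (rule schwartz_bound0[OF product(2), where k=0], rule that)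
    have "norm x ^ k * cmod (f x * g x) \<le> B * C" for x
      using mult_mono[OF B(2)[of x] C(2)[of x] B(1)] by (simp add: norm_mult mult.assoc)
    then show ?case by (intro exI[of _ "B * C"] allI)
  next
    case (sum u v)
    then obtain B C where B: "\<And>x. norm x ^ k * cmod (u x) \<le> B" and C: "\<And>x. norm x ^ k * cmod (v x) \<le> C" by auto
    have "norm x ^ k * cmod (u x + v x) \<le> B + C" for x
    proof -
      have "norm x ^ k * cmod (u x + v x) \<le> norm x ^ k * (cmod (u x) + cmod (v x))"
        by (intro mult_left_mono norm_triangle_ineq) auto
      then show ?thesis using B[of x] C[of x] by (simp add: distrib_left)
    qed
    then show ?case by (intro exI[of _ "B + C"] allI)
  qed
  show ?thesis
  proof (rule schwartz_coinduct)
    show "(\<lambda>x. f x * g x) \<in> product_sums" by (rule product_sums.product[OF assms])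
  next
    fix u :: "'a \<Rightarrow> complex" and k assume "u \<in> product_sums"
    with bdd[OF this, of k] show "bounded (range (\<lambda>x. norm x ^ k * cmod (u x)))" by (auto simp: bounded_iff)
  next
    fix u :: "'a \<Rightarrow> complex" and b :: 'a assume "u \<in> product_sums" and b: "b \<in> Basis"
    then show "pd b u \<in> product_sums"
    proof induction
      case (product f g)
      have "pd b (\<lambda>x. f x * g x) = (\<lambda>x. f x * pd b g x + pd b f x * g x)"
        by (rule ext, rule pd_eqI)
           (auto intro!: derivative_eq_intros schwartz_has_frechet product)
      then show ?case by (simp add: product_sums.intros product schwartz_pd b)
    next
      case (sum u v)
      have "pd b (\<lambda>x. u x + v x) = (\<lambda>x. pd b u x + pd b v x)"
        by (rule ext, rule pd_eqI)
           (intro has_derivative_add has_derivative_frechet diff sum)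
      then show ?case by (simp add: product_sums.intros sum)
    qed
  qed (rule diff)
qed

lemma pd_mult:
  assumes "f \<in> schwartz" "g \<in> schwartz"
  shows "pd b (\<lambda>x. f x * g x) x = f x * pd b g x + pd b f x * g x"
  by (rule pd_eqI) (auto intro!: derivative_eq_intros schwartz_has_frechet assms)

definition coord :: "'a::euclidean_space \<Rightarrow> ('a \<Rightarrow> complex) \<Rightarrow> 'a \<Rightarrow> complex" where
  "coord b f = (\<lambda>x. of_real (x \<bullet> b) * f x)"

lemma coord_has_derivative:
  assumes "f \<in> schwartz"
  shows "(coord b f has_derivative
     (\<lambda>h. of_real (x \<bullet> b) * frechet_derivative f (at x) h + of_real (h \<bullet> b) * f x)) (at x)"
  unfolding coord_def
  by (rule has_derivative_mult[OF bounded_linear_imp_has_derivative schwartz_has_frechet[OF assms]])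
     (rule bounded_linear_compose[OF bounded_linear_of_real bounded_linear_inner_left])

lemma pd_coord:
  assumes "f \<in> schwartz" "b \<in> Basis" "c \<in> Basis"
  shows "pd c (coord b f) x = coord b (pd c f) x + (if b = c then 1 else 0) * f x"
  by (unfold pd_eqI[OF coord_has_derivative[OF assms(1)]])
     (use assms in \<open>auto simp: coord_def inner_Basis\<close>)

lemma coord_schwartz:
  fixes f :: "'a::euclidean_space \<Rightarrow> complex"
  assumes f: "f \<in> schwartz" and b: "b \<in> Basis"
  shows "coord b f \<in> schwartz"
proof -
  \<comment> \<open>Derivatives of \<open>x\<^sub>b f(x)\<close> are of the form \<open>x\<^sub>b f'(x) + g(x)\<close>, with the term \<open>g\<close> from the
    derivative of the coordinate.\<close>
  define A where "A = {\<lambda>x. coord b f x + g x | f g. f \<in> schwartz \<and> g \<in> schwartz}"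
  show ?thesis
  proof (rule schwartz_coinduct[of _ A])
    show "coord b f \<in> A" unfolding A_def
      by (rule CollectI, rule exI[of _ f], rule exI[of _ "\<lambda>_. 0"]) (simp add: f zero_in_schwartz)
  next
    fix u x assume "u \<in> A"
    then obtain f g where u: "u = (\<lambda>x. coord b f x + g x)" and fg: "f \<in> schwartz" "g \<in> schwartz"
      unfolding A_def by (elim CollectE exE conjE)
    show "u differentiable at x" unfolding u
      by (rule differentiable_add[OF differentiableI[OF coord_has_derivative[OF fg(1)]] schwartz_differentiable0[OF fg(2)]])
  next
    fix u c assume "u \<in> A" and c: "c \<in> (Basis::'a set)"
    then obtain f g where u: "u = (\<lambda>x. coord b f x + g x)" and fg: "f \<in> schwartz" "g \<in> schwartz"
      unfolding A_def by (elim CollectE exE conjE)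
    let ?e = "if b = c then 1 else 0 :: complex"
    have d: "coord b f differentiable at x" for x by (rule differentiableI[OF coord_has_derivative[OF fg(1)]])
    have "pd c u = (\<lambda>x. pd c (coord b f) x + pd c g x)" unfolding u
      by (rule ext, rule pd_eqI) (intro has_derivative_add has_derivative_frechet d schwartz_differentiable0 fg)
    also have "\<dots> = (\<lambda>x. coord b (pd c f) x + (?e * f x + 1 * pd c g x))"
      unfolding pd_coord[OF fg(1) b c] by (simp add: add.assoc)
    finally have eq: "pd c u = (\<lambda>x. coord b (pd c f) x + (\<lambda>x. ?e * f x + 1 * pd c g x) x)" .
    show "pd c u \<in> A" unfolding A_def
      by (rule CollectI, rule exI[of _ "pd c f"], rule exI[of _ "\<lambda>x. ?e * f x + 1 * pd c g x"])
         (intro conjI eq schwartz_pd[OF fg(1) c] schwartz_lincomb[OF fg(1) schwartz_pd[OF fg(2) c]])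
  next
    fix u k assume "u \<in> A"
    then obtain f g where u: "u = (\<lambda>x. coord b f x + g x)" and fg: "f \<in> schwartz" "g \<in> schwartz"
      unfolding A_def by (elim CollectE exE conjE)
    obtain B where B: "B \<ge> 0" "\<And>x. norm x ^ Suc k * cmod (f x) \<le> B"
      by (rule schwartz_bound0[OF fg(1), where k="Suc k"], rule that)
    obtain C where C: "C \<ge> 0" "\<And>x. norm x ^ k * cmod (g x) \<le> C"
      by (rule schwartz_bound0[OF fg(2), where k=k], rule that)
    have "norm x ^ k * cmod (u x) \<le> B + C" for x
    proof -
      have "cmod (u x) \<le> \<bar>x \<bullet> b\<bar> * cmod (f x) + cmod (g x)"
        unfolding u coord_def using norm_triangle_ineq[of "of_real (x \<bullet> b) * f x" "g x"] by (simp add: norm_mult)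
      also have "\<dots> \<le> norm x * cmod (f x) + cmod (g x)"
        using Basis_le_norm[OF b, of x] by (intro add_right_mono mult_right_mono) auto
      finally have "norm x ^ k * cmod (u x) \<le> norm x ^ k * (norm x * cmod (f x) + cmod (g x))"
        by (rule mult_left_mono) simp
      also have "\<dots> \<le> B + C" using B(2)[of x] C(2)[of x] by (simp add: algebra_simps)
      finally show ?thesis .
    qed
    then show "bounded (range (\<lambda>x. norm x ^ k * cmod (u x)))" unfolding bounded_iff by auto
  qed
qed

lemma sfunctional_scale:
  assumes "sfunctional T"
  shows "sfunctional (\<lambda>f. a * T f)"
  using sfunctional_lincomb[OF assms assms, of a 0] by simp

text \<open>The lower bound on \<open>B\<close>, which says that \<open>B\<close> is injective, keeps the decay at infinity.\<close>

lemma linear_substitution_schwartz: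
  fixes f :: "'b::euclidean_space \<Rightarrow> complex" and B :: "'a::euclidean_space \<Rightarrow> 'b"
  assumes B: "bounded_linear B" and K: "\<And>x. norm x \<le> K * norm (B x)" and f: "f \<in> schwartz"
  shows "(\<lambda>x. f (B x)) \<in> schwartz"
proof -
  define A where "A = {\<lambda>x. f (B x) | f. f \<in> schwartz}"
  have dB: "(B has_derivative B) (at x)" for x by (rule bounded_linear_imp_has_derivative[OF B])
  have der: "((\<lambda>x. f (B x)) has_derivative (\<lambda>h. frechet_derivative f (at (B x)) (B h))) (at x)"
    if "f \<in> schwartz" for f x
    by (rule has_derivative_compose[OF dB schwartz_has_frechet[OF that]])
  show ?thesis
  proof (rule schwartz_coinduct[of _ A])
    show "(\<lambda>x. f (B x)) \<in> A" unfolding A_def by (rule CollectI, rule exI[of _ f]) (simp add: f)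
  next
    fix u x assume "u \<in> A"
    then obtain f where u: "u = (\<lambda>x. f (B x))" and f: "f \<in> schwartz"
      unfolding A_def by (elim CollectE exE conjE)
    show "u differentiable at x" unfolding u differentiable_def by (rule exI, rule der[OF f])
  next
    fix u c assume "u \<in> A" and c: "c \<in> (Basis::'a set)"
    then obtain f where u: "u = (\<lambda>x. f (B x))" and f: "f \<in> schwartz"
      unfolding A_def by (elim CollectE exE conjE)
    have "pd c u x = (\<Sum>b\<in>Basis. of_real (B c \<bullet> b) * pd b f (B x))" for x
      unfolding u pd_eqI[OF der[OF f]] by (rule derivative_expand[OF schwartz_differentiable0[OF f]])
    moreover have "(\<lambda>y. \<Sum>b\<in>Basis. of_real (B c \<bullet> b) * pd b f y) \<in> schwartz"
      by (rule schwartz_sum) (simp_all add: schwartz_pd f)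
    ultimately show "pd c u \<in> A" unfolding A_def
      by (intro CollectI exI[of _ "\<lambda>y. \<Sum>b\<in>Basis. of_real (B c \<bullet> b) * pd b f y"] conjI ext)
  next
    fix u k assume "u \<in> A"
    then obtain f where u: "u = (\<lambda>x. f (B x))" and f: "f \<in> schwartz"
      unfolding A_def by (elim CollectE exE conjE)
    obtain M where M: "M \<ge> 0" "\<And>x. norm x ^ k * cmod (f x) \<le> M"
      by (rule schwartz_bound0[OF f, where k=k], rule that)
    have "norm x ^ k * cmod (u x) \<le> \<bar>K\<bar> ^ k * M" for x
    proof -
      have "norm x \<le> \<bar>K\<bar> * norm (B x)"
        by (rule order_trans[OF K]) (intro mult_right_mono abs_ge_self norm_ge_zero)
      then have "norm x ^ k \<le> \<bar>K\<bar> ^ k * norm (B x) ^ k"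
        unfolding power_mult_distrib[symmetric] by (intro power_mono) auto
      then have "norm x ^ k * cmod (u x) \<le> (\<bar>K\<bar> ^ k * norm (B x) ^ k) * cmod (u x)"
        by (rule mult_right_mono) simp
      also have "\<dots> \<le> \<bar>K\<bar> ^ k * M"
        using mult_left_mono[OF M(2)[of "B x"], of "\<bar>K\<bar> ^ k"] by (simp add: u mult.assoc)
      finally show ?thesis .
    qed
    then show "bounded (range (\<lambda>x. norm x ^ k * cmod (u x)))" unfolding bounded_iff by auto
  qed
qed

lemma soperator_linear_substitution:
  fixes B :: "'a::euclidean_space \<Rightarrow> 'b::euclidean_space"
  assumes "bounded_linear B" "\<And>x. norm x \<le> K * norm (B x)"
  shows "soperator (\<lambda>f x. f (B x))"
proof (rule soperator_closed_graph)
  show "(\<lambda>x. f (B x)) \<in> schwartz" if "f \<in> schwartz" for f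
    by (rule linear_substitution_schwartz[OF assms that])
  show "sfunctional (\<lambda>f. f (B x))" for x by (rule sfunctional_eval)
qed

lemma tensor_schwartz:
  fixes f :: "'a::euclidean_space \<Rightarrow> complex" and g :: "'b::euclidean_space \<Rightarrow> complex"
  assumes "f \<in> schwartz" "g \<in> schwartz"
  shows "tensor f g \<in> schwartz"
proof -
  define A where "A = {tensor f g | (f :: 'a \<Rightarrow> complex) (g :: 'b \<Rightarrow> complex). f \<in> schwartz \<and> g \<in> schwartz}"
  have teq: "tensor f g = (\<lambda>z. f (fst z) * g (snd z))" for f :: "'a \<Rightarrow> complex" and g :: "'b \<Rightarrow> complex"
    by (auto simp: tensor_def)
  have der: "(tensor f g has_derivative (\<lambda>h. f (fst z) * frechet_derivative g (at (snd z)) (snd h)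
      + frechet_derivative f (at (fst z)) (fst h) * g (snd z))) (at z)"
    if "f \<in> schwartz" "g \<in> schwartz" for f :: "'a \<Rightarrow> complex" and g :: "'b \<Rightarrow> complex" and z
    unfolding teq
    by (intro has_derivative_mult has_derivative_compose[OF has_derivative_fst[OF has_derivative_ident] schwartz_has_frechet[OF that(1)]]
        has_derivative_compose[OF has_derivative_snd[OF has_derivative_ident] schwartz_has_frechet[OF that(2)]])
  show ?thesis
  proof (rule schwartz_coinduct[of _ A])
    show "tensor f g \<in> A" unfolding A_def
      by (rule CollectI, rule exI[of _ f], rule exI[of _ g]) (simp add: assms)
  next
    fix u x assume "u \<in> A"
    then obtain f g where u: "u = tensor f g" and fg: "f \<in> schwartz" "g \<in> schwartz"
      unfolding A_def by (elim CollectE exE conjE)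
    show "u differentiable at x" unfolding u differentiable_def by (rule exI, rule der[OF fg])
  next
    fix u and c :: "'a \<times> 'b" assume "u \<in> A" and c: "c \<in> Basis"
    then obtain f g where u: "u = tensor f g" and fg: "f \<in> schwartz" "g \<in> schwartz"
      unfolding A_def by (elim CollectE exE conjE)
    have z1: "frechet_derivative g (at y) 0 = 0" for y
      by (rule linear_0[OF linear_frechet_derivative[OF schwartz_differentiable0[OF fg(2)]]])
    have z2: "frechet_derivative f (at y) 0 = 0" for y
      by (rule linear_0[OF linear_frechet_derivative[OF schwartz_differentiable0[OF fg(1)]]])
    from c consider b where "b \<in> Basis" "c = (b, 0)" | b where "b \<in> Basis" "c = (0, b)"
      by (auto simp: Basis_prod_def)
    then show "pd c u \<in> A"
    proof cases
      case (1 b)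
      have "pd c u = tensor (pd b f) g"
        by (rule ext, unfold u pd_eqI[OF der[OF fg]]) (simp add: 1 z1 teq)
      then show ?thesis unfolding A_def
        by (intro CollectI exI[of _ "pd b f"] exI[of _ g] conjI schwartz_pd[OF fg(1) 1(1)] fg(2))
    next
      case (2 b)
      have "pd c u = tensor f (pd b g)"
        by (rule ext, unfold u pd_eqI[OF der[OF fg]]) (simp add: 2 z2 teq)
      then show ?thesis unfolding A_def
        by (intro CollectI exI[of _ f] exI[of _ "pd b g"] conjI schwartz_pd[OF fg(2) 2(1)] fg(1))
    qed
  next
    fix u k assume "u \<in> A"
    then obtain f g where u: "u = tensor f g" and fg: "f \<in> schwartz" "g \<in> schwartz"
      unfolding A_def by (elim CollectE exE conjE)
    obtain B where B: "B \<ge> 0" "\<And>x. norm x ^ k * cmod (f x) \<le> B" by (rule schwartz_bound0[OF fg(1), where k=k], rule that)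
    obtain B0 where B0: "B0 \<ge> 0" "\<And>x. norm x ^ 0 * cmod (f x) \<le> B0" by (rule schwartz_bound0[OF fg(1), where k=0], rule that)
    obtain C where C: "C \<ge> 0" "\<And>x. norm x ^ k * cmod (g x) \<le> C" by (rule schwartz_bound0[OF fg(2), where k=k], rule that)
    obtain C0 where C0: "C0 \<ge> 0" "\<And>x. norm x ^ 0 * cmod (g x) \<le> C0" by (rule schwartz_bound0[OF fg(2), where k=0], rule that)
    have "norm z ^ k * cmod (u z) \<le> 2 ^ k * (B * C0 + B0 * C)" for z
    proof -
      obtain x y where z: "z = (x, y)" by (cases z)
      have "norm z \<le> 2 * max (norm x) (norm y)" using norm_Pair_le[of x y] by (auto simp: z max_def)
      then have "norm z ^ k \<le> (2 * max (norm x) (norm y)) ^ k" by (intro power_mono) auto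
      also have "\<dots> \<le> 2 ^ k * (norm x ^ k + norm y ^ k)" by (auto simp: power_mult_distrib max_def)
      finally have "norm z ^ k * cmod (u z) \<le> (2 ^ k * (norm x ^ k + norm y ^ k)) * cmod (u z)"
        by (rule mult_right_mono) simp
      also have "\<dots> = 2 ^ k * ((norm x ^ k * cmod (f x)) * cmod (g y) + cmod (f x) * (norm y ^ k * cmod (g y)))"
        by (simp add: u z teq norm_mult algebra_simps)
      also have "\<dots> \<le> 2 ^ k * (B * C0 + B0 * C)"
        using B(1) B(2)[of x] B0(1) B0(2)[of x] C(1) C(2)[of y] C0(1) C0(2)[of y]
        by (intro mult_left_mono add_mono mult_mono) auto
      finally show ?thesis .
    qed
    then show "bounded (range (\<lambda>x. norm x ^ k * cmod (u x)))" unfolding bounded_iff by auto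
  qed
qed

lemma soperator_tensor:
  fixes f :: "'a::euclidean_space \<Rightarrow> complex" and g :: "'b::euclidean_space \<Rightarrow> complex"
  shows "g \<in> schwartz \<Longrightarrow> soperator (\<lambda>f :: 'a \<Rightarrow> complex. tensor f g)"
    and "f \<in> schwartz \<Longrightarrow> soperator (\<lambda>g :: 'b \<Rightarrow> complex. tensor f g)"
proof -
  assume g: "g \<in> schwartz"
  show "soperator (\<lambda>f :: 'a \<Rightarrow> complex. tensor f g)"
  proof (rule soperator_closed_graph)
    show "tensor f g \<in> schwartz" if "f \<in> schwartz" for f :: "'a \<Rightarrow> complex" by (rule tensor_schwartz[OF that g])
    show "sfunctional (\<lambda>f :: 'a \<Rightarrow> complex. tensor f g z)" for z
      using sfunctional_scale[OF sfunctional_eval[of "fst z"], of "g (snd z)"]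
      by (simp add: tensor_def case_prod_beta mult.commute)
  qed
next
  assume f: "f \<in> schwartz"
  show "soperator (\<lambda>g :: 'b \<Rightarrow> complex. tensor f g)"
  proof (rule soperator_closed_graph)
    show "tensor f g \<in> schwartz" if "g \<in> schwartz" for g :: "'b \<Rightarrow> complex" by (rule tensor_schwartz[OF f that])
    show "sfunctional (\<lambda>g :: 'b \<Rightarrow> complex. tensor f g z)" for z
      using sfunctional_scale[OF sfunctional_eval[of "snd z"], of "f (fst z)"]
      by (simp add: tensor_def case_prod_beta)
  qed
qed

section \<open>Integration of Schwartz functions\<close>

text \<open>An integrable product weight. Being a product of functions of one variable it is integrable by
  Fubini, and a multiple of it dominates each Schwartz function.\<close>

definition poisson_weight :: "'a::euclidean_space \<Rightarrow> real" where
  "poisson_weight x = (\<Prod>b\<in>Basis. 1 / (1 + (x \<bullet> b)\<^sup>2))"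

lemma integrable_inverse_one_plus_square: "integrable lborel (\<lambda>x::real. 1 / (1 + x\<^sup>2))"
proof -
  have "set_integrable lborel (einterval (-\<infinity>) \<infinity>) (\<lambda>x::real. inverse (1 + x\<^sup>2))"
  proof (rule interval_integral_FTC_nonneg)
    show "(arctan has_real_derivative inverse (1 + x\<^sup>2)) (at x)" for x by (rule DERIV_arctan)
    show "isCont (\<lambda>x. inverse (1 + x\<^sup>2)) x" for x :: real
      by (intro continuous_intros) (simp add: add_nonneg_eq_0_iff)
    show "((arctan \<circ> real_of_ereal) \<longlongrightarrow> - (pi / 2)) (at_right (-\<infinity>))"
      by (simp add: ereal_tendsto_simps tendsto_arctan_at_bot)
    show "((arctan \<circ> real_of_ereal) \<longlongrightarrow> pi / 2) (at_left \<infinity>)"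
      by (simp add: ereal_tendsto_simps tendsto_arctan_at_top)
  qed auto
  then show ?thesis by (simp add: set_integrable_def divide_inverse)
qed

lemma integrable_poisson_weight: "integrable lborel (poisson_weight :: 'a::euclidean_space \<Rightarrow> real)"
proof -
  interpret product_sigma_finite "\<lambda>_::'a. lborel :: real measure" by standard
  have eq: "(\<lambda>f. poisson_weight (\<Sum>b\<in>(Basis::'a set). f b *\<^sub>R b)) = (\<lambda>f. \<Prod>b\<in>Basis. 1 / (1 + (f b)\<^sup>2))"
    by (simp add: poisson_weight_def)
  have m: "(poisson_weight :: 'a \<Rightarrow> real) \<in> borel_measurable borel"
    unfolding poisson_weight_def[abs_def] by measurable
  have m': "(\<lambda>f. \<Sum>b\<in>(Basis::'a set). f b *\<^sub>R b) \<in> borel_measurable (\<Pi>\<^sub>M b\<in>(Basis::'a set). lborel)"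
    by measurable
  have "integrable (\<Pi>\<^sub>M b\<in>(Basis::'a set). lborel) (\<lambda>f. \<Prod>b\<in>Basis. (\<lambda>_ t. 1 / (1 + t\<^sup>2)) b (f b) :: real)"
    by (rule product_integrable_prod) (simp_all add: integrable_inverse_one_plus_square)
  then have "integrable (distr (\<Pi>\<^sub>M b\<in>(Basis::'a set). lborel) borel (\<lambda>f. \<Sum>b\<in>Basis. f b *\<^sub>R b)) (poisson_weight :: 'a \<Rightarrow> real)"
    unfolding integrable_distr_eq[OF m' m] eq by simp
  then show ?thesis by (subst lborel_eq)
qed

lemma poisson_weight_pos: "poisson_weight x > 0"
  unfolding poisson_weight_def by (intro prod_pos) (auto intro!: divide_pos_pos add_pos_nonneg)

lemma schwartz_le_weight:
  fixes f :: "'a::euclidean_space \<Rightarrow> complex"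
  assumes "f \<in> schwartz"
  shows "cmod (f x) \<le> 2 ^ Suc DIM('a) * snorm (2 * DIM('a)) f * poisson_weight x"
proof -
  let ?d = "DIM('a)" and ?P = "\<Prod>b\<in>Basis. (1 + (x \<bullet> b)\<^sup>2)"
  have P: "?P > 0" by (intro prod_pos) (auto intro!: add_pos_nonneg)
  have "?P \<le> (\<Prod>b\<in>(Basis::'a set). 1 + norm x ^ 2)"
  proof (intro prod_mono conjI)
    fix b :: 'a assume "b \<in> Basis"
    have "\<bar>x \<bullet> b\<bar>\<^sup>2 \<le> norm x ^ 2" using Basis_le_norm[OF \<open>b \<in> Basis\<close>, of x] by (intro power_mono) auto
    then show "1 + (x \<bullet> b)\<^sup>2 \<le> 1 + norm x ^ 2" by simp
  qed simp
  also have "\<dots> = (1 + norm x ^ 2) ^ ?d" by simp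
  also have "\<dots> \<le> (2 * max 1 (norm x ^ 2)) ^ ?d" by (intro power_mono) (auto simp: max_def)
  also have "\<dots> \<le> 2 ^ ?d * (1 + norm x ^ (2 * ?d))"
    by (auto simp: power_mult_distrib max_def power_mult)
  finally have "?P * cmod (f x) \<le> (2 ^ ?d * (1 + norm x ^ (2 * ?d))) * cmod (f x)"
    by (rule mult_right_mono) simp
  also have "\<dots> = 2 ^ ?d * (norm x ^ 0 * cmod (f x) + norm x ^ (2 * ?d) * cmod (f x))"
    by (simp add: algebra_simps)
  also have "\<dots> \<le> 2 ^ ?d * (snorm (2 * ?d) f + snorm (2 * ?d) f)"
    by (intro mult_left_mono add_mono snorm_bound0 assms) auto
  finally have "?P * cmod (f x) \<le> 2 ^ Suc ?d * snorm (2 * ?d) f" by simp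
  then have "cmod (f x) \<le> 2 ^ Suc ?d * snorm (2 * ?d) f / ?P" using P by (simp add: pos_le_divide_eq mult.commute)
  then show ?thesis by (simp add: poisson_weight_def prod_dividef)
qed

lemma schwartz_continuous: "f \<in> schwartz \<Longrightarrow> continuous_on UNIV f"
  by (intro continuous_at_imp_continuous_on ballI differentiable_imp_continuous_within schwartz_differentiable0)

lemma schwartz_measurable [measurable_dest]: "f \<in> schwartz \<Longrightarrow> f \<in> borel_measurable borel"
  by (rule borel_measurable_continuous_onI[OF schwartz_continuous])

lemma schwartz_mult_bounded_integrable:
  fixes f h :: "'a::euclidean_space \<Rightarrow> complex"
  assumes f: "f \<in> schwartz" and h: "h \<in> borel_measurable borel" "\<And>x. cmod (h x) \<le> B"
  shows "integrable lborel (\<lambda>x. f x * h x)"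
    and "cmod (LINT x|lborel. f x * h x)
      \<le> (2 ^ Suc DIM('a) * B * (LINT x|lborel. poisson_weight (x::'a))) * snorm (2 * DIM('a)) f"
proof -
  let ?C = "2 ^ Suc DIM('a) * snorm (2 * DIM('a)) f * B"
  have b: "cmod (f x * h x) \<le> ?C * poisson_weight x" for x
    using mult_mono[OF schwartz_le_weight[OF f, of x] h(2)[of x]] poisson_weight_pos[of x] snorm_nonneg[OF f, of "2 * DIM('a)"]
    by (simp add: norm_mult mult_ac)
  have w: "integrable lborel (\<lambda>x::'a. ?C * poisson_weight x)"
    by (intro integrable_mult_right integrable_poisson_weight)
  show int: "integrable lborel (\<lambda>x. f x * h x)"
  proof (rule Bochner_Integration.integrable_bound[OF w])
    show "(\<lambda>x. f x * h x) \<in> borel_measurable lborel" using schwartz_measurable[OF f] h(1) by simp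
    show "AE x in lborel. norm (f x * h x) \<le> norm (?C * poisson_weight x)"
      by (intro AE_I2 order_trans[OF b]) simp
  qed
  have "cmod (LINT x|lborel. f x * h x) \<le> (LINT x|lborel. ?C * poisson_weight (x::'a))"
    by (rule Bochner_Integration.integral_norm_bound_integral[OF int w b])
  then show "cmod (LINT x|lborel. f x * h x)
      \<le> (2 ^ Suc DIM('a) * B * (LINT x|lborel. poisson_weight (x::'a))) * snorm (2 * DIM('a)) f"
    by (simp add: mult_ac)
qed

lemma schwartz_integrable: "f \<in> schwartz \<Longrightarrow> integrable lborel f"
  using schwartz_mult_bounded_integrable(1)[of f "\<lambda>_. 1" 1] by simp

lemma schwartz_mult_integrable: "f \<in> schwartz \<Longrightarrow> g \<in> schwartz \<Longrightarrow> integrable lborel (\<lambda>x. f x * g x)"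
  by (rule schwartz_integrable[OF schwartz_mult])

lemma sfunctional_integral:
  fixes h :: "'a::euclidean_space \<Rightarrow> complex"
  assumes h: "h \<in> borel_measurable borel" "\<And>x. cmod (h x) \<le> B"
  shows "sfunctional (\<lambda>f. LINT x|lborel. f x * h x)"
  unfolding sfunctional_def
proof (intro conjI)
  show "clinear_functional_on schwartz (\<lambda>f. LINT x|lborel. f x * h x)"
    unfolding clinear_functional_on_def
  proof (intro ballI allI)
    fix f g :: "'a \<Rightarrow> complex" and a b assume fg: "f \<in> schwartz" "g \<in> schwartz"
    have "(LINT x|lborel. (a * f x + b * g x) * h x) = (LINT x|lborel. a * (f x * h x) + b * (g x * h x))"
      by (simp add: algebra_simps)
    also have "\<dots> = a * (LINT x|lborel. f x * h x) + b * (LINT x|lborel. g x * h x)"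
      using schwartz_mult_bounded_integrable(1)[OF fg(1) h] schwartz_mult_bounded_integrable(1)[OF fg(2) h]
      by (subst Bochner_Integration.integral_add) auto
    finally show "(LINT x|lborel. (a * f x + b * g x) * h x)
        = a * (LINT x|lborel. f x * h x) + b * (LINT x|lborel. g x * h x)" .
  qed
  show "\<exists>m C. \<forall>f\<in>schwartz. cmod (LINT x|lborel. f x * h x) \<le> C * snorm m f"
    by (intro exI[of _ "2 * DIM('a)"] exI[of _ "2 ^ Suc DIM('a) * B * (LINT x|lborel. poisson_weight (x::'a))"] ballI
        schwartz_mult_bounded_integrable(2)[OF _ h])
qed

lemma sfunctional_pairing:
  assumes "g \<in> schwartz"
  shows "sfunctional (\<lambda>f. pairing lborel f g)"
  unfolding pairing_def
proof (rule sfunctional_integral[OF schwartz_measurable[OF assms]])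
  show "cmod (g x) \<le> snorm 0 g" for x using snorm_bound0[OF assms, of 0 0 x] by simp
qed

lemma pairing_commute: "pairing M f g = pairing M g f"
  by (simp add: pairing_def mult.commute)

lemma sfunctional_pairing':
  assumes "g \<in> schwartz"
  shows "sfunctional (\<lambda>f. pairing lborel g f)"
  using sfunctional_pairing[OF assms] by (simp add: pairing_commute[of lborel g])

lemma lborel_integral_affine:
  fixes f :: "'a::euclidean_space \<Rightarrow> complex"
  assumes "f \<in> borel_measurable borel" "c \<noteq> 0"
  shows "(LINT x|lborel. f x) = of_real (\<bar>c\<bar> ^ DIM('a)) * (LINT x|lborel. f (t + c *\<^sub>R x))"
proof -
  have "(LINT x|lborel. f x)
      = (LINT x|density (distr lborel borel (\<lambda>x. t + c *\<^sub>R x)) (\<lambda>_. ennreal (\<bar>c\<bar> ^ DIM('a))). f x)"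
    by (subst lborel_affine[OF assms(2), of t]) (simp add: ennreal_power)
  also have "\<dots> = (LINT x|distr lborel borel (\<lambda>x. t + c *\<^sub>R x). (\<bar>c\<bar> ^ DIM('a)) *\<^sub>R f x)"
    using assms by (intro integral_density) auto
  also have "\<dots> = (LINT x|lborel. (\<bar>c\<bar> ^ DIM('a)) *\<^sub>R f (t + c *\<^sub>R x))"
    using assms by (intro integral_distr) auto
  finally show ?thesis by (simp add: scaleR_conv_of_real)
qed

text \<open>Up to a constant the weight dominates its translates by at most one unit, so that one multiple of it
  dominates all the difference quotients of a Schwartz function.\<close>

lemma poisson_weight_translate:
  fixes x b :: "'a::euclidean_space"
  assumes "b \<in> Basis" "\<bar>s\<bar> \<le> 1"
  shows "poisson_weight (x + s *\<^sub>R b) \<le> 3 * poisson_weight x"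
proof -
  have split: "poisson_weight y = 1 / (1 + (y \<bullet> b)\<^sup>2) * (\<Prod>c\<in>Basis - {b}. 1 / (1 + (y \<bullet> c)\<^sup>2))" for y :: 'a
    unfolding poisson_weight_def using assms(1) by (subst prod.remove[of _ b]) auto
  have same: "(\<Prod>c\<in>Basis - {b}. 1 / (1 + ((x + s *\<^sub>R b) \<bullet> c)\<^sup>2)) = (\<Prod>c\<in>Basis - {b}. 1 / (1 + (x \<bullet> c)\<^sup>2))"
    using assms(1) by (intro prod.cong) (auto simp: inner_add_left inner_Basis)
  define u where "u = x \<bullet> b"
  have xb: "(x + s *\<^sub>R b) \<bullet> b = u + s" using assms(1) by (simp add: u_def inner_add_left inner_Basis)
  have "s\<^sup>2 \<le> 1" using assms(2) by (simp add: abs_square_le_1)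
  \<comment> \<open>This square is \<open>2 (u + s)\<^sup>2 + 2 s\<^sup>2 - u\<^sup>2\<close>.\<close>
  have "0 \<le> (u + 2 * s)\<^sup>2" by simp
  then have "u\<^sup>2 \<le> 2 * (u + s)\<^sup>2 + 2 * s\<^sup>2" by (simp add: power2_eq_square algebra_simps)
  then have "1 + u\<^sup>2 \<le> 3 * (1 + (u + s)\<^sup>2)" using \<open>s\<^sup>2 \<le> 1\<close> zero_le_power2[of "u + s"] by (smt (verit))
  then have "1 / (1 + (u + s)\<^sup>2) \<le> 3 * (1 / (1 + u\<^sup>2))"
    by (simp add: field_simps add_pos_nonneg)
  then have "1 / (1 + (u + s)\<^sup>2) * (\<Prod>c\<in>Basis - {b}. 1 / (1 + (x \<bullet> c)\<^sup>2))
      \<le> 3 * (1 / (1 + u\<^sup>2)) * (\<Prod>c\<in>Basis - {b}. 1 / (1 + (x \<bullet> c)\<^sup>2))"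
    by (intro mult_right_mono prod_nonneg) auto
  then show ?thesis unfolding split xb same by (simp add: u_def)
qed

text \<open>The integral of a partial derivative is the limit of integrals of difference quotients, and these
  vanish because Lebesgue measure is invariant under translations. Dominated convergence applies by the mean value
  theorem on segments.\<close>

lemma integral_pd_zero:
  fixes f :: "'a::euclidean_space \<Rightarrow> complex"
  assumes f: "f \<in> schwartz" and b: "b \<in> Basis"
  shows "(LINT x|lborel. pd b f x) = 0"
proof -
  define u where "u n x = of_real (real (Suc n)) * (f (x + (1 / real (Suc n)) *\<^sub>R b) - f x)" for n x
  define C where "C = 2 ^ Suc DIM('a) * snorm (2 * DIM('a)) (pd b f)"
  have C: "C \<ge> 0" using snorm_nonneg[OF schwartz_pd[OF f b]] by (simp add: C_def)
  have line: "cmod (f (x + h *\<^sub>R b) - f x) \<le> h * (3 * C * poisson_weight x)" if h: "0 \<le> h" "h \<le> 1" for x h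
  proof -
    have "cmod (f (x + h *\<^sub>R b) - f (x + 0 *\<^sub>R b)) \<le> (3 * C * poisson_weight x) * norm (h - 0)"
    proof (rule differentiable_bound[of "{0..h}"])
      fix t assume t: "t \<in> {0..h}"
      have "((\<lambda>t. f (x + t *\<^sub>R b)) has_derivative (\<lambda>s. frechet_derivative f (at (x + t *\<^sub>R b)) (s *\<^sub>R b))) (at t)"
        by (rule has_derivative_compose[OF _ schwartz_has_frechet[OF f]]) (auto intro!: derivative_eq_intros)
      moreover have "frechet_derivative f (at y) (s *\<^sub>R b) = s *\<^sub>R pd b f y" for s y
        by (rule linear_cmul[OF linear_frechet_derivative[OF schwartz_differentiable0[OF f]]])
      ultimately show "((\<lambda>t. f (x + t *\<^sub>R b)) has_derivative (\<lambda>s. s *\<^sub>R pd b f (x + t *\<^sub>R b))) (at t within {0..h})"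
        by (simp add: has_derivative_at_withinI)
      have "cmod (pd b f (x + t *\<^sub>R b)) \<le> C * poisson_weight (x + t *\<^sub>R b)"
        using schwartz_le_weight[OF schwartz_pd[OF f b], of "x + t *\<^sub>R b"] by (simp add: C_def)
      also have "\<dots> \<le> C * (3 * poisson_weight x)"
        using t h C by (intro mult_left_mono poisson_weight_translate b) auto
      finally have "cmod (pd b f (x + t *\<^sub>R b)) \<le> 3 * C * poisson_weight x" by simp
      then show "onorm (\<lambda>s. s *\<^sub>R pd b f (x + t *\<^sub>R b)) \<le> 3 * C * poisson_weight x"
        by (intro onorm_bound) (use C poisson_weight_pos[of x] in \<open>auto simp: mult.commute intro!: mult_left_mono\<close>)
    qed (use h in auto)
    then show ?thesis using h by (simp add: mult_ac)
  qed
  have "(\<lambda>n. LINT x|lborel. u n x) \<longlonglongrightarrow> (LINT x|lborel. pd b f x)"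
  proof (rule integral_dominated_convergence[where w="\<lambda>x. 3 * C * poisson_weight x"])
    show "pd b f \<in> borel_measurable lborel" using schwartz_measurable[OF schwartz_pd[OF f b]] by simp
    show "u n \<in> borel_measurable lborel" for n
      unfolding u_def using schwartz_measurable[OF f] by measurable
    show "integrable lborel (\<lambda>x::'a. 3 * C * poisson_weight x)"
      by (intro integrable_mult_right integrable_poisson_weight)
    show "AE x in lborel. (\<lambda>n. u n x) \<longlonglongrightarrow> pd b f x"
      unfolding u_def by (intro AE_I2 schwartz_difference_quotient f b)
    show "AE x in lborel. norm (u n x) \<le> 3 * C * poisson_weight x" for n
    proof (rule AE_I2)
      fix x :: 'a
      define r where "r = real (Suc n)"
      have r: "r \<ge> 1" by (simp add: r_def)
      have "cmod (f (x + (1 / r) *\<^sub>R b) - f x) \<le> (1 / r) * (3 * C * poisson_weight x)"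
        using r by (intro line) auto
      then have "r * cmod (f (x + (1 / r) *\<^sub>R b) - f x) \<le> 3 * C * poisson_weight x"
        using r by (simp add: field_simps)
      then show "norm (u n x) \<le> 3 * C * poisson_weight x"
        unfolding u_def r_def[symmetric] using r by (simp add: norm_mult)
    qed
  qed
  moreover have "(LINT x|lborel. u n x) = 0" for n
  proof -
    define h where "h = 1 / real (Suc n)"
    have "(LINT x|lborel. f x) = (LINT x|lborel. f (h *\<^sub>R b + 1 *\<^sub>R x))"
      using lborel_integral_affine[OF schwartz_measurable[OF f], of 1 "h *\<^sub>R b"] by simp
    then have eq: "(LINT x|lborel. f (x + h *\<^sub>R b)) = (LINT x|lborel. f x)" by (simp add: add.commute)
    have "integrable lborel (\<lambda>x. f (x + h *\<^sub>R b))"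
      using integrable_distr_eq[of "(+) (h *\<^sub>R b)" lborel borel f] schwartz_integrable[OF f] schwartz_measurable[OF f]
      by (simp add: lborel_distr_plus add.commute)
    then show ?thesis unfolding u_def h_def[symmetric]
      using schwartz_integrable[OF f] eq by (simp add: Bochner_Integration.integral_diff)
  qed
  ultimately show ?thesis by (simp add: LIMSEQ_const_iff)
qed

lemma pairing_pd:
  assumes "f \<in> schwartz" "g \<in> schwartz" "b \<in> Basis"
  shows "pairing lborel (pd b f) g = - pairing lborel f (pd b g)"
proof -
  have "0 = (LINT x|lborel. f x * pd b g x + pd b f x * g x)"
    using integral_pd_zero[OF schwartz_mult[OF assms(1,2)] assms(3)] unfolding pd_mult[OF assms(1,2)] by simp
  also have "\<dots> = pairing lborel f (pd b g) + pairing lborel (pd b f) g"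
    unfolding pairing_def
    by (intro Bochner_Integration.integral_add schwartz_mult_integrable schwartz_pd assms)
  finally show ?thesis by (simp add: eq_neg_iff_add_eq_0 add.commute)
qed

lemma pairing_coord: "pairing M (coord b f) g = pairing M f (coord b g)"
  by (simp add: pairing_def coord_def mult_ac)

section \<open>Fourier transforms\<close>

text \<open>The kernel of a Fourier transform with phase \<open>y \<bullet> J x\<close>. A general linear map \<open>J\<close> covers
  the symplectic Fourier transform, its transpose, and the transforms on the doubled phase space.\<close>

definition wave :: "('a::euclidean_space \<Rightarrow> 'a) \<Rightarrow> 'a \<Rightarrow> 'a \<Rightarrow> complex" where
  "wave J y x = exp (- \<i> * of_real (y \<bullet> J x))"

definition fourier :: "('a::euclidean_space \<Rightarrow> 'a) \<Rightarrow> ('a \<Rightarrow> complex) \<Rightarrow> 'a \<Rightarrow> complex" where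
  "fourier J f y = (LINT x|lborel. f x * wave J y x)"

lemma norm_wave: "cmod (wave J y x) = 1"
  by (simp add: wave_def norm_exp_eq_Re)

text \<open>The second order remainder of the exponential, with a constant that does not depend on \<open>t\<close>; it
  dominates the difference quotients under the Fourier integral.\<close>

lemma wave_remainder: "cmod (exp (- \<i> * of_real t) - 1 + \<i> * of_real t) \<le> t\<^sup>2"
proof -
  have e: "cmod (exp (- \<i> * of_real s) - 1) \<le> \<bar>s\<bar>" for s :: real
  proof -
    have "cmod (exp (\<i> * of_real (- s)) - 1) = 2 * \<bar>sin (- s / 2)\<bar>" by (rule dist_exp_i_1)
    also have "\<dots> \<le> 2 * \<bar>- s / 2\<bar>" by (intro mult_left_mono abs_sin_x_le_abs_x) auto
    finally show ?thesis by simp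
  qed
  let ?\<phi> = "\<lambda>s::real. exp (- \<i> * of_real s) - 1 + \<i> * of_real s"
  have "cmod (?\<phi> t - ?\<phi> 0) \<le> \<bar>t\<bar> * norm (t - 0)"
  proof (rule differentiable_bound[of "cball 0 \<bar>t\<bar>"])
    fix s :: real assume s: "s \<in> cball 0 \<bar>t\<bar>"
    have "(?\<phi> has_vector_derivative (- \<i> * (exp (- \<i> * of_real s) - 1))) (at s within cball 0 \<bar>t\<bar>)"
      by (auto intro!: derivative_eq_intros has_vector_derivative_real_field simp: algebra_simps)
    then show "(?\<phi> has_derivative (\<lambda>h::real. h *\<^sub>R (- \<i> * (exp (- \<i> * of_real s) - 1)))) (at s within cball 0 \<bar>t\<bar>)"
      by (simp add: has_vector_derivative_def)
    have "cmod (- \<i> * (exp (- \<i> * of_real s) - 1)) \<le> \<bar>t\<bar>"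
      using e[of s] s by (simp add: norm_mult)
    then show "onorm (\<lambda>h::real. h *\<^sub>R (- \<i> * (exp (- \<i> * of_real s) - 1))) \<le> \<bar>t\<bar>"
      by (intro onorm_bound) (auto simp: mult.commute intro!: mult_left_mono)
  qed auto
  then show ?thesis by (simp add: power2_eq_square)
qed

lemma wave_has_derivative:
  assumes "bounded_linear J"
  shows "(wave J y has_derivative (\<lambda>h. - \<i> * of_real (y \<bullet> J h) * wave J y x)) (at x)"
proof -
  have "bounded_linear (\<lambda>x. - \<i> * of_real (y \<bullet> J x))"
    by (intro bounded_linear_const_mult bounded_linear_compose[OF bounded_linear_of_real]
        bounded_linear_compose[OF bounded_linear_inner_right] assms)
  then have "((\<lambda>x. - \<i> * of_real (y \<bullet> J x)) has_derivative (\<lambda>h. - \<i> * of_real (y \<bullet> J h))) (at x)"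
    by (rule bounded_linear_imp_has_derivative)
  then have "((\<lambda>x. exp (- \<i> * of_real (y \<bullet> J x))) has_derivative
      (\<lambda>h. - \<i> * of_real (y \<bullet> J h) * exp (- \<i> * of_real (y \<bullet> J x)))) (at x)"
    by (rule has_derivative_compose[OF _ DERIV_exp[unfolded has_field_derivative_def], THEN has_derivative_eq_rhs])
       (simp add: mult.commute)
  then show ?thesis by (simp add: wave_def[abs_def])
qed

lemma wave_measurable: "bounded_linear J \<Longrightarrow> wave J y \<in> borel_measurable borel"
  by (rule borel_measurable_continuous_onI, rule continuous_at_imp_continuous_on, rule ballI,
      rule has_derivative_continuous, erule wave_has_derivative)

lemma mult_wave_has_derivative:
  assumes "bounded_linear J" "f \<in> schwartz"
  shows "((\<lambda>x. f x * wave J y x) has_derivative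
    (\<lambda>h. f x * (- \<i> * of_real (y \<bullet> J h) * wave J y x) + frechet_derivative f (at x) h * wave J y x)) (at x)"
  by (rule has_derivative_mult[OF schwartz_has_frechet[OF assms(2)] wave_has_derivative[OF assms(1)]])

lemma schwartz_mult_wave:
  assumes J: "bounded_linear J" and f: "f \<in> schwartz"
  shows "(\<lambda>x. f x * wave J y x) \<in> schwartz"
proof -
  define A where "A = {\<lambda>x. f x * wave J y x | f. f \<in> schwartz}"
  show ?thesis
  proof (rule schwartz_coinduct[of _ A])
    show "(\<lambda>x. f x * wave J y x) \<in> A" unfolding A_def by (rule CollectI, rule exI[of _ f]) (simp add: f)
  next
    fix u x assume "u \<in> A"
    then obtain f where u: "u = (\<lambda>x. f x * wave J y x)" and f: "f \<in> schwartz"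
      unfolding A_def by (elim CollectE exE conjE)
    show "u differentiable at x" unfolding u by (rule differentiableI[OF mult_wave_has_derivative[OF J f]])
  next
    fix u c assume "u \<in> A" and c: "c \<in> (Basis :: 'a set)"
    then obtain f where u: "u = (\<lambda>x. f x * wave J y x)" and f: "f \<in> schwartz"
      unfolding A_def by (elim CollectE exE conjE)
    have "pd c u x = (1 * pd c f x + (- \<i> * of_real (y \<bullet> J c)) * f x) * wave J y x" for x
      unfolding u pd_eqI[OF mult_wave_has_derivative[OF J f]] by (simp add: algebra_simps)
    moreover have "(\<lambda>x. 1 * pd c f x + (- \<i> * of_real (y \<bullet> J c)) * f x) \<in> schwartz"
      by (rule schwartz_lincomb[OF schwartz_pd[OF f c] f])
    ultimately show "pd c u \<in> A" unfolding A_def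
      by (intro CollectI exI[of _ "\<lambda>x. 1 * pd c f x + (- \<i> * of_real (y \<bullet> J c)) * f x"] conjI ext)
  next
    fix u k assume "u \<in> A"
    then obtain f where u: "u = (\<lambda>x. f x * wave J y x)" and f: "f \<in> schwartz"
      unfolding A_def by (elim CollectE exE conjE)
    show "bounded (range (\<lambda>x. norm x ^ k * cmod (u x)))"
      using schwartz_bounded[OF f, of "[]" k] by (simp add: u norm_mult norm_wave)
  qed
qed

lemma fourier_pd:
  assumes J: "bounded_linear J" and f: "f \<in> schwartz" and c: "c \<in> Basis"
  shows "fourier J (pd c f) y = \<i> * of_real (y \<bullet> J c) * fourier J f y"
proof -
  let ?w = "wave J y"
  have "0 = (LINT x|lborel. pd c (\<lambda>x. f x * ?w x) x)"
    by (rule integral_pd_zero[OF schwartz_mult_wave[OF J f] c, symmetric])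
  also have "\<dots> = (LINT x|lborel. (- \<i> * of_real (y \<bullet> J c)) * (f x * ?w x) + pd c f x * ?w x)"
    unfolding pd_eqI[OF mult_wave_has_derivative[OF J f]] by (simp add: mult_ac)
  also have "\<dots> = (- \<i> * of_real (y \<bullet> J c)) * fourier J f y + fourier J (pd c f) y"
    using schwartz_integrable[OF schwartz_mult_wave[OF J f, of y]]
      schwartz_integrable[OF schwartz_mult_wave[OF J schwartz_pd[OF f c], of y]]
    unfolding fourier_def by (subst Bochner_Integration.integral_add) auto
  finally show ?thesis by (simp add: eq_neg_iff_add_eq_0 add.commute)
qed

text \<open>The function \<open>- \<i> (b \<bullet> J x) f(x)\<close>, expanded in the coordinates of \<open>x\<close> so that it is a linear combination of
  functions known to be Schwartz.\<close>

definition fourier_symbol :: "('a::euclidean_space \<Rightarrow> 'a) \<Rightarrow> 'a \<Rightarrow> ('a \<Rightarrow> complex) \<Rightarrow> 'a \<Rightarrow> complex" where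
  "fourier_symbol J b f = (\<lambda>x. \<Sum>c\<in>Basis. (- \<i> * of_real (b \<bullet> J c)) * coord c f x)"

lemma fourier_symbol_schwartz: "f \<in> schwartz \<Longrightarrow> fourier_symbol J b f \<in> schwartz"
  unfolding fourier_symbol_def by (rule schwartz_sum) (simp_all add: coord_schwartz)

lemma fourier_symbol_eq:
  assumes "bounded_linear J"
  shows "fourier_symbol J b f x = - \<i> * of_real (b \<bullet> J x) * f x"
proof -
  have lin: "linear J" using assms by (rule bounded_linear.linear)
  have "J x = J (\<Sum>c\<in>Basis. (x \<bullet> c) *\<^sub>R c)" by (simp add: euclidean_representation)
  also have "\<dots> = (\<Sum>c\<in>Basis. (x \<bullet> c) *\<^sub>R J c)" by (simp add: linear_sum[OF lin] linear_cmul[OF lin])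
  finally have "b \<bullet> J x = (\<Sum>c\<in>Basis. (x \<bullet> c) * (b \<bullet> J c))" by (simp add: inner_sum_right)
  then show ?thesis
    by (simp add: fourier_symbol_def coord_def sum_distrib_left sum_distrib_right sum_negf mult_ac)
qed

lemma fourier_has_derivative:
  fixes f :: "'a::euclidean_space \<Rightarrow> complex"
  assumes J: "bounded_linear J" and f: "f \<in> schwartz"
  shows "(fourier J f has_derivative (\<lambda>v. \<Sum>b\<in>Basis. of_real (v \<bullet> b) * fourier J (fourier_symbol J b f) y)) (at y)"
proof -
  obtain K where K: "\<And>x. norm (J x) \<le> norm x * K" "K \<ge> 0" using bounded_linear.nonneg_bounded[OF J] by blast
  define sq where "sq = (\<lambda>x. \<Sum>c\<in>Basis. 1 * coord c (coord c f) x)"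
  have sq: "sq \<in> schwartz" unfolding sq_def by (rule schwartz_sum) (simp_all add: coord_schwartz f)
  have sqn: "cmod (sq x) = norm x ^ 2 * cmod (f x)" for x
  proof -
    have "sq x = of_real (\<Sum>c\<in>Basis. (x \<bullet> c) * (x \<bullet> c)) * f x"
      by (simp add: sq_def coord_def sum_distrib_right sum_distrib_left mult_ac)
    then show ?thesis by (simp add: euclidean_inner[symmetric] power2_norm_eq_inner norm_mult)
  qed
  define R where "R = K\<^sup>2 * (LINT x|lborel. cmod (sq x))"
  have int: "integrable lborel (\<lambda>x. g x * wave J z x)" if "g \<in> schwartz" for g z
    by (rule schwartz_integrable[OF schwartz_mult_wave[OF J that]])
  show ?thesis
  proof (rule has_derivative_quadratic_bound[where K=R])
    show "bounded_linear (\<lambda>v. \<Sum>b\<in>Basis. of_real (v \<bullet> b) * fourier J (fourier_symbol J b f) y)"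
      by (intro bounded_linear_sum bounded_linear_mult_const bounded_linear_of_real[THEN bounded_linear_compose]
        bounded_linear_inner_left)
    fix v
    let ?r = "\<lambda>x. f x * wave J y x * (exp (- \<i> * of_real (v \<bullet> J x)) - 1 + \<i> * of_real (v \<bullet> J x))"
    have sum_int: "(\<Sum>b\<in>Basis. of_real (v \<bullet> b) * fourier J (fourier_symbol J b f) y)
        = (LINT x|lborel. (\<Sum>b\<in>Basis. of_real (v \<bullet> b) * (fourier_symbol J b f x * wave J y x)))"
      unfolding fourier_def
      by (subst Bochner_Integration.integral_sum) (auto intro!: integrable_mult_right int fourier_symbol_schwartz f)
    have intS: "integrable lborel (\<lambda>x. \<Sum>b\<in>Basis. of_real (v \<bullet> b) * (fourier_symbol J b f x * wave J y x))"
      by (intro Bochner_Integration.integrable_sum integrable_mult_right int fourier_symbol_schwartz f)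
    have Seq: "(\<Sum>b\<in>Basis. of_real (v \<bullet> b) * (fourier_symbol J b f x * wave J y x))
        = - \<i> * of_real (v \<bullet> J x) * f x * wave J y x" for x
    proof -
      have "(\<Sum>b\<in>Basis. of_real (v \<bullet> b) * (fourier_symbol J b f x * wave J y x))
        = (\<Sum>b\<in>Basis. of_real ((v \<bullet> b) * (J x \<bullet> b))) * (- \<i> * f x * wave J y x)"
        unfolding fourier_symbol_eq[OF J] sum_distrib_right
        by (intro sum.cong) (simp_all add: inner_commute mult_ac)
      also have "(\<Sum>b\<in>Basis. of_real ((v \<bullet> b) * (J x \<bullet> b))) = complex_of_real (v \<bullet> J x)"
        by (simp only: euclidean_inner[of v "J x"] of_real_sum)
      finally show ?thesis by (simp add: mult_ac)
    qed
    have add: "wave J (y + v) x = wave J y x * exp (- \<i> * of_real (v \<bullet> J x))" for x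
      by (simp add: wave_def inner_add_left distrib_left exp_add exp_diff exp_minus field_simps)
    have eq: "fourier J f (y + v) - fourier J f y - (\<Sum>b\<in>Basis. of_real (v \<bullet> b) * fourier J (fourier_symbol J b f) y)
        = (LINT x|lborel. ?r x)"
    proof -
      have "(LINT x|lborel. ?r x) = (LINT x|lborel. f x * wave J (y + v) x - f x * wave J y x
          - (\<Sum>b\<in>Basis. of_real (v \<bullet> b) * (fourier_symbol J b f x * wave J y x)))"
        unfolding Seq add by (intro Bochner_Integration.integral_cong) (simp_all add: algebra_simps)
      also have "\<dots> = (LINT x|lborel. f x * wave J (y + v) x) - (LINT x|lborel. f x * wave J y x)
          - (LINT x|lborel. (\<Sum>b\<in>Basis. of_real (v \<bullet> b) * (fourier_symbol J b f x * wave J y x)))"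
        using int[OF f] intS by simp
      finally show ?thesis unfolding sum_int by (simp add: fourier_def)
    qed
    have bound: "cmod (?r x) \<le> (K\<^sup>2 * norm v ^ 2) * cmod (sq x)" for x
    proof -
      have "\<bar>v \<bullet> J x\<bar> \<le> norm v * (norm x * K)"
        by (rule order_trans[OF Cauchy_Schwarz_ineq2]) (intro mult_left_mono K norm_ge_zero)
      then have "(v \<bullet> J x)\<^sup>2 \<le> (norm v * (norm x * K))\<^sup>2"
        by (metis abs_ge_zero power2_abs power_mono)
      then have "cmod (exp (- \<i> * of_real (v \<bullet> J x)) - 1 + \<i> * of_real (v \<bullet> J x)) \<le> (norm v * (norm x * K))\<^sup>2"
        by (rule order_trans[OF wave_remainder])
      then have "cmod (?r x) \<le> cmod (f x) * (norm v * (norm x * K))\<^sup>2"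
        unfolding norm_mult norm_wave by (simp add: mult_left_mono)
      then show ?thesis unfolding sqn by (simp add: power_mult_distrib mult_ac)
    qed
    have ir: "integrable lborel ?r"
      using Bochner_Integration.integrable_diff[OF Bochner_Integration.integrable_diff[OF int[OF f, of "y + v"] int[OF f, of y]] intS]
      unfolding Seq add by (simp add: algebra_simps)
    have "cmod (LINT x|lborel. ?r x) \<le> (LINT x|lborel. (K\<^sup>2 * norm v ^ 2) * cmod (sq x))"
      by (rule Bochner_Integration.integral_norm_bound_integral[OF ir])
         (use schwartz_integrable[OF sq] bound in auto)
    then show "cmod (fourier J f (y + v) - fourier J f y
        - (\<Sum>b\<in>Basis. of_real (v \<bullet> b) * fourier J (fourier_symbol J b f) y)) \<le> R * norm v ^ 2"
      unfolding eq by (simp add: R_def mult_ac)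
  qed
qed

lemma sfunctional_fourier: "bounded_linear J \<Longrightarrow> sfunctional (\<lambda>f. fourier J f y)"
  unfolding fourier_def
  by (rule sfunctional_integral[where B=1, OF wave_measurable]) (simp_all add: norm_wave)

text \<open>Integration by parts trades a power of \<open>y\<close> for a derivative of \<open>f\<close>. The assumption on \<open>J\<close> says
  that the components \<open>y \<bullet> J c\<close> obtained in this way control the norm of \<open>y\<close>.\<close>

lemma fourier_bounded:
  fixes J :: "'a::euclidean_space \<Rightarrow> 'a"
  assumes J: "bounded_linear J" and lower: "\<And>y. norm y \<le> (\<Sum>c\<in>Basis. \<bar>y \<bullet> J c\<bar>)"
    and f: "f \<in> schwartz"
  shows "\<exists>B. \<forall>y. norm y ^ k * cmod (fourier J f y) \<le> B"
  using f
proof (induction k arbitrary: f)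
  case 0
  have "cmod (fourier J f y) \<le> (LINT x|lborel. cmod (f x))" for y
    unfolding fourier_def
    by (rule Bochner_Integration.integral_norm_bound_integral)
       (use schwartz_integrable[OF schwartz_mult_wave[OF J 0]] schwartz_integrable[OF 0] in \<open>auto simp: norm_mult norm_wave\<close>)
  then show ?case by auto
next
  case (Suc k)
  have "\<forall>c\<in>Basis. \<exists>B. \<forall>y. norm y ^ k * cmod (fourier J (pd c f) y) \<le> B"
    by (intro ballI Suc.IH schwartz_pd Suc.prems)
  then obtain B where B: "\<And>c y. c \<in> Basis \<Longrightarrow> norm y ^ k * cmod (fourier J (pd c f) y) \<le> B c" by metis
  have "norm y ^ Suc k * cmod (fourier J f y) \<le> (\<Sum>c\<in>Basis. B c)" for y
  proof -
    have "norm y ^ Suc k * cmod (fourier J f y) = norm y * (norm y ^ k * cmod (fourier J f y))" by simp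
    also have "\<dots> \<le> (\<Sum>c\<in>Basis. \<bar>y \<bullet> J c\<bar>) * (norm y ^ k * cmod (fourier J f y))"
      by (intro mult_right_mono lower) simp
    also have "\<dots> = (\<Sum>c\<in>Basis. norm y ^ k * cmod (fourier J (pd c f) y))"
      unfolding sum_distrib_right
      by (intro sum.cong) (simp_all add: fourier_pd[OF J Suc.prems] norm_mult)
    also have "\<dots> \<le> (\<Sum>c\<in>Basis. B c)" by (intro sum_mono B)
    finally show ?thesis .
  qed
  then show ?case by auto
qed

lemma fourier_schwartz:
  fixes J :: "'a::euclidean_space \<Rightarrow> 'a"
  assumes J: "bounded_linear J" and lower: "\<And>y. norm y \<le> (\<Sum>c\<in>Basis. \<bar>y \<bullet> J c\<bar>)"
    and f: "f \<in> schwartz"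
  shows "fourier J f \<in> schwartz"
proof (rule schwartz_coinduct[of _ "{fourier J f | f. f \<in> schwartz}"])
  show "fourier J f \<in> {fourier J f | f. f \<in> schwartz}" by (rule CollectI, rule exI[of _ f]) (simp add: f)
next
  fix u x assume "u \<in> {fourier J f | f. f \<in> schwartz}"
  then obtain f where u: "u = fourier J f" and f: "f \<in> schwartz" by (elim CollectE exE conjE)
  show "u differentiable at x" unfolding u by (rule differentiableI[OF fourier_has_derivative[OF J f]])
next
  fix u c assume "u \<in> {fourier J f | f. f \<in> schwartz}" and c: "c \<in> (Basis :: 'a set)"
  then obtain f where u: "u = fourier J f" and f: "f \<in> schwartz" by (elim CollectE exE conjE)
  have "pd c u y = fourier J (fourier_symbol J c f) y" for y
  proof -
    have "pd c u y = (\<Sum>b\<in>Basis. if b = c then fourier J (fourier_symbol J c f) y else 0)"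
      unfolding u pd_eqI[OF fourier_has_derivative[OF J f]]
      using c by (intro sum.cong) (auto simp: inner_Basis)
    then show ?thesis using c by simp
  qed
  then show "pd c u \<in> {fourier J f | f. f \<in> schwartz}"
    by (intro CollectI exI[of _ "fourier_symbol J c f"] conjI ext fourier_symbol_schwartz f)
next
  fix u k assume "u \<in> {fourier J f | f. f \<in> schwartz}"
  then obtain f where u: "u = fourier J f" and f: "f \<in> schwartz" by (elim CollectE exE conjE)
  obtain B where "\<forall>y. norm y ^ k * cmod (fourier J f y) \<le> B" using fourier_bounded[OF J lower f, of k] by (elim exE)
  then show "bounded (range (\<lambda>x. norm x ^ k * cmod (u x)))" unfolding bounded_iff u by auto
qed

lemma soperator_fourier:
  fixes J :: "'a::euclidean_space \<Rightarrow> 'a"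
  assumes "bounded_linear J" "\<And>y. norm y \<le> (\<Sum>c\<in>Basis. \<bar>y \<bullet> J c\<bar>)"
  shows "soperator (fourier J)"
proof (rule soperator_closed_graph)
  show "fourier J f \<in> schwartz" if "f \<in> schwartz" for f by (rule fourier_schwartz[OF assms that])
  show "sfunctional (\<lambda>f. fourier J f y)" for y by (rule sfunctional_fourier[OF assms(1)])
qed

section \<open>Fubini and changes of variables for Schwartz functions\<close>

lemma schwartz_integral_iterated:
  fixes H :: "'a::euclidean_space \<times> 'b::euclidean_space \<Rightarrow> complex"
  assumes "H \<in> schwartz"
  shows "(LINT z|lborel. H z) = (LINT x|lborel. LINT y|lborel. H (x, y))"
proof -
  have "integrable (lborel \<Otimes>\<^sub>M lborel) H" using schwartz_integrable[OF assms] by (simp add: lborel_prod)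
  from lborel_pair.integral_fst'[OF this] show ?thesis by (simp add: lborel_prod)
qed

lemma integral_tensor:
  fixes f :: "'a::euclidean_space \<Rightarrow> complex" and g :: "'b::euclidean_space \<Rightarrow> complex"
  assumes "f \<in> schwartz" "g \<in> schwartz"
  shows "(LINT z|lborel. tensor f g z) = (LINT x|lborel. f x) * (LINT y|lborel. g y)"
  unfolding schwartz_integral_iterated[OF tensor_schwartz[OF assms]] by (simp add: tensor_def)

lemma fourier_tensor:
  fixes f :: "'a::euclidean_space \<Rightarrow> complex" and g :: "'b::euclidean_space \<Rightarrow> complex"
  assumes "bounded_linear J1" "bounded_linear J2" "f \<in> schwartz" "g \<in> schwartz"
  shows "fourier (\<lambda>(x, y). (J1 x, J2 y)) (tensor f g) = tensor (fourier J1 f) (fourier J2 g)"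
proof (rule ext)
  fix z :: "'a \<times> 'b"
  obtain x y where z: "z = (x, y)" by (cases z)
  have eq: "(\<lambda>w. tensor f g w * wave (\<lambda>(x, y). (J1 x, J2 y)) z w)
      = tensor (\<lambda>u. f u * wave J1 x u) (\<lambda>v. g v * wave J2 y v)"
    by (auto simp: tensor_def wave_def z distrib_left exp_diff exp_minus field_simps exp_add)
  show "fourier (\<lambda>(x, y). (J1 x, J2 y)) (tensor f g) z = tensor (fourier J1 f) (fourier J2 g) z"
    unfolding fourier_def eq integral_tensor[OF schwartz_mult_wave[OF assms(1,3)] schwartz_mult_wave[OF assms(2,4)]]
    by (simp add: tensor_def fourier_def z)
qed

text \<open>The double integral of \<open>f(x) g(y)\<close> times the wave can be taken in either order.\<close>

lemma fourier_transpose: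
  fixes f g :: "'a::euclidean_space \<Rightarrow> complex"
  assumes J: "bounded_linear J" and J': "bounded_linear J'" and adj: "\<And>x y. y \<bullet> J x = x \<bullet> J' y"
    and f: "f \<in> schwartz" and g: "g \<in> schwartz"
  shows "pairing lborel (fourier J f) g = pairing lborel f (fourier J' g)"
proof -
  have w: "wave J' x y = wave J y x" for x y by (simp add: wave_def adj)
  let ?H = "\<lambda>(x, y). f x * g y * wave J y x"
  have cont: "continuous_on UNIV (\<lambda>z. wave J (snd z) (fst z))"
    unfolding wave_def
    by (intro continuous_intros bounded_linear.continuous_on[OF J])
  have int: "integrable (lborel \<Otimes>\<^sub>M lborel) ?H"
  proof (rule Bochner_Integration.integrable_bound)
    show "integrable (lborel \<Otimes>\<^sub>M lborel) (tensor f g)"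
      using schwartz_integrable[OF tensor_schwartz[OF f g]] by (simp add: lborel_prod)
    have "?H = (\<lambda>z. tensor f g z * wave J (snd z) (fst z))" by (auto simp: tensor_def)
    then show "?H \<in> borel_measurable (lborel \<Otimes>\<^sub>M lborel)"
      using borel_measurable_continuous_onI[OF cont] schwartz_measurable[OF tensor_schwartz[OF f g]]
      by (simp add: lborel_prod)
    show "AE z in lborel \<Otimes>\<^sub>M lborel. norm (?H z) \<le> norm (tensor f g z)"
      by (intro AE_I2) (auto simp: tensor_def norm_mult norm_wave)
  qed
  have 1: "(LINT x|lborel. f x * g y * wave J y x) = fourier J f y * g y" for y
    unfolding fourier_def integral_mult_left_zero[symmetric]
    by (rule Bochner_Integration.integral_cong[OF refl]) (simp add: mult_ac)
  have 2: "(LINT y|lborel. f x * g y * wave J y x) = f x * fourier J' g x" for x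
    unfolding fourier_def w integral_mult_right_zero[symmetric]
    by (rule Bochner_Integration.integral_cong[OF refl]) (simp add: mult_ac)
  have "(LINT y|lborel. LINT x|lborel. f x * g y * wave J y x)
      = (LINT x|lborel. LINT y|lborel. f x * g y * wave J y x)"
    by (rule lborel_pair.Fubini_integral[OF int])
  then show ?thesis unfolding 1 2 by (simp add: pairing_def)
qed

text \<open>Integrating \<open>y\<close> first, the map is a reflected translation in \<open>y\<close> for fixed \<open>x\<close>, followed by the
  reflection of \<open>x\<close>; both preserve Lebesgue measure.\<close>

lemma integral_shear:
  fixes H :: "'a::euclidean_space \<times> 'a \<Rightarrow> complex"
  assumes H: "H \<in> schwartz" and HC: "(\<lambda>(x, y). H (- x, x - y)) \<in> schwartz"
  shows "(LINT z|lborel. (\<lambda>(x, y). H (- x, x - y)) z) = (LINT z|lborel. H z)"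
proof -
  have m: "H \<in> borel_measurable (borel \<Otimes>\<^sub>M borel)" using schwartz_measurable[OF H] by (simp add: borel_prod)
  have my: "(\<lambda>y. H (x, y)) \<in> borel_measurable borel" for x using m by measurable
  have mx: "(\<lambda>x. LINT y|lborel. H (x, y)) \<in> borel_measurable borel"
  proof -
    have "H \<in> borel_measurable (borel \<Otimes>\<^sub>M lborel)" using m by (simp cong: measurable_cong_sets)
    then show ?thesis using lborel.borel_measurable_lebesgue_integral[of "\<lambda>x y. H (x, y)" borel] by simp
  qed
  have "(LINT z|lborel. (\<lambda>(x, y). H (- x, x - y)) z) = (LINT x|lborel. LINT y|lborel. H (- x, x - y))"
    using schwartz_integral_iterated[OF HC] by simp
  also have "\<dots> = (LINT x|lborel. LINT y|lborel. H (- x, y))"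
  proof (rule Bochner_Integration.integral_cong[OF refl])
    fix x :: 'a
    show "(LINT y|lborel. H (- x, x - y)) = (LINT y|lborel. H (- x, y))"
      using lborel_integral_affine[OF my[of "- x"], of "-1" x] by simp
  qed
  also have "\<dots> = (LINT x|lborel. LINT y|lborel. H (x, y))"
    using lborel_integral_affine[OF mx, of "-1" 0] by simp
  also have "\<dots> = (LINT z|lborel. H z)" by (rule schwartz_integral_iterated[OF H, symmetric])
  finally show ?thesis .
qed

section \<open>Hermite functions on the line\<close>

definition ladder :: "nat \<Rightarrow> real" where
  "ladder n = sqrt (real n / 2)"

text \<open>The Hermite functions scaled such that all of them have the same \<open>L\<^sup>2\<close> norm as the Gaussian:
  multiplication by \<open>x\<close> and differentiation act as sum and difference of the two ladder operators
  with coefficients \<open>ladder\<close>. At \<open>n = 0\<close> the truncated index \<open>n - 1\<close> is harmless because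
  \<open>ladder 0 = 0\<close>.\<close>

fun hermite1 :: "nat \<Rightarrow> real \<Rightarrow> real" where
  "hermite1 0 x = exp (- x\<^sup>2 / 2)"
| "hermite1 (Suc n) x = (x * hermite1 n x - ladder n * hermite1 (n - 1) x) / ladder (Suc n)"

definition hermite1_deriv :: "nat \<Rightarrow> real \<Rightarrow> real" where
  "hermite1_deriv n x = ladder n * hermite1 (n - 1) x - ladder (Suc n) * hermite1 (Suc n) x"

declare hermite1.simps(2) [simp del]

lemma ladder_0 [simp]: "ladder 0 = 0" by (simp add: ladder_def)
lemma ladder_Suc_pos [simp]: "ladder (Suc n) > 0" by (simp add: ladder_def)
lemma ladder_nonneg [simp]: "ladder n \<ge> 0" by (simp add: ladder_def)
lemma ladder_Suc_neq [simp]: "ladder (Suc n) \<noteq> 0" using ladder_Suc_pos[of n] by linarith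
lemma ladder_sq: "ladder n * ladder n = real n / 2" by (simp add: ladder_def)
lemma ladder_mono: "m \<le> n \<Longrightarrow> ladder m \<le> ladder n" by (simp add: ladder_def)

lemma hermite1_coord: "x * hermite1 n x = ladder (Suc n) * hermite1 (Suc n) x + ladder n * hermite1 (n - 1) x"
  by (simp add: hermite1.simps(2))

lemma hermite1_has_derivative: "(hermite1 n has_real_derivative hermite1_deriv n x) (at x)"
proof (induction n rule: less_induct)
  case (less n)
  show ?case
  proof (cases n)
    case 0
    have "((\<lambda>x. exp (- x\<^sup>2 / 2)) has_real_derivative - x * exp (- x\<^sup>2 / 2)) (at x)"
      by (auto intro!: derivative_eq_intros)
    moreover have "hermite1_deriv 0 x = - x * exp (- x\<^sup>2 / 2)"
      using hermite1_coord[of x 0] by (simp add: hermite1_deriv_def)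
    moreover have "hermite1 0 = (\<lambda>x. exp (- x\<^sup>2 / 2))" by (rule ext) simp
    ultimately show ?thesis unfolding 0 by simp
  next
    case (Suc m)
    have d1: "(hermite1 m has_real_derivative hermite1_deriv m x) (at x)" using less Suc by simp
    have d2: "(hermite1 (m - 1) has_real_derivative hermite1_deriv (m - 1) x) (at x)"
      by (rule less.IH) (use Suc in simp)
    have eq: "hermite1 n = (\<lambda>x. (x * hermite1 m x - ladder m * hermite1 (m - 1) x) / ladder n)"
      by (simp add: Suc hermite1.simps(2) fun_eq_iff)
    let ?D = "(hermite1 m x + x * hermite1_deriv m x - ladder m * hermite1_deriv (m - 1) x) / ladder n"
    have der: "(hermite1 n has_real_derivative ?D) (at x)"
      unfolding eq using Suc by (auto intro!: derivative_eq_intros d1 d2[unfolded One_nat_def])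
    have mm: "ladder m * hermite1_deriv (m - 1) x = ladder m * (x * hermite1 (m - 1) x) - 2 * (ladder m * ladder m) * hermite1 m x"
    proof (cases m)
      case (Suc k)
      have eq: "hermite1_deriv k x = x * hermite1 k x - 2 * (ladder (Suc k) * hermite1 (Suc k) x)"
        using hermite1_coord[of x k] by (simp add: hermite1_deriv_def)
      show ?thesis unfolding Suc diff_Suc_1 eq by (simp add: algebra_simps)
    qed simp
    have h: "hermite1_deriv m x = 2 * (ladder m * hermite1 (m - 1) x) - x * hermite1 m x"
      using hermite1_coord[of x m] by (simp add: hermite1_deriv_def)
    have A: "ladder n * hermite1 n x = x * hermite1 m x - ladder m * hermite1 (m - 1) x"
      using hermite1_coord[of x m] Suc by simp
    have eqn: "hermite1_deriv n x = 2 * (ladder n * hermite1 m x) - x * hermite1 n x"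
      using hermite1_coord[of x n] Suc by (simp add: hermite1_deriv_def)
    have "ladder n * hermite1_deriv n x = 2 * (ladder n * ladder n) * hermite1 m x - x * (ladder n * hermite1 n x)"
      unfolding eqn by (simp add: algebra_simps)
    also have "\<dots> = hermite1 m x + x * hermite1_deriv m x - ladder m * hermite1_deriv (m - 1) x"
      unfolding A mm h ladder_sq using Suc by (simp add: algebra_simps add_divide_distrib)
    finally have "?D = hermite1_deriv n x" using Suc by (simp add: field_simps)
    then show ?thesis using der by simp
  qed
qed

text \<open>The oscillator equation \<open>h'' = (x\<^sup>2 - (2 n + 1)) h\<close>, with the second derivative still in ladder
  form.\<close>

lemma hermite1_second: "ladder n * hermite1_deriv (n - 1) x - ladder (Suc n) * hermite1_deriv (Suc n) x
    = (x\<^sup>2 - (2 * real n + 1)) * hermite1 n x"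
proof -
  have 1: "ladder n * hermite1_deriv (n - 1) x = ladder n * (x * hermite1 (n - 1) x) - 2 * (ladder n * ladder n) * hermite1 n x"
  proof (cases n)
    case (Suc k)
    have eq: "hermite1_deriv k x = x * hermite1 k x - 2 * (ladder (Suc k) * hermite1 (Suc k) x)"
      using hermite1_coord[of x k] by (simp add: hermite1_deriv_def)
    show ?thesis unfolding Suc diff_Suc_1 eq by (simp add: algebra_simps)
  qed simp
  have "hermite1_deriv (Suc n) x = 2 * (ladder (Suc n) * hermite1 n x) - x * hermite1 (Suc n) x"
    using hermite1_coord[of x "Suc n"] by (simp add: hermite1_deriv_def)
  then have "ladder (Suc n) * hermite1_deriv (Suc n) x
      = ladder (Suc n) * (2 * (ladder (Suc n) * hermite1 n x) - x * hermite1 (Suc n) x)" by simp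
  then have 2: "ladder (Suc n) * hermite1_deriv (Suc n) x
      = 2 * (ladder (Suc n) * ladder (Suc n)) * hermite1 n x - x * (ladder (Suc n) * hermite1 (Suc n) x)"
    by (simp add: algebra_simps)
  have "ladder n * (x * hermite1 (n - 1) x) + x * (ladder (Suc n) * hermite1 (Suc n) x) = x * (x * hermite1 n x)"
    unfolding hermite1_coord[of x n] by (simp add: algebra_simps)
  then show ?thesis unfolding 1 2 ladder_sq by (simp add: algebra_simps power2_eq_square)
qed

lemma hermite1_deriv_has_derivative:
  "(hermite1_deriv n has_real_derivative (x\<^sup>2 - (2 * real n + 1)) * hermite1 n x) (at x)"
proof -
  have "((\<lambda>x. ladder n * hermite1 (n - 1) x - ladder (Suc n) * hermite1 (Suc n) x) has_real_derivative
     ladder n * hermite1_deriv (n - 1) x - ladder (Suc n) * hermite1_deriv (Suc n) x) (at x)"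
    by (intro DERIV_diff DERIV_cmult hermite1_has_derivative)
  then show ?thesis unfolding hermite1_second by (simp add: hermite1_deriv_def[abs_def])
qed

lemma hermite1_minus: "\<bar>hermite1 n (- x)\<bar> = \<bar>hermite1 n x\<bar>"
proof -
  have "hermite1 n (- x) = (-1) ^ n * hermite1 n x"
  proof (induction n rule: less_induct)
    case (less n)
    show ?case
    proof (cases n)
      case (Suc m)
      have "ladder m * hermite1 (m - 1) (- x) = ladder m * ((-1) ^ n * hermite1 (m - 1) x)"
        using less[of "m - 1"] Suc by (cases m) auto
      moreover have "hermite1 m (- x) = (-1) ^ m * hermite1 m x" using less Suc by simp
      ultimately show ?thesis by (simp add: Suc hermite1.simps(2) algebra_simps)
    qed simp
  qed
  then show ?thesis by (simp add: abs_mult)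
qed

lemma hermite1_decay: "((\<lambda>x. x ^ k * hermite1 n x) \<longlongrightarrow> 0) at_top"
proof (induction n arbitrary: k rule: less_induct)
  case (less n)
  show ?case
  proof (cases n)
    case 0
    have ev: "\<forall>\<^sub>F x in at_top. norm (x ^ k * exp (- x\<^sup>2 / 2)) \<le> x ^ k / exp (x :: real)"
    proof (rule eventually_mono[OF eventually_ge_at_top[of "2::real"]])
      fix x :: real assume x: "2 \<le> x"
      have "x * 2 \<le> x * x" using x by (intro mult_left_mono) auto
      then have "exp (- x\<^sup>2 / 2) \<le> exp (- x)" by (simp add: power2_eq_square)
      then have "x ^ k * exp (- x\<^sup>2 / 2) \<le> x ^ k * exp (- x)" using x by (intro mult_left_mono) auto
      moreover have "0 \<le> x ^ k * exp (- x\<^sup>2 / 2)" using x by (intro mult_nonneg_nonneg) auto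
      moreover have "x ^ k * exp (- x) = x ^ k / exp x" by (simp add: exp_minus divide_inverse)
      ultimately show "norm (x ^ k * exp (- x\<^sup>2 / 2)) \<le> x ^ k / exp x"
        unfolding real_norm_def by linarith
    qed
    have "((\<lambda>x::real. x ^ k * exp (- x\<^sup>2 / 2)) \<longlongrightarrow> 0) at_top"
      by (rule Lim_null_comparison[OF ev tendsto_power_div_exp_0])
    then show ?thesis by (simp add: 0)
  next
    case (Suc m)
    have a: "((\<lambda>x. x ^ Suc k * hermite1 m x) \<longlongrightarrow> 0) at_top"
      by (rule less.IH) (use Suc in simp)
    have b: "((\<lambda>x. x ^ k * hermite1 (m - 1) x) \<longlongrightarrow> 0) at_top"
      by (rule less.IH) (use Suc in simp)
    have "((\<lambda>x. (x ^ Suc k * hermite1 m x - ladder m * (x ^ k * hermite1 (m - 1) x)) / ladder n) \<longlongrightarrow> (0 - ladder m * 0) / ladder n) at_top"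
      by (rule tendsto_divide[OF tendsto_diff[OF a tendsto_mult[OF tendsto_const b]] tendsto_const])
         (simp add: Suc)
    then show ?thesis by (simp add: Suc hermite1.simps(2) algebra_simps)
  qed
qed

lemma hermite1_at_0: "\<bar>hermite1 n 0\<bar> \<le> 1"
proof (induction n rule: less_induct)
  case (less n)
  show ?case
  proof (cases n)
    case (Suc m)
    have "\<bar>hermite1 n 0\<bar> = ladder m * \<bar>hermite1 (m - 1) 0\<bar> / ladder (Suc m)"
      by (simp add: Suc hermite1.simps(2) abs_mult)
    also have "\<dots> \<le> ladder m * 1 / ladder (Suc m)"
      using less[of "m - 1"] Suc by (intro divide_right_mono mult_left_mono) (auto intro: less_imp_le)
    also have "\<dots> \<le> 1" using ladder_mono[of m "Suc m"] by (simp add: divide_le_eq)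
    finally show ?thesis .
  qed simp
qed

text \<open>The bound is uniform in \<open>x\<close> and grows polynomially in \<open>n\<close>. Let \<open>r\<close> be the turning point,
  \<open>r\<^sup>2 = 2 n + 1\<close>. The energy \<open>E = h'\<^sup>2 + (r\<^sup>2 - x\<^sup>2) h\<^sup>2\<close> has derivative \<open>- 2 x h\<^sup>2\<close>, so
  it decreases for \<open>x \<ge> 0\<close>. It bounds \<open>h'\<close> up to the turning point, and \<open>h\<close> up to distance
  one from it. Beyond the turning point \<open>h h'\<close> increases to \<open>0\<close>, so \<open>h\<^sup>2\<close> decreases.\<close>

lemma hermite1_bound: "\<bar>hermite1 n x\<bar> \<le> 4 * (real n + 1)"
proof -
  let ?h = "hermite1 n" and ?d = "hermite1_deriv n"
  define c where "c = 2 * real n + 1"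
  define r where "r = sqrt c"
  have r: "r \<ge> 1" "r * r = c" by (simp_all add: r_def c_def)
  define E where "E x = (?d x)\<^sup>2 + (c - x\<^sup>2) * (?h x)\<^sup>2" for x
  have dE: "(E has_real_derivative - 2 * x * (?h x)\<^sup>2) (at x)" for x
    unfolding E_def
    by (auto intro!: derivative_eq_intros hermite1_has_derivative hermite1_deriv_has_derivative
        simp: c_def power2_eq_square algebra_simps)
  have Emono: "E x \<le> E 0" if "0 \<le> x" for x
  proof (rule DERIV_nonpos_imp_nonincreasing[OF that])
    fix y :: real assume "0 \<le> y"
    then show "\<exists>z. (E has_real_derivative z) (at y) \<and> z \<le> 0"
      using dE[of y] by (intro exI[of _ "- 2 * y * (?h y)\<^sup>2"]) auto
  qed
  have E0: "E 0 \<le> 4 * (real n + 1)"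
  proof -
    have "\<bar>?d 0\<bar> \<le> ladder n * \<bar>hermite1 (n - 1) 0\<bar> + ladder (Suc n) * \<bar>hermite1 (Suc n) 0\<bar>"
      unfolding hermite1_deriv_def
      by (rule order_trans[OF abs_triangle_ineq4]) (simp add: abs_mult)
    also have "\<dots> \<le> ladder (Suc n) * 1 + ladder (Suc n) * 1"
      by (intro add_mono mult_mono hermite1_at_0 ladder_mono) auto
    finally have "\<bar>?d 0\<bar>\<^sup>2 \<le> (2 * ladder (Suc n))\<^sup>2" by (intro power_mono) auto
    also have "\<dots> = 2 * (real n + 1)" using ladder_sq[of "Suc n"] by (simp add: power2_eq_square)
    finally have 1: "(?d 0)\<^sup>2 \<le> 2 * (real n + 1)" by simp
    have "(?h 0)\<^sup>2 \<le> 1" using hermite1_at_0[of n] by (simp add: abs_square_le_1)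
    then have "c * (?h 0)\<^sup>2 \<le> c * 1" by (intro mult_left_mono) (auto simp: c_def)
    moreover have "E 0 = (?d 0)\<^sup>2 + c * (?h 0)\<^sup>2" by (simp add: E_def)
    ultimately have "E 0 \<le> 2 * (real n + 1) + c" using 1 by (simp only: mult_1_right)
    then show ?thesis by (simp add: c_def)
  qed
  define s where "s = 2 * (real n + 1)"
  have s: "4 * (real n + 1) \<le> s\<^sup>2" "s \<ge> 0" by (auto simp: s_def power2_eq_square algebra_simps)
  have dbound: "\<bar>?d y\<bar> \<le> s" if "0 \<le> y" "y \<le> r" for y
  proof -
    have "y * y \<le> r * r" using that by (intro mult_mono) auto
    then have "0 \<le> (c - y\<^sup>2) * (?h y)\<^sup>2" using r by (intro mult_nonneg_nonneg) (auto simp: power2_eq_square)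
    then have "(?d y)\<^sup>2 \<le> s\<^sup>2" using Emono[OF that(1)] E0 s by (simp add: E_def)
    then show ?thesis using s(2) by (simp add: abs_le_square_iff[symmetric])
  qed
  have inner: "\<bar>?h y\<bar> \<le> s" if "0 \<le> y" "y \<le> r - 1" for y
  proof -
    have "y * y \<le> (r - 1) * (r - 1)" using that by (intro mult_mono) auto
    then have "1 \<le> c - y\<^sup>2" using r by (simp add: power2_eq_square algebra_simps)
    then have "1 * (?h y)\<^sup>2 \<le> (c - y\<^sup>2) * (?h y)\<^sup>2" by (intro mult_right_mono) auto
    moreover have "0 \<le> (?d y)\<^sup>2" by simp
    ultimately have "(?h y)\<^sup>2 \<le> s\<^sup>2" using Emono[OF that(1)] E0 s(1) unfolding E_def by linarith
    then show ?thesis using s(2) by (simp add: abs_le_square_iff[symmetric])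
  qed
  have middle: "\<bar>?h y\<bar> \<le> 2 * s" if "0 \<le> y" "y \<le> r" for y
  proof (cases "y \<le> r - 1")
    case True
    then show ?thesis using inner[of y] that s by simp
  next
    case False
    have "norm (?h y - ?h (r - 1)) \<le> s * norm (y - (r - 1))"
    proof (rule field_differentiable_bound[of "{r - 1..r}"])
      show "(?h has_field_derivative ?d z) (at z within {r - 1..r})" for z
        by (rule has_field_derivative_at_within[OF hermite1_has_derivative])
      show "norm (?d z) \<le> s" if "z \<in> {r - 1..r}" for z using dbound[of z] that r(1) by simp
    qed (use that False in auto)
    also have "\<dots> \<le> s * 1" using False that s(2) by (intro mult_left_mono) auto
    finally show ?thesis using inner[of "r - 1"] r(1) by simp
  qed
  have outer: "\<bar>?h y\<bar> \<le> 2 * s" if y: "r \<le> y" for y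
  proof -
    define q where "q x = ?h x * ?d x" for x
    have dq: "(q has_real_derivative (?d x)\<^sup>2 + (x\<^sup>2 - c) * (?h x)\<^sup>2) (at x)" for x
      unfolding q_def
      by (auto intro!: derivative_eq_intros hermite1_has_derivative hermite1_deriv_has_derivative
          simp: c_def power2_eq_square algebra_simps)
    have qmono: "q x \<le> q z" if "r \<le> x" "x \<le> z" for x z
    proof (rule DERIV_nonneg_imp_nondecreasing[OF that(2)])
      fix t assume "x \<le> t"
      then have "r * r \<le> t * t" using that r by (intro mult_mono) auto
      then have "0 \<le> (?d t)\<^sup>2 + (t\<^sup>2 - c) * (?h t)\<^sup>2"
        using r by (intro add_nonneg_nonneg mult_nonneg_nonneg) (auto simp: power2_eq_square)
      then show "\<exists>z. (q has_real_derivative z) (at t) \<and> 0 \<le> z" using dq[of t] by blast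
    qed
    have dec: "(hermite1 k \<longlongrightarrow> 0) at_top" for k using hermite1_decay[of 0 k] by simp
    have "((\<lambda>x. ?h x * (ladder n * hermite1 (n - 1) x - ladder (Suc n) * hermite1 (Suc n) x)) \<longlongrightarrow>
        0 * (ladder n * 0 - ladder (Suc n) * 0)) at_top"
      by (intro tendsto_intros dec)
    then have "(q \<longlongrightarrow> 0) at_top" by (simp add: q_def[abs_def] hermite1_deriv_def)
    then have qneg: "q x \<le> 0" if "r \<le> x" for x
      by (rule tendsto_lowerbound) (use qmono[OF that] in \<open>auto simp: eventually_at_top_linorder\<close>)
    have "(?h y)\<^sup>2 \<le> (?h r)\<^sup>2"
    proof (rule DERIV_nonpos_imp_nonincreasing[OF y])
      fix t assume "r \<le> t"
      have "((\<lambda>x. (?h x)\<^sup>2) has_real_derivative 2 * q t) (at t)"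
        unfolding q_def by (auto intro!: derivative_eq_intros hermite1_has_derivative simp: power2_eq_square)
      then show "\<exists>z. ((\<lambda>x. (?h x)\<^sup>2) has_real_derivative z) (at t) \<and> z \<le> 0"
        using qneg[OF \<open>r \<le> t\<close>] by (intro exI[of _ "2 * q t"]) auto
    qed
    then have "\<bar>?h y\<bar> \<le> \<bar>?h r\<bar>" by (simp add: abs_le_square_iff)
    then show ?thesis using middle[of r] r(1) by simp
  qed
  have "\<bar>?h \<bar>x\<bar>\<bar> \<le> 2 * s" using middle[of "\<bar>x\<bar>"] outer[of "\<bar>x\<bar>"] by linarith
  moreover have "\<bar>?h \<bar>x\<bar>\<bar> = \<bar>?h x\<bar>" by (cases "x \<ge> 0") (simp_all add: hermite1_minus)
  ultimately show ?thesis by (simp add: s_def)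
qed

section \<open>Hermite functions on Euclidean spaces\<close>

text \<open>Multi-indices are functions on the coordinate vectors, made unique by a default value elsewhere.\<close>

definition multi_indices :: "('a::euclidean_space \<Rightarrow> nat) set" where
  "multi_indices = Basis \<rightarrow>\<^sub>E UNIV"

definition hermite :: "('a::euclidean_space \<Rightarrow> nat) \<Rightarrow> 'a \<Rightarrow> complex" where
  "hermite \<alpha> x = of_real (\<Prod>b\<in>Basis. hermite1 (\<alpha> b) (x \<bullet> b))"

definition index_weight :: "('a::euclidean_space \<Rightarrow> nat) \<Rightarrow> real" where
  "index_weight \<alpha> = 1 + real (\<Sum>b\<in>Basis. \<alpha> b)"

abbreviation raise :: "'a \<Rightarrow> ('a \<Rightarrow> nat) \<Rightarrow> 'a \<Rightarrow> nat" where
  "raise c \<alpha> \<equiv> \<alpha>(c := Suc (\<alpha> c))"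

abbreviation lower :: "'a \<Rightarrow> ('a \<Rightarrow> nat) \<Rightarrow> 'a \<Rightarrow> nat" where
  "lower c \<alpha> \<equiv> \<alpha>(c := \<alpha> c - 1)"

lemma index_weight_ge_1: "index_weight \<alpha> \<ge> 1"
  unfolding index_weight_def using of_nat_0_le_iff by (simp only: le_add_same_cancel1)

lemma index_le_weight: "b \<in> Basis \<Longrightarrow> real (\<alpha> b) + 1 \<le> index_weight \<alpha>"
proof -
  assume "b \<in> Basis"
  then have "\<alpha> b \<le> sum \<alpha> Basis" by (intro member_le_sum) auto
  then have "real (\<alpha> b) \<le> real (sum \<alpha> Basis)" by (rule of_nat_mono)
  then show ?thesis unfolding index_weight_def by linarith
qed

lemma multi_indices_update [simp]: "\<alpha> \<in> multi_indices \<Longrightarrow> c \<in> Basis \<Longrightarrow> \<alpha>(c := k) \<in> multi_indices"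
  by (auto simp: multi_indices_def PiE_iff extensional_def)

lemma index_weight_update: "c \<in> Basis \<Longrightarrow> index_weight (\<alpha>(c := k)) = index_weight \<alpha> - real (\<alpha> c) + real k"
proof -
  assume c: "c \<in> Basis"
  have "(\<Sum>b\<in>Basis. (\<alpha>(c := k)) b) = k + (\<Sum>b\<in>Basis - {c}. \<alpha> b)"
    using c by (subst sum.remove[of _ c]) auto
  moreover have "(\<Sum>b\<in>Basis. \<alpha> b) = \<alpha> c + (\<Sum>b\<in>Basis - {c}. \<alpha> b)"
    using c by (subst sum.remove[of _ c]) auto
  ultimately show ?thesis by (simp add: index_weight_def)
qed

lemma index_weight_raise: "c \<in> Basis \<Longrightarrow> index_weight (raise c \<alpha>) \<le> 2 * index_weight \<alpha>"
  using index_weight_update[of c \<alpha> "Suc (\<alpha> c)"] index_weight_ge_1[of \<alpha>] by simp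

lemma index_weight_lower: "c \<in> Basis \<Longrightarrow> index_weight (lower c \<alpha>) \<le> index_weight \<alpha>"
  using index_weight_update[of c \<alpha> "\<alpha> c - 1"] by simp

lemma ladder_le_weight: "c \<in> Basis \<Longrightarrow> ladder (\<alpha> c) \<le> index_weight \<alpha>" "c \<in> Basis \<Longrightarrow> ladder (Suc (\<alpha> c)) \<le> index_weight \<alpha>"
proof -
  assume c: "c \<in> Basis"
  have "ladder (Suc (\<alpha> c)) \<le> sqrt ((real (\<alpha> c) + 1)\<^sup>2)"
    unfolding ladder_def by (intro real_sqrt_le_mono) (simp add: power2_eq_square algebra_simps)
  also have "\<dots> = real (\<alpha> c) + 1" by simp
  finally show "ladder (Suc (\<alpha> c)) \<le> index_weight \<alpha>" using index_le_weight[OF c, of \<alpha>] by simp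
  then show "ladder (\<alpha> c) \<le> index_weight \<alpha>" using ladder_mono[of "\<alpha> c" "Suc (\<alpha> c)"] by simp
qed

lemma hermite_split:
  assumes "c \<in> Basis"
  shows "hermite (\<alpha>(c := k)) x = of_real (hermite1 k (x \<bullet> c)) * of_real (\<Prod>b\<in>Basis - {c}. hermite1 (\<alpha> b) (x \<bullet> b))"
proof -
  have "(\<Prod>b\<in>Basis. hermite1 ((\<alpha>(c := k)) b) (x \<bullet> b))
      = hermite1 k (x \<bullet> c) * (\<Prod>b\<in>Basis - {c}. hermite1 ((\<alpha>(c := k)) b) (x \<bullet> b))"
    using assms by (subst prod.remove[of _ c]) auto
  also have "(\<Prod>b\<in>Basis - {c}. hermite1 ((\<alpha>(c := k)) b) (x \<bullet> b)) = (\<Prod>b\<in>Basis - {c}. hermite1 (\<alpha> b) (x \<bullet> b))"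
    by (intro prod.cong) auto
  finally show ?thesis by (simp add: hermite_def)
qed

lemma hermite_split_self:
  assumes "c \<in> Basis"
  shows "hermite \<alpha> x = of_real (hermite1 (\<alpha> c) (x \<bullet> c)) * of_real (\<Prod>b\<in>Basis - {c}. hermite1 (\<alpha> b) (x \<bullet> b))"
  using hermite_split[OF assms, of \<alpha> "\<alpha> c" x] by simp

lemma coord_hermite:
  assumes "c \<in> Basis"
  shows "coord c (hermite \<alpha>) = (\<lambda>x. of_real (ladder (Suc (\<alpha> c))) * hermite (raise c \<alpha>) x
      + of_real (ladder (\<alpha> c)) * hermite (lower c \<alpha>) x)"
proof (rule ext)
  fix x
  have "complex_of_real (x \<bullet> c) * of_real (hermite1 (\<alpha> c) (x \<bullet> c)) =
     of_real (ladder (Suc (\<alpha> c)) * hermite1 (Suc (\<alpha> c)) (x \<bullet> c) + ladder (\<alpha> c) * hermite1 (\<alpha> c - 1) (x \<bullet> c))"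
    unfolding hermite1_coord[symmetric] by simp
  then show "coord c (hermite \<alpha>) x = of_real (ladder (Suc (\<alpha> c))) * hermite (raise c \<alpha>) x
      + of_real (ladder (\<alpha> c)) * hermite (lower c \<alpha>) x"
    unfolding coord_def hermite_split[OF assms] hermite_split_self[OF assms, of \<alpha>]
    by (simp add: mult.assoc[symmetric]) (simp add: algebra_simps)
qed

lemma hermite_has_derivative:
  "(hermite \<alpha> has_derivative (\<lambda>h. of_real (\<Sum>b\<in>Basis. ((h \<bullet> b) * hermite1_deriv (\<alpha> b) (x \<bullet> b)) *
     (\<Prod>c\<in>Basis - {b}. hermite1 (\<alpha> c) (x \<bullet> c))))) (at x)"
proof -
  have 1: "((\<lambda>x. hermite1 (\<alpha> b) (x \<bullet> b)) has_derivative (\<lambda>h. (h \<bullet> b) * hermite1_deriv (\<alpha> b) (x \<bullet> b))) (at x)" for b :: 'a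
    using has_derivative_compose[OF bounded_linear_imp_has_derivative[OF bounded_linear_inner_left]
        hermite1_has_derivative[unfolded has_field_derivative_def], of "\<alpha> b" b]
    by (simp add: mult.commute)
  have "((\<lambda>x. \<Prod>b\<in>Basis. hermite1 (\<alpha> b) (x \<bullet> b)) has_derivative
      (\<lambda>h. \<Sum>b\<in>Basis. ((h \<bullet> b) * hermite1_deriv (\<alpha> b) (x \<bullet> b)) * (\<Prod>c\<in>Basis - {b}. hermite1 (\<alpha> c) (x \<bullet> c)))) (at x)"
    by (rule has_derivative_prod) (rule 1)
  then show ?thesis unfolding hermite_def[abs_def] by (rule bounded_linear.has_derivative[OF bounded_linear_of_real])
qed

lemma pd_hermite:
  assumes c: "c \<in> Basis"
  shows "pd c (hermite \<alpha>) = (\<lambda>x. of_real (ladder (\<alpha> c)) * hermite (lower c \<alpha>) x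
      + (- of_real (ladder (Suc (\<alpha> c)))) * hermite (raise c \<alpha>) x)"
proof (rule ext)
  fix x :: 'a
  have "(\<Sum>b\<in>Basis. ((c \<bullet> b) * hermite1_deriv (\<alpha> b) (x \<bullet> b)) * (\<Prod>d\<in>Basis - {b}. hermite1 (\<alpha> d) (x \<bullet> d)))
     = (\<Sum>b\<in>Basis. if b = c then hermite1_deriv (\<alpha> c) (x \<bullet> c) * (\<Prod>d\<in>Basis - {c}. hermite1 (\<alpha> d) (x \<bullet> d)) else 0)"
    using c by (intro sum.cong) (auto simp: inner_Basis)
  then have "pd c (hermite \<alpha>) x = of_real (hermite1_deriv (\<alpha> c) (x \<bullet> c)) * of_real (\<Prod>d\<in>Basis - {c}. hermite1 (\<alpha> d) (x \<bullet> d))"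
    unfolding pd_eqI[OF hermite_has_derivative] using c by simp
  then show "pd c (hermite \<alpha>) x = of_real (ladder (\<alpha> c)) * hermite (lower c \<alpha>) x
      + (- of_real (ladder (Suc (\<alpha> c)))) * hermite (raise c \<alpha>) x"
    unfolding hermite_split[OF c] hermite1_deriv_def by (simp add: algebra_simps)
qed

lemmas coord_hermite_apply = fun_cong[OF coord_hermite]
lemmas pd_hermite_apply = fun_cong[OF pd_hermite]

text \<open>Closed under coordinates and partial derivatives by the ladder relations, and thus suited to
  coinduction.\<close>

inductive_set hermite_span :: "('a::euclidean_space \<Rightarrow> complex) set" where
  base: "hermite \<alpha> \<in> hermite_span"
| comb: "u \<in> hermite_span \<Longrightarrow> v \<in> hermite_span \<Longrightarrow> (\<lambda>x. a * u x + b * v x) \<in> hermite_span"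

lemma hermite_le_weight:
  fixes \<alpha> :: "'a::euclidean_space \<Rightarrow> nat"
  shows "cmod (hermite \<alpha> x) \<le> 4 ^ DIM('a) * index_weight \<alpha> ^ DIM('a)"
proof -
  have "cmod (hermite \<alpha> x) = (\<Prod>b\<in>Basis. \<bar>hermite1 (\<alpha> b) (x \<bullet> b)\<bar>)"
    unfolding hermite_def norm_of_real by (rule abs_prod)
  also have "\<dots> \<le> (\<Prod>b\<in>(Basis :: 'a set). 4 * index_weight \<alpha>)"
  proof (intro prod_mono conjI abs_ge_zero)
    fix b :: 'a assume "b \<in> Basis"
    show "\<bar>hermite1 (\<alpha> b) (x \<bullet> b)\<bar> \<le> 4 * index_weight \<alpha>"
      using hermite1_bound[of "\<alpha> b" "x \<bullet> b"] index_le_weight[OF \<open>b \<in> Basis\<close>, of \<alpha>] by simp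
  qed
  finally show ?thesis by (simp add: power_mult_distrib)
qed

lemma hermite_span_coord:
  assumes "u \<in> hermite_span" "c \<in> Basis"
  shows "coord c u \<in> hermite_span"
  using assms(1)
proof induction
  case (base \<alpha>)
  show ?case unfolding coord_hermite[OF assms(2)] by (rule hermite_span.comb[OF hermite_span.base hermite_span.base])
next
  case (comb u v a b)
  have "coord c (\<lambda>x. a * u x + b * v x) = (\<lambda>x. a * coord c u x + b * coord c v x)"
    by (rule ext) (simp add: coord_def algebra_simps)
  then show ?case using hermite_span.comb[OF comb.IH] by simp
qed

lemma coord_weight_bound:
  fixes u :: "'a::euclidean_space \<Rightarrow> complex"
  shows "norm x ^ Suc k * cmod (u x) \<le> (\<Sum>c\<in>Basis. norm x ^ k * cmod (coord c u x))"
proof -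
  have "norm x ^ Suc k * cmod (u x) = norm x * (norm x ^ k * cmod (u x))" by simp
  also have "\<dots> \<le> (\<Sum>c\<in>Basis. \<bar>x \<bullet> c\<bar>) * (norm x ^ k * cmod (u x))"
    by (intro mult_right_mono norm_le_l1) auto
  also have "\<dots> = (\<Sum>c\<in>Basis. norm x ^ k * cmod (coord c u x))"
    unfolding sum_distrib_right by (intro sum.cong) (simp_all add: coord_def norm_mult mult_ac)
  finally show ?thesis .
qed

lemma hermite_span_bounded:
  fixes u :: "'a::euclidean_space \<Rightarrow> complex"
  assumes "u \<in> hermite_span"
  shows "\<exists>B. \<forall>x. norm x ^ k * cmod (u x) \<le> B"
  using assms
proof (induction k arbitrary: u)
  case 0
  then show ?case
  proof induction
    case (base \<alpha>)
    show ?case using hermite_le_weight[of \<alpha>] by auto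
  next
    case (comb u v a b)
    then obtain B C where B: "\<And>x. cmod (u x) \<le> B" and C: "\<And>x. cmod (v x) \<le> C" by auto
    have "cmod (a * u x + b * v x) \<le> cmod a * B + cmod b * C" for x
      by (rule order_trans[OF cmod_lincomb_le]) (intro add_mono mult_left_mono B C norm_ge_zero)
    then show ?case by auto
  qed
next
  case (Suc k)
  have "\<forall>c\<in>Basis. \<exists>B. \<forall>x. norm x ^ k * cmod (coord c u x) \<le> B"
    by (intro ballI Suc.IH hermite_span_coord Suc.prems)
  then obtain B where B: "\<And>c x. c \<in> Basis \<Longrightarrow> norm x ^ k * cmod (coord c u x) \<le> B c" by metis
  have "norm x ^ Suc k * cmod (u x) \<le> (\<Sum>c\<in>Basis. B c)" for x
    by (rule order_trans[OF coord_weight_bound]) (intro sum_mono B)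
  then show ?case by auto
qed

lemma hermite_schwartz: "hermite \<alpha> \<in> schwartz"
proof (rule schwartz_coinduct[of _ hermite_span])
  show "hermite \<alpha> \<in> hermite_span" by (rule hermite_span.base)
next
  show d: "u differentiable at x" if "u \<in> hermite_span" for u :: "'a \<Rightarrow> complex" and x
    using that
  proof induction
    case (base \<alpha>)
    show ?case by (rule differentiableI[OF hermite_has_derivative])
  next
    case (comb u v a b)
    show ?case by (intro differentiable_add differentiable_mult differentiable_const comb.IH)
  qed
  fix u :: "'a \<Rightarrow> complex" and c :: 'a assume "u \<in> hermite_span" and c: "c \<in> Basis"
  from this(1) show "pd c u \<in> hermite_span"
  proof induction
    case (base \<alpha>)
    show ?case unfolding pd_hermite[OF c] by (rule hermite_span.comb[OF hermite_span.base hermite_span.base])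
  next
    case (comb u v a b)
    have "pd c (\<lambda>x. a * u x + b * v x) = (\<lambda>x. a * pd c u x + b * pd c v x)"
      by (rule ext) (rule pd_lincomb[OF d[OF comb.hyps(1)] d[OF comb.hyps(2)]])
    then show ?case using hermite_span.comb[OF comb.IH] by simp
  qed
next
  fix u :: "'a \<Rightarrow> complex" and k assume "u \<in> hermite_span"
  from hermite_span_bounded[OF this, of k] show "bounded (range (\<lambda>x. norm x ^ k * cmod (u x)))"
    unfolding bounded_iff by auto
qed

text \<open>Polynomial growth in the index is what the rapid decrease of Hermite coefficients compensates.\<close>

definition poly_growth :: "(('a::euclidean_space \<Rightarrow> nat) \<Rightarrow> real) \<Rightarrow> bool" where
  "poly_growth p \<longleftrightarrow> (\<exists>C M. \<forall>\<alpha>. p \<alpha> \<le> C * index_weight \<alpha> ^ M)"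

lemma poly_growthD:
  assumes "poly_growth p"
  obtains C M where "C \<ge> 0" "\<And>\<alpha>. p \<alpha> \<le> C * index_weight \<alpha> ^ M"
proof -
  obtain C M where b: "\<And>\<alpha>. p \<alpha> \<le> C * index_weight \<alpha> ^ M" using assms by (auto simp: poly_growth_def)
  have "p \<alpha> \<le> \<bar>C\<bar> * index_weight \<alpha> ^ M" for \<alpha>
  proof -
    have "C * index_weight \<alpha> ^ M \<le> \<bar>C\<bar> * index_weight \<alpha> ^ M"
      using index_weight_ge_1[of \<alpha>] by (intro mult_right_mono zero_le_power) auto
    then show ?thesis using b[of \<alpha>] by linarith
  qed
  then show ?thesis by (intro that[of "\<bar>C\<bar>" M]) auto
qed

lemma poly_growth_mono: "poly_growth q \<Longrightarrow> (\<And>\<alpha>. p \<alpha> \<le> q \<alpha>) \<Longrightarrow> poly_growth p"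
  unfolding poly_growth_def by (meson order_trans)

lemma poly_growth_add:
  assumes "poly_growth p" "poly_growth q"
  shows "poly_growth (\<lambda>\<alpha>. p \<alpha> + q \<alpha>)"
proof -
  obtain C M where C: "C \<ge> 0" "\<And>\<alpha>. p \<alpha> \<le> C * index_weight \<alpha> ^ M" by (rule poly_growthD[OF assms(1)], rule that)
  obtain D N where D: "D \<ge> 0" "\<And>\<alpha>. q \<alpha> \<le> D * index_weight \<alpha> ^ N" by (rule poly_growthD[OF assms(2)], rule that)
  have "p \<alpha> + q \<alpha> \<le> (C + D) * index_weight \<alpha> ^ (M + N)" for \<alpha>
  proof -
    have "index_weight \<alpha> ^ M \<le> index_weight \<alpha> ^ (M + N)" "index_weight \<alpha> ^ N \<le> index_weight \<alpha> ^ (M + N)"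
      using index_weight_ge_1[of \<alpha>] by (auto intro!: power_increasing)
    then have "C * index_weight \<alpha> ^ M + D * index_weight \<alpha> ^ N
        \<le> C * index_weight \<alpha> ^ (M + N) + D * index_weight \<alpha> ^ (M + N)"
      by (intro add_mono mult_left_mono C(1) D(1))
    then show ?thesis using C(2)[of \<alpha>] D(2)[of \<alpha>] by (simp add: distrib_right)
  qed
  then show ?thesis unfolding poly_growth_def by (intro exI allI)
qed

lemma poly_growth_0: "poly_growth (\<lambda>_. 0)"
  unfolding poly_growth_def by (intro exI[of _ 0] allI) simp

lemma poly_growth_sum: "finite A \<Longrightarrow> (\<And>i. i \<in> A \<Longrightarrow> poly_growth (p i)) \<Longrightarrow> poly_growth (\<lambda>\<alpha>. \<Sum>i\<in>A. p i \<alpha>)"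
  by (induction A rule: finite_induct) (simp_all add: poly_growth_0 poly_growth_add)

lemma poly_growth_ladder:
  assumes "poly_growth p" "c \<in> Basis"
  shows "poly_growth (\<lambda>\<alpha>. index_weight \<alpha> * p (raise c \<alpha>))" "poly_growth (\<lambda>\<alpha>. index_weight \<alpha> * p (lower c \<alpha>))"
proof -
  obtain C M where C: "C \<ge> 0" "\<And>\<alpha>. p \<alpha> \<le> C * index_weight \<alpha> ^ M" by (rule poly_growthD[OF assms(1)], rule that)
  have "index_weight \<alpha> * p (raise c \<alpha>) \<le> (C * 2 ^ M) * index_weight \<alpha> ^ Suc M" for \<alpha>
  proof -
    have "index_weight (raise c \<alpha>) ^ M \<le> (2 * index_weight \<alpha>) ^ M"
      using index_weight_raise[OF assms(2), of \<alpha>] index_weight_ge_1[of "raise c \<alpha>"] by (intro power_mono) auto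
    then have "C * index_weight (raise c \<alpha>) ^ M \<le> C * (2 * index_weight \<alpha>) ^ M" by (rule mult_left_mono[OF _ C(1)])
    then have "p (raise c \<alpha>) \<le> C * (2 * index_weight \<alpha>) ^ M" using C(2) by (rule order_trans[rotated])
    then have "index_weight \<alpha> * p (raise c \<alpha>) \<le> index_weight \<alpha> * (C * (2 * index_weight \<alpha>) ^ M)"
      using index_weight_ge_1[of \<alpha>] by (intro mult_left_mono) auto
    then show ?thesis by (simp add: power_mult_distrib mult_ac)
  qed
  then show "poly_growth (\<lambda>\<alpha>. index_weight \<alpha> * p (raise c \<alpha>))" unfolding poly_growth_def by (intro exI allI)
  have "index_weight \<alpha> * p (lower c \<alpha>) \<le> C * index_weight \<alpha> ^ Suc M" for \<alpha>
  proof -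
    have "index_weight (lower c \<alpha>) ^ M \<le> index_weight \<alpha> ^ M"
      using index_weight_lower[OF assms(2), of \<alpha>] index_weight_ge_1[of "lower c \<alpha>"] by (intro power_mono) auto
    then have "C * index_weight (lower c \<alpha>) ^ M \<le> C * index_weight \<alpha> ^ M" by (rule mult_left_mono[OF _ C(1)])
    then have "p (lower c \<alpha>) \<le> C * index_weight \<alpha> ^ M" using C(2) by (rule order_trans[rotated])
    then have "index_weight \<alpha> * p (lower c \<alpha>) \<le> index_weight \<alpha> * (C * index_weight \<alpha> ^ M)"
      using index_weight_ge_1[of \<alpha>] by (intro mult_left_mono) auto
    then show ?thesis by (simp add: mult_ac)
  qed
  then show "poly_growth (\<lambda>\<alpha>. index_weight \<alpha> * p (lower c \<alpha>))" unfolding poly_growth_def by (intro exI allI)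
qed

text \<open>By the ladder relations coordinates and derivatives only shift the index by one and multiply by a
  factor of at most the weight. Starting from the bound on the functions themselves, all seminorms of
  the Hermite functions therefore grow polynomially.\<close>

lemma poly_growth_seminorm_ladder:
  assumes p: "seminorm_on schwartz p" and g: "poly_growth (\<lambda>\<alpha>. p (hermite \<alpha>))" and c: "c \<in> Basis"
  shows "poly_growth (\<lambda>\<alpha>. p (coord c (hermite \<alpha>)))" "poly_growth (\<lambda>\<alpha>. p (pd c (hermite \<alpha>)))"
proof -
  have sum: "poly_growth (\<lambda>\<alpha>. index_weight \<alpha> * p (hermite (raise c \<alpha>)) + index_weight \<alpha> * p (hermite (lower c \<alpha>)))"
    by (rule poly_growth_add[OF poly_growth_ladder(1)[OF g c] poly_growth_ladder(2)[OF g c]])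
  have comb: "p (\<lambda>x. a * hermite (raise c \<alpha>) x + b * hermite (lower c \<alpha>) x)
      \<le> index_weight \<alpha> * p (hermite (raise c \<alpha>)) + index_weight \<alpha> * p (hermite (lower c \<alpha>))"
    if "cmod a \<le> index_weight \<alpha>" "cmod b \<le> index_weight \<alpha>" for a b \<alpha>
    by (rule order_trans[OF seminorm_lin[OF p hermite_schwartz hermite_schwartz]])
       (intro add_mono mult_right_mono that seminorm_nonneg[OF p hermite_schwartz])
  show "poly_growth (\<lambda>\<alpha>. p (coord c (hermite \<alpha>)))"
    by (rule poly_growth_mono[OF sum], unfold coord_hermite[OF c], rule comb) (simp_all add: ladder_le_weight c)
  show "poly_growth (\<lambda>\<alpha>. p (pd c (hermite \<alpha>)))"
  proof (rule poly_growth_mono[OF sum])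
    fix \<alpha> :: "'a \<Rightarrow> nat"
    have "pd c (hermite \<alpha>) = (\<lambda>x. (- of_real (ladder (Suc (\<alpha> c)))) * hermite (raise c \<alpha>) x
        + of_real (ladder (\<alpha> c)) * hermite (lower c \<alpha>) x)"
      unfolding pd_hermite[OF c] by (rule ext) simp
    then show "p (pd c (hermite \<alpha>)) \<le> index_weight \<alpha> * p (hermite (raise c \<alpha>)) + index_weight \<alpha> * p (hermite (lower c \<alpha>))"
      using comb[of "- of_real (ladder (Suc (\<alpha> c)))" \<alpha> "of_real (ladder (\<alpha> c))"] by (simp add: ladder_le_weight c)
  qed
qed

lemma schwartz_seminorm_coord_bound:
  fixes u :: "'a::euclidean_space \<Rightarrow> complex"
  assumes u: "u \<in> schwartz"
  shows "schwartz_seminorm (Suc k) [] u \<le> (\<Sum>c\<in>Basis. schwartz_seminorm k [] (coord c u))"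
proof (rule schwartz_seminorm_le)
  fix x
  have "norm x ^ Suc k * cmod (u x) \<le> (\<Sum>c\<in>Basis. norm x ^ k * cmod (coord c u x))" by (rule coord_weight_bound)
  also have "\<dots> \<le> (\<Sum>c\<in>Basis. schwartz_seminorm k [] (coord c u))"
    using schwartz_seminorm_bound[OF coord_schwartz[OF u], of _ "[]" x k] by (intro sum_mono) simp
  finally show "norm x ^ Suc k * cmod (iterated_derivative [] u x) \<le> (\<Sum>c\<in>Basis. schwartz_seminorm k [] (coord c u))"
    by simp
qed

lemma poly_growth_schwartz_seminorm:
  assumes "vs \<in> lists Basis"
  shows "poly_growth (\<lambda>\<alpha>. schwartz_seminorm k vs (hermite \<alpha> :: 'a::euclidean_space \<Rightarrow> complex))"
  using assms
proof (induction vs rule: rev_induct)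
  case Nil
  show ?case
  proof (induction k)
    case 0
    have "schwartz_seminorm 0 [] (hermite \<alpha> :: 'a \<Rightarrow> complex) \<le> 4 ^ DIM('a) * index_weight \<alpha> ^ DIM('a)" for \<alpha>
      by (rule schwartz_seminorm_le) (simp add: hermite_le_weight)
    then show ?case unfolding poly_growth_def by (intro exI allI)
  next
    case (Suc k)
    have "poly_growth (\<lambda>\<alpha>. \<Sum>c\<in>Basis. schwartz_seminorm k [] (coord c (hermite \<alpha> :: 'a \<Rightarrow> complex)))"
      by (intro poly_growth_sum finite_Basis poly_growth_seminorm_ladder(1)[OF seminorm_on_schwartz_seminorm Suc.IH]) auto
    then show ?case by (rule poly_growth_mono) (rule schwartz_seminorm_coord_bound[OF hermite_schwartz])
  qed
next
  case (snoc c vs)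
  then have c: "c \<in> Basis" and vs: "vs \<in> lists Basis" by auto
  show ?case unfolding schwartz_seminorm_pd[symmetric]
    by (rule poly_growth_seminorm_ladder(2)[OF seminorm_on_schwartz_seminorm[OF vs] snoc.IH[OF vs] c])
qed

lemma snorm_hermite_growth: "poly_growth (\<lambda>\<alpha>. snorm m (hermite \<alpha>))"
  unfolding snorm_def
  by (intro poly_growth_sum finite_basis_words finite_atMost poly_growth_schwartz_seminorm basis_words_lists)

section \<open>Orthogonality\<close>

text \<open>The number operator of the oscillator in direction \<open>c\<close>. It is symmetric for the bilinear pairing and has
  eigenvalue \<open>\<alpha> c\<close> on \<open>hermite \<alpha>\<close>.\<close>

definition number_op :: "'a::euclidean_space \<Rightarrow> ('a \<Rightarrow> complex) \<Rightarrow> 'a \<Rightarrow> complex" where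
  "number_op c f = (\<lambda>x. (coord c (coord c f) x - pd c (pd c f) x - f x) / 2)"

lemma number_op_schwartz:
  assumes "f \<in> schwartz" "c \<in> Basis"
  shows "number_op c f \<in> schwartz"
proof -
  have 1: "(\<lambda>x. coord c (coord c f) x - pd c (pd c f) x) \<in> schwartz"
    by (rule schwartz_ops(2)[OF coord_schwartz[OF coord_schwartz[OF assms] assms(2)] schwartz_pd[OF schwartz_pd[OF assms] assms(2)]])
  have "(\<lambda>x. (1/2) * (coord c (coord c f) x - pd c (pd c f) x) + (- 1/2) * f x) \<in> schwartz"
    by (rule schwartz_lincomb[OF 1 assms(1)])
  then show ?thesis by (simp add: number_op_def[abs_def] diff_divide_distrib)
qed

lemma pairing_lincomb:
  assumes "f \<in> schwartz" "g \<in> schwartz" "h \<in> schwartz"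
  shows "pairing lborel (\<lambda>x. a * f x + b * g x) h = a * pairing lborel f h + b * pairing lborel g h"
    and "pairing lborel h (\<lambda>x. a * f x + b * g x) = a * pairing lborel h f + b * pairing lborel h g"
proof -
  show 1: "pairing lborel (\<lambda>x. a * f x + b * g x) h = a * pairing lborel f h + b * pairing lborel g h"
    by (rule functional_lin[OF sfunctional_linear[OF sfunctional_pairing[OF assms(3)]] assms(1,2)])
  then show "pairing lborel h (\<lambda>x. a * f x + b * g x) = a * pairing lborel h f + b * pairing lborel h g"
    by (simp add: pairing_commute[of lborel h])
qed

lemma pairing_number_op:
  assumes f: "f \<in> schwartz" and g: "g \<in> schwartz" and c: "c \<in> Basis"
  shows "pairing lborel (number_op c f) g = pairing lborel f (number_op c g)"
proof -
  have ex: "pairing lborel (number_op c u) v = (pairing lborel (coord c (coord c u)) v - pairing lborel (pd c (pd c u)) v - pairing lborel u v) / 2"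
    if u: "u \<in> schwartz" and v: "v \<in> schwartz" for u v
  proof -
    have 0: "coord c (coord c u) \<in> schwartz" "pd c (pd c u) \<in> schwartz"
      by (intro coord_schwartz schwartz_pd u c)+
    have 1: "(\<lambda>x. 1 * coord c (coord c u) x + (-1) * pd c (pd c u) x) \<in> schwartz" by (rule schwartz_lincomb[OF 0])
    have "number_op c u = (\<lambda>x. (1/2) * (1 * coord c (coord c u) x + (-1) * pd c (pd c u) x) + (- 1/2) * u x)"
      by (rule ext) (simp add: number_op_def field_simps)
    then have "pairing lborel (number_op c u) v = (1/2) * pairing lborel (\<lambda>x. 1 * coord c (coord c u) x + (-1) * pd c (pd c u) x) v
        + (- 1/2) * pairing lborel u v"
      using pairing_lincomb(1)[OF 1 u v, of "1/2" "-1/2"] by simp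
    then show ?thesis unfolding pairing_lincomb(1)[OF 0 v] by (simp add: diff_divide_distrib)
  qed
  have "pairing lborel (coord c (coord c f)) g = pairing lborel f (coord c (coord c g))"
    by (simp only: pairing_coord)
  then have "pairing lborel (coord c (coord c f)) g = pairing lborel (coord c (coord c g)) f"
    by (simp only: pairing_commute[of lborel f])
  moreover have "pairing lborel (pd c (pd c f)) g = pairing lborel (pd c (pd c g)) f"
    unfolding pairing_pd[OF schwartz_pd[OF f c] g c] pairing_pd[OF schwartz_pd[OF g c] f c]
    by (simp add: pairing_commute)
  ultimately have "pairing lborel (number_op c f) g = pairing lborel (number_op c g) f"
    unfolding ex[OF f g] ex[OF g f] by (simp add: pairing_commute[of lborel f g])
  then show ?thesis by (simp add: pairing_commute)
qed

lemma number_op_hermite: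
  assumes c: "c \<in> Basis"
  shows "number_op c (hermite \<alpha>) = (\<lambda>x. of_nat (\<alpha> c) * hermite \<alpha> x)"
proof (rule ext)
  fix x
  define P where "P = complex_of_real (\<Prod>b\<in>Basis - {c}. hermite1 (\<alpha> b) (x \<bullet> b))"
  have pk: "pd c (hermite (\<alpha>(c := k))) x = of_real (hermite1_deriv k (x \<bullet> c)) * P" for k
    unfolding pd_hermite_apply[OF c] fun_upd_upd fun_upd_same hermite_split[OF c] P_def[symmetric]
    by (simp add: hermite1_deriv_def algebra_simps)
  have "pd c (pd c (hermite \<alpha>)) x = of_real (ladder (\<alpha> c)) * pd c (hermite (lower c \<alpha>)) x
      + (- of_real (ladder (Suc (\<alpha> c)))) * pd c (hermite (raise c \<alpha>)) x"
    unfolding pd_hermite[OF c, of \<alpha>]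
    by (rule pd_lincomb[OF schwartz_differentiable0[OF hermite_schwartz] schwartz_differentiable0[OF hermite_schwartz]])
  also have "\<dots> = of_real (ladder (\<alpha> c) * hermite1_deriv (\<alpha> c - 1) (x \<bullet> c)
      - ladder (Suc (\<alpha> c)) * hermite1_deriv (Suc (\<alpha> c)) (x \<bullet> c)) * P"
    unfolding pk by (simp add: algebra_simps)
  also have "\<dots> = of_real ((x \<bullet> c)\<^sup>2 - (2 * real (\<alpha> c) + 1)) * (of_real (hermite1 (\<alpha> c) (x \<bullet> c)) * P)"
    unfolding hermite1_second by simp
  also have "of_real (hermite1 (\<alpha> c) (x \<bullet> c)) * P = hermite \<alpha> x" unfolding P_def hermite_split_self[OF c, of \<alpha>] ..
  finally have "pd c (pd c (hermite \<alpha>)) x = of_real ((x \<bullet> c)\<^sup>2 - (2 * real (\<alpha> c) + 1)) * hermite \<alpha> x" .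
  then show "number_op c (hermite \<alpha>) x = of_nat (\<alpha> c) * hermite \<alpha> x"
    by (simp add: number_op_def coord_def power2_eq_square algebra_simps)
qed

text \<open>Eigenfunctions of a symmetric operator for different eigenvalues.\<close>

lemma hermite_orthogonal:
  assumes "\<alpha> \<in> multi_indices" "\<beta> \<in> multi_indices" "\<alpha> \<noteq> \<beta>"
  shows "pairing lborel (hermite \<alpha>) (hermite \<beta>) = 0"
proof -
  have "\<exists>c\<in>Basis. \<alpha> c \<noteq> \<beta> c"
    using assms PiE_ext[of \<alpha> Basis "\<lambda>_. UNIV" \<beta>] unfolding multi_indices_def by blast
  then obtain c where c: "c \<in> Basis" "\<alpha> c \<noteq> \<beta> c" by blast
  have "of_nat (\<alpha> c) * pairing lborel (hermite \<alpha>) (hermite \<beta>) = of_nat (\<beta> c) * pairing lborel (hermite \<alpha>) (hermite \<beta>)"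
    using pairing_number_op[OF hermite_schwartz hermite_schwartz c(1), of \<alpha> \<beta>]
      pairing_lincomb(1)[OF hermite_schwartz hermite_schwartz hermite_schwartz, of "of_nat (\<alpha> c)" \<alpha> 0 \<alpha> \<beta>]
      pairing_lincomb(2)[OF hermite_schwartz hermite_schwartz hermite_schwartz, of \<alpha> "of_nat (\<beta> c)" \<beta> 0 \<beta>]
    unfolding number_op_hermite[OF c(1)] by simp
  then have "(of_nat (\<alpha> c) - of_nat (\<beta> c)) * pairing lborel (hermite \<alpha>) (hermite \<beta>) = 0"
    by (simp add: left_diff_distrib)
  then show ?thesis using c(2) by simp
qed

definition ground_state :: "'a::euclidean_space \<Rightarrow> nat" where
  "ground_state = (\<lambda>b\<in>Basis. 0)"

text \<open>The common value of the pairing of a Hermite function with itself; the functions are not normalised.\<close>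

definition hermite_norm :: "'a::euclidean_space itself \<Rightarrow> complex" where
  "hermite_norm _ = pairing lborel (hermite (ground_state :: 'a \<Rightarrow> nat)) (hermite (ground_state :: 'a \<Rightarrow> nat))"

text \<open>The operators \<open>x - d/dx\<close> and \<open>x + d/dx\<close> are transposes of each other and shift the index up and down
  with the same factor.\<close>

lemma hermite_norm_raise:
  assumes c: "c \<in> Basis"
  shows "pairing lborel (hermite (raise c \<alpha>)) (hermite (raise c \<alpha>)) = pairing lborel (hermite \<alpha>) (hermite \<alpha>)"
proof -
  let ?h = "hermite \<alpha>" and ?g = "hermite (raise c \<alpha>)" and ?A = "complex_of_real (ladder (Suc (\<alpha> c)))"
  note S = coord_schwartz[OF hermite_schwartz c] schwartz_pd[OF hermite_schwartz c]
  have 1: "(\<lambda>x. 1 * coord c ?h x + (-1) * pd c ?h x) = (\<lambda>x. (2 * ?A) * ?g x + 0 * ?g x)"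
    by (rule ext, unfold coord_hermite_apply[OF c] pd_hermite_apply[OF c]) (simp add: algebra_simps)
  have 2: "(\<lambda>x. 1 * coord c ?g x + 1 * pd c ?g x) = (\<lambda>x. (2 * ?A) * ?h x + 0 * ?h x)"
    by (rule ext, unfold coord_hermite_apply[OF c] pd_hermite_apply[OF c]) (simp add: algebra_simps)
  have "2 * ?A * pairing lborel ?g ?g = pairing lborel (\<lambda>x. 1 * coord c ?h x + (-1) * pd c ?h x) ?g"
    unfolding 1 pairing_lincomb(1)[OF hermite_schwartz hermite_schwartz hermite_schwartz] by simp
  also have "\<dots> = pairing lborel ?h (coord c ?g) + pairing lborel ?h (pd c ?g)"
    unfolding pairing_lincomb(1)[OF S hermite_schwartz] pairing_pd[OF hermite_schwartz hermite_schwartz c] pairing_coord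
    by simp
  also have "\<dots> = pairing lborel ?h (\<lambda>x. 1 * coord c ?g x + 1 * pd c ?g x)"
    unfolding pairing_lincomb(2)[OF S hermite_schwartz] by simp
  also have "\<dots> = 2 * ?A * pairing lborel ?h ?h"
    unfolding 2 pairing_lincomb(2)[OF hermite_schwartz hermite_schwartz hermite_schwartz] by simp
  finally show ?thesis using ladder_Suc_neq[of "\<alpha> c"] by simp
qed

lemma hermite_norm_eq:
  fixes \<alpha> :: "'a::euclidean_space \<Rightarrow> nat"
  assumes "\<alpha> \<in> multi_indices"
  shows "pairing lborel (hermite \<alpha>) (hermite \<alpha>) = hermite_norm TYPE('a)"
  using assms
proof (induction "\<Sum>b\<in>Basis. \<alpha> b" arbitrary: \<alpha>)
  case 0
  then have "\<alpha> b = ground_state b" for b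
    by (cases "b \<in> Basis") (auto simp: ground_state_def multi_indices_def PiE_iff extensional_def)
  then have "\<alpha> = ground_state" by (rule ext)
  then show ?case by (simp add: hermite_norm_def)
next
  case (Suc n)
  then have "(\<Sum>b\<in>Basis. \<alpha> b) \<noteq> 0" by linarith
  then obtain c where c: "c \<in> Basis" "\<alpha> c \<noteq> 0" by (meson sum.neutral)
  let ?\<beta> = "lower c \<alpha>"
  have "(\<Sum>b\<in>Basis. ?\<beta> b) = (\<alpha> c - 1) + (\<Sum>b\<in>Basis - {c}. \<alpha> b)"
    using c by (subst sum.remove[of _ c]) auto
  moreover have "(\<Sum>b\<in>Basis. \<alpha> b) = \<alpha> c + (\<Sum>b\<in>Basis - {c}. \<alpha> b)"
    using c by (subst sum.remove[of _ c]) auto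
  ultimately have n: "n = (\<Sum>b\<in>Basis. ?\<beta> b)" using c Suc.hyps(2) by linarith
  have r: "raise c ?\<beta> = \<alpha>" using c by (auto simp: fun_eq_iff)
  show ?case
    using Suc.hyps(1)[OF n multi_indices_update[OF Suc.prems c(1)]] hermite_norm_raise[OF c(1), of ?\<beta>]
    unfolding r by simp
qed

section \<open>Completeness of the Hermite functions\<close>

definition gauss :: "real \<Rightarrow> 'a::euclidean_space \<Rightarrow> real" where
  "gauss s x = exp (- s * norm x ^ 2 / 2)"

lemma gauss_continuous: "continuous_on UNIV (gauss s)"
  unfolding gauss_def by (intro continuous_intros) auto

lemma gauss_measurable [measurable]: "gauss s \<in> borel_measurable borel"
  by (rule borel_measurable_continuous_onI[OF gauss_continuous])

lemma hermite_ground_state: "hermite ground_state x = of_real (gauss 1 x)"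
proof -
  have "(\<Prod>b\<in>Basis. hermite1 (ground_state b) (x \<bullet> b)) = (\<Prod>b\<in>Basis. exp (- (x \<bullet> b)\<^sup>2 / 2))"
    by (intro prod.cong) (simp_all add: ground_state_def)
  also have "\<dots> = exp (\<Sum>b\<in>Basis. (- (x \<bullet> b)\<^sup>2 / 2))"
    by (simp add: exp_sum)
  also have "(\<Sum>b\<in>Basis. (- (x \<bullet> b)\<^sup>2 / 2)) = - 1 * norm x ^ 2 / 2"
    unfolding power2_norm_eq_inner euclidean_inner[of x x]
    by (simp add: power2_eq_square sum_negf sum_divide_distrib[symmetric])
  finally show ?thesis unfolding hermite_def gauss_def by simp
qed

lemma positive_integral_pos:
  fixes g :: "'a::euclidean_space \<Rightarrow> real"
  assumes g: "integrable lborel g" "\<And>x. g x > 0"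
  shows "(LINT x|lborel. g x) > 0"
proof -
  have "(LINT x|lborel. g x) \<noteq> 0"
  proof
    assume "(LINT x|lborel. g x) = 0"
    then have "AE x in lborel. g x = 0"
      using integral_nonneg_eq_0_iff_AE[OF g(1)] g(2) by (simp add: less_imp_le)
    then have "AE x in (lborel :: 'a measure). False" by eventually_elim (use g(2) in \<open>metis less_irrefl\<close>)
    then have "ae_filter (lborel :: 'a measure) = bot" by (simp add: trivial_limit_def)
    then show False by (simp add: ae_filter_eq_bot_iff)
  qed
  moreover have "(LINT x|lborel. g x) \<ge> 0"
    using g(2) by (intro Bochner_Integration.integral_nonneg) (auto intro: less_imp_le)
  ultimately show ?thesis by linarith
qed

lemma gauss_integrable: "integrable lborel (gauss 1 :: 'a::euclidean_space \<Rightarrow> real)"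
proof -
  have "integrable lborel (\<lambda>x::'a. Re (hermite ground_state x))"
    by (intro integrable_Re schwartz_integrable hermite_schwartz)
  then show ?thesis by (simp add: hermite_ground_state)
qed

lemma hermite_norm_neq_0: "hermite_norm TYPE('a::euclidean_space) \<noteq> 0"
proof -
  have int: "integrable lborel (\<lambda>x::'a. hermite ground_state x * hermite ground_state x)"
    by (rule schwartz_mult_integrable[OF hermite_schwartz hermite_schwartz])
  have "integrable lborel (\<lambda>x::'a. gauss 1 x * gauss 1 x)"
    using integrable_Re[OF int] by (simp add: hermite_ground_state)
  then have "(LINT x|lborel. gauss 1 (x :: 'a) * gauss 1 x) > 0"
    by (rule positive_integral_pos) (simp add: gauss_def)
  moreover have "hermite_norm TYPE('a) = of_real (LINT x|lborel. gauss 1 (x :: 'a) * gauss 1 x)"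
    unfolding hermite_norm_def pairing_def hermite_ground_state of_real_mult[symmetric]
    by (rule integral_complex_of_real)
  ultimately show ?thesis by simp
qed

text \<open>Integrals against all powers of \<open>q\<close> determine the integral against \<open>exp q\<close>, provided the exponential
  series may be integrated term by term.\<close>

lemma exp_series_integral_zero:
  fixes w :: "'a::euclidean_space \<Rightarrow> complex" and q :: "'a \<Rightarrow> real"
  assumes w: "w \<in> borel_measurable borel" and q: "q \<in> borel_measurable borel"
    and int: "integrable lborel (\<lambda>x. cmod (w x) * exp \<bar>q x\<bar>)"
    and zero: "\<And>k. (LINT x|lborel. w x * of_real (q x ^ k)) = 0"
  shows "(LINT x|lborel. w x * of_real (exp (q x))) = 0"
proof -
  define S where "S n x = (\<Sum>k<n. of_real (1 / fact k) * (w x * of_real (q x ^ k)))" for n x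
  have part: "(\<Sum>k<n. \<bar>t\<bar> ^ k / fact k) \<le> exp \<bar>t\<bar>" for n and t :: real
  proof -
    have "(\<Sum>k<n. \<bar>t\<bar> ^ k /\<^sub>R fact k) \<le> (\<Sum>k. \<bar>t\<bar> ^ k /\<^sub>R fact k)"
      by (rule sum_le_suminf[OF summable_exp_generic]) auto
    then show ?thesis by (simp add: exp_def divide_inverse mult.commute)
  qed
  have tint: "integrable lborel (\<lambda>x. w x * of_real (q x ^ k))" for k
  proof (rule Bochner_Integration.integrable_bound)
    show "integrable lborel (\<lambda>x. fact k * (cmod (w x) * exp \<bar>q x\<bar>))" by (intro integrable_mult_right int)
    show "(\<lambda>x. w x * of_real (q x ^ k)) \<in> borel_measurable lborel" using w q by simp
    show "AE x in lborel. norm (w x * of_real (q x ^ k)) \<le> norm (fact k * (cmod (w x) * exp \<bar>q x\<bar>))"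
    proof (rule AE_I2)
      fix x
      have "\<bar>q x\<bar> ^ k / fact k \<le> (\<Sum>j<Suc k. \<bar>q x\<bar> ^ j / fact j)"
        by (intro member_le_sum) auto
      then have "\<bar>q x\<bar> ^ k / fact k \<le> exp \<bar>q x\<bar>" using part[of "q x" "Suc k"] by linarith
      then have "\<bar>q x\<bar> ^ k \<le> fact k * exp \<bar>q x\<bar>" by (simp add: field_simps)
      then have "cmod (w x) * \<bar>q x\<bar> ^ k \<le> cmod (w x) * (fact k * exp \<bar>q x\<bar>)" by (rule mult_left_mono) simp
      then show "norm (w x * of_real (q x ^ k)) \<le> norm (fact k * (cmod (w x) * exp \<bar>q x\<bar>))"
        by (simp add: norm_mult norm_power power_abs mult_ac)
    qed
  qed
  have "(\<lambda>n. LINT x|lborel. S n x) \<longlonglongrightarrow> (LINT x|lborel. w x * of_real (exp (q x)))"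
  proof (rule integral_dominated_convergence[where w="\<lambda>x. cmod (w x) * exp \<bar>q x\<bar>"])
    show "(\<lambda>x. w x * of_real (exp (q x))) \<in> borel_measurable lborel" using w q by simp
    show "S n \<in> borel_measurable lborel" for n unfolding S_def[abs_def] using w q by simp
    show "integrable lborel (\<lambda>x. cmod (w x) * exp \<bar>q x\<bar>)" by (rule int)
    show "AE x in lborel. (\<lambda>n. S n x) \<longlonglongrightarrow> w x * of_real (exp (q x))"
    proof (rule AE_I2)
      fix x
      have "(\<lambda>n. \<Sum>k<n. q x ^ k /\<^sub>R fact k) \<longlonglongrightarrow> exp (q x)" using exp_converges[of "q x"] by (simp add: sums_def)
      then have "(\<lambda>n. w x * of_real (\<Sum>k<n. q x ^ k /\<^sub>R fact k)) \<longlonglongrightarrow> w x * of_real (exp (q x))"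
        by (intro tendsto_intros)
      moreover have "w x * of_real (\<Sum>k<n. q x ^ k /\<^sub>R fact k) = S n x" for n
        unfolding S_def of_real_sum sum_distrib_left by (intro sum.cong) (simp_all add: divide_inverse)
      ultimately show "(\<lambda>n. S n x) \<longlonglongrightarrow> w x * of_real (exp (q x))" by simp
    qed
    show "AE x in lborel. norm (S n x) \<le> cmod (w x) * exp \<bar>q x\<bar>" for n
    proof (rule AE_I2)
      fix x
      have "norm (S n x) \<le> (\<Sum>k<n. cmod (w x) * (\<bar>q x\<bar> ^ k / fact k))"
        unfolding S_def by (rule sum_norm_le) (simp add: norm_mult norm_power power_abs norm_divide)
      also have "\<dots> \<le> cmod (w x) * exp \<bar>q x\<bar>"
        unfolding sum_distrib_left[symmetric] by (intro mult_left_mono part) simp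
      finally show "norm (S n x) \<le> cmod (w x) * exp \<bar>q x\<bar>" .
    qed
  qed
  moreover have "(LINT x|lborel. S n x) = 0" for n
    unfolding S_def by (subst Bochner_Integration.integral_sum) (simp_all only: integrable_mult_right tint integral_mult_right_zero zero mult_zero_right sum.neutral_const)
  ultimately show ?thesis by (simp add: LIMSEQ_const_iff)
qed

text \<open>A Schwartz function orthogonal to all Hermite functions is zero. The set of these functions is
  closed under multiplication by polynomials, so it is orthogonal to all products of polynomials with the
  Gaussian. From these one reaches narrow Gaussians about arbitrary points, which recover point
  values in the limit.\<close>

definition hermite_null :: "('a::euclidean_space \<Rightarrow> complex) set" where
  "hermite_null = {f \<in> schwartz. \<forall>\<alpha>\<in>multi_indices. pairing lborel f (hermite \<alpha>) = 0}"

lemma hermite_null_schwartz: "f \<in> hermite_null \<Longrightarrow> f \<in> schwartz"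
  by (simp add: hermite_null_def)

lemma function_space_hermite_null: "function_space hermite_null"
  unfolding function_space_def
proof (intro conjI ballI allI)
  show "(\<lambda>_. 0) \<in> hermite_null" by (simp add: hermite_null_def zero_in_schwartz pairing_def)
  fix f g :: "'a \<Rightarrow> complex" and a b assume fg: "f \<in> hermite_null" "g \<in> hermite_null"
  then have S: "f \<in> schwartz" "g \<in> schwartz" by (simp_all add: hermite_null_def)
  have "pairing lborel (\<lambda>x. a * f x + b * g x) (hermite \<alpha>) = 0" if "\<alpha> \<in> multi_indices" for \<alpha>
    unfolding pairing_lincomb(1)[OF S hermite_schwartz] using fg that by (simp add: hermite_null_def)
  then show "(\<lambda>x. a * f x + b * g x) \<in> hermite_null" by (simp add: hermite_null_def schwartz_lincomb[OF S])
qed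

lemma hermite_null_coord:
  assumes f: "f \<in> hermite_null" and c: "c \<in> Basis"
  shows "coord c f \<in> hermite_null"
proof -
  have "pairing lborel (coord c f) (hermite \<alpha>) = 0" if "\<alpha> \<in> multi_indices" for \<alpha>
    unfolding pairing_coord coord_hermite[OF c]
      pairing_lincomb(2)[OF hermite_schwartz hermite_schwartz hermite_null_schwartz[OF f]]
    using f that c by (simp add: hermite_null_def)
  then show ?thesis using coord_schwartz[OF hermite_null_schwartz[OF f] c] by (simp add: hermite_null_def)
qed

lemma sum_coord: "(\<Sum>c\<in>Basis. of_real (a \<bullet> c) * coord c g x) = of_real (x \<bullet> a) * g x"
proof -
  have "(\<Sum>c\<in>Basis. of_real (a \<bullet> c) * coord c g x) = (\<Sum>c\<in>Basis. of_real ((x \<bullet> c) * (a \<bullet> c))) * g x"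
    unfolding sum_distrib_right by (intro sum.cong) (simp_all add: coord_def)
  then show ?thesis by (simp only: of_real_sum[symmetric] euclidean_inner[symmetric])
qed

lemma hermite_null_inner_power:
  assumes "f \<in> hermite_null"
  shows "(\<lambda>x. f x * of_real ((x \<bullet> a) ^ k)) \<in> hermite_null"
proof (induction k)
  case (Suc k)
  let ?g = "\<lambda>x. f x * of_real ((x \<bullet> a) ^ k)"
  have "(\<lambda>x. \<Sum>c\<in>Basis. of_real (a \<bullet> c) * coord c ?g x) \<in> hermite_null"
    by (rule function_space_sum[OF function_space_hermite_null finite_Basis hermite_null_coord[OF Suc]])
  moreover have "(\<Sum>c\<in>Basis. of_real (a \<bullet> c) * coord c ?g x) = f x * of_real ((x \<bullet> a) ^ Suc k)" for x
    unfolding sum_coord by simp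
  ultimately show ?case by simp
qed (use assms in simp)

lemma hermite_null_norm_power:
  assumes "f \<in> hermite_null"
  shows "(\<lambda>x. f x * of_real ((norm x ^ 2) ^ k)) \<in> hermite_null"
proof (induction k)
  case (Suc k)
  let ?g = "\<lambda>x. f x * of_real ((norm x ^ 2) ^ k)"
  have "(\<lambda>x. \<Sum>c\<in>Basis. 1 * coord c (coord c ?g) x) \<in> hermite_null"
    by (rule function_space_sum[OF function_space_hermite_null finite_Basis hermite_null_coord[OF hermite_null_coord[OF Suc]]])
  moreover have "(\<Sum>c\<in>Basis. 1 * coord c (coord c ?g) x) = f x * of_real ((norm x ^ 2) ^ Suc k)" for x
  proof -
    have "(\<Sum>c\<in>Basis. 1 * coord c (coord c ?g) x) = (\<Sum>c\<in>Basis. of_real (x \<bullet> c) * coord c ?g x)"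
      by (simp add: coord_def)
    then show ?thesis unfolding sum_coord by (simp add: power2_norm_eq_inner)
  qed
  ultimately show ?case by simp
qed (use assms in simp)

text \<open>The power series of \<open>exp (- s |x|\<^sup>2 / 4)\<close> may be integrated term by term against the
  weight \<open>exp (- s |x|\<^sup>2 / 2)\<close>, which passes from the parameter \<open>s\<close> to \<open>3 s / 2\<close>. Repeating
  this step gives arbitrarily narrow Gaussians.\<close>

lemma hermite_null_gauss:
  fixes f :: "'a::euclidean_space \<Rightarrow> complex"
  assumes "f \<in> hermite_null"
  shows "(LINT x|lborel. f x * of_real (gauss ((3/2) ^ n) x)) = 0"
  using assms
proof (induction n arbitrary: f)
  case 0
  have "pairing lborel f (hermite ground_state) = 0"
    using 0 by (simp add: hermite_null_def ground_state_def multi_indices_def)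
  then show ?case by (simp add: pairing_def hermite_ground_state)
next
  case (Suc n)
  define s :: real where "s = (3/2) ^ n"
  have s: "s > 0" by (simp add: s_def)
  define w where "w x = f x * of_real (gauss s x)" for x
  define q where "q x = - (s / 4) * norm x ^ 2" for x :: 'a
  note fS = hermite_null_schwartz[OF Suc.prems]
  note [measurable] = schwartz_measurable[OF fS]
  have "(LINT x|lborel. w x * of_real (exp (q x))) = 0"
  proof (rule exp_series_integral_zero)
    show "w \<in> borel_measurable borel"
      unfolding w_def[abs_def] by measurable
    show "q \<in> borel_measurable borel" unfolding q_def[abs_def] by measurable
    show "integrable lborel (\<lambda>x. cmod (w x) * exp \<bar>q x\<bar>)"
    proof (rule Bochner_Integration.integrable_bound[OF integrable_norm[OF schwartz_integrable[OF fS]]])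
      show "(\<lambda>x. cmod (w x) * exp \<bar>q x\<bar>) \<in> borel_measurable lborel"
        unfolding w_def[abs_def] q_def[abs_def] by measurable
      show "AE x in lborel. norm (cmod (w x) * exp \<bar>q x\<bar>) \<le> norm (norm (f x))"
      proof (rule AE_I2)
        fix x
        have "gauss s x * exp \<bar>q x\<bar> = exp (- s * norm x ^ 2 / 4)"
          using s by (simp add: gauss_def q_def abs_mult exp_add[symmetric] field_simps)
        also have "\<dots> \<le> 1" using s by simp
        finally have "cmod (f x) * (gauss s x * exp \<bar>q x\<bar>) \<le> cmod (f x) * 1" by (rule mult_left_mono) simp
        then show "norm (cmod (w x) * exp \<bar>q x\<bar>) \<le> norm (norm (f x))"
          by (simp add: w_def norm_mult gauss_def mult_ac)
      qed
    qed
    fix k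
    have "(LINT x|lborel. w x * of_real (q x ^ k))
        = (LINT x|lborel. of_real ((- (s / 4)) ^ k) * ((\<lambda>x. f x * of_real ((norm x ^ 2) ^ k)) x * of_real (gauss s x)))"
      by (rule Bochner_Integration.integral_cong[OF refl]) (simp only: w_def q_def power_mult_distrib of_real_mult mult_ac)
    also have "\<dots> = 0"
      unfolding integral_mult_right_zero s_def using Suc.IH[OF hermite_null_norm_power[OF Suc.prems, of k]] by simp
    finally show "(LINT x|lborel. w x * of_real (q x ^ k)) = 0" .
  qed
  moreover have "w x * of_real (exp (q x)) = f x * of_real (gauss ((3/2) ^ Suc n) x)" for x
  proof -
    have "gauss s x * exp (q x) = gauss ((3/2) * s) x"
      unfolding gauss_def q_def exp_add[symmetric] by (simp add: field_simps)
    then show ?thesis by (simp add: w_def s_def mult.assoc of_real_mult[symmetric] del: of_real_mult)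
  qed
  ultimately show ?case by simp
qed

text \<open>The Gaussian about \<open>a\<close> is the one about the origin times \<open>exp (s (x \<bullet> a))\<close> and a constant, and the power
  series of this factor is integrable against the Gaussian.\<close>

lemma hermite_null_gauss_shift:
  fixes f :: "'a::euclidean_space \<Rightarrow> complex"
  assumes f: "f \<in> hermite_null"
  shows "(LINT x|lborel. f x * of_real (gauss ((3/2) ^ n) (x - a))) = 0"
proof -
  define s :: real where "s = (3/2) ^ n"
  have s: "s > 0" by (simp add: s_def)
  define w where "w x = f x * of_real (gauss s x)" for x
  define q where "q x = s * (x \<bullet> a)" for x :: 'a
  note fS = hermite_null_schwartz[OF f]
  note [measurable] = schwartz_measurable[OF fS]
  have "(LINT x|lborel. w x * of_real (exp (q x))) = 0"
  proof (rule exp_series_integral_zero)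
    show "w \<in> borel_measurable borel"
      unfolding w_def[abs_def] by measurable
    show "q \<in> borel_measurable borel" unfolding q_def[abs_def] by measurable
    show "integrable lborel (\<lambda>x. cmod (w x) * exp \<bar>q x\<bar>)"
    proof (rule Bochner_Integration.integrable_bound)
      show "integrable lborel (\<lambda>x. exp (s * norm a ^ 2 / 2) * norm (f x))"
        by (intro integrable_mult_right integrable_norm schwartz_integrable fS)
      show "(\<lambda>x. cmod (w x) * exp \<bar>q x\<bar>) \<in> borel_measurable lborel"
        unfolding w_def[abs_def] q_def[abs_def] by measurable
      show "AE x in lborel. norm (cmod (w x) * exp \<bar>q x\<bar>) \<le> norm (exp (s * norm a ^ 2 / 2) * norm (f x))"
      proof (rule AE_I2)
        fix x :: 'a
        have "0 \<le> (norm x - norm a)\<^sup>2" by simp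
        then have "norm x * norm a \<le> norm x ^ 2 / 2 + norm a ^ 2 / 2" by (simp add: power2_eq_square algebra_simps)
        then have "\<bar>x \<bullet> a\<bar> \<le> norm x ^ 2 / 2 + norm a ^ 2 / 2" using Cauchy_Schwarz_ineq2[of x a] by linarith
        then have "s * \<bar>x \<bullet> a\<bar> \<le> s * (norm x ^ 2 / 2 + norm a ^ 2 / 2)" using s by (intro mult_left_mono) auto
        then have "gauss s x * exp \<bar>q x\<bar> \<le> exp (s * norm a ^ 2 / 2)"
          using s unfolding gauss_def q_def exp_add[symmetric] by (simp add: abs_mult distrib_left)
        then have "cmod (f x) * (gauss s x * exp \<bar>q x\<bar>) \<le> cmod (f x) * exp (s * norm a ^ 2 / 2)"
          by (rule mult_left_mono) simp
        then show "norm (cmod (w x) * exp \<bar>q x\<bar>) \<le> norm (exp (s * norm a ^ 2 / 2) * norm (f x))"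
          by (simp add: w_def norm_mult gauss_def mult_ac)
      qed
    qed
    fix k
    have "(LINT x|lborel. w x * of_real (q x ^ k))
        = (LINT x|lborel. of_real (s ^ k) * ((\<lambda>x. f x * of_real ((x \<bullet> a) ^ k)) x * of_real (gauss s x)))"
      by (rule Bochner_Integration.integral_cong[OF refl]) (simp only: w_def q_def power_mult_distrib of_real_mult mult_ac)
    also have "\<dots> = 0"
      unfolding integral_mult_right_zero s_def using hermite_null_gauss[OF hermite_null_inner_power[OF f, of a k], of n] by simp
    finally show "(LINT x|lborel. w x * of_real (q x ^ k)) = 0" .
  qed
  moreover have "f x * of_real (gauss s (x - a)) = of_real (exp (- s * norm a ^ 2 / 2)) * (w x * of_real (exp (q x)))" for x
  proof -
    have eq: "norm (x - a) ^ 2 = norm x ^ 2 - 2 * (x \<bullet> a) + norm a ^ 2"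
      by (simp add: power2_norm_eq_inner inner_diff_left inner_diff_right inner_commute)
    have "gauss s (x - a) = exp (- s * norm a ^ 2 / 2) * (gauss s x * exp (q x))"
      unfolding gauss_def q_def exp_add[symmetric] eq by (simp add: field_simps)
    then show ?thesis by (simp add: w_def mult_ac)
  qed
  ultimately show ?thesis unfolding s_def[symmetric] by simp
qed

text \<open>After rescaling, the Gaussians about \<open>a\<close> become a fixed Gaussian integrated against the values of \<open>f\<close>
  near \<open>a\<close>.\<close>

lemma hermite_null_zero:
  fixes f :: "'a::euclidean_space \<Rightarrow> complex"
  assumes f: "f \<in> hermite_null"
  shows "f a = 0"
proof -
  note fS = hermite_null_schwartz[OF f]
  note fm = schwartz_measurable[OF fS]
  \<comment> \<open>The width of the Gaussian with parameter \<open>(3/2) ^ n\<close>.\<close>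
  define c :: "nat \<Rightarrow> real" where "c n = sqrt ((2/3) ^ n)" for n
  have c: "c n > 0" "(3/2) ^ n * (c n)\<^sup>2 = 1" for n
    by (simp_all add: c_def power_mult_distrib[symmetric])
  have zero: "(LINT y|lborel. f (a + c n *\<^sub>R y) * of_real (gauss 1 y)) = 0" for n
  proof -
    let ?h = "\<lambda>x. f x * of_real (gauss ((3/2) ^ n) (x - a))"
    have "?h \<in> borel_measurable borel"
      using fm measurable_compose[OF _ gauss_measurable, of "\<lambda>x. x - a" borel "(3/2) ^ n"] by simp
    from lborel_integral_affine[OF this, of "c n" a] c(1)[of n] hermite_null_gauss_shift[OF f, of n a]
    have "(LINT y|lborel. ?h (a + c n *\<^sub>R y)) = 0" by simp
    moreover have "gauss ((3/2) ^ n) (c n *\<^sub>R y) = gauss 1 y" for y :: 'a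
      using c(2)[of n] by (simp add: gauss_def power_mult_distrib mult.assoc[symmetric])
    ultimately show ?thesis by simp
  qed
  have "(\<lambda>n. sqrt ((2/3 :: real) ^ n)) \<longlonglongrightarrow> sqrt 0"
    by (intro tendsto_real_sqrt LIMSEQ_realpow_zero) auto
  then have c0: "c \<longlonglongrightarrow> 0" by (simp add: c_def[abs_def])
  define S where "S n y = f (a + c n *\<^sub>R y) * of_real (gauss 1 y)" for n y
  have "(\<lambda>n. LINT y|lborel. S n y) \<longlonglongrightarrow> (LINT y|lborel. f a * of_real (gauss 1 (y :: 'a)))"
  proof (rule integral_dominated_convergence[where w="\<lambda>y. snorm 0 f * gauss 1 y"])
    show "(\<lambda>y. f a * of_real (gauss 1 y)) \<in> borel_measurable lborel" using gauss_measurable by simp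
    show "S n \<in> borel_measurable lborel" for n
      unfolding S_def[abs_def] using fm by measurable
    show "integrable lborel (\<lambda>y::'a. snorm 0 f * gauss 1 y)" by (intro integrable_mult_right gauss_integrable)
    show "AE y in lborel. (\<lambda>n. S n y) \<longlonglongrightarrow> f a * of_real (gauss 1 y)"
    proof (rule AE_I2)
      fix y :: 'a
      have "(\<lambda>n. a + c n *\<^sub>R y) \<longlonglongrightarrow> a + 0 *\<^sub>R y" by (intro tendsto_intros c0)
      moreover have "isCont f a" by (rule differentiable_imp_continuous_within[OF schwartz_differentiable0[OF fS]])
      ultimately have "(\<lambda>n. f (a + c n *\<^sub>R y)) \<longlonglongrightarrow> f a" by (intro isCont_tendsto_compose[of a f]) auto
      then show "(\<lambda>n. S n y) \<longlonglongrightarrow> f a * of_real (gauss 1 y)"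
        unfolding S_def by (rule tendsto_mult_right)
    qed
    show "AE y in lborel. norm (S n y) \<le> snorm 0 f * gauss 1 y" for n
    proof (rule AE_I2)
      fix y :: 'a
      have "cmod (f (a + c n *\<^sub>R y)) * gauss 1 y \<le> snorm 0 f * gauss 1 y"
        using snorm_bound0[OF fS, of 0 0 "a + c n *\<^sub>R y"] by (intro mult_right_mono) (auto simp: gauss_def)
      then show "norm (S n y) \<le> snorm 0 f * gauss 1 y"
        by (simp add: S_def norm_mult gauss_def)
    qed
  qed
  then have "(LINT y|lborel. f a * of_real (gauss 1 (y :: 'a))) = 0"
    unfolding S_def zero by (simp add: LIMSEQ_const_iff)
  then have "f a * of_real (LINT y|lborel. gauss 1 (y :: 'a)) = 0" by simp
  moreover have "(LINT y|lborel. gauss 1 (y :: 'a)) > 0"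
    by (rule positive_integral_pos[OF gauss_integrable]) (simp add: gauss_def)
  ultimately show ?thesis by simp
qed

section \<open>Hermite expansions\<close>

definition hermite_coeff :: "('a::euclidean_space \<Rightarrow> nat) \<Rightarrow> ('a \<Rightarrow> complex) \<Rightarrow> complex" where
  "hermite_coeff \<alpha> f = pairing lborel f (hermite \<alpha>) / hermite_norm TYPE('a)"

lemma sfunctional_hermite_coeff: "sfunctional (hermite_coeff \<alpha>)"
  using sfunctional_scale[OF sfunctional_pairing[OF hermite_schwartz[of \<alpha>]], of "1 / hermite_norm TYPE('a)"]
  by (simp add: hermite_coeff_def[abs_def])

lemma hermite_coeff_hermite:
  assumes "\<alpha> \<in> multi_indices" "\<beta> \<in> multi_indices"
  shows "hermite_coeff \<alpha> (hermite \<beta>) = (if \<alpha> = \<beta> then 1 else 0)"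
  using assms hermite_orthogonal[OF assms(2,1)] hermite_norm_eq[OF assms(1)] hermite_norm_neq_0
  by (auto simp: hermite_coeff_def)

text \<open>One plus the sum of the number operators; its eigenvalue on \<open>hermite \<alpha>\<close> is the weight of \<open>\<alpha>\<close>.
  The unit factors present it as a linear combination with explicit coefficients, the form in which linearity
  is stated.\<close>

definition harmonic_op :: "('a::euclidean_space \<Rightarrow> complex) \<Rightarrow> 'a \<Rightarrow> complex" where
  "harmonic_op f = (\<lambda>x. 1 * f x + 1 * (\<Sum>c\<in>Basis. 1 * number_op c f x))"

lemma harmonic_op_schwartz: "f \<in> schwartz \<Longrightarrow> harmonic_op f \<in> schwartz"
  unfolding harmonic_op_def
  by (rule schwartz_lincomb[OF _ schwartz_sum]) (simp_all add: number_op_schwartz)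

lemma pairing_harmonic_op:
  assumes f: "f \<in> schwartz"
  shows "pairing lborel (harmonic_op f) (hermite \<alpha>) = of_real (index_weight \<alpha>) * pairing lborel f (hermite \<alpha>)"
proof -
  have n: "pairing lborel (number_op c f) (hermite \<alpha>) = of_nat (\<alpha> c) * pairing lborel f (hermite \<alpha>)"
    if c: "c \<in> Basis" for c
  proof -
    have "pairing lborel (number_op c f) (hermite \<alpha>) = pairing lborel f (\<lambda>x. of_nat (\<alpha> c) * hermite \<alpha> x + 0 * hermite \<alpha> x)"
      unfolding pairing_number_op[OF f hermite_schwartz c] number_op_hermite[OF c] by simp
    then show ?thesis unfolding pairing_lincomb(2)[OF hermite_schwartz hermite_schwartz f] by simp
  qed
  have S: "(\<lambda>x. \<Sum>c\<in>Basis. 1 * number_op c f x) \<in> schwartz"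
    by (rule schwartz_sum) (simp_all add: number_op_schwartz f)
  have "pairing lborel (\<lambda>x. \<Sum>c\<in>Basis. 1 * number_op c f x) (hermite \<alpha>)
      = (\<Sum>c\<in>Basis. 1 * pairing lborel (number_op c f) (hermite \<alpha>))"
    by (rule functional_sum[OF sfunctional_linear[OF sfunctional_pairing[OF hermite_schwartz]] function_space_schwartz])
       (simp_all add: number_op_schwartz f)
  also have "\<dots> = of_nat (\<Sum>c\<in>Basis. \<alpha> c) * pairing lborel f (hermite \<alpha>)"
    by (simp add: n sum_distrib_right)
  finally show ?thesis
    unfolding harmonic_op_def pairing_lincomb(1)[OF f S hermite_schwartz]
    by (simp add: index_weight_def distrib_right)
qed

text \<open>Applying \<open>harmonic_op\<close> \<open>N + p\<close> times multiplies the coefficients by that power of the weight,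
  while the coefficients of any Schwartz function grow at most like the power \<open>p\<close>. This bounds the weighted
  coefficients of each \<open>f\<close>; uniformity in \<open>f\<close> comes from uniform boundedness.\<close>

lemma hermite_coeff_decay:
  "\<exists>M::nat. \<forall>\<alpha>. \<forall>f\<in>schwartz. index_weight \<alpha> ^ N * cmod (hermite_coeff \<alpha> f) \<le> real M * snorm M (f :: 'a::euclidean_space \<Rightarrow> complex)"
proof -
  let ?d = "2 * DIM('a)"
  obtain C p where C: "C \<ge> 0" "\<And>\<alpha>. snorm ?d (hermite \<alpha> :: 'a \<Rightarrow> complex) \<le> C * index_weight \<alpha> ^ p"
    by (rule poly_growthD[OF snorm_hermite_growth[of ?d]], rule that)
  have base: "\<exists>B. \<forall>\<alpha>. cmod (pairing lborel g (hermite \<alpha>)) \<le> B * index_weight \<alpha> ^ p"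
    if g: "g \<in> schwartz" for g :: "'a \<Rightarrow> complex"
  proof -
    define K where "K = 2 ^ Suc DIM('a) * snorm 0 g * (LINT x|lborel. poisson_weight (x::'a))"
    have gb: "cmod (g x) \<le> snorm 0 g" for x using snorm_bound0[OF g, of 0 0 x] by simp
    have "(LINT x|lborel. poisson_weight (x::'a)) \<ge> 0"
      by (intro Bochner_Integration.integral_nonneg less_imp_le poisson_weight_pos)
    then have K: "K \<ge> 0" using snorm_nonneg[OF g] by (simp add: K_def)
    have "cmod (pairing lborel g (hermite \<alpha>)) \<le> (K * C) * index_weight \<alpha> ^ p" for \<alpha>
    proof -
      have "cmod (pairing lborel (hermite \<alpha>) g) \<le> K * snorm ?d (hermite \<alpha> :: 'a \<Rightarrow> complex)"
        unfolding pairing_def K_def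
        by (rule schwartz_mult_bounded_integrable(2)[OF hermite_schwartz schwartz_measurable[OF g] gb])
      also have "\<dots> \<le> K * (C * index_weight \<alpha> ^ p)" by (rule mult_left_mono[OF C(2) K])
      finally show ?thesis by (simp add: pairing_commute mult.assoc)
    qed
    then show ?thesis by (intro exI allI)
  qed
  have "\<exists>M::nat. \<forall>\<alpha>. \<forall>f\<in>schwartz. cmod (of_real (index_weight \<alpha> ^ N) * hermite_coeff \<alpha> f) \<le> real M * snorm M (f :: 'a \<Rightarrow> complex)"
  proof (rule sfunctional_equicontinuous)
    show "sfunctional (\<lambda>f. of_real (index_weight \<alpha> ^ N) * hermite_coeff \<alpha> f)" for \<alpha> :: "'a \<Rightarrow> nat"
      by (rule sfunctional_scale[OF sfunctional_hermite_coeff])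
    fix f :: "'a \<Rightarrow> complex" assume f: "f \<in> schwartz"
    have it: "(harmonic_op ^^ k) f \<in> schwartz \<and> (\<forall>\<alpha>. pairing lborel ((harmonic_op ^^ k) f) (hermite \<alpha>)
        = of_real (index_weight \<alpha> ^ k) * pairing lborel f (hermite \<alpha>))" for k
      by (induction k) (simp_all add: f harmonic_op_schwartz pairing_harmonic_op)
    obtain B where B: "\<And>\<alpha>. cmod (pairing lborel ((harmonic_op ^^ (N + p)) f) (hermite \<alpha>)) \<le> B * index_weight \<alpha> ^ p"
      using base[OF conjunct1[OF it]] by auto
    have "cmod (of_real (index_weight \<alpha> ^ N) * hermite_coeff \<alpha> f) \<le> B / cmod (hermite_norm TYPE('a))" for \<alpha>
    proof -
      have w: "index_weight \<alpha> > 0" using index_weight_ge_1[of \<alpha>] by linarith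
      have "index_weight \<alpha> ^ (N + p) * cmod (pairing lborel f (hermite \<alpha>)) \<le> B * index_weight \<alpha> ^ p"
        using B[of \<alpha>] it w by (simp add: norm_mult norm_power)
      then have "(index_weight \<alpha> ^ N * cmod (pairing lborel f (hermite \<alpha>))) * index_weight \<alpha> ^ p \<le> B * index_weight \<alpha> ^ p"
        by (simp add: power_add mult_ac)
      then have "index_weight \<alpha> ^ N * cmod (pairing lborel f (hermite \<alpha>)) \<le> B"
        by (rule mult_right_le_imp_le) (use w in simp)
      then have "index_weight \<alpha> ^ N * cmod (pairing lborel f (hermite \<alpha>)) / cmod (hermite_norm TYPE('a)) \<le> B / cmod (hermite_norm TYPE('a))"
        by (rule divide_right_mono) simp
      then show ?thesis using w by (simp add: hermite_coeff_def norm_mult norm_divide norm_power)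
    qed
    then show "bounded (range (\<lambda>\<alpha>. of_real (index_weight \<alpha> ^ N) * hermite_coeff \<alpha> f))"
      unfolding bounded_iff by auto
  qed
  then obtain M :: nat where M: "\<And>\<alpha> f. f \<in> schwartz \<Longrightarrow>
      cmod (of_real (index_weight \<alpha> ^ N) * hermite_coeff \<alpha> f) \<le> real M * snorm M (f :: 'a \<Rightarrow> complex)" by auto
  have "index_weight \<alpha> ^ N * cmod (hermite_coeff \<alpha> f) \<le> real M * snorm M f" if "f \<in> schwartz" for \<alpha> and f :: "'a \<Rightarrow> complex"
    using M[OF that, of \<alpha>] index_weight_ge_1[of \<alpha>] by (simp add: norm_mult norm_power)
  then show ?thesis by (intro exI[of _ M] allI ballI)
qed

text \<open>The weight dominates each \<open>1 + \<alpha> b\<close>, so its power is at least a product of squares, and the sum of the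
  reciprocals is at most a power of the sum of the inverse squares.\<close>

lemma index_weight_summable:
  "(\<lambda>\<alpha>. 1 / index_weight \<alpha> ^ (2 * DIM('a::euclidean_space))) summable_on (multi_indices :: ('a \<Rightarrow> nat) set)"
proof (rule nonneg_bdd_above_summable_on)
  show "0 \<le> 1 / index_weight \<alpha> ^ (2 * DIM('a))" for \<alpha> :: "'a \<Rightarrow> nat"
    using index_weight_ge_1[of \<alpha>] by simp
  define S :: real where "S = (\<Sum>k. 1 / (1 + real k) ^ 2)"
  have sm: "summable (\<lambda>k. 1 / (1 + real k) ^ 2)"
    using inverse_power_summable[of 2, where 'a=real] summable_Suc_iff[of "\<lambda>n. inverse (real n ^ 2)"]
    by (simp add: divide_inverse add.commute)
  have partS: "(\<Sum>k\<le>n. 1 / (1 + real k) ^ 2) \<le> S" for n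
    unfolding S_def by (rule sum_le_suminf[OF sm]) auto
  show "bdd_above (sum (\<lambda>\<alpha>. 1 / index_weight \<alpha> ^ (2 * DIM('a))) ` {F. F \<subseteq> (multi_indices :: ('a \<Rightarrow> nat) set) \<and> finite F})"
  proof (rule bdd_aboveI[where M="S ^ DIM('a)"], elim imageE CollectE conjE, hypsubst)
    fix F :: "('a \<Rightarrow> nat) set" assume F: "F \<subseteq> multi_indices" "finite F"
    define n where "n = Max (insert 0 ((\<lambda>(\<alpha>, b). \<alpha> b) ` (F \<times> Basis)))"
    have n: "\<alpha> b \<le> n" if "\<alpha> \<in> F" "b \<in> Basis" for \<alpha> b
      unfolding n_def using F(2) that by (intro Max_ge) (auto intro!: image_eqI[of _ _ "(\<alpha>, b)"])
    have sub: "F \<subseteq> Basis \<rightarrow>\<^sub>E {..n}"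
      using F(1) n by (auto simp: multi_indices_def PiE_iff)
    have fin: "finite ((Basis :: 'a set) \<rightarrow>\<^sub>E {..n})" by (intro finite_PiE) auto
    have "sum (\<lambda>\<alpha>. 1 / index_weight \<alpha> ^ (2 * DIM('a))) F \<le> (\<Sum>\<alpha>\<in>F. \<Prod>b\<in>Basis. 1 / (1 + real (\<alpha> b)) ^ 2)"
    proof (rule sum_mono)
      fix \<alpha> assume "\<alpha> \<in> F"
      have "(\<Prod>b\<in>(Basis :: 'a set). (1 + real (\<alpha> b)) ^ 2) \<le> (\<Prod>b\<in>(Basis :: 'a set). index_weight \<alpha> ^ 2)"
        using index_le_weight[of _ \<alpha>] by (intro prod_mono conjI power_mono) (auto simp: add.commute)
      also have "\<dots> = index_weight \<alpha> ^ (2 * DIM('a))" by (simp add: power_mult)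
      finally have le: "(\<Prod>b\<in>(Basis :: 'a set). (1 + real (\<alpha> b)) ^ 2) \<le> index_weight \<alpha> ^ (2 * DIM('a))" .
      have "0 < (\<Prod>b\<in>(Basis :: 'a set). (1 + real (\<alpha> b)) ^ 2)" by (intro prod_pos) auto
      then have "1 / index_weight \<alpha> ^ (2 * DIM('a)) \<le> 1 / (\<Prod>b\<in>(Basis :: 'a set). (1 + real (\<alpha> b)) ^ 2)"
        using le by (intro divide_left_mono mult_pos_pos) auto
      also have "\<dots> = (\<Prod>b\<in>Basis. 1 / (1 + real (\<alpha> b)) ^ 2)" by (simp add: prod_dividef)
      finally show "1 / index_weight \<alpha> ^ (2 * DIM('a)) \<le> (\<Prod>b\<in>Basis. 1 / (1 + real (\<alpha> b)) ^ 2)" .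
    qed
    also have "\<dots> \<le> (\<Sum>\<alpha>\<in>(Basis :: 'a set) \<rightarrow>\<^sub>E {..n}. \<Prod>b\<in>Basis. 1 / (1 + real (\<alpha> b)) ^ 2)"
      by (intro sum_mono2 fin sub prod_nonneg) auto
    also have "\<dots> = (\<Prod>b\<in>(Basis :: 'a set). \<Sum>k\<le>n. 1 / (1 + real k) ^ 2)"
      by (rule prod_sum_PiE[symmetric]) auto
    also have "\<dots> \<le> (\<Prod>b\<in>(Basis :: 'a set). S)"
      by (intro prod_mono conjI partS sum_nonneg) auto
    finally show "sum (\<lambda>\<alpha>. 1 / index_weight \<alpha> ^ (2 * DIM('a))) F \<le> S ^ DIM('a)" by simp
  qed
qed

lemma summable_hermite:
  fixes c :: "('a::euclidean_space \<Rightarrow> nat) \<Rightarrow> complex"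
  assumes "\<And>N. \<exists>C. \<forall>\<alpha>\<in>multi_indices. index_weight \<alpha> ^ N * cmod (c \<alpha>) \<le> C"
  shows "schwartz_summable (\<lambda>\<alpha> x. c \<alpha> * hermite \<alpha> x) multi_indices"
  unfolding schwartz_summable_def
proof (intro conjI ballI allI)
  show cS: "(\<lambda>x. c \<alpha> * hermite \<alpha> x) \<in> schwartz" for \<alpha> by (rule schwartz_ops(3)[OF hermite_schwartz hermite_schwartz])
  fix m
  obtain C p where C: "C \<ge> 0" "\<And>\<alpha>. snorm m (hermite \<alpha> :: 'a \<Rightarrow> complex) \<le> C * index_weight \<alpha> ^ p"
    by (rule poly_growthD[OF snorm_hermite_growth[of m]], rule that)
  obtain D where D: "\<forall>\<alpha>\<in>multi_indices. index_weight \<alpha> ^ (p + 2 * DIM('a)) * cmod (c \<alpha>) \<le> D"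
    using assms[of "p + 2 * DIM('a)"] by (elim exE)
  show "(\<lambda>\<alpha>. snorm m (\<lambda>x. c \<alpha> * hermite \<alpha> x)) summable_on multi_indices"
  proof (rule summable_on_comparison_test)
    show "(\<lambda>\<alpha>. (C * D) * (1 / index_weight \<alpha> ^ (2 * DIM('a)))) summable_on (multi_indices :: ('a \<Rightarrow> nat) set)"
      by (rule summable_on_cmult_right[OF index_weight_summable])
    fix \<alpha> :: "'a \<Rightarrow> nat" assume \<alpha>: "\<alpha> \<in> multi_indices"
    show "0 \<le> snorm m (\<lambda>x. c \<alpha> * hermite \<alpha> x)" by (rule snorm_nonneg[OF cS])
    have w: "index_weight \<alpha> > 0" using index_weight_ge_1[of \<alpha>] by linarith
    have "snorm m (\<lambda>x. c \<alpha> * hermite \<alpha> x) \<le> cmod (c \<alpha>) * snorm m (hermite \<alpha> :: 'a \<Rightarrow> complex)"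
      by (rule seminorm_ops(3)[OF seminorm_on_snorm hermite_schwartz hermite_schwartz])
    also have "\<dots> \<le> cmod (c \<alpha>) * (C * index_weight \<alpha> ^ p)" by (rule mult_left_mono[OF C(2)]) simp
    also have "\<dots> = C * (index_weight \<alpha> ^ (p + 2 * DIM('a)) * cmod (c \<alpha>)) * (1 / index_weight \<alpha> ^ (2 * DIM('a)))"
      using w by (simp add: power_add)
    also have "\<dots> \<le> (C * D) * (1 / index_weight \<alpha> ^ (2 * DIM('a)))"
      using D \<alpha> w by (intro mult_right_mono mult_left_mono C(1)) auto
    finally show "snorm m (\<lambda>x. c \<alpha> * hermite \<alpha> x) \<le> (C * D) * (1 / index_weight \<alpha> ^ (2 * DIM('a)))" .
  qed
qed

lemma has_sum_single:
  fixes f :: "'i \<Rightarrow> complex"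
  assumes "a \<in> I" "\<And>i. i \<in> I \<Longrightarrow> i \<noteq> a \<Longrightarrow> f i = 0"
  shows "(f has_sum f a) I"
proof -
  have "(f has_sum f a) {a}" using has_sum_finite[of "{a}" f] by simp
  also have "?this \<longleftrightarrow> (f has_sum f a) I"
    by (rule has_sum_cong_neutral) (use assms in auto)
  finally show ?thesis .
qed

lemma hermite_coeff_series:
  assumes "schwartz_summable (\<lambda>\<alpha> x. c \<alpha> * hermite \<alpha> x) multi_indices" and \<beta>: "\<beta> \<in> multi_indices"
  shows "hermite_coeff \<beta> (\<lambda>x. \<Sum>\<^sub>\<infinity>\<alpha>\<in>multi_indices. c \<alpha> * hermite \<alpha> x) = c \<beta>"
proof -
  have h: "hermite_coeff \<beta> (\<lambda>x. c \<alpha> * hermite \<alpha> x) = c \<alpha> * (if \<beta> = \<alpha> then 1 else 0)" if "\<alpha> \<in> multi_indices" for \<alpha>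
    using functional_ops(3)[OF sfunctional_linear[OF sfunctional_hermite_coeff] hermite_schwartz hermite_schwartz, of \<beta> "c \<alpha>" \<alpha>]
      hermite_coeff_hermite[OF \<beta> that] by simp
  have "((\<lambda>\<alpha>. hermite_coeff \<beta> (\<lambda>x. c \<alpha> * hermite \<alpha> x)) has_sum hermite_coeff \<beta> (\<lambda>x. c \<beta> * hermite \<beta> x)) multi_indices"
    by (rule has_sum_single[OF \<beta>]) (simp add: h)
  then have "hermite_coeff \<beta> (\<lambda>x. \<Sum>\<^sub>\<infinity>\<alpha>\<in>multi_indices. c \<alpha> * hermite \<alpha> x) = hermite_coeff \<beta> (\<lambda>x. c \<beta> * hermite \<beta> x)"
    by (rule has_sum_unique[OF sfunctional_series[OF sfunctional_hermite_coeff assms(1)]])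
  then show ?thesis using h[OF \<beta>] by simp
qed

lemma hermite_coeff_bounded:
  assumes "f \<in> schwartz"
  shows "\<exists>C. \<forall>\<alpha>\<in>multi_indices. index_weight \<alpha> ^ N * cmod (hermite_coeff \<alpha> f) \<le> C"
proof -
  obtain M :: nat where "\<forall>\<alpha>. \<forall>f\<in>schwartz. index_weight \<alpha> ^ N * cmod (hermite_coeff \<alpha> f) \<le> real M * snorm M (f :: 'a \<Rightarrow> complex)"
    using hermite_coeff_decay[of N] by (elim exE)
  then show ?thesis using assms by (intro exI[of _ "real M * snorm M f"]) auto
qed

text \<open>The difference between \<open>f\<close> and its expansion is orthogonal to all Hermite functions.\<close>

lemma hermite_expansion:
  fixes f :: "'a::euclidean_space \<Rightarrow> complex"
  assumes f: "f \<in> schwartz"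
  shows "schwartz_summable (\<lambda>\<alpha> x. hermite_coeff \<alpha> f * hermite \<alpha> x) multi_indices"
    and "(\<lambda>x. \<Sum>\<^sub>\<infinity>\<alpha>\<in>multi_indices. hermite_coeff \<alpha> f * hermite \<alpha> x) = f"
proof -
  show sm: "schwartz_summable (\<lambda>\<alpha> x. hermite_coeff \<alpha> f * hermite \<alpha> x) multi_indices"
    by (rule summable_hermite[OF hermite_coeff_bounded[OF f]])
  let ?g = "\<lambda>x. \<Sum>\<^sub>\<infinity>\<alpha>\<in>multi_indices. hermite_coeff \<alpha> f * hermite \<alpha> x"
  have g: "?g \<in> schwartz" by (rule schwartz_series(1)[OF sm])
  have "(\<lambda>x. ?g x - f x) \<in> hermite_null"
    unfolding hermite_null_def
  proof (intro CollectI conjI ballI)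
    show "(\<lambda>x. ?g x - f x) \<in> schwartz" by (rule schwartz_ops(2)[OF g f])
    fix \<beta> :: "'a \<Rightarrow> nat" assume \<beta>: "\<beta> \<in> multi_indices"
    have "hermite_coeff \<beta> (\<lambda>x. ?g x - f x) = 0"
      unfolding functional_ops(2)[OF sfunctional_linear[OF sfunctional_hermite_coeff] g f] hermite_coeff_series[OF sm \<beta>] by simp
    then show "pairing lborel (\<lambda>x. ?g x - f x) (hermite \<beta>) = 0"
      using hermite_norm_neq_0[where 'a='a] by (simp add: hermite_coeff_def)
  qed
  from hermite_null_zero[OF this] show "?g = f" by (simp add: fun_eq_iff)
qed

lemma sfunctional_hermite_sum:
  assumes T: "sfunctional T" and f: "f \<in> schwartz"
  shows "((\<lambda>\<alpha>. hermite_coeff \<alpha> f * T (hermite \<alpha>)) has_sum T f) multi_indices"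
proof -
  have "((\<lambda>\<alpha>. T (\<lambda>x. hermite_coeff \<alpha> f * hermite \<alpha> x)) has_sum T f) multi_indices"
    using sfunctional_series[OF T hermite_expansion(1)[OF f]] unfolding hermite_expansion(2)[OF f] .
  then show ?thesis
    unfolding functional_ops(3)[OF sfunctional_linear[OF T] hermite_schwartz hermite_schwartz] .
qed

lemma sfunctional_eqI:
  assumes "sfunctional S" "sfunctional T" "\<And>\<alpha>. \<alpha> \<in> multi_indices \<Longrightarrow> S (hermite \<alpha>) = T (hermite \<alpha>)" "f \<in> schwartz"
  shows "S f = T f"
proof -
  have "((\<lambda>\<alpha>. hermite_coeff \<alpha> f * S (hermite \<alpha>)) has_sum T f) multi_indices"
    using sfunctional_hermite_sum[OF assms(2,4)] assms(3) by (simp cong: has_sum_cong)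
  then show ?thesis by (rule has_sum_unique[OF sfunctional_hermite_sum[OF assms(1,4)]])
qed

text \<open>The row \<open>t \<alpha>\<close> is the coefficient sequence of a Schwartz function \<open>K \<alpha>\<close> with seminorms that grow
  polynomially in \<open>\<alpha>\<close>. The operator sends \<open>f\<close> to the series of the \<open>K \<alpha>\<close> with the rapidly decreasing
  Hermite coefficients of \<open>f\<close>.\<close>

lemma matrix_operator:
  fixes t :: "('a::euclidean_space \<Rightarrow> nat) \<Rightarrow> ('a \<Rightarrow> nat) \<Rightarrow> complex"
  assumes t: "\<And>N. \<exists>C M. \<forall>\<alpha>\<in>multi_indices. \<forall>\<beta>\<in>multi_indices. index_weight \<beta> ^ N * cmod (t \<alpha> \<beta>) \<le> C * index_weight \<alpha> ^ M"
  shows "\<exists>A. soperator A \<and> (\<forall>\<alpha>\<in>multi_indices. \<forall>\<beta>\<in>multi_indices. pairing lborel (A (hermite \<alpha>)) (hermite \<beta>) = t \<alpha> \<beta>)"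
proof -
  let ?I = "multi_indices :: ('a \<Rightarrow> nat) set" and ?\<kappa> = "hermite_norm TYPE('a)"
  define K where "K \<alpha> x = (\<Sum>\<^sub>\<infinity>\<beta>\<in>?I. (t \<alpha> \<beta> / ?\<kappa>) * hermite \<beta> x)" for \<alpha> x
  have Ksum: "schwartz_summable (\<lambda>\<beta> x. (t \<alpha> \<beta> / ?\<kappa>) * hermite \<beta> x) ?I" if \<alpha>: "\<alpha> \<in> ?I" for \<alpha>
  proof (rule summable_hermite)
    fix N
    obtain C M where CM: "\<forall>\<alpha>\<in>?I. \<forall>\<beta>\<in>?I. index_weight \<beta> ^ N * cmod (t \<alpha> \<beta>) \<le> C * index_weight \<alpha> ^ M"
      using t[of N] by (elim exE)
    have "index_weight \<beta> ^ N * cmod (t \<alpha> \<beta> / ?\<kappa>) \<le> C * index_weight \<alpha> ^ M / cmod ?\<kappa>" if "\<beta> \<in> ?I" for \<beta>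
      using CM \<alpha> that divide_right_mono[of "index_weight \<beta> ^ N * cmod (t \<alpha> \<beta>)" "C * index_weight \<alpha> ^ M" "cmod ?\<kappa>"]
      by (simp add: norm_divide)
    then show "\<exists>C. \<forall>\<beta>\<in>?I. index_weight \<beta> ^ N * cmod (t \<alpha> \<beta> / ?\<kappa>) \<le> C" by (intro exI ballI)
  qed
  have KS: "K \<alpha> \<in> schwartz" if "\<alpha> \<in> ?I" for \<alpha>
    unfolding K_def[abs_def] by (rule schwartz_series(1)[OF Ksum[OF that]])
  have Kbound: "\<exists>C M. C \<ge> 0 \<and> (\<forall>\<alpha>\<in>?I. snorm m (K \<alpha>) \<le> C * index_weight \<alpha> ^ M)" for m
  proof -
    obtain C p where C: "C \<ge> 0" "\<And>\<alpha>. snorm m (hermite \<alpha> :: 'a \<Rightarrow> complex) \<le> C * index_weight \<alpha> ^ p"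
      by (rule poly_growthD[OF snorm_hermite_growth[of m]], rule that)
    obtain D M where D: "\<forall>\<alpha>\<in>?I. \<forall>\<beta>\<in>?I. index_weight \<beta> ^ (p + 2 * DIM('a)) * cmod (t \<alpha> \<beta>) \<le> D * index_weight \<alpha> ^ M"
      using t[of "p + 2 * DIM('a)"] by (elim exE)
    define W where "W = (\<Sum>\<^sub>\<infinity>\<beta>\<in>?I. 1 / index_weight \<beta> ^ (2 * DIM('a)))"
    define L where "L = real (card (basis_words m :: 'a list set)) * real (Suc m)"
    have W: "W \<ge> 0" unfolding W_def
      by (rule infsum_nonneg) (use index_weight_ge_1 in \<open>auto intro: order_trans[of 0 1]\<close>)
    have "snorm m (K \<alpha>) \<le> \<bar>L * (C * D / cmod ?\<kappa> * W)\<bar> * index_weight \<alpha> ^ M" if \<alpha>: "\<alpha> \<in> ?I" for \<alpha>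
    proof -
      have wa: "index_weight \<alpha> ^ M \<ge> 0" using index_weight_ge_1[of \<alpha>] by simp
      have each: "snorm m (\<lambda>x. (t \<alpha> \<beta> / ?\<kappa>) * hermite \<beta> x) \<le> (C * (D * index_weight \<alpha> ^ M) / cmod ?\<kappa>) * (1 / index_weight \<beta> ^ (2 * DIM('a)))"
        if \<beta>: "\<beta> \<in> ?I" for \<beta>
      proof -
        have w: "index_weight \<beta> > 0" using index_weight_ge_1[of \<beta>] by linarith
        have "snorm m (\<lambda>x. (t \<alpha> \<beta> / ?\<kappa>) * hermite \<beta> x) \<le> cmod (t \<alpha> \<beta> / ?\<kappa>) * snorm m (hermite \<beta> :: 'a \<Rightarrow> complex)"
          by (rule seminorm_ops(3)[OF seminorm_on_snorm hermite_schwartz hermite_schwartz])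
        also have "\<dots> \<le> cmod (t \<alpha> \<beta> / ?\<kappa>) * (C * index_weight \<beta> ^ p)" by (rule mult_left_mono[OF C(2)]) simp
        also have "\<dots> = (C / cmod ?\<kappa> * (1 / index_weight \<beta> ^ (2 * DIM('a)))) * (index_weight \<beta> ^ (p + 2 * DIM('a)) * cmod (t \<alpha> \<beta>))"
          using w by (simp add: power_add norm_divide)
        also have "\<dots> \<le> (C / cmod ?\<kappa> * (1 / index_weight \<beta> ^ (2 * DIM('a)))) * (D * index_weight \<alpha> ^ M)"
          using D \<alpha> \<beta> w C(1) by (intro mult_left_mono) auto
        finally show ?thesis by (simp add: mult_ac)
      qed
      have "snorm m (K \<alpha>) \<le> L * (\<Sum>\<^sub>\<infinity>\<beta>\<in>?I. snorm m (\<lambda>x. (t \<alpha> \<beta> / ?\<kappa>) * hermite \<beta> x))"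
        unfolding K_def[abs_def] L_def by (rule schwartz_series(2)[OF Ksum[OF \<alpha>]])
      also have "\<dots> \<le> L * (\<Sum>\<^sub>\<infinity>\<beta>\<in>?I. (C * (D * index_weight \<alpha> ^ M) / cmod ?\<kappa>) * (1 / index_weight \<beta> ^ (2 * DIM('a))))"
      proof (rule mult_left_mono)
        show "(\<Sum>\<^sub>\<infinity>\<beta>\<in>?I. snorm m (\<lambda>x. (t \<alpha> \<beta> / ?\<kappa>) * hermite \<beta> x))
            \<le> (\<Sum>\<^sub>\<infinity>\<beta>\<in>?I. (C * (D * index_weight \<alpha> ^ M) / cmod ?\<kappa>) * (1 / index_weight \<beta> ^ (2 * DIM('a))))"
          using Ksum[OF \<alpha>] each
          by (intro infsum_mono summable_on_cmult_right index_weight_summable) (simp_all add: schwartz_summable_def)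
      qed (simp add: L_def)
      also have "\<dots> = (L * (C * D / cmod ?\<kappa> * W)) * index_weight \<alpha> ^ M"
        unfolding infsum_cmult_right' W_def by (simp add: mult_ac)
      also have "\<dots> \<le> \<bar>L * (C * D / cmod ?\<kappa> * W)\<bar> * index_weight \<alpha> ^ M"
        by (rule mult_right_mono[OF abs_ge_self wa])
      finally show ?thesis .
    qed
    then show ?thesis by (intro exI[of _ "\<bar>L * (C * D / cmod ?\<kappa> * W)\<bar>"] exI[of _ M] conjI ballI abs_ge_zero)
  qed
  define A where "A f x = (\<Sum>\<^sub>\<infinity>\<alpha>\<in>?I. hermite_coeff \<alpha> f * K \<alpha> x)" for f x
  \<comment> \<open>The decay of the coefficients exceeds the growth of \<open>K \<alpha>\<close> by a summable factor.\<close>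
  have small: "\<exists>n::nat. \<exists>C. C \<ge> 0 \<and> (\<forall>f\<in>schwartz. \<forall>\<alpha>\<in>?I.
      snorm m (\<lambda>x. hermite_coeff \<alpha> f * K \<alpha> x) \<le> C * snorm n f * (1 / index_weight \<alpha> ^ (2 * DIM('a))))" for m
  proof -
    obtain C p where C: "C \<ge> 0" "\<forall>\<alpha>\<in>?I. snorm m (K \<alpha>) \<le> C * index_weight \<alpha> ^ p"
      using Kbound[of m] by (elim exE conjE)
    obtain n :: nat where n: "\<forall>\<alpha>. \<forall>f\<in>schwartz. index_weight \<alpha> ^ (p + 2 * DIM('a)) * cmod (hermite_coeff \<alpha> f) \<le> real n * snorm n (f :: 'a \<Rightarrow> complex)"
      using hermite_coeff_decay[of "p + 2 * DIM('a)"] by (elim exE)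
    have "snorm m (\<lambda>x. hermite_coeff \<alpha> f * K \<alpha> x) \<le> (C * real n) * snorm n f * (1 / index_weight \<alpha> ^ (2 * DIM('a)))"
      if f: "f \<in> schwartz" and \<alpha>: "\<alpha> \<in> ?I" for f \<alpha>
    proof -
      have w: "index_weight \<alpha> > 0" using index_weight_ge_1[of \<alpha>] by linarith
      have "snorm m (\<lambda>x. hermite_coeff \<alpha> f * K \<alpha> x) \<le> cmod (hermite_coeff \<alpha> f) * snorm m (K \<alpha>)"
        by (rule seminorm_ops(3)[OF seminorm_on_snorm KS[OF \<alpha>] KS[OF \<alpha>]])
      also have "\<dots> \<le> cmod (hermite_coeff \<alpha> f) * (C * index_weight \<alpha> ^ p)"
        using C(2) \<alpha> by (intro mult_left_mono) auto
      also have "\<dots> = (C * (1 / index_weight \<alpha> ^ (2 * DIM('a)))) * (index_weight \<alpha> ^ (p + 2 * DIM('a)) * cmod (hermite_coeff \<alpha> f))"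
        using w by (simp add: power_add)
      also have "\<dots> \<le> (C * (1 / index_weight \<alpha> ^ (2 * DIM('a)))) * (real n * snorm n f)"
        using n f w C(1) by (intro mult_left_mono) auto
      finally show ?thesis by (simp add: mult_ac)
    qed
    then show ?thesis using C(1) by (intro exI[of _ n] exI[of _ "C * real n"] conjI ballI) auto
  qed
  have Asum: "schwartz_summable (\<lambda>\<alpha> x. hermite_coeff \<alpha> f * K \<alpha> x) ?I" if f: "f \<in> schwartz" for f
    unfolding schwartz_summable_def
  proof (intro conjI ballI allI)
    show cS: "(\<lambda>x. hermite_coeff \<alpha> f * K \<alpha> x) \<in> schwartz" if "\<alpha> \<in> ?I" for \<alpha>
      by (rule schwartz_ops(3)[OF KS[OF that] KS[OF that]])
    fix m
    obtain n :: nat and C where C: "\<forall>f\<in>schwartz. \<forall>\<alpha>\<in>?I.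
      snorm m (\<lambda>x. hermite_coeff \<alpha> f * K \<alpha> x) \<le> C * snorm n f * (1 / index_weight \<alpha> ^ (2 * DIM('a)))"
      using small[of m] by (elim exE conjE)
    show "(\<lambda>\<alpha>. snorm m (\<lambda>x. hermite_coeff \<alpha> f * K \<alpha> x)) summable_on ?I"
    proof (rule summable_on_comparison_test)
      show "(\<lambda>\<alpha>. (C * snorm n f) * (1 / index_weight \<alpha> ^ (2 * DIM('a)))) summable_on ?I"
        by (rule summable_on_cmult_right[OF index_weight_summable])
      fix \<alpha> assume \<alpha>: "\<alpha> \<in> ?I"
      show "0 \<le> snorm m (\<lambda>x. hermite_coeff \<alpha> f * K \<alpha> x)" by (rule snorm_nonneg[OF cS[OF \<alpha>]])
      show "snorm m (\<lambda>x. hermite_coeff \<alpha> f * K \<alpha> x) \<le> (C * snorm n f) * (1 / index_weight \<alpha> ^ (2 * DIM('a)))"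
        using C f \<alpha> by auto
    qed
  qed
  have AS: "A f \<in> schwartz" if "f \<in> schwartz" for f
    unfolding A_def[abs_def] by (rule schwartz_series(1)[OF Asum[OF that]])
  have Alin: "clinear_map_on schwartz A"
    unfolding clinear_map_on_def
  proof (intro ballI allI ext)
    fix f g :: "'a \<Rightarrow> complex" and a b x assume fg: "f \<in> schwartz" "g \<in> schwartz"
    note s = abs_summable_summable[OF schwartz_summable_pointwise[OF Asum[OF fg(1)]]]
      abs_summable_summable[OF schwartz_summable_pointwise[OF Asum[OF fg(2)]]]
    have "A (\<lambda>x. a * f x + b * g x) x = (\<Sum>\<^sub>\<infinity>\<alpha>\<in>?I. a * (hermite_coeff \<alpha> f * K \<alpha> x) + b * (hermite_coeff \<alpha> g * K \<alpha> x))"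
      unfolding A_def functional_lin[OF sfunctional_linear[OF sfunctional_hermite_coeff] fg] by (simp add: algebra_simps)
    also have "\<dots> = a * A f x + b * A g x"
      unfolding A_def by (subst infsum_add) (auto intro!: summable_on_cmult_right s simp: infsum_cmult_right')
    finally show "A (\<lambda>x. a * f x + b * g x) x = a * A f x + b * A g x" .
  qed
  have "soperator A"
    unfolding soperator_def
  proof (intro conjI ballI allI)
    show "A f \<in> schwartz" if "f \<in> schwartz" for f by (rule AS[OF that])
    show "clinear_map_on schwartz A" by (rule Alin)
    fix m
    obtain n :: nat and C where C: "\<forall>f\<in>schwartz. \<forall>\<alpha>\<in>?I.
      snorm m (\<lambda>x. hermite_coeff \<alpha> f * K \<alpha> x) \<le> C * snorm n f * (1 / index_weight \<alpha> ^ (2 * DIM('a)))"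
      using small[of m] by (elim exE conjE)
    define W where "W = (\<Sum>\<^sub>\<infinity>\<beta>\<in>?I. 1 / index_weight \<beta> ^ (2 * DIM('a)))"
    define L where "L = real (card (basis_words m :: 'a list set)) * real (Suc m)"
    have "snorm m (A f) \<le> (L * (C * W)) * snorm n f" if f: "f \<in> schwartz" for f
    proof -
      have "snorm m (A f) \<le> L * (\<Sum>\<^sub>\<infinity>\<alpha>\<in>?I. snorm m (\<lambda>x. hermite_coeff \<alpha> f * K \<alpha> x))"
        unfolding A_def[abs_def] L_def by (rule schwartz_series(2)[OF Asum[OF f]])
      also have "\<dots> \<le> L * (\<Sum>\<^sub>\<infinity>\<alpha>\<in>?I. (C * snorm n f) * (1 / index_weight \<alpha> ^ (2 * DIM('a))))"
      proof (rule mult_left_mono)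
        show "(\<Sum>\<^sub>\<infinity>\<alpha>\<in>?I. snorm m (\<lambda>x. hermite_coeff \<alpha> f * K \<alpha> x))
            \<le> (\<Sum>\<^sub>\<infinity>\<alpha>\<in>?I. (C * snorm n f) * (1 / index_weight \<alpha> ^ (2 * DIM('a))))"
          using Asum[OF f] C f
          by (intro infsum_mono summable_on_cmult_right index_weight_summable) (simp_all add: schwartz_summable_def)
      qed (simp add: L_def)
      also have "\<dots> = (L * (C * W)) * snorm n f"
        unfolding infsum_cmult_right' W_def by (simp add: mult_ac)
      finally show ?thesis .
    qed
    then show "\<exists>n C. \<forall>f\<in>schwartz. snorm m (A f) \<le> C * snorm n f"
      by (intro exI[of _ n] exI[of _ "L * (C * W)"] ballI)
  qed
  moreover have "pairing lborel (A (hermite \<alpha>)) (hermite \<beta>) = t \<alpha> \<beta>" if \<alpha>: "\<alpha> \<in> ?I" and \<beta>: "\<beta> \<in> ?I" for \<alpha> \<beta>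
  proof -
    have "A (hermite \<alpha>) x = K \<alpha> x" for x
    proof -
      have "((\<lambda>\<gamma>. hermite_coeff \<gamma> (hermite \<alpha>) * K \<gamma> x) has_sum hermite_coeff \<alpha> (hermite \<alpha>) * K \<alpha> x) ?I"
        by (rule has_sum_single[OF \<alpha>]) (simp add: hermite_coeff_hermite \<alpha>)
      then show ?thesis unfolding A_def by (simp add: infsumI hermite_coeff_hermite \<alpha>)
    qed
    then have AK: "A (hermite \<alpha>) = K \<alpha>" by (rule ext)
    have "hermite_coeff \<beta> (K \<alpha>) = t \<alpha> \<beta> / ?\<kappa>"
      unfolding K_def[abs_def] by (rule hermite_coeff_series[OF Ksum[OF \<alpha>] \<beta>])
    then show ?thesis unfolding AK using hermite_norm_neq_0[where 'a='a] by (simp add: hermite_coeff_def)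
  qed
  ultimately show ?thesis by (intro exI[of _ A] conjI ballI)
qed

section \<open>Topologies on Schwartz functions and tempered distributions\<close>

lemma seminorm_on_schwartz_seminorms: "p \<in> schwartz_seminorms \<Longrightarrow> seminorm_on schwartz p"
  by (auto simp: schwartz_seminorms_def intro: seminorm_on_schwartz_seminorm)

lemma schwartz_seminorms_nonempty: "schwartz_seminorms \<noteq> {}"
  by (auto simp: schwartz_seminorms_def)

lemma schwartz_seminorm_dominated:
  assumes "p \<in> schwartz_seminorms"
  shows "\<exists>m. \<forall>n\<ge>m. \<forall>f\<in>schwartz. p f \<le> snorm n f"
proof -
  obtain k vs where p: "p = schwartz_seminorm k vs" "vs \<in> lists Basis"
    using assms by (auto simp: schwartz_seminorms_def)
  then show ?thesis
    by (intro exI[of _ "k + length vs"] allI impI ballI) (auto intro: schwartz_seminorm_le_snorm)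
qed

lemma finite_seminorms_dominated:
  assumes "finite P0" "P0 \<subseteq> schwartz_seminorms"
  shows "\<exists>m. \<forall>p\<in>P0. \<forall>f\<in>schwartz. p f \<le> snorm m f"
proof -
  have "\<forall>p\<in>P0. \<exists>m. \<forall>n\<ge>m. \<forall>f\<in>schwartz. p f \<le> snorm n f"
    using assms(2) schwartz_seminorm_dominated by auto
  then obtain m where m: "\<And>p n f. p \<in> P0 \<Longrightarrow> n \<ge> m p \<Longrightarrow> f \<in> schwartz \<Longrightarrow> p f \<le> snorm n f"
    by metis
  have "m p \<le> (\<Sum>p\<in>P0. m p)" if "p \<in> P0" for p using assms(1) that by (intro member_le_sum) auto
  then show ?thesis using m by (intro exI[of _ "\<Sum>p\<in>P0. m p"] ballI) auto
qed

lemma snorm_le_finite_seminorms: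
  "\<exists>P0 N. finite P0 \<and> P0 \<subseteq> schwartz_seminorms \<and> N \<ge> 0 \<and>
     (\<forall>f\<in>schwartz. snorm m f \<le> N * (\<Sum>p\<in>P0. p (f :: 'a::euclidean_space \<Rightarrow> complex)))"
proof -
  define P0 where "P0 = (\<lambda>(k, vs). schwartz_seminorm k vs) ` ({..m} \<times> (basis_words m :: 'a list set))"
  define N where "N = real (card (basis_words m :: 'a list set)) * real (Suc m)"
  have fin: "finite P0" unfolding P0_def by simp
  have sub: "P0 \<subseteq> schwartz_seminorms" by (auto simp: P0_def schwartz_seminorms_def basis_words_def)
  have "snorm m f \<le> N * (\<Sum>p\<in>P0. p f)" if f: "f \<in> schwartz" for f
  proof -
    have "snorm m f \<le> (\<Sum>vs\<in>(basis_words m :: 'a list set). \<Sum>k\<le>m. (\<Sum>p\<in>P0. p f))"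
      unfolding snorm_def
    proof (intro sum_mono)
      fix vs :: "'a list" and k assume "vs \<in> basis_words m" "k \<in> {..m}"
      then have "schwartz_seminorm k vs \<in> P0" by (auto simp: P0_def)
      then show "schwartz_seminorm k vs f \<le> (\<Sum>p\<in>P0. p f)"
      proof (rule member_le_sum[where f = "\<lambda>p. p f", OF _ _ fin])
        fix p assume "p \<in> P0 - {schwartz_seminorm k vs}"
        then have "p \<in> schwartz_seminorms" using sub by auto
        then show "0 \<le> p f" by (rule seminorm_nonneg[OF seminorm_on_schwartz_seminorms f])
      qed
    qed
    then show ?thesis by (simp add: N_def mult.assoc)
  qed
  then show ?thesis using fin sub by (intro exI[of _ P0] exI[of _ N]) (auto simp: N_def)
qed

text \<open>The norms and the defining seminorms of the Schwartz topology dominate each other.\<close>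

lemma sfunctional_iff_continuous:
  assumes lin: "clinear_functional_on schwartz T"
  shows "continuous_map schwartz_topology euclidean T \<longleftrightarrow> sfunctional T"
proof
  assume "continuous_map schwartz_topology euclidean T"
  then have "\<exists>P0 C. finite P0 \<and> P0 \<subseteq> schwartz_seminorms \<and> C \<ge> 0 \<and> (\<forall>f\<in>schwartz. cmod (T f) \<le> C * (\<Sum>p\<in>P0. p f))"
    unfolding schwartz_topology_def
    by (intro seminorm_continuous_functional_bound[OF _ schwartz_seminorms_nonempty
      function_space_schwartz lin] seminorm_on_schwartz_seminorms)
  then obtain P0 C where P0: "finite P0" "P0 \<subseteq> schwartz_seminorms" and C: "C \<ge> 0" "\<forall>f\<in>schwartz. cmod (T f) \<le> C * (\<Sum>p\<in>P0. p f)"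
    by (elim exE conjE)
  obtain m where m: "\<forall>p\<in>P0. \<forall>f\<in>schwartz. p f \<le> snorm m f" using finite_seminorms_dominated[OF P0] by (elim exE)
  have "cmod (T f) \<le> (C * real (card P0)) * snorm m f" if f: "f \<in> schwartz" for f
  proof -
    have "(\<Sum>p\<in>P0. p f) \<le> (\<Sum>p\<in>P0. snorm m f)" using m f by (intro sum_mono) auto
    then have "C * (\<Sum>p\<in>P0. p f) \<le> C * (real (card P0) * snorm m f)" using C(1) by (intro mult_left_mono) auto
    then show ?thesis using C(2) f by (auto simp: mult.assoc)
  qed
  then show "sfunctional T" unfolding sfunctional_def
    by (intro conjI lin exI[of _ m] exI[of _ "C * real (card P0)"] ballI)
next
  assume T: "sfunctional T"
  obtain C m where C: "C \<ge> 0" "\<And>f. f \<in> schwartz \<Longrightarrow> cmod (T f) \<le> C * snorm m f"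
    by (rule sfunctional_bound[OF T], rule that)
  obtain P0 N where P0: "finite P0" "P0 \<subseteq> schwartz_seminorms" "N \<ge> 0" and
    N: "\<forall>f\<in>schwartz. snorm m f \<le> N * (\<Sum>p\<in>P0. p (f :: 'a \<Rightarrow> complex))"
    using snorm_le_finite_seminorms[of m] by (elim exE conjE)
  show "continuous_map schwartz_topology euclidean T"
    unfolding schwartz_topology_def
  proof (rule seminorm_bound_continuous_functional[OF seminorm_on_schwartz_seminorms schwartz_seminorms_nonempty
      function_space_schwartz lin P0(1,2)])
    show "cmod (T f) \<le> (C * N) * (\<Sum>p\<in>P0. p f)" if "f \<in> schwartz" for f
      using order_trans[OF C(2)[OF that] mult_left_mono[OF N[rule_format, OF that] C(1)]] by (simp add: mult.assoc)
  qed
qed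

lemma soperator_continuous:
  assumes A: "soperator A"
  shows "linear_continuous_map schwartz_topology schwartz_topology A"
  unfolding linear_continuous_map_def topspace_schwartz_topology
proof (intro conjI soperator_linear[OF A])
  show "continuous_map schwartz_topology schwartz_topology A"
    unfolding schwartz_topology_def
  proof (rule seminorm_bound_continuous_map[OF seminorm_on_schwartz_seminorms schwartz_seminorms_nonempty
      function_space_schwartz seminorm_on_schwartz_seminorms schwartz_seminorms_nonempty function_space_schwartz])
    show "A f \<in> schwartz" if "f \<in> schwartz" for f by (rule soperator_schwartz[OF A that])
    show "clinear_map_on schwartz A" by (rule soperator_linear[OF A])
    fix q :: "('b \<Rightarrow> complex) \<Rightarrow> real" assume "q \<in> schwartz_seminorms"
    then obtain k where k: "\<forall>n\<ge>k. \<forall>f\<in>schwartz. q f \<le> snorm n f" using schwartz_seminorm_dominated by auto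
    obtain C n where C: "C \<ge> 0" "\<And>f. f \<in> schwartz \<Longrightarrow> snorm k (A f) \<le> C * snorm n f"
      by (rule soperator_bound[OF A], rule that)
    obtain P0 N where P0: "finite P0" "P0 \<subseteq> schwartz_seminorms" "N \<ge> 0" and
      N: "\<forall>f\<in>schwartz. snorm n f \<le> N * (\<Sum>p\<in>P0. p (f :: 'a \<Rightarrow> complex))"
      using snorm_le_finite_seminorms[of n] by (elim exE conjE)
    have "q (A f) \<le> (C * N) * (\<Sum>p\<in>P0. p f)" if f: "f \<in> schwartz" for f
    proof -
      have "q (A f) \<le> snorm k (A f)" using k soperator_schwartz[OF A f] by auto
      also have "\<dots> \<le> C * snorm n f" by (rule C(2)[OF f])
      also have "\<dots> \<le> C * (N * (\<Sum>p\<in>P0. p f))" using N f by (intro mult_left_mono C(1)) auto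
      finally show ?thesis by (simp add: mult.assoc)
    qed
    then show "\<exists>P0 C. finite P0 \<and> P0 \<subseteq> schwartz_seminorms \<and> (\<forall>f\<in>schwartz. q (A f) \<le> C * (\<Sum>p\<in>P0. p f))"
      by (intro exI[of _ P0] exI[of _ "C * N"] conjI P0(1,2) ballI)
  qed
qed

lemma tempered_iff: "T \<in> tempered \<longleftrightarrow> sfunctional T \<and> (\<forall>f. f \<notin> schwartz \<longrightarrow> T f = 0)"
  using sfunctional_iff_continuous[of T] by (auto simp: tempered_def dest: sfunctional_linear)

lemma tempered_sfunctional: "T \<in> tempered \<Longrightarrow> sfunctional T"
  by (simp add: tempered_iff)

lemma function_space_tempered: "function_space tempered"
  unfolding function_space_def
proof (intro conjI ballI allI)
  have "sfunctional (\<lambda>_. 0)" using sfunctional_scale[OF sfunctional_eval, of 0] by simp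
  then show "(\<lambda>_. 0) \<in> tempered" by (simp add: tempered_iff)
  fix S T :: "('a \<Rightarrow> complex) \<Rightarrow> complex" and a b assume "S \<in> tempered" "T \<in> tempered"
  then show "(\<lambda>f. a * S f + b * T f) \<in> tempered"
    by (simp add: tempered_iff sfunctional_lincomb)
qed

definition strong_seminorms :: "((('a::euclidean_space \<Rightarrow> complex) \<Rightarrow> complex) \<Rightarrow> real) set" where
  "strong_seminorms = {strong_seminorm B |B. bounded_in_schwartz B \<and> B \<noteq> {}}"

lemma tempered_topology_eq: "tempered_topology = seminorm_topology tempered strong_seminorms"
  by (simp add: tempered_topology_def strong_seminorms_def)

lemma bounded_in_schwartz_iff:
  "bounded_in_schwartz B \<longleftrightarrow> B \<subseteq> schwartz \<and> (\<forall>m. \<exists>C. \<forall>f\<in>B. snorm m f \<le> C)"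
proof (intro iffI conjI allI)
  assume B: "bounded_in_schwartz B"
  then show sub: "B \<subseteq> schwartz" by (simp add: bounded_in_schwartz_def)
  fix m
  obtain P0 N where P0: "finite P0" "P0 \<subseteq> schwartz_seminorms" "N \<ge> 0" and
    N: "\<forall>f\<in>schwartz. snorm m f \<le> N * (\<Sum>p\<in>P0. p (f :: 'a \<Rightarrow> complex))"
    using snorm_le_finite_seminorms[of m] by (elim exE conjE)
  have "\<forall>p\<in>P0. \<exists>C. \<forall>f\<in>B. p f \<le> C" using B P0(2) by (auto simp: bounded_in_schwartz_def bdd_above_def)
  then obtain C where C: "\<And>p f. p \<in> P0 \<Longrightarrow> f \<in> B \<Longrightarrow> p f \<le> C p" by metis
  have "snorm m f \<le> N * (\<Sum>p\<in>P0. C p)" if "f \<in> B" for f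
  proof -
    have "N * (\<Sum>p\<in>P0. p f) \<le> N * (\<Sum>p\<in>P0. C p)" using C that by (intro mult_left_mono sum_mono P0(3)) auto
    then show ?thesis using N that sub by force
  qed
  then show "\<exists>C. \<forall>f\<in>B. snorm m f \<le> C" by (intro exI ballI)
next
  assume B: "B \<subseteq> schwartz \<and> (\<forall>m. \<exists>C. \<forall>f\<in>B. snorm m f \<le> C)"
  show "bounded_in_schwartz B" unfolding bounded_in_schwartz_def
  proof (intro conjI ballI)
    show "B \<subseteq> schwartz" using B by simp
    fix p :: "('a \<Rightarrow> complex) \<Rightarrow> real" assume "p \<in> schwartz_seminorms"
    then obtain m where m: "\<forall>n\<ge>m. \<forall>f\<in>schwartz. p f \<le> snorm n f" using schwartz_seminorm_dominated by auto
    obtain C where C: "\<forall>f\<in>B. snorm m f \<le> C" using B by (elim conjE allE[of _ m] exE)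
    have "p f \<le> C" if "f \<in> B" for f
    proof -
      have "f \<in> schwartz" using B that by auto
      then have "p f \<le> snorm m f" using m by simp
      then show ?thesis using C that by force
    qed
    then show "bdd_above (p ` B)" by (intro bdd_aboveI[of _ C]) auto
  qed
qed

lemma sfunctional_bounded_on:
  assumes "sfunctional T" "bounded_in_schwartz B"
  shows "bdd_above ((\<lambda>f. cmod (T f)) ` B)"
proof -
  obtain C m where C: "C \<ge> 0" "\<And>f. f \<in> schwartz \<Longrightarrow> cmod (T f) \<le> C * snorm m f"
    by (rule sfunctional_bound[OF assms(1)], rule that)
  obtain D where D: "\<forall>f\<in>B. snorm m f \<le> D" "B \<subseteq> schwartz" using assms(2) bounded_in_schwartz_iff by blast
  have "cmod (T f) \<le> C * D" if "f \<in> B" for f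
  proof -
    have "cmod (T f) \<le> C * snorm m f" using C(2) D(2) that by auto
    also have "\<dots> \<le> C * D" using D(1) that C(1) by (intro mult_left_mono) auto
    finally show ?thesis .
  qed
  then show ?thesis by (intro bdd_aboveI[of _ "C * D"]) auto
qed

lemma strong_seminorm_upper:
  assumes "sfunctional T" "bounded_in_schwartz B" "f \<in> B"
  shows "cmod (T f) \<le> strong_seminorm B T"
  unfolding strong_seminorm_def by (rule cSUP_upper[OF assms(3) sfunctional_bounded_on[OF assms(1,2)]])

lemma strong_seminorm_least:
  assumes "B \<noteq> {}" "\<And>f. f \<in> B \<Longrightarrow> cmod (T f) \<le> C"
  shows "strong_seminorm B T \<le> C"
  unfolding strong_seminorm_def by (rule cSUP_least[OF assms])

lemma seminorm_on_strong_seminorm: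
  assumes B: "bounded_in_schwartz B" "B \<noteq> {}"
  shows "seminorm_on tempered (strong_seminorm B)"
  unfolding seminorm_on_def
proof (intro conjI ballI allI)
  obtain f0 where f0: "f0 \<in> B" using B(2) by blast
  fix S :: "('a \<Rightarrow> complex) \<Rightarrow> complex" assume S: "S \<in> tempered"
  show "0 \<le> strong_seminorm B S"
    by (rule order_trans[OF norm_ge_zero strong_seminorm_upper[OF tempered_sfunctional[OF S] B(1) f0]])
  fix T :: "('a \<Rightarrow> complex) \<Rightarrow> complex" and a b assume T: "T \<in> tempered"
  show "strong_seminorm B (\<lambda>f. a * S f + b * T f) \<le> cmod a * strong_seminorm B S + cmod b * strong_seminorm B T"
  proof (rule strong_seminorm_least[OF B(2)])
    fix f assume f: "f \<in> B"
    show "cmod (a * S f + b * T f) \<le> cmod a * strong_seminorm B S + cmod b * strong_seminorm B T"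
      by (rule order_trans[OF cmod_lincomb_le])
         (intro add_mono mult_left_mono strong_seminorm_upper[OF tempered_sfunctional[OF S] B(1) f]
           strong_seminorm_upper[OF tempered_sfunctional[OF T] B(1) f] norm_ge_zero)
  qed
qed

lemma seminorm_on_strong_seminorms: "p \<in> strong_seminorms \<Longrightarrow> seminorm_on tempered p"
  by (auto simp: strong_seminorms_def intro: seminorm_on_strong_seminorm)

lemma bounded_in_schwartz_singleton: "f \<in> schwartz \<Longrightarrow> bounded_in_schwartz {f}"
  by (auto simp: bounded_in_schwartz_iff)

lemma strong_seminorms_nonempty: "(strong_seminorms :: ((('a::euclidean_space \<Rightarrow> complex) \<Rightarrow> complex) \<Rightarrow> real) set) \<noteq> {}"
  using bounded_in_schwartz_singleton[OF zero_in_schwartz] by (auto simp: strong_seminorms_def)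

lemma continuous_evaluation:
  assumes "f \<in> schwartz"
  shows "continuous_map tempered_topology euclidean (\<lambda>T. T f)"
  unfolding tempered_topology_eq
proof (rule seminorm_bound_continuous_functional[OF seminorm_on_strong_seminorms strong_seminorms_nonempty function_space_tempered])
  show "clinear_functional_on tempered (\<lambda>T. T f)" by (simp add: clinear_functional_on_def)
  show "finite {strong_seminorm {f}}" by simp
  show "{strong_seminorm {f}} \<subseteq> strong_seminorms"
    using bounded_in_schwartz_singleton[OF assms] by (auto simp: strong_seminorms_def)
  show "cmod (T f) \<le> 1 * (\<Sum>p\<in>{strong_seminorm {f}}. p T)" if "T \<in> tempered" for T
    using strong_seminorm_upper[OF tempered_sfunctional[OF that] bounded_in_schwartz_singleton[OF assms], of f] by simp
qed

lemma soperator_bounded_image: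
  assumes A: "soperator A" and B: "bounded_in_schwartz B"
  shows "bounded_in_schwartz (A ` B)"
  unfolding bounded_in_schwartz_iff
proof (intro conjI allI)
  have sub: "B \<subseteq> schwartz" using B by (simp add: bounded_in_schwartz_def)
  then show "A ` B \<subseteq> schwartz" using soperator_schwartz[OF A] by auto
  fix m
  obtain C n where C: "C \<ge> 0" "\<And>f. f \<in> schwartz \<Longrightarrow> snorm m (A f) \<le> C * snorm n f"
    by (rule soperator_bound[OF A], rule that)
  obtain D where D: "\<forall>f\<in>B. snorm n f \<le> D" using B bounded_in_schwartz_iff by blast
  have "snorm m (A f) \<le> C * D" if "f \<in> B" for f
  proof -
    have "snorm m (A f) \<le> C * snorm n f" using C(2) sub that by auto
    also have "\<dots> \<le> C * D" using D that C(1) by (intro mult_left_mono) auto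
    finally show ?thesis .
  qed
  then show "\<exists>C. \<forall>g\<in>A ` B. snorm m g \<le> C" by (intro exI[of _ "C * D"]) auto
qed

text \<open>Precomposition with \<open>A\<close>, with the default value that distributions have outside the Schwartz space.\<close>

definition transposed ::
    "(('a::euclidean_space \<Rightarrow> complex) \<Rightarrow> 'a \<Rightarrow> complex) \<Rightarrow> (('a \<Rightarrow> complex) \<Rightarrow> complex) \<Rightarrow> ('a \<Rightarrow> complex) \<Rightarrow> complex" where
  "transposed A T = (\<lambda>f. if f \<in> schwartz then T (A f) else 0)"

lemma sfunctional_cong:
  assumes "sfunctional S" "\<And>f. f \<in> schwartz \<Longrightarrow> T f = S f"
  shows "sfunctional T"
proof -
  obtain C m where C: "C \<ge> 0" "\<And>f. f \<in> schwartz \<Longrightarrow> cmod (S f) \<le> C * snorm m f"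
    by (rule sfunctional_bound[OF assms(1)], rule that)
  show ?thesis unfolding sfunctional_def clinear_functional_on_def
  proof (intro conjI ballI allI exI[of _ m] exI[of _ C])
    fix f g :: "'a \<Rightarrow> complex" and a b assume fg: "f \<in> schwartz" "g \<in> schwartz"
    show "T (\<lambda>x. a * f x + b * g x) = a * T f + b * T g"
      unfolding assms(2)[OF fg(1)] assms(2)[OF fg(2)] assms(2)[OF schwartz_lincomb[OF fg]]
      by (rule functional_lin[OF sfunctional_linear[OF assms(1)] fg])
  next
    fix f :: "'a \<Rightarrow> complex" assume f: "f \<in> schwartz"
    show "cmod (T f) \<le> C * snorm m f" unfolding assms(2)[OF f] by (rule C(2)[OF f])
  qed
qed

lemma transposed_tempered:
  assumes "soperator A" "T \<in> tempered"
  shows "transposed A T \<in> tempered"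
  unfolding tempered_iff
proof (intro conjI allI impI)
  show "sfunctional (transposed A T)"
    by (rule sfunctional_cong[OF sfunctional_compose[OF tempered_sfunctional[OF assms(2)] assms(1)]])
       (simp add: transposed_def)
qed (simp add: transposed_def)

text \<open>Strong seminorms are suprema over bounded sets, and a continuous operator maps bounded sets to bounded
  sets.\<close>

lemma transposed_continuous:
  assumes A: "soperator A"
  shows "linear_continuous_map tempered_topology tempered_topology (transposed A)"
  unfolding linear_continuous_map_def topspace_tempered_topology
proof
  show lin: "clinear_map_on tempered (transposed A)"
    by (auto simp: clinear_map_on_def transposed_def)
  show "continuous_map tempered_topology tempered_topology (transposed A)"
    unfolding tempered_topology_eq
  proof (rule seminorm_bound_continuous_map[OF seminorm_on_strong_seminorms strong_seminorms_nonempty function_space_tempered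
        seminorm_on_strong_seminorms strong_seminorms_nonempty function_space_tempered _ lin])
    show "transposed A T \<in> tempered" if "T \<in> tempered" for T by (rule transposed_tempered[OF A that])
    fix q :: "(('a \<Rightarrow> complex) \<Rightarrow> complex) \<Rightarrow> real" assume "q \<in> strong_seminorms"
    then obtain B where q: "q = strong_seminorm B" and B: "bounded_in_schwartz B" "B \<noteq> {}"
      by (auto simp: strong_seminorms_def)
    note AB = soperator_bounded_image[OF A B(1)]
    have "q (transposed A T) \<le> 1 * (\<Sum>p\<in>{strong_seminorm (A ` B)}. p T)" if T: "T \<in> tempered" for T
      unfolding q
    proof (rule strong_seminorm_least[OF B(2)])
      fix f assume f: "f \<in> B"
      then have "f \<in> schwartz" using B(1) by (auto simp: bounded_in_schwartz_def)
      then show "cmod (transposed A T f) \<le> 1 * (\<Sum>p\<in>{strong_seminorm (A ` B)}. p T)"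
        using strong_seminorm_upper[OF tempered_sfunctional[OF T] AB imageI[OF f]] by (simp add: transposed_def)
    qed
    moreover have "strong_seminorm (A ` B) \<in> strong_seminorms" using AB B(2) by (auto simp: strong_seminorms_def)
    ultimately show "\<exists>P0 C. finite P0 \<and> P0 \<subseteq> strong_seminorms \<and> (\<forall>T\<in>tempered. q (transposed A T) \<le> C * (\<Sum>p\<in>P0. p T))"
      by (intro exI[of _ "{strong_seminorm (A ` B)}"] exI[of _ 1] conjI ballI) auto
  qed
qed

section \<open>Functions as distributions and extension by transposition\<close>

text \<open>Both measures of the theorem, on phase space and on its double, are constant multiples of
  Lebesgue measure. Treating the constant as a parameter allows all analysis to be done for Lebesgue
  measure itself.\<close>

locale scaled_lebesgue =
  fixes \<mu> :: "'a::euclidean_space measure" and c :: real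
  assumes \<mu>: "\<mu> = density lborel (\<lambda>_. ennreal c)" and c: "c > 0"
begin

lemma integral_scaled: "f \<in> borel_measurable borel \<Longrightarrow> (LINT x|\<mu>. f x) = of_real c * (LINT x|lborel. f x :: complex)"
  unfolding \<mu> using c by (subst integral_density) (auto simp: scaleR_conv_of_real)

lemma pairing_scaled: "f \<in> schwartz \<Longrightarrow> g \<in> schwartz \<Longrightarrow> pairing \<mu> f g = of_real c * pairing lborel f g"
  unfolding pairing_def by (rule integral_scaled[OF schwartz_measurable[OF schwartz_mult]])

lemma distribution_scaled:
  "f \<in> schwartz \<Longrightarrow> g \<in> schwartz \<Longrightarrow> distribution_of \<mu> f g = of_real c * pairing lborel f g"
  by (simp add: distribution_of_def pairing_scaled)

lemma distribution_of_tempered: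
  assumes "f \<in> schwartz"
  shows "distribution_of \<mu> f \<in> tempered"
  unfolding tempered_iff
proof (intro conjI allI impI)
  show "sfunctional (distribution_of \<mu> f)"
    by (rule sfunctional_cong[OF sfunctional_scale[OF sfunctional_pairing'[OF assms], of "of_real c"]])
       (simp add: distribution_scaled assms)
qed (simp add: distribution_of_def)

lemma distribution_of_continuous:
  assumes A: "soperator (A :: ('b::euclidean_space \<Rightarrow> complex) \<Rightarrow> 'a \<Rightarrow> complex)"
  shows "linear_continuous_map schwartz_topology tempered_topology
           (\<lambda>F. if F \<in> schwartz then distribution_of \<mu> (A F) else (\<lambda>_. 0))" (is "linear_continuous_map _ _ ?D")
  unfolding linear_continuous_map_def topspace_schwartz_topology
proof
  show lin: "clinear_map_on schwartz ?D"
    unfolding clinear_map_on_def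
  proof (intro ballI allI)
    fix f g :: "'b \<Rightarrow> complex" and a b assume fg: "f \<in> schwartz" "g \<in> schwartz"
    have "distribution_of \<mu> (A (\<lambda>x. a * f x + b * g x)) h = a * distribution_of \<mu> (A f) h + b * distribution_of \<mu> (A g) h" for h
    proof (cases "h \<in> schwartz")
      case True
      note S = soperator_schwartz[OF A fg(1)] soperator_schwartz[OF A fg(2)]
      show ?thesis
        unfolding soperator_apply[OF A fg] distribution_scaled[OF schwartz_lincomb[OF S] True]
          distribution_scaled[OF S(1) True] distribution_scaled[OF S(2) True] pairing_lincomb(1)[OF S True]
        by (simp add: algebra_simps)
    qed (simp add: distribution_of_def)
    then show "?D (\<lambda>x. a * f x + b * g x) = (\<lambda>h. a * ?D f h + b * ?D g h)"
      using fg schwartz_lincomb[OF fg] by (simp add: fun_eq_iff)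
  qed
  show "continuous_map schwartz_topology tempered_topology ?D"
    unfolding tempered_topology_eq schwartz_topology_def
  proof (rule seminorm_bound_continuous_map[OF seminorm_on_schwartz_seminorms schwartz_seminorms_nonempty
      function_space_schwartz seminorm_on_strong_seminorms strong_seminorms_nonempty function_space_tempered _ lin])
    show "?D f \<in> tempered" if "f \<in> schwartz" for f
      using that by (simp add: distribution_of_tempered soperator_schwartz[OF A])
    fix q :: "(('a \<Rightarrow> complex) \<Rightarrow> complex) \<Rightarrow> real" assume "q \<in> strong_seminorms"
    then obtain B where q: "q = strong_seminorm B" and B: "bounded_in_schwartz B" "B \<noteq> {}"
      by (auto simp: strong_seminorms_def)
    have BS: "B \<subseteq> schwartz" using B(1) by (simp add: bounded_in_schwartz_def)
    obtain D where D: "\<forall>h\<in>B. snorm 0 h \<le> D" using B(1) bounded_in_schwartz_iff by blast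
    define W where "W = (LINT x|lborel. poisson_weight (x::'a))"
    have W: "W \<ge> 0" unfolding W_def by (intro Bochner_Integration.integral_nonneg less_imp_le poisson_weight_pos)
    let ?d = "2 * DIM('a)"
    obtain C n where C: "C \<ge> 0" "\<And>f. f \<in> schwartz \<Longrightarrow> snorm ?d (A f) \<le> C * snorm n f"
      by (rule soperator_bound[OF A], rule that)
    obtain P0 N where P0: "finite P0" "P0 \<subseteq> schwartz_seminorms" "N \<ge> 0" and
      N: "\<forall>f\<in>schwartz. snorm n f \<le> N * (\<Sum>p\<in>P0. p (f :: 'b \<Rightarrow> complex))"
      using snorm_le_finite_seminorms[of n] by (elim exE conjE)
    define K where "K = c * (2 ^ Suc DIM('a) * D * W)"
    obtain h0 where h0: "h0 \<in> B" using B(2) by blast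
    have "D \<ge> 0" using D h0 BS snorm_nonneg[of h0 0] by force
    then have K: "K \<ge> 0" using c W by (simp add: K_def)
    have "q (?D f) \<le> (K * C * N) * (\<Sum>p\<in>P0. p f)" if f: "f \<in> schwartz" for f
      unfolding q
    proof (rule strong_seminorm_least[OF B(2)])
      fix h assume h: "h \<in> B"
      then have hS: "h \<in> schwartz" using BS by auto
      have hb: "cmod (h x) \<le> D" for x using snorm_bound0[OF hS, of 0 0 x] D h by force
      note Af = soperator_schwartz[OF A f]
      have "cmod (?D f h) = c * cmod (pairing lborel (A f) h)"
        using f c by (simp add: distribution_scaled[OF Af hS] norm_mult)
      also have "\<dots> \<le> c * ((2 ^ Suc DIM('a) * D * W) * snorm ?d (A f))"
        unfolding pairing_def W_def using c
        by (intro mult_left_mono schwartz_mult_bounded_integrable(2)[OF Af schwartz_measurable[OF hS] hb]) auto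
      also have "\<dots> = K * snorm ?d (A f)" by (simp add: K_def mult_ac)
      also have "\<dots> \<le> K * (C * (N * (\<Sum>p\<in>P0. p f)))"
        using C(2)[OF f] mult_left_mono[OF N[rule_format, OF f] C(1)] by (intro mult_left_mono K) linarith
      finally show "cmod (?D f h) \<le> (K * C * N) * (\<Sum>p\<in>P0. p f)" by (simp only: mult.assoc)
    qed
    then show "\<exists>P0 C. finite P0 \<and> P0 \<subseteq> schwartz_seminorms \<and> (\<forall>f\<in>schwartz. q (?D f) \<le> C * (\<Sum>p\<in>P0. p f))"
      by (intro exI[of _ P0] exI[of _ "K * C * N"] conjI P0(1,2) ballI)
  qed
qed

text \<open>The partial sum over \<open>F\<close> of the Hermite expansion of the distribution \<open>T\<close>; the factor \<open>c\<close> cancels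
  that of the pairing.\<close>

definition hermite_section :: "(('a \<Rightarrow> complex) \<Rightarrow> complex) \<Rightarrow> ('a \<Rightarrow> nat) set \<Rightarrow> 'a \<Rightarrow> complex" where
  "hermite_section T F = (\<lambda>x. \<Sum>\<alpha>\<in>F. (T (hermite \<alpha>) / (hermite_norm TYPE('a) * of_real c)) * hermite \<alpha> x)"

lemma hermite_section_schwartz: "finite F \<Longrightarrow> hermite_section T F \<in> schwartz"
  unfolding hermite_section_def by (rule schwartz_sum) (simp_all add: hermite_schwartz)

lemma hermite_section_apply:
  assumes "finite F" "h \<in> schwartz"
  shows "distribution_of \<mu> (hermite_section T F) h = (\<Sum>\<alpha>\<in>F. hermite_coeff \<alpha> h * T (hermite \<alpha>))"
proof -
  have "pairing lborel (hermite_section T F) h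
      = (\<Sum>\<alpha>\<in>F. (T (hermite \<alpha>) / (hermite_norm TYPE('a) * of_real c)) * pairing lborel (hermite \<alpha>) h)"
    unfolding hermite_section_def
    by (rule functional_sum[OF sfunctional_linear[OF sfunctional_pairing[OF assms(2)]] function_space_schwartz assms(1) hermite_schwartz])
  then show ?thesis
    unfolding distribution_scaled[OF hermite_section_schwartz[OF assms(1)] assms(2)]
    using c by (simp add: sum_distrib_left hermite_coeff_def pairing_commute[of lborel h] mult_ac)
qed

text \<open>Since \<open>T\<close> grows polynomially on the Hermite functions, and the coefficients decrease rapidly with
  bounds that are uniform on a bounded set, the remainder of the expansion is uniformly small on it.\<close>

lemma hermite_section_strong_limit:
  assumes T: "T \<in> tempered" and B: "bounded_in_schwartz B" "B \<noteq> {}"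
  shows "((\<lambda>F. strong_seminorm B (\<lambda>h. T h - distribution_of \<mu> (hermite_section T F) h)) \<longlongrightarrow> 0)
           (finite_subsets_at_top multi_indices)"
proof -
  let ?I = "multi_indices :: ('a \<Rightarrow> nat) set" and ?v = "\<lambda>\<alpha>::'a \<Rightarrow> nat. 1 / index_weight \<alpha> ^ (2 * DIM('a))"
  obtain C m where C: "C \<ge> 0" "\<And>f. f \<in> schwartz \<Longrightarrow> cmod (T f) \<le> C * snorm m f"
    by (rule sfunctional_bound[OF tempered_sfunctional[OF T]], rule that)
  obtain D p where D: "D \<ge> 0" "\<And>\<alpha>. snorm m (hermite \<alpha> :: 'a \<Rightarrow> complex) \<le> D * index_weight \<alpha> ^ p"
    by (rule poly_growthD[OF snorm_hermite_growth[of m]], rule that)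
  obtain n :: nat where n: "\<forall>\<alpha>. \<forall>f\<in>schwartz. index_weight \<alpha> ^ (p + 2 * DIM('a)) * cmod (hermite_coeff \<alpha> f) \<le> real n * snorm n (f :: 'a \<Rightarrow> complex)"
    using hermite_coeff_decay[of "p + 2 * DIM('a)"] by (elim exE)
  obtain H where H: "\<forall>f\<in>B. snorm n f \<le> H" using B(1) bounded_in_schwartz_iff by blast
  have BS: "B \<subseteq> schwartz" using B(1) by (simp add: bounded_in_schwartz_def)
  define K where "K = C * D * (real n * H)"
  have each: "cmod (hermite_coeff \<alpha> h * T (hermite \<alpha>)) \<le> K * ?v \<alpha>" if h: "h \<in> B" for h \<alpha>
  proof -
    have w: "index_weight \<alpha> > 0" using index_weight_ge_1[of \<alpha>] by linarith
    have hS: "h \<in> schwartz" using h BS by auto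
    have "cmod (T (hermite \<alpha>)) \<le> C * (D * index_weight \<alpha> ^ p)"
      by (rule order_trans[OF C(2)[OF hermite_schwartz] mult_left_mono[OF D(2) C(1)]])
    then have "cmod (hermite_coeff \<alpha> h * T (hermite \<alpha>)) \<le> cmod (hermite_coeff \<alpha> h) * (C * (D * index_weight \<alpha> ^ p))"
      unfolding norm_mult by (rule mult_left_mono) simp
    also have "\<dots> = (C * D * ?v \<alpha>) * (index_weight \<alpha> ^ (p + 2 * DIM('a)) * cmod (hermite_coeff \<alpha> h))"
      using w by (simp add: power_add)
    also have "\<dots> \<le> (C * D * ?v \<alpha>) * (real n * H)"
    proof (rule mult_left_mono)
      have "real n * snorm n h \<le> real n * H" using H h by (intro mult_left_mono) auto
      then show "index_weight \<alpha> ^ (p + 2 * DIM('a)) * cmod (hermite_coeff \<alpha> h) \<le> real n * H"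
        using n[rule_format, OF hS, of \<alpha>] by linarith
    qed (use C(1) D(1) w in simp)
    finally show ?thesis by (simp add: K_def mult_ac)
  qed
  have bound: "strong_seminorm B (\<lambda>h. T h - distribution_of \<mu> (hermite_section T F) h) \<le> K * ((\<Sum>\<^sub>\<infinity>\<alpha>\<in>?I. ?v \<alpha>) - sum ?v F)"
    if F: "finite F" "F \<subseteq> ?I" for F
  proof (rule strong_seminorm_least[OF B(2)])
    fix h assume h: "h \<in> B"
    then have hS: "h \<in> schwartz" using BS by auto
    have "((\<lambda>\<alpha>. hermite_coeff \<alpha> h * T (hermite \<alpha>)) has_sum (T h - (\<Sum>\<alpha>\<in>F. hermite_coeff \<alpha> h * T (hermite \<alpha>)))) (?I - F)"
      by (rule has_sum_Diff[OF sfunctional_hermite_sum[OF tempered_sfunctional[OF T] hS] has_sum_finite[OF F(1)] F(2)])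
    moreover have "((\<lambda>\<alpha>. K * ?v \<alpha>) has_sum (K * ((\<Sum>\<^sub>\<infinity>\<alpha>\<in>?I. ?v \<alpha>) - sum ?v F))) (?I - F)"
      by (intro has_sum_cmult_right has_sum_Diff[OF has_sum_infsum[OF index_weight_summable] has_sum_finite[OF F(1)] F(2)])
    ultimately have "norm (T h - (\<Sum>\<alpha>\<in>F. hermite_coeff \<alpha> h * T (hermite \<alpha>))) \<le> K * ((\<Sum>\<^sub>\<infinity>\<alpha>\<in>?I. ?v \<alpha>) - sum ?v F)"
      by (rule norm_infsum_le) (rule each[OF h])
    then show "cmod (T h - distribution_of \<mu> (hermite_section T F) h) \<le> K * ((\<Sum>\<^sub>\<infinity>\<alpha>\<in>?I. ?v \<alpha>) - sum ?v F)"
      unfolding hermite_section_apply[OF F(1) hS] .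
  qed
  have nonneg: "0 \<le> strong_seminorm B (\<lambda>h. T h - distribution_of \<mu> (hermite_section T F) h)" if "finite F" for F
    by (rule seminorm_nonneg[OF seminorm_on_strong_seminorm[OF B]
        function_space_ops(2)[OF function_space_tempered T distribution_of_tempered[OF hermite_section_schwartz[OF that]]]])
  have ev: "\<forall>\<^sub>F F in finite_subsets_at_top ?I. norm (strong_seminorm B (\<lambda>h. T h - distribution_of \<mu> (hermite_section T F) h))
      \<le> K * ((\<Sum>\<^sub>\<infinity>\<alpha>\<in>?I. ?v \<alpha>) - sum ?v F)"
    by (intro eventually_finite_subsets_at_top_weakI) (use bound nonneg in auto)
  have "((\<lambda>F. K * ((\<Sum>\<^sub>\<infinity>\<alpha>\<in>?I. ?v \<alpha>) - sum ?v F)) \<longlongrightarrow> K * ((\<Sum>\<^sub>\<infinity>\<alpha>\<in>?I. ?v \<alpha>) - (\<Sum>\<^sub>\<infinity>\<alpha>\<in>?I. ?v \<alpha>))) (finite_subsets_at_top ?I)"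
    by (intro tendsto_intros infsum_tendsto index_weight_summable)
  then have "((\<lambda>F. K * ((\<Sum>\<^sub>\<infinity>\<alpha>\<in>?I. ?v \<alpha>) - sum ?v F)) \<longlongrightarrow> 0) (finite_subsets_at_top ?I)" by simp
  then show ?thesis by (rule Lim_null_comparison[OF ev])
qed

text \<open>Schwartz functions are dense in the strong dual.\<close>

lemma continuous_functional_on_tempered_eqI:
  assumes D: "clinear_functional_on tempered D1" "continuous_map tempered_topology euclidean D1"
      "clinear_functional_on tempered D2" "continuous_map tempered_topology euclidean D2"
    and eq: "\<And>F. F \<in> schwartz \<Longrightarrow> D1 (distribution_of \<mu> F) = D2 (distribution_of \<mu> F)"
    and T: "T \<in> tempered"
  shows "D1 T = D2 T"
proof -
  have lim: "((\<lambda>F. D (distribution_of \<mu> (hermite_section T F))) \<longlongrightarrow> D T) (finite_subsets_at_top multi_indices)"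
    if D: "clinear_functional_on tempered D" "continuous_map tempered_topology euclidean D" for D
  proof -
    have "\<exists>P0 C. finite P0 \<and> P0 \<subseteq> strong_seminorms \<and> C \<ge> 0 \<and> (\<forall>S\<in>tempered. cmod (D S) \<le> C * (\<Sum>p\<in>P0. p S))"
      using D(2) unfolding tempered_topology_eq
      by (intro seminorm_continuous_functional_bound[OF _ strong_seminorms_nonempty
        function_space_tempered D(1)] seminorm_on_strong_seminorms)
    then obtain P0 C where P0: "finite P0" "P0 \<subseteq> strong_seminorms" and C: "C \<ge> 0" "\<forall>S\<in>tempered. cmod (D S) \<le> C * (\<Sum>p\<in>P0. p S)"
      by (elim exE conjE)
    let ?R = "\<lambda>F h. T h - distribution_of \<mu> (hermite_section T F) h"
    have "((\<lambda>F. p (?R F)) \<longlongrightarrow> 0) (finite_subsets_at_top multi_indices)" if "p \<in> P0" for p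
    proof -
      obtain B where p: "p = strong_seminorm B" and B: "bounded_in_schwartz B" "B \<noteq> {}"
        using P0(2) \<open>p \<in> P0\<close> by (auto simp: strong_seminorms_def)
      show ?thesis unfolding p by (rule hermite_section_strong_limit[OF T B])
    qed
    then have "((\<lambda>F. C * (\<Sum>p\<in>P0. p (?R F))) \<longlongrightarrow> C * (\<Sum>p\<in>P0. 0)) (finite_subsets_at_top multi_indices)"
      by (intro tendsto_mult tendsto_const tendsto_sum)
    then have z: "((\<lambda>F. C * (\<Sum>p\<in>P0. p (?R F))) \<longlongrightarrow> 0) (finite_subsets_at_top multi_indices)" by simp
    have "\<forall>\<^sub>F F in finite_subsets_at_top multi_indices. norm (D (distribution_of \<mu> (hermite_section T F)) - D T) \<le> C * (\<Sum>p\<in>P0. p (?R F))"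
    proof (intro eventually_finite_subsets_at_top_weakI)
      fix F :: "('a \<Rightarrow> nat) set" assume F: "finite F"
      note S = distribution_of_tempered[OF hermite_section_schwartz[OF F], of T]
      have "D (?R F) = D T - D (distribution_of \<mu> (hermite_section T F))" by (rule functional_ops(2)[OF D(1) T S])
      then show "norm (D (distribution_of \<mu> (hermite_section T F)) - D T) \<le> C * (\<Sum>p\<in>P0. p (?R F))"
        using C(2)[rule_format, OF function_space_ops(2)[OF function_space_tempered T S]] by (simp only: norm_minus_commute)
    qed
    then have "((\<lambda>F. D (distribution_of \<mu> (hermite_section T F)) - D T) \<longlongrightarrow> 0) (finite_subsets_at_top multi_indices)"
      by (rule Lim_null_comparison[OF _ z])
    then show ?thesis by (simp add: LIM_zero_iff)
  qed
  have ev: "\<forall>\<^sub>F F in finite_subsets_at_top multi_indices. D1 (distribution_of \<mu> (hermite_section T F)) = D2 (distribution_of \<mu> (hermite_section T F))"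
    by (intro eventually_finite_subsets_at_top_weakI eq hermite_section_schwartz)
  have "((\<lambda>F. D2 (distribution_of \<mu> (hermite_section T F))) \<longlongrightarrow> D1 T) (finite_subsets_at_top multi_indices)"
    by (rule Lim_transform_eventually[OF lim[OF D(1,2)] ev])
  then show ?thesis
    by (rule tendsto_unique[OF finite_subsets_at_top_neq_bot _ lim[OF D(3,4)]])
qed

text \<open>The extension is the transpose of \<open>A'\<close>. It is unique because evaluation of the image at a Schwartz function is a
  continuous functional on the strong dual, and these are determined on the dense set of Schwartz
  functions.\<close>

lemma transpose_extension:
  fixes \<Phi> :: "('a \<Rightarrow> complex) \<Rightarrow> ('a \<Rightarrow> complex) \<Rightarrow> complex"
  assumes A: "soperator A" and A': "soperator A'"
    and tr: "\<And>F G. F \<in> schwartz \<Longrightarrow> G \<in> schwartz \<Longrightarrow> pairing lborel (A F) G = pairing lborel F (A' G)"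
    and \<Phi>: "\<And>F. F \<in> schwartz \<Longrightarrow> \<Phi> F = distribution_of \<mu> (A F)"
  shows "(\<exists>\<Phi>\<^sub>0. linear_continuous_map schwartz_topology schwartz_topology \<Phi>\<^sub>0 \<and>
          (\<forall>F\<in>schwartz. \<Phi> F = distribution_of \<mu> (\<Phi>\<^sub>0 F))) \<and>
    (\<exists>\<Psi>. linear_continuous_map tempered_topology tempered_topology \<Psi> \<and>
         (\<forall>F\<in>schwartz. \<Psi> (distribution_of \<mu> F) = \<Phi> F) \<and>
         (\<forall>\<Psi>'. linear_continuous_map tempered_topology tempered_topology \<Psi>' \<and>
               (\<forall>F\<in>schwartz. \<Psi>' (distribution_of \<mu> F) = \<Phi> F)
               \<longrightarrow> (\<forall>T\<in>tempered. \<Psi>' T = \<Psi> T)))"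
proof -
  have cont: "linear_continuous_map tempered_topology tempered_topology (transposed A')" by (rule transposed_continuous[OF A'])
  have extends: "transposed A' (distribution_of \<mu> F) = \<Phi> F" if F: "F \<in> schwartz" for F
  proof (rule ext)
    fix G
    show "transposed A' (distribution_of \<mu> F) G = \<Phi> F G"
    proof (cases "G \<in> schwartz")
      case True
      then show ?thesis
        by (simp add: transposed_def \<Phi>[OF F] distribution_scaled F soperator_schwartz[OF A'] soperator_schwartz[OF A] tr)
    qed (simp add: transposed_def \<Phi>[OF F] distribution_of_def)
  qed
  have unique: "\<Psi>' T = transposed A' T" if \<Psi>': "linear_continuous_map tempered_topology tempered_topology \<Psi>' \<and> (\<forall>F\<in>schwartz. \<Psi>' (distribution_of \<mu> F) = \<Phi> F)"
    and T: "T \<in> tempered"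
    for \<Psi>' :: "(('a \<Rightarrow> complex) \<Rightarrow> complex) \<Rightarrow> (('a \<Rightarrow> complex) \<Rightarrow> complex)" and T :: "('a \<Rightarrow> complex) \<Rightarrow> complex"
  proof -
    have in_tempered: "\<Psi> T \<in> tempered" if "linear_continuous_map tempered_topology tempered_topology \<Psi>"
      for \<Psi> :: "(('a \<Rightarrow> complex) \<Rightarrow> complex) \<Rightarrow> (('a \<Rightarrow> complex) \<Rightarrow> complex)"
      using that T continuous_map_image_subset_topspace[of tempered_topology tempered_topology \<Psi>]
      unfolding linear_continuous_map_def topspace_tempered_topology by blast
    have ev: "clinear_functional_on tempered (\<lambda>T. \<Psi> T G) \<and> continuous_map tempered_topology euclidean (\<lambda>T. \<Psi> T G)"
      if \<Psi>: "linear_continuous_map tempered_topology tempered_topology \<Psi>" and G: "G \<in> schwartz"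
      for \<Psi> :: "(('a \<Rightarrow> complex) \<Rightarrow> complex) \<Rightarrow> (('a \<Rightarrow> complex) \<Rightarrow> complex)" and G
    proof
      show "clinear_functional_on tempered (\<lambda>T. \<Psi> T G)"
        using \<Psi> unfolding linear_continuous_map_def topspace_tempered_topology clinear_map_on_def clinear_functional_on_def
        by simp
      show "continuous_map tempered_topology euclidean (\<lambda>T. \<Psi> T G)"
        using continuous_map_compose[of tempered_topology tempered_topology \<Psi> euclidean "\<lambda>T. T G"] \<Psi> continuous_evaluation[OF G]
        by (simp add: linear_continuous_map_def o_def)
    qed
    show "\<Psi>' T = transposed A' T"
    proof (rule ext)
      fix G
      show "\<Psi>' T G = transposed A' T G"
      proof (cases "G \<in> schwartz")
        case True
        have agree: "\<Psi>' (distribution_of \<mu> F) G = transposed A' (distribution_of \<mu> F) G" if "F \<in> schwartz" for F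
          using that \<Psi>' extends by simp
        show ?thesis
          by (rule continuous_functional_on_tempered_eqI[OF conjunct1[OF ev[OF conjunct1[OF \<Psi>'] True]]
              conjunct2[OF ev[OF conjunct1[OF \<Psi>'] True]] conjunct1[OF ev[OF cont True]]
              conjunct2[OF ev[OF cont True]] agree T])
      next
        case False
        then show ?thesis using in_tempered[OF conjunct1[OF \<Psi>']] by (simp add: tempered_iff transposed_def)
    qed
    qed
  qed
  show ?thesis
  proof (rule conjI)
    show "\<exists>\<Phi>\<^sub>0. linear_continuous_map schwartz_topology schwartz_topology \<Phi>\<^sub>0 \<and>
          (\<forall>F\<in>schwartz. \<Phi> F = distribution_of \<mu> (\<Phi>\<^sub>0 F))"
      by (rule exI[of _ A], rule conjI[OF soperator_continuous[OF A]], rule ballI, rule \<Phi>)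
  next
    show "\<exists>\<Psi>. linear_continuous_map tempered_topology tempered_topology \<Psi> \<and>
         (\<forall>F\<in>schwartz. \<Psi> (distribution_of \<mu> F) = \<Phi> F) \<and>
         (\<forall>\<Psi>'. linear_continuous_map tempered_topology tempered_topology \<Psi>' \<and>
               (\<forall>F\<in>schwartz. \<Psi>' (distribution_of \<mu> F) = \<Phi> F)
               \<longrightarrow> (\<forall>T\<in>tempered. \<Psi>' T = \<Psi> T))"
    proof (rule exI[of _ "transposed A'"], rule conjI[OF cont], rule conjI)
      show "\<forall>F\<in>schwartz. transposed A' (distribution_of \<mu> F) = \<Phi> F" by (rule ballI, rule extends)
    next
      show "\<forall>\<Psi>'. linear_continuous_map tempered_topology tempered_topology \<Psi>' \<and>
               (\<forall>F\<in>schwartz. \<Psi>' (distribution_of \<mu> F) = \<Phi> F)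
               \<longrightarrow> (\<forall>T\<in>tempered. \<Psi>' T = transposed A' T)"
        by (rule allI, rule impI, rule ballI, rule unique)
    qed
  qed
qed

end

section \<open>Tensor products and kernels\<close>

lemma sum_Basis_prod:
  fixes f :: "'a::euclidean_space \<times> 'b::euclidean_space \<Rightarrow> 'c::comm_monoid_add"
  shows "(\<Sum>b\<in>Basis. f b) = (\<Sum>u\<in>Basis. f (u, 0)) + (\<Sum>v\<in>Basis. f (0, v))"
proof -
  have "(\<Sum>b\<in>Basis. f b) = sum f ((\<lambda>u. (u, 0)) ` Basis) + sum f ((\<lambda>v. (0, v)) ` Basis)"
    unfolding Basis_prod_def by (rule sum.union_disjoint) auto
  then show ?thesis by (simp add: sum.reindex inj_on_def)
qed

lemma prod_Basis_prod:
  fixes f :: "'a::euclidean_space \<times> 'b::euclidean_space \<Rightarrow> 'c::comm_monoid_mult"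
  shows "(\<Prod>b\<in>Basis. f b) = (\<Prod>u\<in>Basis. f (u, 0)) * (\<Prod>v\<in>Basis. f (0, v))"
proof -
  have "(\<Prod>b\<in>Basis. f b) = prod f ((\<lambda>u. (u, 0)) ` Basis) * prod f ((\<lambda>v. (0, v)) ` Basis)"
    unfolding Basis_prod_def by (rule prod.union_disjoint) auto
  then show ?thesis by (simp add: prod.reindex inj_on_def)
qed

definition fst_index :: "('a::euclidean_space \<times> 'b::euclidean_space \<Rightarrow> nat) \<Rightarrow> 'a \<Rightarrow> nat" where
  "fst_index \<gamma> = (\<lambda>u\<in>Basis. \<gamma> (u, 0))"

definition snd_index :: "('a::euclidean_space \<times> 'b::euclidean_space \<Rightarrow> nat) \<Rightarrow> 'b \<Rightarrow> nat" where
  "snd_index \<gamma> = (\<lambda>v\<in>Basis. \<gamma> (0, v))"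

text \<open>A coordinate vector of the product lies in the second factor exactly if its second component is not zero.\<close>

definition pair_index :: "('a::euclidean_space \<Rightarrow> nat) \<Rightarrow> ('b::euclidean_space \<Rightarrow> nat) \<Rightarrow> 'a \<times> 'b \<Rightarrow> nat" where
  "pair_index \<alpha> \<beta> = (\<lambda>b\<in>Basis. if snd b = 0 then \<alpha> (fst b) else \<beta> (snd b))"

lemma pair_index_multi_indices: "pair_index \<alpha> \<beta> \<in> multi_indices"
  by (simp add: pair_index_def multi_indices_def)

lemma fst_index_multi_indices: "fst_index \<gamma> \<in> multi_indices" "snd_index \<gamma> \<in> multi_indices"
  by (simp_all add: fst_index_def snd_index_def multi_indices_def)

lemma fst_pair_index: "\<alpha> \<in> multi_indices \<Longrightarrow> fst_index (pair_index \<alpha> \<beta>) = \<alpha>"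
  by (rule ext) (auto simp: fst_index_def pair_index_def multi_indices_def Basis_prod_def PiE_def extensional_def)

lemma snd_pair_index: "\<beta> \<in> multi_indices \<Longrightarrow> snd_index (pair_index \<alpha> \<beta>) = \<beta>"
  by (rule ext) (auto simp: snd_index_def pair_index_def multi_indices_def Basis_prod_def PiE_def extensional_def nonzero_Basis)

lemma hermite_prod: "hermite \<gamma> = tensor (hermite (fst_index \<gamma>)) (hermite (snd_index \<gamma>))"
  by (rule ext) (auto simp: hermite_def tensor_def fst_index_def snd_index_def prod_Basis_prod)

lemma hermite_pair_index:
  "\<alpha> \<in> multi_indices \<Longrightarrow> \<beta> \<in> multi_indices \<Longrightarrow> hermite (pair_index \<alpha> \<beta>) = tensor (hermite \<alpha>) (hermite \<beta>)"
  by (simp add: hermite_prod fst_pair_index snd_pair_index)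

lemma index_weight_prod:
  "index_weight \<gamma> = index_weight (fst_index \<gamma>) + index_weight (snd_index \<gamma>) - 1"
  by (simp add: index_weight_def sum_Basis_prod fst_index_def snd_index_def)

lemma index_weight_prod_le: "index_weight \<gamma> \<le> index_weight (fst_index \<gamma>) * index_weight (snd_index \<gamma>)"
proof -
  have "0 \<le> (index_weight (fst_index \<gamma>) - 1) * (index_weight (snd_index \<gamma>) - 1)"
    using index_weight_ge_1[of "fst_index \<gamma>"] index_weight_ge_1[of "snd_index \<gamma>"]
    by (intro mult_nonneg_nonneg) linarith+
  then show ?thesis by (simp add: index_weight_prod algebra_simps)
qed

lemma index_weight_fst_le: "index_weight (fst_index \<gamma>) \<le> index_weight \<gamma>"
  using index_weight_ge_1[of "snd_index \<gamma>"] by (simp add: index_weight_prod)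

lemma index_weight_snd_le: "index_weight (snd_index \<gamma>) \<le> index_weight \<gamma>"
  using index_weight_ge_1[of "fst_index \<gamma>"] by (simp add: index_weight_prod)

lemma sfunctional_tensor_eqI:
  fixes S T :: "('a::euclidean_space \<times> 'b::euclidean_space \<Rightarrow> complex) \<Rightarrow> complex"
  assumes S: "sfunctional S" and T: "sfunctional T"
    and eq: "\<And>\<alpha> \<beta>. \<alpha> \<in> multi_indices \<Longrightarrow> \<beta> \<in> multi_indices \<Longrightarrow>
               S (tensor (hermite \<alpha>) (hermite \<beta>)) = T (tensor (hermite \<alpha>) (hermite \<beta>))"
    and F: "F \<in> schwartz"
  shows "S F = T F"
proof (rule sfunctional_eqI[OF S T _ F])
  fix \<gamma> :: "'a \<times> 'b \<Rightarrow> nat"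
  show "S (hermite \<gamma>) = T (hermite \<gamma>)"
    unfolding hermite_prod[of \<gamma>] by (rule eq[OF fst_index_multi_indices])
qed

lemma tempered_tensor_eqI:
  fixes S T :: "('a::euclidean_space \<times> 'b::euclidean_space \<Rightarrow> complex) \<Rightarrow> complex"
  assumes S: "S \<in> tempered" and T: "T \<in> tempered"
    and eq: "\<And>f g. f \<in> schwartz \<Longrightarrow> g \<in> schwartz \<Longrightarrow> S (tensor f g) = T (tensor f g)"
  shows "S = T"
proof (rule ext)
  fix F
  show "S F = T F"
  proof (cases "F \<in> schwartz")
    case True
    show ?thesis
      by (rule sfunctional_tensor_eqI[OF tempered_sfunctional[OF S] tempered_sfunctional[OF T] _ True])
         (rule eq[OF hermite_schwartz hermite_schwartz])
  qed (use S T in \<open>simp add: tempered_iff\<close>)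
qed

lemma schwartz_to_tempered_evaluation:
  assumes R: "linear_continuous_map schwartz_topology tempered_topology R" and G: "G \<in> schwartz"
  shows "sfunctional (\<lambda>F. R F G)"
proof -
  have "clinear_functional_on schwartz (\<lambda>F. R F G)"
    using R unfolding linear_continuous_map_def clinear_map_on_def clinear_functional_on_def topspace_schwartz_topology
    by simp
  moreover have "continuous_map schwartz_topology euclidean (\<lambda>F. R F G)"
    using continuous_map_compose[of schwartz_topology tempered_topology R euclidean "\<lambda>T. T G"] R continuous_evaluation[OF G]
    by (simp add: linear_continuous_map_def o_def)
  ultimately show ?thesis by (simp add: sfunctional_iff_continuous)
qed

lemma schwartz_to_tempered_in:
  assumes R: "linear_continuous_map schwartz_topology tempered_topology R" and F: "F \<in> schwartz"
  shows "R F \<in> tempered"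
  using R F continuous_map_image_subset_topspace[of schwartz_topology tempered_topology R]
  unfolding linear_continuous_map_def topspace_schwartz_topology topspace_tempered_topology by blast

lemma kernel_unique:
  fixes R S :: "('a::euclidean_space \<times> 'b::euclidean_space \<Rightarrow> complex) \<Rightarrow> ('c::euclidean_space \<times> 'd::euclidean_space \<Rightarrow> complex) \<Rightarrow> complex"
  assumes R: "linear_continuous_map schwartz_topology tempered_topology R"
    and S: "linear_continuous_map schwartz_topology tempered_topology S"
    and eq: "\<And>f1 f2 g1 g2. f1 \<in> schwartz \<Longrightarrow> f2 \<in> schwartz \<Longrightarrow> g1 \<in> schwartz \<Longrightarrow> g2 \<in> schwartz \<Longrightarrow>
               R (tensor f1 f2) (tensor g1 g2) = S (tensor f1 f2) (tensor g1 g2)"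
    and F: "F \<in> schwartz"
  shows "R F = S F"
proof (rule tempered_tensor_eqI[OF schwartz_to_tempered_in[OF R F] schwartz_to_tempered_in[OF S F]])
  fix g1 :: "'c \<Rightarrow> complex" and g2 :: "'d \<Rightarrow> complex" assume g: "g1 \<in> schwartz" "g2 \<in> schwartz"
  show "R F (tensor g1 g2) = S F (tensor g1 g2)"
    by (rule sfunctional_tensor_eqI[OF schwartz_to_tempered_evaluation[OF R tensor_schwartz[OF g]]
          schwartz_to_tempered_evaluation[OF S tensor_schwartz[OF g]] _ F])
       (rule eq[OF hermite_schwartz hermite_schwartz g])
qed

text \<open>The description of \<open>R\<close> and \<open>N\<close> by their values on tensor products determines them, because the
  Hermite functions of a product space are tensor products; so any operator with the right values
  is the described object.\<close>

lemma kernel_theorem_value: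
  fixes \<mu> :: "('c::euclidean_space \<times> 'd::euclidean_space) measure"
    and K :: "('a::euclidean_space \<times> 'b::euclidean_space \<Rightarrow> complex) \<Rightarrow> 'c \<times> 'd \<Rightarrow> complex"
  assumes \<mu>: "scaled_lebesgue \<mu> c" and K: "soperator K"
    and q: "\<And>f1 f2 g1 g2. f1 \<in> schwartz \<Longrightarrow> f2 \<in> schwartz \<Longrightarrow> g1 \<in> schwartz \<Longrightarrow> g2 \<in> schwartz \<Longrightarrow>
               of_real c * pairing lborel (K (tensor f1 f2)) (tensor g1 g2) = q f1 f2 g1 g2"
  shows "(THE R. linear_continuous_map schwartz_topology tempered_topology R \<and>
     (\<forall>f1\<in>schwartz. \<forall>f2\<in>schwartz. \<forall>g1\<in>schwartz. \<forall>g2\<in>schwartz. R (tensor f1 f2) (tensor g1 g2) = q f1 f2 g1 g2) \<and>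
     (\<forall>F. F \<notin> schwartz \<longrightarrow> R F = (\<lambda>_. 0)))
     = (\<lambda>F. if F \<in> schwartz then distribution_of \<mu> (K F) else (\<lambda>_. 0))" (is "_ = ?D")
proof (rule the_equality)
  interpret scaled_lebesgue \<mu> c by (rule \<mu>)
  have D: "linear_continuous_map schwartz_topology tempered_topology ?D" by (rule distribution_of_continuous[OF K])
  have val: "?D (tensor f1 f2) (tensor g1 g2) = q f1 f2 g1 g2"
    if f: "f1 \<in> schwartz" "f2 \<in> schwartz" and g: "g1 \<in> schwartz" "g2 \<in> schwartz"
    for f1 :: "'a \<Rightarrow> complex" and f2 :: "'b \<Rightarrow> complex" and g1 :: "'c \<Rightarrow> complex" and g2 :: "'d \<Rightarrow> complex"
    by (simp add: tensor_schwartz[OF f] q[OF f g, symmetric]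
        distribution_scaled[OF soperator_schwartz[OF K tensor_schwartz[OF f]] tensor_schwartz[OF g]])
  show "linear_continuous_map schwartz_topology tempered_topology ?D \<and>
     (\<forall>f1\<in>schwartz. \<forall>f2\<in>schwartz. \<forall>g1\<in>schwartz. \<forall>g2\<in>schwartz. ?D (tensor f1 f2) (tensor g1 g2) = q f1 f2 g1 g2) \<and>
     (\<forall>F. F \<notin> schwartz \<longrightarrow> ?D F = (\<lambda>_. 0))"
    by (rule conjI[OF D], rule conjI, (rule ballI)+, rule val, assumption+, simp)
  fix R :: "('a \<times> 'b \<Rightarrow> complex) \<Rightarrow> ('c \<times> 'd \<Rightarrow> complex) \<Rightarrow> complex"
  assume R: "linear_continuous_map schwartz_topology tempered_topology R \<and>
     (\<forall>f1\<in>schwartz. \<forall>f2\<in>schwartz. \<forall>g1\<in>schwartz. \<forall>g2\<in>schwartz. R (tensor f1 f2) (tensor g1 g2) = q f1 f2 g1 g2) \<and>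
     (\<forall>F. F \<notin> schwartz \<longrightarrow> R F = (\<lambda>_. 0))"
  show "R = ?D"
  proof (rule ext)
    fix F
    show "R F = ?D F"
    proof (cases "F \<in> schwartz")
      case True
      show ?thesis
      proof (rule kernel_unique[OF conjunct1[OF R] D _ True])
        fix f1 :: "'a \<Rightarrow> complex" and f2 :: "'b \<Rightarrow> complex" and g1 :: "'c \<Rightarrow> complex" and g2 :: "'d \<Rightarrow> complex"
        assume f: "f1 \<in> schwartz" "f2 \<in> schwartz" and g: "g1 \<in> schwartz" "g2 \<in> schwartz"
        show "R (tensor f1 f2) (tensor g1 g2) = ?D (tensor f1 f2) (tensor g1 g2)"
          unfolding val[OF f g] using R f g by simp
      qed
    qed (use R in simp)
  qed
qed

section \<open>A uniform boundedness principle for absolutely summable coefficients\<close>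

lemma function_space_abs_summable: "function_space {c :: 'd \<Rightarrow> complex. (\<lambda>\<delta>. cmod (c \<delta>)) summable_on UNIV}"
proof -
  have "(\<lambda>\<delta>. cmod (a * f \<delta> + b * g \<delta>)) summable_on UNIV"
    if f: "(\<lambda>\<delta>. cmod (f \<delta>)) summable_on UNIV" and g: "(\<lambda>\<delta>. cmod (g \<delta>)) summable_on UNIV" for a b and f g :: "'d \<Rightarrow> complex"
    by (rule summable_on_comparison_test[OF summable_on_add[OF summable_on_cmult_right[OF f, of "cmod a"] summable_on_cmult_right[OF g, of "cmod b"]]])
       (auto intro: cmod_lincomb_le)
  then show ?thesis by (auto simp: function_space_def)
qed

lemma abs_summable_weighted_bound:
  fixes c a :: "'d \<Rightarrow> complex"
  assumes c: "(\<lambda>\<delta>. cmod (c \<delta>)) summable_on UNIV" and a: "\<And>\<delta>. cmod (a \<delta>) \<le> B"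
  shows "(\<lambda>\<delta>. c \<delta> * a \<delta>) summable_on UNIV" "cmod (\<Sum>\<^sub>\<infinity>\<delta>. c \<delta> * a \<delta>) \<le> B * (\<Sum>\<^sub>\<infinity>\<delta>. cmod (c \<delta>))"
proof -
  have le: "cmod (c \<delta> * a \<delta>) \<le> B * cmod (c \<delta>)" for \<delta>
    using mult_right_mono[OF a[of \<delta>], of "cmod (c \<delta>)"] by (simp add: norm_mult mult.commute)
  have "(\<lambda>\<delta>. cmod (c \<delta> * a \<delta>)) summable_on UNIV"
    by (rule summable_on_comparison_test[OF summable_on_cmult_right[OF c, of B]]) (use le in auto)
  then show s: "(\<lambda>\<delta>. c \<delta> * a \<delta>) summable_on UNIV" by (rule abs_summable_summable)
  show "cmod (\<Sum>\<^sub>\<infinity>\<delta>. c \<delta> * a \<delta>) \<le> B * (\<Sum>\<^sub>\<infinity>\<delta>. cmod (c \<delta>))"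
    by (rule norm_infsum_le[OF has_sum_infsum[OF s] has_sum_cmult_right[OF has_sum_infsum[OF c]] le])
qed

lemma abs_summable_series:
  fixes f :: "nat \<Rightarrow> 'd \<Rightarrow> complex"
  assumes f: "\<And>k. (\<lambda>\<delta>. cmod (f k \<delta>)) summable_on UNIV" and s: "summable (\<lambda>k. \<Sum>\<^sub>\<infinity>\<delta>. cmod (f k \<delta>))"
  shows "(\<lambda>\<delta>. cmod (\<Sum>\<^sub>\<infinity>k. f k \<delta>)) summable_on UNIV"
    and "(\<And>\<delta>. cmod (a \<delta>) \<le> B) \<Longrightarrow>
           (\<lambda>k. \<Sum>\<^sub>\<infinity>\<delta>. f k \<delta> * a \<delta>) sums (\<Sum>\<^sub>\<infinity>\<delta>. (\<Sum>\<^sub>\<infinity>k. f k \<delta>) * a \<delta>)"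
proof -
  have "(\<lambda>k. \<Sum>\<^sub>\<infinity>\<delta>. cmod (f k \<delta>)) summable_on UNIV"
    using s by (subst summable_on_UNIV_nonneg_real_iff) (auto intro: infsum_nonneg)
  then have abs: "(\<lambda>z. cmod (f (fst z) (snd z))) summable_on UNIV \<times> UNIV"
    using f Infinite_Sum.abs_summable_on_Sigma_iff[of "\<lambda>z. f (fst z) (snd z)" UNIV "\<lambda>_. UNIV"] by (simp add: infsum_nonneg)
  have abs': "(\<lambda>z. cmod (f (snd z) (fst z))) summable_on UNIV \<times> UNIV"
    using has_sum_imp_summable[OF has_sum_swap[THEN iffD1, OF has_sum_infsum[OF abs]]] by (simp add: case_prod_unfold)
  have inner: "(\<lambda>k. cmod (f k \<delta>)) summable_on UNIV" for \<delta>
    using abs' Infinite_Sum.abs_summable_on_Sigma_iff[of "\<lambda>z. f (snd z) (fst z)" UNIV "\<lambda>_. UNIV"] by simp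
  have outer: "(\<lambda>\<delta>. \<Sum>\<^sub>\<infinity>k. cmod (f k \<delta>)) summable_on UNIV"
    using abs' Infinite_Sum.abs_summable_on_Sigma_iff[of "\<lambda>z. f (snd z) (fst z)" UNIV "\<lambda>_. UNIV"] by (simp add: infsum_nonneg)
  show "(\<lambda>\<delta>. cmod (\<Sum>\<^sub>\<infinity>k. f k \<delta>)) summable_on UNIV"
    by (rule summable_on_comparison_test[OF outer norm_infsum_bound[OF inner]]) simp
  assume a: "\<And>\<delta>. cmod (a \<delta>) \<le> B"
  have "(\<lambda>z. cmod (f (fst z) (snd z) * a (snd z))) summable_on UNIV \<times> UNIV"
  proof (rule summable_on_comparison_test[OF summable_on_cmult_right[OF abs, of B]])
    show "cmod (f (fst z) (snd z) * a (snd z)) \<le> B * cmod (f (fst z) (snd z))" for z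
      using mult_right_mono[OF a[of "snd z"], of "cmod (f (fst z) (snd z))"] by (simp add: norm_mult mult.commute)
  qed simp
  then have h: "(\<lambda>(k, \<delta>). f k \<delta> * a \<delta>) summable_on UNIV \<times> UNIV"
    using abs_summable_summable[of "\<lambda>z. f (fst z) (snd z) * a (snd z)" "UNIV \<times> UNIV"] by (simp add: case_prod_unfold)
  have "(\<lambda>k. \<Sum>\<^sub>\<infinity>\<delta>. f k \<delta> * a \<delta>) sums (\<Sum>\<^sub>\<infinity>k. \<Sum>\<^sub>\<infinity>\<delta>. f k \<delta> * a \<delta>)"
    by (rule has_sum_imp_sums[OF has_sum_infsum[OF summable_on_Sigma_banach[OF h]]])
  then show "(\<lambda>k. \<Sum>\<^sub>\<infinity>\<delta>. f k \<delta> * a \<delta>) sums (\<Sum>\<^sub>\<infinity>\<delta>. (\<Sum>\<^sub>\<infinity>k. f k \<delta>) * a \<delta>)"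
    unfolding infsum_swap_banach[OF h] infsum_cmult_left' .
qed

text \<open>The dual of the space of summable families is the space of bounded families: rows that are bounded one by one, and
  bounded after summation against every summable family, are bounded together.\<close>

lemma abs_summable_uniform_boundedness:
  fixes a :: "'c \<Rightarrow> 'd \<Rightarrow> complex"
  assumes a: "\<And>\<gamma>. \<exists>B. \<forall>\<delta>. cmod (a \<gamma> \<delta>) \<le> B"
    and pointwise: "\<And>c. (\<lambda>\<delta>. cmod (c \<delta>)) summable_on UNIV \<Longrightarrow> \<exists>B. \<forall>\<gamma>. cmod (\<Sum>\<^sub>\<infinity>\<delta>. c \<delta> * a \<gamma> \<delta>) \<le> B"
  shows "\<exists>M. \<forall>\<gamma> \<delta>. cmod (a \<gamma> \<delta>) \<le> M"
proof -
  let ?V = "{c :: 'd \<Rightarrow> complex. (\<lambda>\<delta>. cmod (c \<delta>)) summable_on UNIV}"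
  let ?p = "\<lambda>c :: 'd \<Rightarrow> complex. \<Sum>\<^sub>\<infinity>\<delta>. cmod (c \<delta>)"
  let ?l = "\<lambda>\<gamma> c. \<Sum>\<^sub>\<infinity>\<delta>. c \<delta> * a \<gamma> \<delta>"
  obtain B where B: "\<And>\<gamma> \<delta>. cmod (a \<gamma> \<delta>) \<le> B \<gamma>" using a by metis
  have "\<exists>M::nat. \<forall>\<gamma>. \<forall>c\<in>?V. cmod (?l \<gamma> c) \<le> real M * 1 ^ M * ?p c"
  proof (rule uniform_boundedness_growth[OF function_space_abs_summable, where p = "\<lambda>_. ?p"])
    show "seminorm_on ?V ?p"
      unfolding seminorm_on_def
    proof (intro conjI ballI allI)
      fix f g :: "'d \<Rightarrow> complex" and x y assume f: "f \<in> ?V" and g: "g \<in> ?V"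
      have "(\<lambda>\<delta>. x * f \<delta> + y * g \<delta>) \<in> ?V"
        by (rule function_space_lin[OF function_space_abs_summable f g])
      then have "(\<Sum>\<^sub>\<infinity>\<delta>. cmod (x * f \<delta> + y * g \<delta>)) \<le> (\<Sum>\<^sub>\<infinity>\<delta>. cmod x * cmod (f \<delta>) + cmod y * cmod (g \<delta>))"
        using f g by (intro infsum_mono summable_on_add summable_on_cmult_right cmod_lincomb_le) auto
      also have "\<dots> = cmod x * ?p f + cmod y * ?p g"
        using f g by (subst infsum_add) (auto intro: summable_on_cmult_right simp: infsum_cmult_right)
      finally show "?p (\<lambda>\<delta>. x * f \<delta> + y * g \<delta>) \<le> cmod x * ?p f + cmod y * ?p g" .
    qed (simp add: infsum_nonneg)
    show "clinear_functional_on ?V (?l \<gamma>)" for \<gamma>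
      unfolding clinear_functional_on_def
    proof (intro ballI allI)
      fix f g :: "'d \<Rightarrow> complex" and x y assume "f \<in> ?V" and "g \<in> ?V"
      then have f: "(\<lambda>\<delta>. f \<delta> * a \<gamma> \<delta>) summable_on UNIV" and g: "(\<lambda>\<delta>. g \<delta> * a \<gamma> \<delta>) summable_on UNIV"
        using abs_summable_weighted_bound(1)[OF _ B[of \<gamma>]] by auto
      have "(\<Sum>\<^sub>\<infinity>\<delta>. (x * f \<delta> + y * g \<delta>) * a \<gamma> \<delta>) = (\<Sum>\<^sub>\<infinity>\<delta>. x * (f \<delta> * a \<gamma> \<delta>) + y * (g \<delta> * a \<gamma> \<delta>))"
        by (simp add: algebra_simps)
      also have "\<dots> = x * ?l \<gamma> f + y * ?l \<gamma> g"
        using f g by (subst infsum_add) (auto intro: summable_on_cmult_right simp: infsum_cmult_right)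
      finally show "?l \<gamma> (\<lambda>\<delta>. x * f \<delta> + y * g \<delta>) = x * ?l \<gamma> f + y * ?l \<gamma> g" .
    qed
    show "\<exists>m::nat. \<exists>C. \<forall>c\<in>?V. cmod (?l \<gamma> c) \<le> C * ?p c" for \<gamma>
      using abs_summable_weighted_bound(2)[OF _ B[of \<gamma>]] by (intro exI[of _ 0] exI[of _ "B \<gamma>"]) auto
    show "\<exists>M::nat. \<forall>\<gamma>. cmod (?l \<gamma> c) \<le> real M * 1 ^ M" if c: "c \<in> ?V" for c
    proof -
      obtain D where "\<forall>\<gamma>. cmod (?l \<gamma> c) \<le> D" using pointwise[of c] c by auto
      moreover have "D \<le> real (nat \<lceil>D\<rceil>)" by linarith
      ultimately show ?thesis by (intro exI[of _ "nat \<lceil>D\<rceil>"]) (auto intro: order_trans)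
    qed
    show "\<exists>g\<in>?V. \<forall>\<gamma>. (\<lambda>k. ?l \<gamma> (f k)) sums ?l \<gamma> g"
      if f: "\<And>k. f k \<in> ?V" and s: "\<And>m::nat. summable (\<lambda>k. ?p (f k))" for f :: "nat \<Rightarrow> 'd \<Rightarrow> complex"
    proof (intro bexI[of _ "\<lambda>\<delta>. \<Sum>\<^sub>\<infinity>k. f k \<delta>"] allI)
      have fV: "(\<lambda>\<delta>. cmod (f k \<delta>)) summable_on UNIV" for k using f by simp
      show "(\<lambda>\<delta>. \<Sum>\<^sub>\<infinity>k. f k \<delta>) \<in> ?V" using abs_summable_series(1)[OF fV s] by simp
      show "(\<lambda>k. ?l \<gamma> (f k)) sums ?l \<gamma> (\<lambda>\<delta>. \<Sum>\<^sub>\<infinity>k. f k \<delta>)" for \<gamma>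
        by (rule abs_summable_series(2)[OF fV s B])
    qed
  qed auto
  then obtain M :: nat where M: "\<And>\<gamma> c. c \<in> ?V \<Longrightarrow> cmod (?l \<gamma> c) \<le> real M * ?p c" by auto
  have "cmod (a \<gamma> \<delta>) \<le> real M" for \<gamma> \<delta>
  proof -
    \<comment> \<open>The entry itself is the sum against a unit vector.\<close>
    let ?c = "\<lambda>\<delta>'. if \<delta>' = \<delta> then 1 else 0 :: complex"
    have 1: "((\<lambda>\<delta>'. ?c \<delta>' * a \<gamma> \<delta>') has_sum a \<gamma> \<delta>) UNIV"
      by (rule has_sum_finite_neutralI[of "{\<delta>}"]) auto
    have 2: "((\<lambda>\<delta>'. cmod (?c \<delta>')) has_sum 1) UNIV"
      by (rule has_sum_finite_neutralI[of "{\<delta>}"]) auto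
    show ?thesis using M[of ?c \<gamma>] has_sum_imp_summable[OF 2] infsumI[OF 1] infsumI[OF 2] by simp
  qed
  then show ?thesis by (intro exI[of _ "real M"] allI)
qed

section \<open>Phase space\<close>

definition phase_density :: "'n::finite itself \<Rightarrow> real" where
  "phase_density _ = 1 / (2 * pi) ^ CARD('n)"

lemma phase_density_pos: "phase_density TYPE('n::finite) > 0"
  by (simp add: phase_density_def)

lemma scaled_lebesgue_phase_measure:
  "scaled_lebesgue (phase_measure :: 'n::finite phase measure) (phase_density TYPE('n))"
  by unfold_locales (simp_all add: phase_measure_def phase_density_def)

lemma scaled_lebesgue_phase_measure2:
  "scaled_lebesgue (phase_measure2 :: ('n::finite phase \<times> 'n phase) measure) (phase_density TYPE('n) * phase_density TYPE('n))"
proof unfold_locales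
  let ?d = "phase_density TYPE('n)"
  have pos: "0 \<le> ?d" using phase_density_pos[where 'n='n] by linarith
  have fin: "sigma_finite_measure (density lborel (\<lambda>_. ennreal ?d) :: 'n phase measure)"
    by (subst sigma_finite_measure.sigma_finite_iff_density_finite[OF sigma_finite_lborel]) auto
  have "(phase_measure2 :: ('n phase \<times> 'n phase) measure) = density lborel (\<lambda>_. ennreal ?d) \<Otimes>\<^sub>M density lborel (\<lambda>_. ennreal ?d)"
    by (simp add: phase_measure2_def phase_measure_def phase_density_def)
  also have "\<dots> = density (lborel \<Otimes>\<^sub>M lborel) (\<lambda>(x, y). ennreal ?d * ennreal ?d)"
    by (rule pair_measure_density[OF _ _ sigma_finite_lborel fin]) simp_all
  also have "\<dots> = density lborel (\<lambda>_. ennreal (?d * ?d))"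
    unfolding lborel_prod ennreal_mult[OF pos pos] by (simp add: case_prod_unfold)
  finally show "(phase_measure2 :: ('n phase \<times> 'n phase) measure) = density lborel (\<lambda>_. ennreal (?d * ?d))" .
  show "0 < ?d * ?d" using phase_density_pos[where 'n='n] by simp
qed

text \<open>For an isometric adjoint the components \<open>y \<bullet> J c\<close> are those of a vector of the same norm as \<open>y\<close>.\<close>

lemma soperator_isometric_fourier:
  fixes J J' :: "'a::euclidean_space \<Rightarrow> 'a"
  assumes J: "bounded_linear J" and adj: "\<And>x y. y \<bullet> J x = x \<bullet> J' y" and iso: "\<And>y. norm (J' y) = norm y"
  shows "soperator (fourier J)"
proof (rule soperator_fourier[OF J])
  show "norm y \<le> (\<Sum>c\<in>Basis. \<bar>y \<bullet> J c\<bar>)" for y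
    using norm_le_l1[of "J' y"] by (simp add: adj iso inner_commute)
qed

text \<open>The matrix of the symplectic form with respect to the inner product.\<close>

definition symplectic_map :: "'n::finite phase \<Rightarrow> 'n phase" where
  "symplectic_map Z = (- snd Z, fst Z)"

lemma bounded_linear_symplectic_map: "bounded_linear symplectic_map"
  unfolding symplectic_map_def
  by (intro bounded_linear_Pair bounded_linear_minus bounded_linear_fst bounded_linear_snd)

lemma symplectic_map_adjoint: "Y \<bullet> symplectic_map Z = Z \<bullet> (- symplectic_map Y)"
  by (simp add: symplectic_map_def inner_prod_def inner_commute)

lemma norm_symplectic_map: "norm (symplectic_map Z) = norm Z"
  by (simp add: symplectic_map_def norm_prod_def add.commute)

lemma symplectic_inner: "symplectic Y Z = Y \<bullet> symplectic_map Z"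
  by (simp add: symplectic_def symplectic_map_def inner_prod_def inner_commute)

lemma symplectic_fourier_eq:
  fixes f :: "'n::finite phase \<Rightarrow> complex"
  assumes "f \<in> schwartz"
  shows "symplectic_fourier f = (\<lambda>Y. of_real (phase_density TYPE('n)) * fourier symplectic_map f Y)"
proof
  interpret scaled_lebesgue "phase_measure :: 'n phase measure" "phase_density TYPE('n)"
    by (rule scaled_lebesgue_phase_measure)
  fix Y
  have "(\<lambda>Z. exp (- \<i> * of_real (symplectic Y Z)) * f Z) \<in> borel_measurable borel"
    unfolding symplectic_inner
    by (intro borel_measurable_times schwartz_measurable[OF assms] borel_measurable_continuous_onI
        continuous_intros linear_continuous_on bounded_linear_symplectic_map)
  then show "symplectic_fourier f Y = of_real (phase_density TYPE('n)) * fourier symplectic_map f Y"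
    unfolding symplectic_fourier_def fourier_def wave_def symplectic_inner
    by (simp only: integral_scaled mult.commute[of "f _"])
qed

definition symplectic_map2 :: "'n::finite phase \<times> 'n phase \<Rightarrow> 'n phase \<times> 'n phase" where
  "symplectic_map2 = (\<lambda>(X, Y). (symplectic_map X, symplectic_map Y))"

lemma bounded_linear_symplectic_map2: "bounded_linear symplectic_map2"
  unfolding symplectic_map2_def case_prod_unfold
  by (intro bounded_linear_Pair bounded_linear_compose[OF bounded_linear_symplectic_map] bounded_linear_fst bounded_linear_snd)

lemma symplectic_map2_adjoint: "Y \<bullet> symplectic_map2 Z = Z \<bullet> (- symplectic_map2 Y)"
  by (simp add: symplectic_map2_def case_prod_unfold inner_prod_def[of Y] inner_prod_def[of Z]
      symplectic_map_adjoint[of "fst Y" "fst Z"] symplectic_map_adjoint[of "snd Y" "snd Z"])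

lemma norm_symplectic_map2: "norm (symplectic_map2 Z) = norm Z"
  by (simp add: symplectic_map2_def case_prod_unfold norm_prod_def[of "(symplectic_map _, _)"] norm_symplectic_map)
     (simp add: norm_prod_def[of Z])

lemma coord_change_apply:
  "coord_change z = (- fst z, fst z - snd z)" "inv coord_change z = (- fst z, - fst z - snd z)"
  by (simp add: coord_change_def case_prod_unfold) (simp add: inv_coord_change case_prod_unfold)

lemma coord_change_norm:
  "norm z \<le> 3 * norm (coord_change z)" "norm z \<le> 3 * norm (inv coord_change z)"
proof -
  have n: "norm (X, Y) \<le> norm X + norm Y" "norm X \<le> norm (X, Y)" "norm Y \<le> norm (X, Y)" for X Y :: "'a phase"
    by (rule norm_Pair_le, rule norm_fst_le, rule norm_snd_le)
  obtain X Y where z: "z = (X, Y)" by (cases z)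
  have "norm Y \<le> norm X + norm (X - Y)" using norm_triangle_ineq4[of X "X - Y"] by simp
  moreover have "norm X \<le> norm (- X, X - Y)" using n(2)[of "- X"] by (simp only: norm_minus_cancel)
  ultimately show "norm z \<le> 3 * norm (coord_change z)"
    unfolding z coord_change_apply fst_conv snd_conv using n(1)[of X Y] n(3)[of "X - Y" "- X"] by linarith
  have "norm Y \<le> norm X + norm (- X - Y)" using norm_triangle_ineq4[of "- X" "- X - Y"] by simp
  moreover have "norm X \<le> norm (- X, - X - Y)" using n(2)[of "- X"] by (simp only: norm_minus_cancel)
  ultimately show "norm z \<le> 3 * norm (inv coord_change z)"
    unfolding z coord_change_apply fst_conv snd_conv using n(1)[of X Y] n(3)[of "- X - Y" "- X"] by linarith
qed

lemma bounded_linear_coord_change: "bounded_linear coord_change" "bounded_linear (inv coord_change)"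
  unfolding coord_change_apply(2)[abs_def] unfolding coord_change_apply(1)[abs_def]
  by (intro bounded_linear_Pair bounded_linear_minus bounded_linear_sub bounded_linear_fst bounded_linear_snd)+

lemma soperator_coord_change:
  "soperator (\<lambda>F z. F (coord_change z))" "soperator (\<lambda>F z. F (inv coord_change z))"
  by (rule soperator_linear_substitution[OF bounded_linear_coord_change(1) coord_change_norm(1)],
      rule soperator_linear_substitution[OF bounded_linear_coord_change(2) coord_change_norm(2)])

lemma coord_change_inverse: "coord_change (inv coord_change z) = z" "inv coord_change (coord_change z) = z"
  by (simp_all add: coord_change_apply)

text \<open>The change of variables has a Jacobian of modulus one, which \<open>integral_shear\<close> expresses without
  determinants.\<close>

lemma pairing_coord_change:
  assumes F: "F \<in> schwartz" and G: "G \<in> schwartz"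
  shows "pairing lborel (\<lambda>z. F (coord_change z)) G = pairing lborel F (\<lambda>z. G (inv coord_change z))"
proof -
  define H where "H = (\<lambda>z. F z * G (inv coord_change z))"
  have H: "H \<in> schwartz" unfolding H_def by (rule schwartz_mult[OF F soperator_schwartz[OF soperator_coord_change(2) G]])
  have eq: "(\<lambda>(x, y). H (- x, x - y)) = (\<lambda>z. F (coord_change z) * G z)"
    by (rule ext) (simp add: H_def case_prod_unfold coord_change_apply)
  have HC: "(\<lambda>(x, y). H (- x, x - y)) \<in> schwartz"
    unfolding eq by (rule schwartz_mult[OF soperator_schwartz[OF soperator_coord_change(1) F] G])
  show ?thesis using integral_shear[OF H HC] unfolding eq by (simp add: pairing_def H_def)
qed

lemma soperator_swap: "soperator (\<lambda>(F :: 'b::euclidean_space \<times> 'a::euclidean_space \<Rightarrow> complex) z. F (snd z, fst z))"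
proof (rule soperator_linear_substitution[where K=1])
  show "bounded_linear (\<lambda>z :: 'a \<times> 'b. (snd z, fst z))"
    by (intro bounded_linear_Pair bounded_linear_fst bounded_linear_snd)
  show "norm z \<le> 1 * norm (snd z, fst z)" for z :: "'a \<times> 'b" by (simp add: norm_prod_def add.commute)
qed

lemma soperator_scale: "soperator A \<Longrightarrow> soperator (\<lambda>f x. c * A f x)"
proof (rule soperator_closed_graph)
  assume A: "soperator A"
  show "(\<lambda>x. c * A f x) \<in> schwartz" if "f \<in> schwartz" for f
    using schwartz_lincomb[OF soperator_schwartz[OF A that] soperator_schwartz[OF A that], of c 0] by simp
  show "sfunctional (\<lambda>f. c * A f x)" for x
    by (rule sfunctional_scale[OF sfunctional_compose[OF sfunctional_eval A]])
qed

text \<open>The point evaluations of a continuous map are continuous, so the closed graph lemma applies.\<close>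

lemma linear_continuous_map_soperator:
  assumes A: "linear_continuous_map schwartz_topology schwartz_topology A"
  shows "soperator A"
proof (rule soperator_closed_graph)
  show "A f \<in> schwartz" if "f \<in> schwartz" for f
    using A that continuous_map_image_subset_topspace[of schwartz_topology schwartz_topology A]
    unfolding linear_continuous_map_def topspace_schwartz_topology by blast
  fix x
  have "clinear_functional_on schwartz (\<lambda>f. A f x)"
    using A unfolding linear_continuous_map_def clinear_map_on_def clinear_functional_on_def topspace_schwartz_topology
    by simp
  moreover have "continuous_map schwartz_topology euclidean (\<lambda>f. A f x)"
    using continuous_map_compose[of schwartz_topology schwartz_topology A euclidean "\<lambda>u. u x"] A
      sfunctional_iff_continuous[OF sfunctional_linear[OF sfunctional_eval[of x]]] sfunctional_eval[of x]
    by (simp add: linear_continuous_map_def o_def)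
  ultimately show "sfunctional (\<lambda>f. A f x)" by (simp add: sfunctional_iff_continuous)
qed

lemma power_bound_nat:
  assumes "(C::real) \<ge> 0"
  shows "\<exists>M'::nat. \<forall>x\<ge>1. C * x ^ M \<le> real M' * x ^ M'"
proof (intro exI allI impI)
  fix x :: real assume x: "x \<ge> 1"
  show "C * x ^ M \<le> real (max (nat \<lceil>C\<rceil>) M) * x ^ max (nat \<lceil>C\<rceil>) M"
    using x assms by (intro mult_mono power_increasing zero_le_power) linarith+
qed

lemma pairing_hermite_decay:
  "\<exists>C m. C \<ge> 0 \<and> (\<forall>\<alpha>. \<forall>f\<in>schwartz. index_weight \<alpha> ^ N * cmod (pairing lborel f (hermite \<alpha>)) \<le> C * snorm m (f :: 'a::euclidean_space \<Rightarrow> complex))"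
proof -
  obtain n :: nat where n: "\<forall>\<alpha>. \<forall>f\<in>schwartz. index_weight \<alpha> ^ N * cmod (hermite_coeff \<alpha> f) \<le> real n * snorm n (f :: 'a \<Rightarrow> complex)"
    using hermite_coeff_decay[of N] by (elim exE)
  let ?h = "cmod (hermite_norm TYPE('a))"
  have "index_weight \<alpha> ^ N * cmod (pairing lborel f (hermite \<alpha>)) \<le> (?h * real n) * snorm n f"
    if f: "f \<in> schwartz" for \<alpha> and f :: "'a \<Rightarrow> complex"
  proof -
    have "pairing lborel f (hermite \<alpha>) = hermite_norm TYPE('a) * hermite_coeff \<alpha> f"
      by (simp add: hermite_coeff_def hermite_norm_neq_0[where 'a='a])
    then have "index_weight \<alpha> ^ N * cmod (pairing lborel f (hermite \<alpha>)) = ?h * (index_weight \<alpha> ^ N * cmod (hermite_coeff \<alpha> f))"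
      by (simp add: norm_mult)
    also have "\<dots> \<le> ?h * (real n * snorm n f)" by (rule mult_left_mono[OF n[rule_format, OF f] norm_ge_zero])
    finally show ?thesis by (simp only: mult.assoc)
  qed
  then show ?thesis by (intro exI[of _ "?h * real n"] exI[of _ n] conjI allI ballI) simp_all
qed

section \<open>The composition law\<close>

text \<open>The density of the measure is a parameter because it depends on the type of the phase space alone; this
  makes it a plain real number inside the locale.\<close>

locale composition_law =
  fixes law :: "'n::finite composition" and \<kappa> :: real
  assumes A: "hypothesis_A law" and B: "hypothesis_B law" and \<kappa>: "\<kappa> = phase_density TYPE('n)"
begin

lemma \<kappa>_pos: "\<kappa> > 0" unfolding \<kappa> by (rule phase_density_pos)

lemma phase_scaled: "scaled_lebesgue (phase_measure :: 'n phase measure) \<kappa>"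
  unfolding \<kappa> by (rule scaled_lebesgue_phase_measure)

lemma law_schwartz: "f \<in> schwartz \<Longrightarrow> g \<in> schwartz \<Longrightarrow> law f g \<in> schwartz"
  using A by (simp add: hypothesis_A_def)

lemma soperator_law_left: "g \<in> schwartz \<Longrightarrow> soperator (\<lambda>f. law f g)"
  using A by (intro linear_continuous_map_soperator) (simp add: hypothesis_A_def)

lemma soperator_law_right: "f \<in> schwartz \<Longrightarrow> soperator (\<lambda>g. law f g)"
  using A by (intro linear_continuous_map_soperator) (simp add: hypothesis_A_def)

lemma law_assoc: "f \<in> schwartz \<Longrightarrow> g \<in> schwartz \<Longrightarrow> h \<in> schwartz \<Longrightarrow> law (law f g) h = law f (law g h)"
  using A by (simp add: hypothesis_A_def)

lemma integral_law:
  assumes f: "f \<in> schwartz" and g: "g \<in> schwartz"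
  shows "(LINT X|lborel. law f g X) = pairing lborel f g"
proof -
  interpret scaled_lebesgue "phase_measure :: 'n phase measure" \<kappa> by (rule phase_scaled)
  have "(LINT X|phase_measure. law f g X) = (LINT X|phase_measure. f X * g X)"
    using A f g by (simp add: hypothesis_A_def)
  then show ?thesis
    using \<kappa>_pos
    by (simp add: integral_scaled schwartz_measurable[OF law_schwartz[OF f g]] schwartz_measurable[OF schwartz_mult[OF f g]] pairing_def)
qed

lemma pairing_law_assoc:
  assumes f: "f \<in> schwartz" and g: "g \<in> schwartz" and h: "h \<in> schwartz"
  shows "pairing lborel (law f g) h = pairing lborel f (law g h)"
  using integral_law[OF law_schwartz[OF f g] h] integral_law[OF f law_schwartz[OF g h]] law_assoc[OF f g h] by simp

text \<open>The kernel of \<open>R\<close>: the trace of the product of \<open>g1\<close>, \<open>f1\<close>, \<open>g2\<close>, \<open>f2\<close> in this order. It is taken for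
  Lebesgue measure, so the kernel of \<open>R\<close> carries an additional factor \<open>\<kappa>\<close>.\<close>

definition four_form ::
    "('n phase \<Rightarrow> complex) \<Rightarrow> ('n phase \<Rightarrow> complex) \<Rightarrow> ('n phase \<Rightarrow> complex) \<Rightarrow> ('n phase \<Rightarrow> complex) \<Rightarrow> complex" where
  "four_form f1 f2 g1 g2 = pairing lborel (law g1 f1) (law g2 f2)"

text \<open>Rotating the product by one place exchanges the roles of the pairs \<open>(f1, f2)\<close> and \<open>(g2, g1)\<close>.\<close>

lemma four_form_symmetric:
  assumes "f1 \<in> schwartz" "f2 \<in> schwartz" "g1 \<in> schwartz" "g2 \<in> schwartz"
  shows "four_form f1 f2 g1 g2 = four_form g2 g1 f1 f2"
proof -
  have "four_form f1 f2 g1 g2 = pairing lborel (law (law g1 f1) g2) f2"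
    unfolding four_form_def by (rule pairing_law_assoc[symmetric]) (intro law_schwartz assms)+
  also have "\<dots> = pairing lborel f2 (law g1 (law f1 g2))"
    unfolding law_assoc[OF assms(3,1,4)] by (rule pairing_commute)
  also have "\<dots> = pairing lborel (law f2 g1) (law f1 g2)"
    by (rule pairing_law_assoc[symmetric]) (intro law_schwartz assms)+
  also have "\<dots> = four_form g2 g1 f1 f2" unfolding four_form_def by (rule pairing_commute)
  finally show ?thesis .
qed

text \<open>With \<open>g2\<close> isolated, the form appears as a functional of \<open>f2 # g1 # f1\<close>, which is where Hypothesis B enters.\<close>

lemma four_form_cyclic:
  assumes "f1 \<in> schwartz" "f2 \<in> schwartz" "g1 \<in> schwartz" "g2 \<in> schwartz"
  shows "four_form f1 f2 g1 g2 = pairing lborel (law (law f2 g1) f1) g2"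
  unfolding four_form_symmetric[OF assms] unfolding four_form_def pairing_commute[of lborel "law f1 g2"]
  by (rule pairing_law_assoc[symmetric]) (intro law_schwartz assms)+

lemma sfunctional_four_form:
  "f2 \<in> schwartz \<Longrightarrow> g1 \<in> schwartz \<Longrightarrow> g2 \<in> schwartz \<Longrightarrow> sfunctional (\<lambda>f1. four_form f1 f2 g1 g2)"
  "f1 \<in> schwartz \<Longrightarrow> g1 \<in> schwartz \<Longrightarrow> g2 \<in> schwartz \<Longrightarrow> sfunctional (\<lambda>f2. four_form f1 f2 g1 g2)"
  "f1 \<in> schwartz \<Longrightarrow> f2 \<in> schwartz \<Longrightarrow> g2 \<in> schwartz \<Longrightarrow> sfunctional (\<lambda>g1. four_form f1 f2 g1 g2)"
  "f1 \<in> schwartz \<Longrightarrow> f2 \<in> schwartz \<Longrightarrow> g1 \<in> schwartz \<Longrightarrow> sfunctional (\<lambda>g2. four_form f1 f2 g1 g2)"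
  unfolding four_form_def
  subgoal by (rule sfunctional_compose[OF sfunctional_pairing[OF law_schwartz] soperator_law_right])
  subgoal by (rule sfunctional_compose[OF sfunctional_pairing'[OF law_schwartz] soperator_law_right])
  subgoal by (rule sfunctional_compose[OF sfunctional_pairing[OF law_schwartz] soperator_law_left])
  subgoal by (rule sfunctional_compose[OF sfunctional_pairing'[OF law_schwartz] soperator_law_left])
  done

text \<open>Hypothesis B in terms of test functions: \<open>f1 # T # f2\<close> tested on \<open>h\<close> is \<open>T\<close> tested on \<open>f2 # h # f1\<close>.\<close>

lemma sandwich_regular:
  assumes T: "sfunctional T" and f: "f1 \<in> schwartz" "f2 \<in> schwartz"
  shows "\<exists>u\<in>schwartz. \<forall>h\<in>schwartz. T (law (law f2 h) f1) = of_real \<kappa> * pairing lborel u h"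
proof -
  interpret scaled_lebesgue "phase_measure :: 'n phase measure" \<kappa> by (rule phase_scaled)
  define T' where "T' = (\<lambda>f. if f \<in> schwartz then T f else 0)"
  have "sfunctional T'" by (rule sfunctional_cong[OF T]) (simp add: T'_def)
  then have T': "T' \<in> tempered" by (simp add: tempered_iff T'_def)
  obtain u where u: "u \<in> schwartz" and eq: "comp_right law (comp_left law f1 T') f2 = distribution_of phase_measure u"
    using B[unfolded hypothesis_B_def, rule_format, OF f T'] by (elim bexE)
  have "T (law (law f2 h) f1) = of_real \<kappa> * pairing lborel u h" if h: "h \<in> schwartz" for h
    using fun_cong[OF eq, of h] h law_schwartz[OF f(2) h] law_schwartz[OF law_schwartz[OF f(2) h] f(1)]
    by (simp add: comp_right_def comp_left_def T'_def distribution_scaled[OF u h])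
  then show ?thesis using u by (intro bexI[of _ u] ballI)
qed

text \<open>A summable family \<open>c\<close> defines the tempered distribution \<open>T\<close> with coefficients \<open>c \<delta>\<close> times a power of the weight.
  Summing the form against \<open>c\<close> in \<open>\<delta>\<close> means testing \<open>f1 # T # f2\<close> on the Hermite function of
  index \<open>\<gamma>\<close>. This is a Schwartz function by Hypothesis B, hence the sum decreases rapidly in \<open>\<gamma>\<close>, and
  uniform boundedness over all \<open>c\<close> gives the joint decay.\<close>

lemma four_form_decay:
  assumes f: "f1 \<in> schwartz" "f2 \<in> schwartz"
  shows "\<exists>C. \<forall>\<gamma> \<delta>. cmod (of_real (index_weight \<gamma> ^ N * index_weight \<delta> ^ N) * four_form f1 f2 (hermite \<gamma>) (hermite \<delta>)) \<le> C"
proof (rule abs_summable_uniform_boundedness)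
  obtain C m where C: "C \<ge> 0" and decay: "\<forall>\<alpha>. \<forall>g\<in>schwartz. index_weight \<alpha> ^ N * cmod (pairing lborel g (hermite \<alpha>)) \<le> C * snorm m (g :: 'n phase \<Rightarrow> complex)"
    using pairing_hermite_decay[of N] by (elim exE conjE)
  have w: "index_weight \<alpha> \<ge> 0" for \<alpha> :: "'n phase \<Rightarrow> nat" using index_weight_ge_1[of \<alpha>] by linarith
  let ?k = "\<lambda>\<gamma>. law (law f2 (hermite \<gamma>)) f1"
  let ?d = "\<lambda>g \<delta>. of_real (index_weight \<delta> ^ N) * pairing lborel g (hermite \<delta>)"
  have k: "?k \<gamma> \<in> schwartz" for \<gamma> by (intro law_schwartz f hermite_schwartz)
  have d: "cmod (?d g \<delta>) \<le> C * snorm m g" if "g \<in> schwartz" for g :: "'n phase \<Rightarrow> complex" and \<delta>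
    using decay[rule_format, OF that, of \<delta>] w[of \<delta>] by (simp add: norm_mult norm_power)
  have form: "of_real (index_weight \<gamma> ^ N * index_weight \<delta> ^ N) * four_form f1 f2 (hermite \<gamma>) (hermite \<delta>)
      = of_real (index_weight \<gamma> ^ N) * ?d (?k \<gamma>) \<delta>" for \<gamma> \<delta>
    by (simp add: four_form_cyclic[OF f hermite_schwartz hermite_schwartz])
  show "\<exists>B. \<forall>\<delta>. cmod (of_real (index_weight \<gamma> ^ N * index_weight \<delta> ^ N) * four_form f1 f2 (hermite \<gamma>) (hermite \<delta>)) \<le> B" for \<gamma>
  proof (intro exI[of _ "index_weight \<gamma> ^ N * (C * snorm m (?k \<gamma>))"] allI)
    fix \<delta>
    have "cmod (of_real (index_weight \<gamma> ^ N) * ?d (?k \<gamma>) \<delta>) = index_weight \<gamma> ^ N * cmod (?d (?k \<gamma>) \<delta>)"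
      using w[of \<gamma>] by (simp add: norm_mult norm_power)
    also have "\<dots> \<le> index_weight \<gamma> ^ N * (C * snorm m (?k \<gamma>))"
      by (rule mult_left_mono[OF d[OF k]]) (simp add: w)
    finally show "cmod (of_real (index_weight \<gamma> ^ N * index_weight \<delta> ^ N) * four_form f1 f2 (hermite \<gamma>) (hermite \<delta>))
        \<le> index_weight \<gamma> ^ N * (C * snorm m (?k \<gamma>))" unfolding form .
  qed
  fix c :: "('n phase \<Rightarrow> nat) \<Rightarrow> complex" assume c: "(\<lambda>\<delta>. cmod (c \<delta>)) summable_on UNIV"
  define T where "T = (\<lambda>g. \<Sum>\<^sub>\<infinity>\<delta>. c \<delta> * ?d g \<delta>)"
  have sm: "(\<lambda>\<delta>. c \<delta> * ?d g \<delta>) summable_on UNIV" if "g \<in> schwartz" for g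
    by (rule abs_summable_weighted_bound(1)[OF c d[OF that]])
  have T: "sfunctional T"
    unfolding sfunctional_def
  proof (intro conjI exI[of _ m] exI[of _ "C * (\<Sum>\<^sub>\<infinity>\<delta>. cmod (c \<delta>))"] ballI)
    show "clinear_functional_on schwartz T"
      unfolding clinear_functional_on_def
    proof (intro ballI allI)
      fix f g :: "'n phase \<Rightarrow> complex" and a b assume fg: "f \<in> schwartz" "g \<in> schwartz"
      have "T (\<lambda>x. a * f x + b * g x) = (\<Sum>\<^sub>\<infinity>\<delta>. a * (c \<delta> * ?d f \<delta>) + b * (c \<delta> * ?d g \<delta>))"
        unfolding T_def pairing_lincomb(1)[OF fg hermite_schwartz] by (simp add: algebra_simps)
      also have "\<dots> = (\<Sum>\<^sub>\<infinity>\<delta>. a * (c \<delta> * ?d f \<delta>)) + (\<Sum>\<^sub>\<infinity>\<delta>. b * (c \<delta> * ?d g \<delta>))"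
        by (rule infsum_add[OF summable_on_cmult_right[OF sm[OF fg(1)]] summable_on_cmult_right[OF sm[OF fg(2)]]])
      also have "\<dots> = a * T f + b * T g" unfolding T_def infsum_cmult_right' ..
      finally show "T (\<lambda>x. a * f x + b * g x) = a * T f + b * T g" .
    qed
    fix g :: "'n phase \<Rightarrow> complex" assume g: "g \<in> schwartz"
    show "cmod (T g) \<le> C * (\<Sum>\<^sub>\<infinity>\<delta>. cmod (c \<delta>)) * snorm m g"
      using abs_summable_weighted_bound(2)[OF c d[OF g]] unfolding T_def by (simp only: mult_ac)
  qed
  obtain u where u: "u \<in> schwartz" and Tu: "\<forall>h\<in>schwartz. T (law (law f2 h) f1) = of_real \<kappa> * pairing lborel u h"
    using sandwich_regular[OF T f] by (elim bexE)
  show "\<exists>B. \<forall>\<gamma>. cmod (\<Sum>\<^sub>\<infinity>\<delta>. c \<delta> * (of_real (index_weight \<gamma> ^ N * index_weight \<delta> ^ N) * four_form f1 f2 (hermite \<gamma>) (hermite \<delta>))) \<le> B"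
  proof (intro exI[of _ "\<kappa> * (C * snorm m u)"] allI)
    fix \<gamma>
    have "(\<Sum>\<^sub>\<infinity>\<delta>. c \<delta> * (of_real (index_weight \<gamma> ^ N) * ?d (?k \<gamma>) \<delta>)) = (\<Sum>\<^sub>\<infinity>\<delta>. of_real (index_weight \<gamma> ^ N) * (c \<delta> * ?d (?k \<gamma>) \<delta>))"
      by (simp add: mult_ac)
    also have "\<dots> = of_real (index_weight \<gamma> ^ N) * T (?k \<gamma>)" unfolding T_def infsum_cmult_right' ..
    also have "\<dots> = of_real \<kappa> * ?d u \<gamma>" using Tu hermite_schwartz[of \<gamma>] by (simp add: mult_ac)
    finally have "cmod (\<Sum>\<^sub>\<infinity>\<delta>. c \<delta> * (of_real (index_weight \<gamma> ^ N) * ?d (?k \<gamma>) \<delta>)) = \<kappa> * cmod (?d u \<gamma>)"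
      using \<kappa>_pos by (simp add: norm_mult)
    also have "\<dots> \<le> \<kappa> * (C * snorm m u)"
      by (rule mult_left_mono[OF d[OF u]]) (use \<kappa>_pos in linarith)
    finally show "cmod (\<Sum>\<^sub>\<infinity>\<delta>. c \<delta> * (of_real (index_weight \<gamma> ^ N * index_weight \<delta> ^ N) * four_form f1 f2 (hermite \<gamma>) (hermite \<delta>))) \<le> \<kappa> * (C * snorm m u)"
      unfolding form .
  qed
qed

text \<open>Uniform boundedness in \<open>f1\<close> for fixed \<open>f2\<close>, and then in \<open>f2\<close> for the family that also includes the index
  \<open>\<alpha>\<close> of \<open>f1\<close>. The second step needs the version with growing bounds, since the bound from the first step
  grows with an exponent that depends on \<open>f2\<close>.\<close>

lemma four_form_joint_bound:
  "\<exists>C M. \<forall>\<alpha> \<beta> \<gamma> \<delta>. index_weight \<gamma> ^ N * index_weight \<delta> ^ N * cmod (four_form (hermite \<alpha>) (hermite \<beta>) (hermite \<gamma>) (hermite \<delta>))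
     \<le> C * (index_weight \<alpha> ^ M * index_weight \<beta> ^ M)"
proof -
  let ?l = "\<lambda>(\<gamma>, \<delta>) f1 f2. of_real (index_weight \<gamma> ^ N * index_weight \<delta> ^ N) * four_form f1 f2 (hermite \<gamma>) (hermite \<delta>)"
  have first: "\<exists>M::nat. \<forall>j. cmod (case j of (\<gamma>\<delta>, \<alpha>) \<Rightarrow> ?l \<gamma>\<delta> (hermite \<alpha>) f2) \<le> real M * index_weight (snd j) ^ M"
    if f2: "f2 \<in> schwartz" for f2
  proof -
    have "\<exists>M::nat. \<forall>\<gamma>\<delta>. \<forall>f1\<in>schwartz. cmod (?l \<gamma>\<delta> f1 f2) \<le> real M * snorm M f1"
    proof (rule sfunctional_equicontinuous)
      show "sfunctional (\<lambda>f1. ?l \<gamma>\<delta> f1 f2)" for \<gamma>\<delta>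
        using sfunctional_scale[OF sfunctional_four_form(1)[OF f2 hermite_schwartz hermite_schwartz]] by (cases \<gamma>\<delta>) simp
      show "bounded (range (\<lambda>\<gamma>\<delta>. ?l \<gamma>\<delta> f1 f2))" if f1: "f1 \<in> schwartz" for f1
      proof -
        obtain C where "\<forall>\<gamma> \<delta>. cmod (of_real (index_weight \<gamma> ^ N * index_weight \<delta> ^ N) * four_form f1 f2 (hermite \<gamma>) (hermite \<delta>)) \<le> C"
          using four_form_decay[OF f1 f2, of N] by (elim exE)
        then show ?thesis by (intro boundedI[of _ C]) (auto simp: case_prod_unfold)
      qed
    qed
    then obtain M :: nat where M: "\<forall>\<gamma>\<delta>. \<forall>f1\<in>schwartz. cmod (?l \<gamma>\<delta> f1 f2) \<le> real M * snorm M f1" by (elim exE)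
    obtain D p where D: "D \<ge> 0" "\<And>\<alpha>. snorm M (hermite \<alpha> :: 'n phase \<Rightarrow> complex) \<le> D * index_weight \<alpha> ^ p"
      by (rule poly_growthD[OF snorm_hermite_growth[of M]], rule that)
    have MD: "real M * D \<ge> 0" using D(1) by simp
    obtain M' :: nat where M': "\<forall>x\<ge>1. real M * D * x ^ p \<le> real M' * x ^ M'"
      using power_bound_nat[OF MD, of p] by (elim exE)
    show ?thesis
    proof (intro exI[of _ M'] allI)
      fix j :: "(('n phase \<Rightarrow> nat) \<times> ('n phase \<Rightarrow> nat)) \<times> ('n phase \<Rightarrow> nat)"
      obtain \<gamma>\<delta> \<alpha> where j: "j = (\<gamma>\<delta>, \<alpha>)" by (cases j)
      have "cmod (?l \<gamma>\<delta> (hermite \<alpha>) f2) \<le> real M * snorm M (hermite \<alpha> :: 'n phase \<Rightarrow> complex)"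
        by (rule M[rule_format, OF hermite_schwartz])
      also have "\<dots> \<le> real M * (D * index_weight \<alpha> ^ p)" by (rule mult_left_mono[OF D(2)]) simp
      also have "\<dots> \<le> real M' * index_weight \<alpha> ^ M'"
        using M'[rule_format, OF index_weight_ge_1[of \<alpha>]] by (simp only: mult.assoc)
      finally show "cmod (case j of (\<gamma>\<delta>, \<alpha>) \<Rightarrow> ?l \<gamma>\<delta> (hermite \<alpha>) f2) \<le> real M' * index_weight (snd j) ^ M'"
        by (simp only: j prod.case snd_conv)
    qed
  qed
  have "\<exists>M::nat. \<forall>j. \<forall>f2\<in>schwartz. cmod (case j of (\<gamma>\<delta>, \<alpha>) \<Rightarrow> ?l \<gamma>\<delta> (hermite \<alpha>) f2)
      \<le> real M * index_weight (snd j) ^ M * snorm M f2"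
  proof (rule sfunctional_uniform_boundedness[OF _ index_weight_ge_1 first])
    show "sfunctional (\<lambda>f2. case j of (\<gamma>\<delta>, \<alpha>) \<Rightarrow> ?l \<gamma>\<delta> (hermite \<alpha>) f2)" for j
      using sfunctional_scale[OF sfunctional_four_form(2)[OF hermite_schwartz hermite_schwartz hermite_schwartz]]
      by (simp add: case_prod_unfold)
  qed
  then obtain M :: nat where M: "\<forall>j. \<forall>f2\<in>schwartz. cmod (case j of (\<gamma>\<delta>, \<alpha>) \<Rightarrow> ?l \<gamma>\<delta> (hermite \<alpha>) f2)
      \<le> real M * index_weight (snd j) ^ M * snorm M f2" by (elim exE)
  obtain D p where D: "D \<ge> 0" "\<And>\<alpha>. snorm M (hermite \<alpha> :: 'n phase \<Rightarrow> complex) \<le> D * index_weight \<alpha> ^ p"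
    by (rule poly_growthD[OF snorm_hermite_growth[of M]], rule that)
  show ?thesis
  proof (intro exI[of _ "real M * D"] exI[of _ "max M p"] allI)
    fix \<alpha> \<beta> \<gamma> \<delta> :: "'n phase \<Rightarrow> nat"
    have w: "index_weight \<epsilon> \<ge> 1" "index_weight \<epsilon> \<ge> 0" for \<epsilon> :: "'n phase \<Rightarrow> nat" using index_weight_ge_1[of \<epsilon>] by linarith+
    have "index_weight \<gamma> ^ N * index_weight \<delta> ^ N * cmod (four_form (hermite \<alpha>) (hermite \<beta>) (hermite \<gamma>) (hermite \<delta>))
        = cmod (?l (\<gamma>, \<delta>) (hermite \<alpha>) (hermite \<beta>))"
      using w by (simp add: norm_mult norm_power)
    also have "\<dots> \<le> real M * index_weight \<alpha> ^ M * snorm M (hermite \<beta> :: 'n phase \<Rightarrow> complex)"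
      using M[rule_format, OF hermite_schwartz[of \<beta>], of "((\<gamma>, \<delta>), \<alpha>)"] by simp
    also have "\<dots> \<le> real M * index_weight \<alpha> ^ M * (D * index_weight \<beta> ^ p)"
      by (rule mult_left_mono[OF D(2)]) (simp add: w)
    also have "\<dots> = real M * D * (index_weight \<alpha> ^ M * index_weight \<beta> ^ p)" by (simp only: mult_ac)
    also have "\<dots> \<le> real M * D * (index_weight \<alpha> ^ max M p * index_weight \<beta> ^ max M p)"
      using w D(1) by (intro mult_left_mono mult_mono power_increasing zero_le_power mult_nonneg_nonneg) auto
    finally show "index_weight \<gamma> ^ N * index_weight \<delta> ^ N * cmod (four_form (hermite \<alpha>) (hermite \<beta>) (hermite \<gamma>) (hermite \<delta>))
        \<le> real M * D * (index_weight \<alpha> ^ max M p * index_weight \<beta> ^ max M p)" .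
  qed
qed

text \<open>The matrix with entries on Hermite functions gives the operator. Its values on tensor products are then checked in
  one argument at a time, since a continuous functional is determined on Hermite functions. The factor
  \<open>1 / \<kappa>\<close> accounts for the pairing on the doubled phase space, which carries \<open>\<kappa>\<close> twice.\<close>

lemma four_form_operator:
  "\<exists>K. soperator K \<and> (\<forall>f1\<in>schwartz. \<forall>f2\<in>schwartz. \<forall>g1\<in>schwartz. \<forall>g2\<in>schwartz.
     pairing lborel (K (tensor f1 f2)) (tensor g1 g2) = four_form f1 f2 g1 g2 / of_real \<kappa>)"
proof -
  let ?t = "\<lambda>(\<alpha> :: 'n phase \<times> 'n phase \<Rightarrow> nat) (\<beta> :: 'n phase \<times> 'n phase \<Rightarrow> nat).
    four_form (hermite (fst_index \<alpha>)) (hermite (snd_index \<alpha>)) (hermite (fst_index \<beta>)) (hermite (snd_index \<beta>)) / of_real \<kappa>"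
  have bound: "\<exists>C M. \<forall>\<alpha>\<in>multi_indices. \<forall>\<beta>\<in>multi_indices. index_weight \<beta> ^ N * cmod (?t \<alpha> \<beta>) \<le> C * index_weight \<alpha> ^ M" for N
  proof -
    obtain C M where C: "\<forall>\<alpha> \<beta> \<gamma> \<delta>. index_weight \<gamma> ^ N * index_weight \<delta> ^ N * cmod (four_form (hermite \<alpha>) (hermite \<beta>) (hermite \<gamma>) (hermite \<delta>))
     \<le> C * (index_weight \<alpha> ^ M * index_weight \<beta> ^ M)"
      using four_form_joint_bound[of N] by (elim exE)
    show ?thesis
    proof (intro exI[of _ "\<bar>C\<bar> / \<kappa>"] exI[of _ "M + M"] ballI)
      fix \<alpha> \<beta> :: "'n phase \<times> 'n phase \<Rightarrow> nat"
      have w: "index_weight \<epsilon> \<ge> 0" for \<epsilon> :: "'a::euclidean_space \<Rightarrow> nat" using index_weight_ge_1[of \<epsilon>] by linarith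
      let ?q = "cmod (four_form (hermite (fst_index \<alpha>)) (hermite (snd_index \<alpha>)) (hermite (fst_index \<beta>)) (hermite (snd_index \<beta>)))"
      have "index_weight \<beta> ^ N * ?q \<le> (index_weight (fst_index \<beta>) * index_weight (snd_index \<beta>)) ^ N * ?q"
        by (intro mult_right_mono power_mono index_weight_prod_le w) simp
      also have "\<dots> \<le> C * (index_weight (fst_index \<alpha>) ^ M * index_weight (snd_index \<alpha>) ^ M)"
        using C unfolding power_mult_distrib by (elim allE)
      also have "\<dots> \<le> \<bar>C\<bar> * (index_weight \<alpha> ^ M * index_weight \<alpha> ^ M)"
        by (intro mult_mono power_mono index_weight_fst_le index_weight_snd_le w mult_nonneg_nonneg zero_le_power) auto
      finally have "index_weight \<beta> ^ N * ?q / \<kappa> \<le> \<bar>C\<bar> * (index_weight \<alpha> ^ M * index_weight \<alpha> ^ M) / \<kappa>"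
        using \<kappa>_pos by (intro divide_right_mono) auto
      then show "index_weight \<beta> ^ N * cmod (?t \<alpha> \<beta>) \<le> \<bar>C\<bar> / \<kappa> * index_weight \<alpha> ^ (M + M)"
        using \<kappa>_pos by (simp add: norm_divide power_add)
    qed
  qed
  obtain K where K: "soperator K" and
    val: "\<forall>\<alpha>\<in>multi_indices. \<forall>\<beta>\<in>multi_indices. pairing lborel (K (hermite \<alpha>)) (hermite \<beta>) = ?t \<alpha> \<beta>"
    using matrix_operator[of ?t, OF bound] by (elim exE conjE)
  let ?I = "multi_indices :: ('n phase \<Rightarrow> nat) set"
  let ?P = "\<lambda>f1 f2 g1 g2. pairing lborel (K (tensor f1 f2)) (tensor g1 g2)"
  let ?Q = "\<lambda>f1 f2 g1 g2. (1 / of_real \<kappa>) * four_form f1 f2 g1 g2"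
  have 0: "?P (hermite \<alpha>) (hermite \<beta>) (hermite \<gamma>) (hermite \<delta>) = ?Q (hermite \<alpha>) (hermite \<beta>) (hermite \<gamma>) (hermite \<delta>)"
    if i: "\<alpha> \<in> ?I" "\<beta> \<in> ?I" "\<gamma> \<in> ?I" "\<delta> \<in> ?I" for \<alpha> \<beta> \<gamma> \<delta>
    using val[rule_format, OF pair_index_multi_indices[of \<alpha> \<beta>] pair_index_multi_indices[of \<gamma> \<delta>]]
    by (simp add: hermite_pair_index i fst_pair_index snd_pair_index)
  have 1: "?P f1 (hermite \<beta>) (hermite \<gamma>) (hermite \<delta>) = ?Q f1 (hermite \<beta>) (hermite \<gamma>) (hermite \<delta>)"
    if f: "f1 \<in> schwartz" and i: "\<beta> \<in> ?I" "\<gamma> \<in> ?I" "\<delta> \<in> ?I" for f1 \<beta> \<gamma> \<delta>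
    by (rule sfunctional_eqI[OF sfunctional_compose[OF sfunctional_pairing[OF tensor_schwartz[OF hermite_schwartz hermite_schwartz]]
            soperator_compose[OF K soperator_tensor(1)[OF hermite_schwartz]]]
          sfunctional_scale[OF sfunctional_four_form(1)[OF hermite_schwartz hermite_schwartz hermite_schwartz]] 0[OF _ i] f])
  have 2: "?P f1 f2 (hermite \<gamma>) (hermite \<delta>) = ?Q f1 f2 (hermite \<gamma>) (hermite \<delta>)"
    if f: "f1 \<in> schwartz" "f2 \<in> schwartz" and i: "\<gamma> \<in> ?I" "\<delta> \<in> ?I" for f1 f2 \<gamma> \<delta>
    by (rule sfunctional_eqI[OF sfunctional_compose[OF sfunctional_pairing[OF tensor_schwartz[OF hermite_schwartz hermite_schwartz]]
            soperator_compose[OF K soperator_tensor(2)[OF f(1)]]]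
          sfunctional_scale[OF sfunctional_four_form(2)[OF f(1) hermite_schwartz hermite_schwartz]] 1[OF f(1) _ i] f(2)])
  have 3: "?P f1 f2 g1 (hermite \<delta>) = ?Q f1 f2 g1 (hermite \<delta>)"
    if f: "f1 \<in> schwartz" "f2 \<in> schwartz" and g: "g1 \<in> schwartz" and i: "\<delta> \<in> ?I" for f1 f2 g1 \<delta>
    by (rule sfunctional_eqI[OF sfunctional_compose[OF sfunctional_pairing'[OF soperator_schwartz[OF K tensor_schwartz[OF f]]]
            soperator_tensor(1)[OF hermite_schwartz]]
          sfunctional_scale[OF sfunctional_four_form(3)[OF f hermite_schwartz]] 2[OF f _ i] g])
  have 4: "?P f1 f2 g1 g2 = ?Q f1 f2 g1 g2"
    if f: "f1 \<in> schwartz" "f2 \<in> schwartz" and g: "g1 \<in> schwartz" "g2 \<in> schwartz" for f1 f2 g1 g2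
    by (rule sfunctional_eqI[OF sfunctional_compose[OF sfunctional_pairing'[OF soperator_schwartz[OF K tensor_schwartz[OF f]]]
            soperator_tensor(2)[OF g(1)]]
          sfunctional_scale[OF sfunctional_four_form(4)[OF f g(1)]] 3[OF f g(1)] g(2)])
  show ?thesis
    by (rule exI[of _ K], rule conjI[OF K], (rule ballI)+) (simp add: 4)
qed

end

section \<open>The mappings R, N and M\<close>

lemma pairing_scale:
  assumes "f \<in> schwartz" "g \<in> schwartz"
  shows "pairing lborel (\<lambda>x. c * f x) g = c * pairing lborel f g" "pairing lborel f (\<lambda>x. c * g x) = c * pairing lborel f g"
  using pairing_lincomb(1)[OF assms(1,1,2), of c 0] pairing_lincomb(1)[OF assms(2,2,1), of c 0]
  by (simp_all add: pairing_commute[of lborel f])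

context composition_law
begin

abbreviation extension_property ::
    "(('n phase \<times> 'n phase \<Rightarrow> complex) \<Rightarrow> ('n phase \<times> 'n phase \<Rightarrow> complex) \<Rightarrow> complex) \<Rightarrow> bool" where
  "extension_property \<Phi> \<equiv>
    (\<exists>\<Phi>\<^sub>0. linear_continuous_map schwartz_topology schwartz_topology \<Phi>\<^sub>0 \<and>
          (\<forall>F\<in>schwartz. \<Phi> F = distribution_of phase_measure2 (\<Phi>\<^sub>0 F))) \<and>
    (\<exists>\<Psi>. linear_continuous_map tempered_topology tempered_topology \<Psi> \<and>
         (\<forall>F\<in>schwartz. \<Psi> (distribution_of phase_measure2 F) = \<Phi> F) \<and>
         (\<forall>\<Psi>'. linear_continuous_map tempered_topology tempered_topology \<Psi>' \<and>
               (\<forall>F\<in>schwartz. \<Psi>' (distribution_of phase_measure2 F) = \<Phi> F)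
               \<longrightarrow> (\<forall>T\<in>tempered. \<Psi>' T = \<Psi> T)))"

lemma phase_scaled2: "scaled_lebesgue (phase_measure2 :: ('n phase \<times> 'n phase) measure) (\<kappa> * \<kappa>)"
  unfolding \<kappa> by (rule scaled_lebesgue_phase_measure2)

text \<open>The symmetry of the form says this on tensor products, and these are total.\<close>

lemma kernel_transpose:
  assumes K: "soperator K"
    and val: "\<And>f1 f2 g1 g2. f1 \<in> schwartz \<Longrightarrow> f2 \<in> schwartz \<Longrightarrow> g1 \<in> schwartz \<Longrightarrow> g2 \<in> schwartz \<Longrightarrow>
      pairing lborel (K (tensor f1 f2)) (tensor g1 g2) = four_form f1 f2 g1 g2 / of_real \<kappa>"
    and F: "F \<in> schwartz" and G: "G \<in> schwartz"
  shows "pairing lborel (K F) G = pairing lborel F (K (\<lambda>z. G (snd z, fst z)))"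
proof -
  let ?K' = "\<lambda>G. K (\<lambda>z. G (snd z, fst z))"
  have K': "soperator ?K'" by (rule soperator_compose[OF K soperator_swap])
  have tensors: "pairing lborel (K (tensor f1 f2)) (tensor g1 g2) = pairing lborel (tensor f1 f2) (?K' (tensor g1 g2))"
    if f: "f1 \<in> schwartz" "f2 \<in> schwartz" and g: "g1 \<in> schwartz" "g2 \<in> schwartz"
    for f1 f2 g1 g2 :: "'n phase \<Rightarrow> complex"
  proof -
    have swap: "(\<lambda>z. tensor g1 g2 (snd z, fst z)) = tensor g2 g1"
      by (rule ext) (simp add: tensor_def case_prod_unfold)
    show ?thesis
      unfolding swap pairing_commute[of lborel "tensor f1 f2"] val[OF f g] val[OF g(2,1) f] four_form_symmetric[OF f g] ..
  qed
  have one: "pairing lborel (K F) (tensor g1 g2) = pairing lborel F (?K' (tensor g1 g2))"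
    if g: "g1 \<in> schwartz" "g2 \<in> schwartz" for g1 g2 :: "'n phase \<Rightarrow> complex"
  proof (rule sfunctional_tensor_eqI[OF sfunctional_compose[OF sfunctional_pairing[OF tensor_schwartz[OF g]] K]
        sfunctional_pairing[OF soperator_schwartz[OF K' tensor_schwartz[OF g]]] _ F])
    show "pairing lborel (K (tensor (hermite \<alpha>) (hermite \<beta>))) (tensor g1 g2) = pairing lborel (tensor (hermite \<alpha>) (hermite \<beta>)) (?K' (tensor g1 g2))"
      for \<alpha> \<beta> :: "'n phase \<Rightarrow> nat"
      by (rule tensors[OF hermite_schwartz hermite_schwartz g])
  qed
  show ?thesis
  proof (rule sfunctional_tensor_eqI[OF sfunctional_pairing'[OF soperator_schwartz[OF K F]]
        sfunctional_compose[OF sfunctional_pairing'[OF F] K'] _ G])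
    show "pairing lborel (K F) (tensor (hermite \<alpha>) (hermite \<beta>)) = pairing lborel F (?K' (tensor (hermite \<alpha>) (hermite \<beta>)))"
      for \<alpha> \<beta> :: "'n phase \<Rightarrow> nat"
      by (rule one[OF hermite_schwartz hermite_schwartz])
  qed
qed

lemma extension_properties:
  "extension_property (mapping_R law) \<and> extension_property (mapping_N law) \<and> extension_property (mapping_M law)"
proof -
  interpret scaled: scaled_lebesgue "phase_measure2 :: ('n phase \<times> 'n phase) measure" "\<kappa> * \<kappa>" by (rule phase_scaled2)
  interpret phase: scaled_lebesgue "phase_measure :: 'n phase measure" \<kappa> by (rule phase_scaled)
  obtain K where K: "soperator K" and "\<forall>f1\<in>schwartz. \<forall>f2\<in>schwartz. \<forall>g1\<in>schwartz. \<forall>g2\<in>schwartz.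
     pairing lborel (K (tensor f1 f2)) (tensor g1 g2) = four_form f1 f2 g1 g2 / of_real \<kappa>"
    using four_form_operator by (elim exE conjE)
  then have val: "pairing lborel (K (tensor f1 f2)) (tensor g1 g2) = four_form f1 f2 g1 g2 / of_real \<kappa>"
    if "f1 \<in> schwartz" "f2 \<in> schwartz" "g1 \<in> schwartz" "g2 \<in> schwartz" for f1 f2 g1 g2 using that by simp
  let ?K' = "\<lambda>G. K (\<lambda>z. G (snd z, fst z))"
  have K': "soperator ?K'" by (rule soperator_compose[OF K soperator_swap])
  have trK: "pairing lborel (K F) G = pairing lborel F (?K' G)" if "F \<in> schwartz" "G \<in> schwartz" for F G
    by (rule kernel_transpose[OF K val that])
  have ff: "pairing phase_measure (law g1 f1) (law g2 f2) = of_real (\<kappa> * \<kappa>) * pairing lborel (K (tensor f1 f2)) (tensor g1 g2)"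
    if f: "f1 \<in> schwartz" "f2 \<in> schwartz" and g: "g1 \<in> schwartz" "g2 \<in> schwartz" for f1 f2 g1 g2
    using \<kappa>_pos by (simp add: val[OF f g] four_form_def phase.pairing_scaled[OF law_schwartz[OF g(1) f(1)] law_schwartz[OF g(2) f(2)]])
  have R: "mapping_R law = (\<lambda>F. if F \<in> schwartz then distribution_of phase_measure2 (K F) else (\<lambda>_. 0))"
    unfolding mapping_R_def by (rule kernel_theorem_value[OF phase_scaled2 K ff[symmetric]])
  have extR: "extension_property (mapping_R law)"
    by (rule scaled.transpose_extension[OF K K' trK]) (simp_all add: R)

  let ?J = "symplectic_map2 :: 'n phase \<times> 'n phase \<Rightarrow> 'n phase \<times> 'n phase" and ?c = "of_real (\<kappa> * \<kappa>) :: complex"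
  let ?J' = "\<lambda>z. - ?J z"
  note blJ = bounded_linear_symplectic_map2
  have blJ': "bounded_linear ?J'" by (rule bounded_linear_minus[OF blJ])
  have adj': "y \<bullet> ?J' x = x \<bullet> ?J y" for x y using symplectic_map2_adjoint[of y x] by simp
  \<comment> \<open>The symplectic Fourier transform in both variables, and its transpose.\<close>
  define \<F> where "\<F> = (\<lambda>G x. ?c * fourier ?J G x)"
  define \<F>' where "\<F>' = (\<lambda>G x. ?c * fourier ?J' G x)"
  have oJ: "soperator (fourier ?J)"
    by (rule soperator_isometric_fourier[OF blJ symplectic_map2_adjoint]) (simp add: norm_symplectic_map2)
  have oJ': "soperator (fourier ?J')"
    by (rule soperator_isometric_fourier[OF blJ' adj' norm_symplectic_map2])
  have F: "soperator \<F>" and F': "soperator \<F>'"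
    unfolding \<F>_def \<F>'_def by (rule soperator_scale[OF oJ], rule soperator_scale[OF oJ'])
  have trF: "pairing lborel (\<F>' F) G = pairing lborel F (\<F> G)" if FG: "F \<in> schwartz" "G \<in> schwartz" for F G
    unfolding \<F>_def \<F>'_def pairing_scale(1)[OF soperator_schwartz[OF oJ' FG(1)] FG(2)]
      pairing_scale(2)[OF FG(1) soperator_schwartz[OF oJ FG(2)]]
    by (simp add: fourier_transpose[OF blJ' blJ adj' FG])
  have sf: "symplectic_fourier g \<in> schwartz" if "g \<in> schwartz" for g :: "'n phase \<Rightarrow> complex"
    unfolding symplectic_fourier_eq[OF that]
    by (rule soperator_schwartz[OF soperator_scale[OF soperator_isometric_fourier[OF bounded_linear_symplectic_map symplectic_map_adjoint]] that])
       (simp add: norm_symplectic_map)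
  have Ft: "\<F> (tensor g1 g2) = tensor (symplectic_fourier g1) (symplectic_fourier g2)"
    if g: "g1 \<in> schwartz" "g2 \<in> schwartz" for g1 g2 :: "'n phase \<Rightarrow> complex"
    unfolding \<F>_def symplectic_map2_def fourier_tensor[OF bounded_linear_symplectic_map bounded_linear_symplectic_map g]
      symplectic_fourier_eq[OF g(1)] symplectic_fourier_eq[OF g(2)] \<kappa>
    by (rule ext) (simp add: tensor_def case_prod_unfold)
  let ?N = "\<lambda>F. \<F>' (K F)" and ?N' = "\<lambda>G. ?K' (\<F> G)"
  have N: "soperator ?N" and N': "soperator ?N'"
    by (rule soperator_compose[OF F' K], rule soperator_compose[OF K' F])
  have trN: "pairing lborel (?N F) G = pairing lborel F (?N' G)" if FG: "F \<in> schwartz" "G \<in> schwartz" for F G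
    unfolding trF[OF soperator_schwartz[OF K FG(1)] FG(2)] by (rule trK[OF FG(1) soperator_schwartz[OF F FG(2)]])
  have valN: "?c * pairing lborel (?N (tensor f1 f2)) (tensor g1 g2)
      = pairing phase_measure (law (symplectic_fourier g1) f1) (law (symplectic_fourier g2) f2)"
    if f: "f1 \<in> schwartz" "f2 \<in> schwartz" and g: "g1 \<in> schwartz" "g2 \<in> schwartz" for f1 f2 g1 g2
    unfolding trF[OF soperator_schwartz[OF K tensor_schwartz[OF f]] tensor_schwartz[OF g]] Ft[OF g]
    by (rule ff[OF f sf[OF g(1)] sf[OF g(2)], symmetric])
  have mN: "mapping_N law = (\<lambda>F. if F \<in> schwartz then distribution_of phase_measure2 (?N F) else (\<lambda>_. 0))"
    unfolding mapping_N_def by (rule kernel_theorem_value[OF phase_scaled2 N valN])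
  have extN: "extension_property (mapping_N law)"
    by (rule scaled.transpose_extension[OF N N' trN]) (simp_all add: mN)

  \<comment> \<open>For \<open>M\<close> the distribution is tested after the inverse change of variables; moving it to the other
    factor composes the function with the change of variables.\<close>
  let ?M = "\<lambda>F z. ?N F (coord_change z)" and ?M' = "\<lambda>G. ?N' (\<lambda>z. G (inv coord_change z))"
  have M: "soperator ?M" and M': "soperator ?M'"
    by (rule soperator_compose[OF soperator_coord_change(1) N], rule soperator_compose[OF N' soperator_coord_change(2)])
  have trM: "pairing lborel (?M F) G = pairing lborel F (?M' G)" if FG: "F \<in> schwartz" "G \<in> schwartz" for F G
    unfolding pairing_coord_change[OF soperator_schwartz[OF N FG(1)] FG(2)]
    by (rule trN[OF FG(1) soperator_schwartz[OF soperator_coord_change(2) FG(2)]])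
  have mM: "mapping_M law F = distribution_of phase_measure2 (?M F)" if FS: "F \<in> schwartz" for F
  proof
    fix G :: "'n phase \<times> 'n phase \<Rightarrow> complex"
    have m: "mapping_M law F G = distribution_of phase_measure2 (?N F) (\<lambda>z. G (inv coord_change z))"
      by (simp add: mapping_M_def pullback_C_def mN FS o_def)
    show "mapping_M law F G = distribution_of phase_measure2 (?M F) G"
    proof (cases "G \<in> schwartz")
      case True
      show ?thesis
        unfolding m scaled.distribution_scaled[OF soperator_schwartz[OF N FS] soperator_schwartz[OF soperator_coord_change(2) True]]
          scaled.distribution_scaled[OF soperator_schwartz[OF M FS] True]
          pairing_coord_change[OF soperator_schwartz[OF N FS] True] ..
    next
      case False
      \<comment> \<open>Both sides take the default value, since the change of variables preserves the Schwartz space in both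
        directions.\<close>
      have "(\<lambda>z. G (inv coord_change z)) \<notin> schwartz"
      proof
        assume "(\<lambda>z. G (inv coord_change z)) \<in> schwartz"
        then have "(\<lambda>z. G (inv coord_change (coord_change z))) \<in> schwartz"
          by (rule soperator_schwartz[OF soperator_coord_change(1)])
        then show False using False by (simp add: coord_change_inverse)
      qed
      then show ?thesis unfolding m using False by (simp add: distribution_of_def)
    qed
  qed
  have extM: "extension_property (mapping_M law)"
    by (rule scaled.transpose_extension[OF M M' trM mM])
  show ?thesis by (intro conjI extR[THEN conjunct1] extR[THEN conjunct2] extN[THEN conjunct1] extN[THEN conjunct2]
        extM[THEN conjunct1] extM[THEN conjunct2])
qed

end

theorem theorem2p5:
  fixes law :: "'n::finite composition"
  assumes "hypothesis_A law" and "hypothesis_B law"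
  shows "\<forall>\<Phi> \<in> {mapping_M law, mapping_N law, mapping_R law}.
    (\<exists>\<Phi>\<^sub>0. linear_continuous_map schwartz_topology schwartz_topology \<Phi>\<^sub>0 \<and>
          (\<forall>F\<in>schwartz. \<Phi> F = distribution_of phase_measure2 (\<Phi>\<^sub>0 F))) \<and>
    (\<exists>\<Psi>. linear_continuous_map tempered_topology tempered_topology \<Psi> \<and>
         (\<forall>F\<in>schwartz. \<Psi> (distribution_of phase_measure2 F) = \<Phi> F) \<and>
         (\<forall>\<Psi>'. linear_continuous_map tempered_topology tempered_topology \<Psi>' \<and>
               (\<forall>F\<in>schwartz. \<Psi>' (distribution_of phase_measure2 F) = \<Phi> F)
               \<longrightarrow> (\<forall>T\<in>tempered. \<Psi>' T = \<Psi> T)))"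
proof -
  interpret composition_law law "phase_density TYPE('n)"
    using assms by unfold_locales auto
  show ?thesis using extension_properties by (simp only: ball_simps simp_thms)
qed

end
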